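(* Let $1\le u,v\le\infty$. Then, as $n\to\infty$, $$\pi_\gamma(\mathrm{id}:\mathcal S_u^n\hookrightarrow\mathcal S_v^n)\asymp\begin{cases} n^{1/2+1/v} & \text{if } 2\le u\le\infty,\\ n^{1/2+\max(0,\,1/2+1/v-1/u)} & \text{if } 1\le u\le 2.\end{cases}$$ In particular, $$\pi_\gamma(\mathrm{id}:\mathcal S_u^n\hookrightarrow\mathcal S_v^n)\asymp n^{1/2+\lambda(\Pi_\gamma,u,v)}.$$
   Context: All Banach spaces are complex; $B_E$ is the closed unit ball and $E'$ the dual of a Banach space $E$. Convention $1/\infty=0$. For positive sequences, $a_n\asymp b_n$ means that there are constants $c,C>0$ independent of $n$ (they may depend on $u,v$) with $c\,b_n\le a_n\le C\,b_n$ for all $n\in\mathbb N$. $\mathcal S_u^n$ is the space of all linear operators $T:\ell_2^n\to\ell_2^n$ with norm $\|T\|_{\mathcal S_u^n}:=\|(s_k(T))_{k=1}^n\|_{\ell_u^n}$, where $(s_k(T))_{k=1}^n$ is the sequence of singular numbers of $T$. Gaussian-summing operators: let $(g_i)$ be a sequence of independent standard Gaussian random variables on a probability space $(\Omega,\mu)$. A bounded linear operator $T:E\to F$ between Banach spaces is Gaussian-summing if there is $c>0$ such that for all $n$, all distinct $b_1,\dots,b_n$ in $\{g_i\}$ and all $x_1,\dots,x_n\in E$ $$\left(\int_\Omega \Big\|\sum_{i=1}^n b_i\cdot Tx_i\Big\|^2 d\mu\right)^{1/2}\le c\cdot \sup_{x'\in B_{E'}}\left(\sum_{i=1}^n|\langle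 x',x_i\rangle|^2\right)^{1/2}.$$ The smallest such $c$ is $\pi_\gamma(T)$; $(\Pi_\gamma,\pi_\gamma)$ is the Banach operator ideal of all Gaussian-summing operators. Limit order: for $1\le u,v\le\infty$, $$\lambda(\Pi_\gamma,u,v):=\inf\{\lambda>0 \mid \exists\,\rho>0\ \forall\, n\in\mathbb N:\ \pi_\gamma(\mathrm{id}:\ell_u^n\hookrightarrow\ell_v^n)\le\rho\cdot n^\lambda\}.$$ *)

theory Defs
  imports
    "HOL-Probability.Probability"
    "Jordan_Normal_Form.Schur_Decomposition"
begin

text \<open>
  The dimension of the spaces varies inside the statements, so a complex normed space is a
  module record (with scalars in the complex numbers) together with a norm. The notions below are
  meant for records that are complex Banach spaces.
\<close>

record 'b cnormed = "(complex, 'b) module" +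
  nrm :: "'b \<Rightarrow> real"

definition clinear_on :: "'a cnormed \<Rightarrow> 'b cnormed \<Rightarrow> ('a \<Rightarrow> 'b) \<Rightarrow> bool" where
  "clinear_on E F T \<longleftrightarrow>
     T \<in> carrier E \<rightarrow> carrier F \<and>
     (\<forall>x\<in>carrier E. \<forall>y\<in>carrier E. T (x \<oplus>\<^bsub>E\<^esub> y) = T x \<oplus>\<^bsub>F\<^esub> T y) \<and>
     (\<forall>a. \<forall>x\<in>carrier E. T (a \<odot>\<^bsub>E\<^esub> x) = a \<odot>\<^bsub>F\<^esub> T x)"

definition bounded_clinear_on :: "'a cnormed \<Rightarrow> 'b cnormed \<Rightarrow> ('a \<Rightarrow> 'b) \<Rightarrow> bool" where
  "bounded_clinear_on E F T \<longleftrightarrow>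
     clinear_on E F T \<and> (\<exists>K. \<forall>x\<in>carrier E. nrm F (T x) \<le> K * nrm E x)"

definition dual_ball :: "'a cnormed \<Rightarrow> ('a \<Rightarrow> complex) set" where
  "dual_ball E = {\<phi>.
     (\<forall>x\<in>carrier E. \<forall>y\<in>carrier E. \<phi> (x \<oplus>\<^bsub>E\<^esub> y) = \<phi> x + \<phi> y) \<and>
     (\<forall>a. \<forall>x\<in>carrier E. \<phi> (a \<odot>\<^bsub>E\<^esub> x) = a * \<phi> x) \<and>
     (\<forall>x\<in>carrier E. cmod (\<phi> x) \<le> nrm E x)}"

definition std_gaussian_seq :: "'w measure \<Rightarrow> (nat \<Rightarrow> 'w \<Rightarrow> real) \<Rightarrow> bool" where
  "std_gaussian_seq M g \<longleftrightarrow>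
     prob_space M \<and>
     prob_space.indep_vars M (\<lambda>_. borel) g UNIV \<and>
     (\<forall>i. distributed M lborel (g i) std_normal_density)"

text \<open>
  The defining inequality is stated in squared form because the integral is taken with values in
  \<open>[0, \<infinity>]\<close>.
\<close>

definition gaussian_summing_const ::
  "'w measure \<Rightarrow> (nat \<Rightarrow> 'w \<Rightarrow> real) \<Rightarrow> 'a cnormed \<Rightarrow> 'b cnormed \<Rightarrow> ('a \<Rightarrow> 'b) \<Rightarrow> real \<Rightarrow> bool"
where
  "gaussian_summing_const M g E F T c \<longleftrightarrow>
     c > 0 \<and>
     (\<forall>(n::nat) b x.
        inj_on b {..<n} \<and> b ` {..<n} \<subseteq> range g \<and> x ` {..<n} \<subseteq> carrier E \<longrightarrow>
        (\<integral>\<^sup>+\<omega>. ennreal ((nrm F (\<Oplus>\<^bsub>F\<^esub>i\<in>{..<n}. complex_of_real (b i \<omega>) \<odot>\<^bsub>F\<^esub> T (x i)))\<^sup>2) \<partial>M)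
          \<le> ennreal ((c * (SUP \<phi>\<in>dual_ball E. sqrt (\<Sum>i<n. (cmod (\<phi> (x i)))\<^sup>2)))\<^sup>2))"

text \<open>The value is \<open>\<infinity>\<close> precisely if \<open>T\<close> is not a Gaussian-summing operator.\<close>

definition pi_gamma ::
  "'w measure \<Rightarrow> (nat \<Rightarrow> 'w \<Rightarrow> real) \<Rightarrow> 'a cnormed \<Rightarrow> 'b cnormed \<Rightarrow> ('a \<Rightarrow> 'b) \<Rightarrow> ennreal"
where
  "pi_gamma M g E F T =
     Inf {ennreal c |c. bounded_clinear_on E F T \<and> gaussian_summing_const M g E F T c}"

definition lp_norm :: "ennreal \<Rightarrow> 'a::real_normed_vector Matrix.vec \<Rightarrow> real" where
  "lp_norm p x =
     (if p = \<infinity> then Max (insert 0 ((\<lambda>i. norm (vec_index x i)) ` {..<dim_vec x}))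
      else (\<Sum>i<dim_vec x. norm (vec_index x i) powr enn2real p) powr (1 / enn2real p))"

definition lp_space :: "ennreal \<Rightarrow> nat \<Rightarrow> complex Matrix.vec cnormed" where
  "lp_space p n = module.extend (module_vec TYPE(complex) n) (cnormed.fields (lp_norm p))"

text \<open>
  Operators on \<open>\<ell>\<^sub>2\<^sup>n\<close> are represented by their matrices with respect to the
  unit vector basis. The singular numbers are the eigenvalues of \<open>\<bar>A\<bar> = (A\<^sup>*A)\<^sup>1\<^sup>/\<^sup>2\<close> with algebraic
  multiplicity, in nonincreasing order; the eigenvalues of \<open>A\<^sup>*A\<close> are real and nonnegative.
\<close>

definition singular_numbers :: "complex Matrix.mat \<Rightarrow> real Matrix.vec" where
  "singular_numbers A =
     vec_of_list (rev (sorted_list_of_multiset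
       (image_mset (\<lambda>z. sqrt (Re z)) (proots (char_poly (mat_adjoint A * A))))))"

definition schatten_norm :: "ennreal \<Rightarrow> complex Matrix.mat \<Rightarrow> real" where
  "schatten_norm p A = lp_norm p (singular_numbers A)"

definition schatten_space :: "ennreal \<Rightarrow> nat \<Rightarrow> complex Matrix.mat cnormed" where
  "schatten_space p n =
     module.extend (module_mat TYPE(complex) n n) (cnormed.fields (schatten_norm p))"

definition recip :: "ennreal \<Rightarrow> real" where
  "recip p = enn2real (1 / p)"

definition limit_order_gamma ::
  "'w measure \<Rightarrow> (nat \<Rightarrow> 'w \<Rightarrow> real) \<Rightarrow> ennreal \<Rightarrow> ennreal \<Rightarrow> real"
where
  "limit_order_gamma M g u v =
     Inf {l. 0 < l \<and> (\<exists>r>0. \<forall>n\<ge>1.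
       pi_gamma M g (lp_space u n) (lp_space v n) (\<lambda>x. x) \<le> ennreal (r * real n powr l))}"

definition seq_equiv :: "(nat \<Rightarrow> ennreal) \<Rightarrow> (nat \<Rightarrow> real) \<Rightarrow> bool" where
  "seq_equiv a b \<longleftrightarrow>
     (\<exists>c>0. \<exists>C>0. \<forall>n\<ge>1. ennreal (c * b n) \<le> a n \<and> a n \<le> ennreal (C * b n))"

lemma recip_top: "recip \<infinity> = 0"
  by (simp add: recip_def)

lemma lp_space_simps:
  "carrier (lp_space p n) = carrier_vec n"
  "add (lp_space p n) = (+)"
  "zero (lp_space p n) = 0\<^sub>v n"
  "smult (lp_space p n) = (\<cdot>\<^sub>v)"
  "nrm (lp_space p n) = lp_norm p"
  by (simp_all add: lp_space_def module_vec_def module.defs cnormed.defs)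

lemma schatten_space_simps:
  "carrier (schatten_space p n) = carrier_mat n n"
  "add (schatten_space p n) = (+)"
  "zero (schatten_space p n) = 0\<^sub>m n n"
  "smult (schatten_space p n) = (\<cdot>\<^sub>m)"
  "nrm (schatten_space p n) = schatten_norm p"
  by (simp_all add: schatten_space_def module_mat_def module.defs cnormed.defs)

end

theory Submission
  imports Defs
begin

text \<open>
  Let \<open>\<kappa> = max 0 (1/v - max 0 (1/u - 1/2))\<close>; the claim is \<open>\<pi>\<^sub>\<gamma>(S\<^sub>u \<rightarrow> S\<^sub>v) \<asymp> n^(1/2 + \<kappa>)\<close> and that
  \<open>\<kappa>\<close> is the limit order.

  Upper bound: since the identity from \<open>S\<^sub>t\<close> to \<open>S\<^sub>v\<close> has norm \<open>n^\<kappa>\<close> for \<open>1/t = max 0 (1/u - 1/2)\<close>, it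
  suffices to estimate \<open>\<parallel>\<Sum> g\<^sub>i X\<^sub>i\<parallel>\<^sub>t\<^sup>2\<close> in mean by \<open>n w\<^sup>2\<close>, where \<open>w\<close> is the weak \<open>\<ell>\<^sub>2\<close>-norm of \<open>(X\<^sub>i)\<close>
  in \<open>S\<^sub>u\<close>. For \<open>t = \<infinity>\<close> this follows from a net of the ball with \<open>exp (O(n))\<close> points, for \<open>t = 2\<close>
  from orthogonality, and in between from a Gaussian integration by parts for \<open>tr |Y|\<^sup>t\<close>.

  Lower bound: the matrix units of one row span a Hilbert space in every \<open>S\<^sub>u\<close> and give \<open>n^(1/2)\<close>; all
  \<open>n\<^sup>2\<close> matrix units together give \<open>n^(1/2 + \<kappa>)\<close> whenever \<open>\<kappa> > 0\<close>.

  For \<open>\<ell>\<^sub>u \<rightarrow> \<ell>\<^sub>v\<close> the maximum of the Gaussian coordinates costs only a factor \<open>O(ln n)^(1/2)\<close>, which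
  the limit order does not see.
\<close>

section \<open>Orthonormal systems and the spectral theorem\<close>

text \<open>The exponents are forced by duality. For 1 < u < 2 and 1/t = 1/u - 1/2, the family is
  tested against |Y|^((t-2)/2) times unitaries, where Y is the Gaussian sum: Hoelder's inequality
  with the dual exponent of u, which is 2t/(t-2), returns tr |Y|^t, so the integration by parts
  closes on itself. The factor n is the number of cyclic diagonals needed to see all entries of a
  matrix. A net alone would not do here, since passing from the operator norm to S_t loses n^(1/t).
  Two obstacles shape the formulation. The Schatten norm of a general random matrix is not shown to
  be measurable; the integral behind \<open>pi_gamma\<close> is monotone for arbitrary functions, so
  upper estimates go through measurable majorants \<open>h\<close> and lower estimates through
  measurable minorants. And |Y|^t would have to be differentiated along Y; a difference inequality
  between the eigenbases of two Hermitian matrices replaces the derivative, and general matrices are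
  split into their Hermitian and skew-Hermitian parts.\<close>

definition cip :: "nat \<Rightarrow> (nat \<Rightarrow> complex) \<Rightarrow> (nat \<Rightarrow> complex) \<Rightarrow> complex" where
  "cip n x y = (\<Sum>i<n. x i * cnj (y i))"

definition nsq :: "nat \<Rightarrow> (nat \<Rightarrow> complex) \<Rightarrow> real" where
  "nsq n x = (\<Sum>i<n. (cmod (x i))\<^sup>2)"

definition kap :: "nat \<Rightarrow> (nat \<Rightarrow> nat \<Rightarrow> complex) \<Rightarrow> (nat \<Rightarrow> complex) \<Rightarrow> nat \<Rightarrow> complex" where
  "kap n K x i = (\<Sum>j<n. K i j * x j)"

definition herm :: "nat \<Rightarrow> (nat \<Rightarrow> nat \<Rightarrow> complex) \<Rightarrow> bool" where
  "herm n K \<longleftrightarrow> (\<forall>i<n. \<forall>j<n. K i j = cnj (K j i))"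

definition ons :: "nat \<Rightarrow> nat \<Rightarrow> (nat \<Rightarrow> nat \<Rightarrow> complex) \<Rightarrow> bool" where
  "ons n m e \<longleftrightarrow> (\<forall>k<m. \<forall>l<m. cip n (e k) (e l) = (if k = l then 1 else 0))"

lemma cip_cong: "(\<And>i. i < n \<Longrightarrow> x i = x' i) \<Longrightarrow> (\<And>i. i < n \<Longrightarrow> y i = y' i) \<Longrightarrow> cip n x y = cip n x' y'"
  by (simp add: cip_def)

lemma cip_cnj: "cnj (cip n x y) = cip n y x"
  by (simp add: cip_def mult.commute)

lemma cip_self: "cip n x x = complex_of_real (nsq n x)"
  by (simp add: cip_def nsq_def complex_norm_square del: of_real_power)

lemma nsq_nonneg [simp]: "0 \<le> nsq n x"
  by (simp add: nsq_def sum_nonneg)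

lemma nsq_cong: "(\<And>i. i < n \<Longrightarrow> x i = x' i) \<Longrightarrow> nsq n x = nsq n x'"
  by (simp add: nsq_def)

lemma cip_scale_left: "cip n (\<lambda>i. c * x i) y = c * cip n x y"
  by (simp add: cip_def sum_distrib_left mult_ac)

lemma cip_scale_right: "cip n x (\<lambda>i. c * y i) = cnj c * cip n x y"
  by (simp add: cip_def sum_distrib_left mult_ac)

lemma cip_add_left: "cip n (\<lambda>i. x i + x' i) y = cip n x y + cip n x' y"
  by (simp add: cip_def sum.distrib algebra_simps)

lemma cip_diff_left: "cip n (\<lambda>i. x i - x' i) y = cip n x y - cip n x' y"
  by (simp add: cip_def sum_subtractf algebra_simps)

lemma cip_sum_left: "cip n (\<lambda>i. \<Sum>k\<in>S. f k i) y = (\<Sum>k\<in>S. cip n (f k) y)"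
  unfolding cip_def sum_distrib_right by (rule sum.swap)

lemma cip_sum_right: "cip n y (\<lambda>i. \<Sum>k\<in>S. f k i) = (\<Sum>k\<in>S. cip n y (f k))"
  unfolding cip_def cnj_sum sum_distrib_left by (rule sum.swap)

lemma kap_cong: "(\<And>i. i < n \<Longrightarrow> x i = x' i) \<Longrightarrow> kap n K x i = kap n K x' i"
  by (simp add: kap_def)

lemma kap_scale: "kap n K (\<lambda>i. c * x i) i = c * kap n K x i"
  by (simp add: kap_def sum_distrib_left mult_ac)

lemma kap_sum: "kap n K (\<lambda>i. \<Sum>k\<in>S. f k i) i = (\<Sum>k\<in>S. kap n K (f k) i)"
  unfolding kap_def sum_distrib_left by (rule sum.swap)

lemma cip_kap_adjoint:
  "cip n (kap n K x) y = cip n x (kap n (\<lambda>i j. cnj (K j i)) y)"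
proof -
  have "cip n (kap n K x) y = (\<Sum>i<n. \<Sum>j<n. K i j * x j * cnj (y i))"
    by (simp add: cip_def kap_def sum_distrib_right)
  also have "\<dots> = (\<Sum>j<n. \<Sum>i<n. K i j * x j * cnj (y i))"
    by (rule sum.swap)
  also have "\<dots> = cip n x (kap n (\<lambda>i j. cnj (K j i)) y)"
    by (simp add: cip_def kap_def sum_distrib_left mult_ac)
  finally show ?thesis .
qed

lemma kap_herm_adjoint:
  assumes "herm n K" "i < n"
  shows "kap n (\<lambda>i j. cnj (K j i)) x i = kap n K x i"
  unfolding kap_def
proof (intro sum.cong refl)
  fix j assume "j \<in> {..<n}"
  then have "K i j = cnj (K j i)" using assms unfolding herm_def by blast
  then show "cnj (K j i) * x j = K i j * x j" by simp
qed

lemma cip_kap_herm: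
  assumes "herm n K"
  shows "cip n (kap n K x) y = cip n x (kap n K y)"
  unfolding cip_kap_adjoint by (intro cip_cong refl kap_herm_adjoint[OF assms])

lemma nsq_eq_0_iff: "nsq n x = 0 \<longleftrightarrow> (\<forall>i<n. x i = 0)"
  by (auto simp: nsq_def sum_nonneg_eq_0_iff)

lemma nsq_scale: "nsq n (\<lambda>i. c * x i) = (cmod c)\<^sup>2 * nsq n x"
  by (simp add: nsq_def norm_mult power_mult_distrib sum_distrib_left)

text \<open>A left inverse of a square matrix is also a right inverse; this is where the number of
  vectors has to equal the dimension.\<close>

lemma ons_complete:
  assumes "ons n n e" "i < n" "j < n"
  shows "(\<Sum>k<n. e k i * cnj (e k j)) = (if i = j then 1 else 0)"
proof -
  define U where "U = mat n n (\<lambda>(i, k). e k i)"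
  define V where "V = mat n n (\<lambda>(k, i). cnj (e k i))"
  have "V * U = 1\<^sub>m n"
  proof (rule eq_matI)
    fix a b assume "a < dim_row (1\<^sub>m n :: complex mat)" "b < dim_col (1\<^sub>m n :: complex mat)"
    then have ab: "a < n" "b < n" by auto
    then have "(V * U) $$ (a, b) = cip n (e b) (e a)"
      by (simp add: U_def V_def scalar_prod_def cip_def lessThan_atLeast0 mult.commute)
    then show "(V * U) $$ (a, b) = 1\<^sub>m n $$ (a, b)"
      using assms(1) ab by (auto simp: ons_def)
  qed (auto simp: U_def V_def)
  then have "U * V = 1\<^sub>m n"
    by (rule mat_mult_left_right_inverse[rotated 2]) (auto simp: U_def V_def)
  then have "(U * V) $$ (i, j) = 1\<^sub>m n $$ (i, j)" by simp
  then show ?thesis using assms(2,3)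
    by (simp add: U_def V_def scalar_prod_def lessThan_atLeast0)
qed

lemma ons_expand:
  assumes "ons n n e" "i < n"
  shows "x i = (\<Sum>k<n. cip n x (e k) * e k i)"
proof -
  have "(\<Sum>k<n. cip n x (e k) * e k i) = (\<Sum>k<n. \<Sum>j<n. x j * (e k i * cnj (e k j)))"
    unfolding cip_def sum_distrib_right by (simp add: mult_ac)
  also have "\<dots> = (\<Sum>j<n. x j * (\<Sum>k<n. e k i * cnj (e k j)))"
    unfolding sum_distrib_left by (rule sum.swap)
  also have "\<dots> = (\<Sum>j<n. if i = j then x j else 0)"
    by (intro sum.cong) (auto simp: ons_complete[OF assms])
  finally show ?thesis using assms(2) by simp
qed

lemma parseval:
  assumes "ons n n e"
  shows "cip n x y = (\<Sum>k<n. cip n x (e k) * cip n (e k) y)"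
proof -
  have "cip n x y = cip n (\<lambda>i. \<Sum>k<n. cip n x (e k) * e k i) y"
    by (intro cip_cong refl ons_expand[OF assms])
  also have "\<dots> = (\<Sum>k<n. cip n x (e k) * cip n (e k) y)"
    by (simp add: cip_sum_left cip_scale_left)
  finally show ?thesis .
qed

lemma cip_mult_cnj: "cip n x y * cip n y x = complex_of_real ((cmod (cip n x y))\<^sup>2)"
  by (subst (2) cip_cnj[symmetric]) (simp add: complex_norm_square del: of_real_power)

lemma parseval_nsq:
  assumes "ons n n e"
  shows "nsq n x = (\<Sum>k<n. (cmod (cip n x (e k)))\<^sup>2)"
proof -
  have "complex_of_real (nsq n x) = complex_of_real (\<Sum>k<n. (cmod (cip n x (e k)))\<^sup>2)"
    unfolding cip_self[symmetric] by (subst parseval[OF assms]) (simp add: cip_mult_cnj)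
  then show ?thesis by (simp only: of_real_eq_iff)
qed

text \<open>Zero vectors are admitted in the orthogonal system, as they occur in the polar part of a
  singular matrix.\<close>

lemma bessel:
  fixes p :: "nat \<Rightarrow> nat \<Rightarrow> complex"
  assumes orth: "\<And>k l. k < m \<Longrightarrow> l < m \<Longrightarrow> cip n (p k) (p l) = (if k = l \<and> Z k then 1 else 0)"
  shows "(\<Sum>k<m. (cmod (cip n x (p k)))\<^sup>2) \<le> nsq n x"
proof -
  \<comment> \<open>The orthogonal projection of \<open>x\<close> onto the span of the
    \<open>p k\<close>; the claim is that the squared length of \<open>x - y\<close> is
    nonnegative.\<close>
  define y where "y i = (\<Sum>k<m. cip n x (p k) * p k i)" for i
  have zero: "cip n x (p k) = 0" if "k < m" "\<not> Z k" for k
  proof -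
    have "nsq n (p k) = 0" using orth[of k k] that by (simp add: cip_self)
    then show ?thesis by (simp add: nsq_eq_0_iff cip_def)
  qed
  have xy: "cip n x y = complex_of_real (\<Sum>k<m. (cmod (cip n x (p k)))\<^sup>2)"
    unfolding y_def cip_sum_right cip_scale_right by (simp add: cip_cnj cip_mult_cnj mult.commute)
  have "cip n y y = (\<Sum>k<m. \<Sum>l<m. cip n x (p k) * cip n (p l) x * cip n (p k) (p l))"
    unfolding y_def cip_sum_right cip_sum_left cip_scale_right cip_scale_left
    unfolding sum_distrib_left by (simp add: cip_cnj sum_distrib_left mult_ac)
  also have "\<dots> = (\<Sum>k<m. cip n x (p k) * cip n (p k) x)"
  proof (intro sum.cong refl)
    fix k assume k: "k \<in> {..<m}"
    have "(\<Sum>l<m. cip n x (p k) * cip n (p l) x * cip n (p k) (p l))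
        = (\<Sum>l<m. if k = l then cip n x (p k) * cip n (p k) x else 0)"
      using k zero by (intro sum.cong) (auto simp: orth)
    also have "\<dots> = cip n x (p k) * cip n (p k) x"
      using k by (subst sum.delta') auto
    finally show "(\<Sum>l<m. cip n x (p k) * cip n (p l) x * cip n (p k) (p l)) = cip n x (p k) * cip n (p k) x" .
  qed
  finally have yy: "cip n y y = complex_of_real (\<Sum>k<m. (cmod (cip n x (p k)))\<^sup>2)"
    by (simp add: cip_mult_cnj)
  define S where "S = (\<Sum>k<m. (cmod (cip n x (p k)))\<^sup>2)"
  have xy': "cip n x y = of_real S" and yy': "cip n y y = of_real S" 
    unfolding S_def by (rule xy, rule yy)
  have yx': "cip n y x = of_real S" using xy' by (metis cip_cnj complex_cnj_complex_of_real)
  have "complex_of_real (nsq n (\<lambda>i. x i - y i)) = cip n x x - cip n x y - cip n y x + cip n y y"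
    unfolding cip_self[symmetric] by (simp add: cip_def sum_subtractf sum.distrib algebra_simps)
  also have "\<dots> = complex_of_real (nsq n x - S)"
    unfolding xy' yy' yx' cip_self[of n x] by simp
  finally have "nsq n (\<lambda>i. x i - y i) = nsq n x - S" by (simp only: of_real_eq_iff)
  then show ?thesis using nsq_nonneg[of n "\<lambda>i. x i - y i"] S_def by simp
qed

text \<open>Bessel's inequality for the single vector \<open>y\<close>, normalised.\<close>

lemma cip_Cauchy_Schwarz: "(cmod (cip n x y))\<^sup>2 \<le> nsq n x * nsq n y"
proof (cases "nsq n y = 0")
  case True
  then show ?thesis by (simp add: nsq_eq_0_iff cip_def)
next
  case False
  then have pos: "nsq n y > 0" using nsq_nonneg[of n y] by linarith
  define c where "c = 1 / sqrt (nsq n y)"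
  have "nsq n (\<lambda>i. of_real c * y i) = 1"
    unfolding nsq_scale norm_of_real power2_abs using pos by (simp add: c_def power_divide)
  then have "cip n (\<lambda>i. of_real c * y i) (\<lambda>i. of_real c * y i) = 1"
    by (simp add: cip_self)
  then have "(\<Sum>k<Suc 0. (cmod (cip n x (\<lambda>i. of_real c * y i)))\<^sup>2) \<le> nsq n x"
    by (intro bessel[where Z = "\<lambda>_. True"]) auto
  then have "c\<^sup>2 * (cmod (cip n x y))\<^sup>2 \<le> nsq n x"
    by (simp add: cip_scale_right norm_mult power_mult_distrib)
  then show ?thesis using pos by (simp add: c_def power_divide field_simps)
qed

section \<open>Traces and the existence of eigenvectors\<close>

lemma sum_mult_diag_comm:
  fixes A B :: "complex mat"
  assumes "A \<in> carrier_mat n n" "B \<in> carrier_mat n n"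
  shows "(\<Sum>i<n. (A * B) $$ (i, i)) = (\<Sum>i<n. (B * A) $$ (i, i))"
proof -
  have "(\<Sum>i<n. (A * B) $$ (i, i)) = (\<Sum>i<n. \<Sum>j<n. A $$ (i, j) * B $$ (j, i))"
    using assms by (simp add: scalar_prod_def lessThan_atLeast0)
  also have "\<dots> = (\<Sum>j<n. \<Sum>i<n. B $$ (j, i) * A $$ (i, j))"
    by (subst sum.swap) (simp add: mult.commute)
  also have "\<dots> = (\<Sum>i<n. (B * A) $$ (i, i))"
    using assms by (simp add: scalar_prod_def lessThan_atLeast0)
  finally show ?thesis .
qed

text \<open>The trace is invariant under the similarity of Schur's triangular form, whose diagonal
  lists the eigenvalues.\<close>

lemma trace_eq_sum_eigenvalues:
  fixes A :: "complex mat"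
  assumes A: "A \<in> carrier_mat n n" and cp: "char_poly A = (\<Prod>a\<leftarrow>as. [:- a, 1:])"
  shows "(\<Sum>i<n. A $$ (i, i)) = sum_list as"
proof -
  obtain B P Q where sd: "schur_decomposition A as = (B, P, Q)" by (metis prod_cases3)
  from schur_decomposition[OF A cp sd] have w: "similar_mat_wit A B P Q" and d: "diag_mat B = as"
    by auto
  from similar_mat_witD2[OF A w] have "A = P * B * Q" "Q * P = 1\<^sub>m n"
    and c: "B \<in> carrier_mat n n" "P \<in> carrier_mat n n" "Q \<in> carrier_mat n n" by auto
  then have "(\<Sum>i<n. A $$ (i, i)) = (\<Sum>i<n. (Q * (P * B)) $$ (i, i))"
    using sum_mult_diag_comm[of "P * B" n Q] by simp
  also have "Q * (P * B) = B"
    unfolding assoc_mult_mat[OF c(3,2,1), symmetric] \<open>Q * P = 1\<^sub>m n\<close>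
    using c(1) by (rule left_mult_one_mat)
  also have "(\<Sum>i<n. B $$ (i, i)) = sum_list as"
    using c unfolding d[symmetric] diag_mat_def
    by (simp add: interv_sum_list_conv_sum_set_nat lessThan_atLeast0)
  finally show ?thesis .
qed

text \<open>If every root of the characteristic polynomial were \<open>t\<close>, the trace would be
  \<open>n * t\<close>. This turns a trace computation into an eigenvalue different from a
  prescribed one.\<close>

lemma exists_eigenvalue_neq:
  fixes A :: "complex mat"
  assumes A: "A \<in> carrier_mat n n" and tr: "(\<Sum>i<n. A $$ (i, i)) \<noteq> of_nat n * t"
  shows "\<exists>\<mu>. \<mu> \<noteq> t \<and> eigenvalue A \<mu>"
proof (rule ccontr)
  assume none: "\<not> ?thesis"
  obtain as where as: "char_poly A = (\<Prod>a\<leftarrow>as. [:- a, 1:])" "length as = n"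
    using char_poly_factorized[OF A] by auto
  have "a = t" if "a \<in> set as" for a
  proof -
    have "poly (char_poly A) a = 0"
      unfolding as(1) poly_prod_list using that by (auto simp: prod_list_zero_iff)
    then show ?thesis using none eigenvalue_root_char_poly[OF A] by auto
  qed
  then have "as = replicate n t" using as(2) by (intro replicate_eqI) auto
  then show False using trace_eq_sum_eigenvalues[OF A as(1)] tr by (simp add: sum_list_replicate)
qed

text \<open>One more eigenvector: replacing the known eigenvalues by a common real value \<open>t\<close> keeps
  the matrix Hermitian, and if \<open>t\<close> does not match the trace there is an eigenvector for another
  eigenvalue; it is orthogonal to the ones already found.\<close>

lemma exists_next_eigenvector:
  assumes K: "herm n K" and m: "m < n" and e: "ons n m e"
    and ev: "\<And>l i. l < m \<Longrightarrow> i < n \<Longrightarrow> kap n K (e l) i = of_real (lam l) * e l i"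
  shows "\<exists>w \<mu>. nsq n w = 1 \<and> (\<forall>l<m. cip n w (e l) = 0) \<and> (\<forall>i<n. kap n K w i = complex_of_real \<mu> * w i)"
proof -
  \<comment> \<open>The quotient is the mean of the eigenvalues still missing, for which the trace
    of \<open>C\<close> would be exactly \<open>n * t\<close>; adding 1 spoils this
    equality.\<close>
  define t where "t = (Re (\<Sum>i<n. K i i) - (\<Sum>l<m. lam l)) / (real n - real m) + 1"
  define C where "C i j = K i j + (\<Sum>l<m. of_real (t - lam l) * e l i * cnj (e l j))" for i j
  define A where "A = mat n n (\<lambda>(i, j). C i j)"
  have A: "A \<in> carrier_mat n n" by (simp add: A_def)
  have C: "herm n C"
    unfolding herm_def
  proof (intro allI impI)
    fix i j assume "i < n" "j < n"
    then have "K i j = cnj (K j i)" using K unfolding herm_def by blast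
    then show "C i j = cnj (C j i)" by (simp add: C_def mult_ac)
  qed
  have kapC: "kap n C x i = kap n K x i + (\<Sum>l<m. of_real (t - lam l) * cip n x (e l) * e l i)" for x i
  proof -
    have "kap n C x i = kap n K x i + (\<Sum>j<n. \<Sum>l<m. of_real (t - lam l) * e l i * cnj (e l j) * x j)"
      by (simp add: kap_def C_def algebra_simps sum.distrib sum_distrib_left)
    also have "(\<Sum>j<n. \<Sum>l<m. of_real (t - lam l) * e l i * cnj (e l j) * x j)
      = (\<Sum>l<m. of_real (t - lam l) * cip n x (e l) * e l i)"
      by (subst sum.swap) (simp add: cip_def sum_distrib_left sum_distrib_right mult_ac)
    finally show ?thesis .
  qed
  have Ce: "kap n C (e k) i = of_real t * e k i" if "k < m" "i < n" for k i
  proof -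
    have "(\<Sum>l<m. of_real (t - lam l) * cip n (e k) (e l) * e l i)
        = (\<Sum>l<m. if k = l then of_real (t - lam k) * e k i else 0)"
      using e that by (intro sum.cong) (auto simp: ons_def)
    also have "\<dots> = of_real (t - lam k) * e k i" using that by (subst sum.delta') auto
    finally show ?thesis unfolding kapC using ev[OF that] by (simp add: algebra_simps)
  qed
  have "Re (\<Sum>i<n. A $$ (i, i)) = Re (\<Sum>i<n. K i i) + (\<Sum>l<m. t - lam l)"
  proof -
    have "(\<Sum>i<n. \<Sum>l<m. of_real (t - lam l) * e l i * cnj (e l i)) = (\<Sum>l<m. of_real (t - lam l) * cip n (e l) (e l))"
      by (subst sum.swap) (simp add: cip_def sum_distrib_left mult_ac)
    also have "\<dots> = (\<Sum>l<m. of_real (t - lam l))"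
      using e by (intro sum.cong) (auto simp: ons_def)
    finally show ?thesis by (simp add: A_def C_def sum.distrib)
  qed
  also have "\<dots> \<noteq> real n * t"
  proof -
    have "(real n - real m) * t = Re (\<Sum>i<n. K i i) - (\<Sum>l<m. lam l) + (real n - real m)"
      using m by (simp add: t_def distrib_left del: Re_sum)
    moreover have "(\<Sum>l<m. t - lam l) = real m * t - (\<Sum>l<m. lam l)"
      by (simp add: sum_subtractf)
    ultimately show ?thesis using m by (simp add: left_diff_distrib del: Re_sum)
  qed
  finally have "(\<Sum>i<n. A $$ (i, i)) \<noteq> of_nat n * complex_of_real t"
    by (metis Re_complex_of_real of_real_mult of_real_of_nat_eq)
  from exists_eigenvalue_neq[OF A this] obtain \<mu> v where mu: "\<mu> \<noteq> of_real t"
    and v: "eigenvector A v \<mu>" unfolding eigenvalue_def by blast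
  then have vc: "v \<in> carrier_vec n" and v0: "v \<noteq> 0\<^sub>v n" and Av: "A *\<^sub>v v = \<mu> \<cdot>\<^sub>v v"
    using A by (auto simp: eigenvector_def)
  define x where "x i = v $ i" for i
  have Cx: "kap n C x i = \<mu> * x i" if "i < n" for i
  proof -
    have "(A *\<^sub>v v) $ i = kap n C x i"
      using that vc A by (simp add: A_def kap_def x_def scalar_prod_def lessThan_atLeast0)
    then show ?thesis using Av that vc by (simp add: x_def)
  qed
  \<comment> \<open>Eigenvectors of the Hermitian \<open>C\<close> for the distinct eigenvalues
    \<mu> and \<open>t\<close> are orthogonal, \<open>t\<close> being real. On such vectors
    \<open>C\<close> and \<open>K\<close> agree.\<close>
  have orth: "cip n x (e l) = 0" if "l < m" for l
  proof -
    have "\<mu> * cip n x (e l) = cip n (kap n C x) (e l)"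
      unfolding cip_scale_left[symmetric] by (intro cip_cong) (auto simp: Cx)
    also have "\<dots> = cip n x (\<lambda>i. of_real t * e l i)"
      unfolding cip_kap_herm[OF C] by (intro cip_cong refl Ce that)
    also have "\<dots> = of_real t * cip n x (e l)" by (simp add: cip_scale_right)
    finally show ?thesis using mu by simp
  qed
  have Kx: "kap n K x i = \<mu> * x i" if "i < n" for i
    using kapC[of x i] Cx[OF that] by (simp add: orth)
  have pos: "nsq n x > 0"
  proof -
    have "nsq n x \<noteq> 0"
      using v0 vc unfolding nsq_eq_0_iff x_def by (metis eq_vecI carrier_vecD index_zero_vec)
    then show ?thesis using nsq_nonneg[of n x] by linarith
  qed
  have "\<mu> * cip n x x = cip n (kap n K x) x"
    unfolding cip_scale_left[symmetric] by (intro cip_cong) (auto simp: Kx)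
  also have "\<dots> = cip n x (\<lambda>i. \<mu> * x i)"
    unfolding cip_kap_herm[OF K] by (intro cip_cong refl Kx)
  also have "\<dots> = cnj \<mu> * cip n x x" by (rule cip_scale_right)
  finally have "\<mu> = cnj \<mu>" using pos by (simp add: cip_self)
  then have mu_real: "\<mu> = of_real (Re \<mu>)" by (metis complex_cnj_cancel_iff complex_eq_iff cnj.sel neg_equal_zero Re_complex_of_real Im_complex_of_real)
  define c where "c = complex_of_real (1 / sqrt (nsq n x))"
  show ?thesis
  proof (intro exI conjI allI impI)
    show "nsq n (\<lambda>i. c * x i) = 1"
      unfolding nsq_scale c_def norm_of_real power2_abs using pos by (simp add: power_divide)
    show "cip n (\<lambda>i. c * x i) (e l) = 0" if "l < m" for l
      by (simp add: cip_scale_left orth[OF that])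
    show "kap n K (\<lambda>i. c * x i) i = complex_of_real (Re \<mu>) * (c * x i)" if "i < n" for i
      unfolding kap_scale Kx[OF that] using mu_real by simp
  qed
qed

lemma spectral_partial:
  assumes K: "herm n K" and "m \<le> n"
  shows "\<exists>e lam. ons n m e \<and> (\<forall>l<m. \<forall>i<n. kap n K (e l) i = complex_of_real (lam l) * e l i)"
  using assms(2)
proof (induction m)
  case 0
  show ?case by (auto simp: ons_def)
next
  case (Suc m)
  then obtain e lam where e: "ons n m e"
    and ev: "\<And>l i. l < m \<Longrightarrow> i < n \<Longrightarrow> kap n K (e l) i = complex_of_real (lam l) * e l i" by auto
  from exists_next_eigenvector[OF K _ e ev] Suc.prems obtain w \<mu> where w: "nsq n w = 1"
    "\<And>l. l < m \<Longrightarrow> cip n w (e l) = 0" "\<And>i. i < n \<Longrightarrow> kap n K w i = complex_of_real \<mu> * w i" by auto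
  have w': "cip n (e l) w = 0" if "l < m" for l
    using w(2)[OF that] by (metis cip_cnj complex_cnj_zero)
  show ?case
  proof (intro exI conjI)
    show "ons n (Suc m) (e(m := w))"
      using e w w' unfolding ons_def by (auto simp: less_Suc_eq cip_self)
    show "\<forall>l<Suc m. \<forall>i<n. kap n K ((e(m := w)) l) i = complex_of_real ((lam(m := \<mu>)) l) * (e(m := w)) l i"
      using ev w(3) by (auto simp: less_Suc_eq)
  qed
qed

lemma spectral_theorem:
  assumes "herm n K"
  obtains e lam where "ons n n e" "\<And>k i. k < n \<Longrightarrow> i < n \<Longrightarrow> kap n K (e k) i = complex_of_real (lam k) * e k i"
  using spectral_partial[OF assms order_refl] by auto

section \<open>Singular value decompositions\<close>

abbreviation lpf :: "nat \<Rightarrow> ennreal \<Rightarrow> (nat \<Rightarrow> 'a::real_normed_vector) \<Rightarrow> real" where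
  "lpf n p f \<equiv> lp_norm p (Matrix.vec n f)"

abbreviation ent :: "complex Matrix.mat \<Rightarrow> nat \<Rightarrow> nat \<Rightarrow> complex" where
  "ent A i j \<equiv> A $$ (i, j)"

lemma lp_norm_vec_of_list:
  "lp_norm p (vec_of_list xs) =
    (if p = \<infinity> then Max (insert 0 (norm ` set xs))
     else (\<Sum>x\<in>#mset xs. norm x powr enn2real p) powr (1 / enn2real p))"
proof -
  have "(\<lambda>i. norm (vec_of_list xs $ i)) ` {..<length xs} = norm ` set xs"
    by (auto simp: set_conv_nth vec_of_list_index)
  moreover have "(\<Sum>i<length xs. norm (vec_of_list xs $ i) powr enn2real p)
      = (\<Sum>x\<in>#mset xs. norm x powr enn2real p)"
    by (simp add: vec_of_list_index sum_mset_sum_list sum_list_sum_nth lessThan_atLeast0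
        flip: mset_map)
  ultimately show ?thesis by (simp add: lp_norm_def)
qed

lemma lpf_eq_vec_of_list: "lpf n p f = lp_norm p (vec_of_list (map f [0..<n]))"
proof -
  have "Matrix.vec n f = vec_of_list (map f [0..<n])"
    by (intro eq_vecI) (auto simp: vec_of_list_index)
  then show ?thesis by simp
qed

text \<open>The norm depends only on the multiset of singular numbers, and diagonalising identifies
  the roots of the characteristic polynomial with the \<mu>. From here on any orthonormal eigenbasis
  may be used and the sorting is forgotten.\<close>

lemma singular_numbers_norm:
  assumes A: "A \<in> carrier_mat n n" and q: "ons n n q"
    and ev: "\<And>k i. k < n \<Longrightarrow> i < n \<Longrightarrow> kap n (ent (mat_adjoint A * A)) (q k) i = complex_of_real (\<mu> k) * q k i"
  shows "schatten_norm p A = lpf n p (\<lambda>k. sqrt (\<mu> k))"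
proof -
  define B where "B = mat_adjoint A * A"
  have dim: "mat_adjoint A \<in> carrier_mat n n"
    using A by (auto simp: mat_adjoint_def)
  have B: "B \<in> carrier_mat n n" unfolding B_def using A dim by auto
  define U where "U = mat n n (\<lambda>(i, k). q k i)"
  define V where "V = mat n n (\<lambda>(k, i). cnj (q k i))"
  define D where "D = mat n n (\<lambda>(i, j). if i = j then complex_of_real (\<mu> i) else 0)"
  have c: "U \<in> carrier_mat n n" "V \<in> carrier_mat n n" "D \<in> carrier_mat n n"
    by (auto simp: U_def V_def D_def)
  have VU: "V * U = 1\<^sub>m n"
  proof (rule eq_matI)
    fix a b assume "a < dim_row (1\<^sub>m n :: complex mat)" "b < dim_col (1\<^sub>m n :: complex mat)"
    then have ab: "a < n" "b < n" by auto
    then have "(V * U) $$ (a, b) = cip n (q b) (q a)"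
      by (simp add: U_def V_def scalar_prod_def cip_def lessThan_atLeast0 mult.commute)
    then show "(V * U) $$ (a, b) = 1\<^sub>m n $$ (a, b)"
      using q ab by (auto simp: ons_def)
  qed (auto simp: U_def V_def)
  have UV: "U * V = 1\<^sub>m n"
    by (rule mat_mult_left_right_inverse[OF c(2,1) VU])
  have BU: "B * U = U * D"
  proof (rule eq_matI)
    fix i k assume "i < dim_row (U * D)" "k < dim_col (U * D)"
    then have ik: "i < n" "k < n" using c by auto
    have "(B * U) $$ (i, k) = kap n (ent B) (q k) i"
      using ik B by (simp add: U_def scalar_prod_def kap_def lessThan_atLeast0)
    also have "\<dots> = complex_of_real (\<mu> k) * q k i" unfolding B_def by (rule ev[OF ik(2,1)])
    also have "\<dots> = (\<Sum>j<n. q j i * (if j = k then complex_of_real (\<mu> j) else 0))"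
      using ik by (simp add: if_distrib mult.commute cong: if_cong)
    also have "\<dots> = (U * D) $$ (i, k)"
      using ik by (simp add: U_def D_def scalar_prod_def lessThan_atLeast0)
    finally show "(B * U) $$ (i, k) = (U * D) $$ (i, k)" .
  qed (use B c in auto)
  have "U * D * V = B * (U * V)"
    unfolding BU[symmetric] by (rule assoc_mult_mat[OF B c(1,2)])
  then have "B = U * D * V" using UV B by simp
  then have "similar_mat_wit B D U V"
    using B c UV VU by (intro similar_mat_witI) auto
  then have "char_poly B = char_poly D"
    by (intro char_poly_similar) (auto simp: similar_mat_def)
  also have "\<dots> = (\<Prod>a\<leftarrow>diag_mat D. [:- a, 1:])"
    by (rule char_poly_upper_triangular[OF c(3)]) (auto simp: D_def)
  also have "diag_mat D = map (\<lambda>k. complex_of_real (\<mu> k)) [0..<n]"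
    by (auto simp: diag_mat_def D_def)
  finally have cp: "char_poly B = (\<Prod>a\<leftarrow>map (\<lambda>k. complex_of_real (\<mu> k)) [0..<n]. [:- a, 1:])" .
  have "proots (\<Prod>a\<leftarrow>xs. [:- a, 1:]) = mset xs" for xs :: "complex list"
  proof (induction xs)
    case (Cons a xs)
    have "(\<Prod>a\<leftarrow>xs. [:- a, 1:]) \<noteq> 0" by (auto simp: prod_list_zero_iff)
    then show ?case using Cons by (simp add: proots_mult del: mult_pCons_left)
  qed simp
  then have pr: "proots (char_poly B) = mset (map (\<lambda>k. complex_of_real (\<mu> k)) [0..<n])"
    unfolding cp .
  define xs where "xs = rev (sorted_list_of_multiset (image_mset (\<lambda>z. sqrt (Re z)) (proots (char_poly B))))"
  have m: "mset xs = mset (map (\<lambda>k. sqrt (\<mu> k)) [0..<n])"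
    unfolding xs_def pr by (simp add: multiset.map_comp comp_def flip: mset_map)
  then have "set xs = set (map (\<lambda>k. sqrt (\<mu> k)) [0..<n])" by (metis set_mset_mset)
  then show ?thesis
    unfolding schatten_norm_def singular_numbers_def B_def[symmetric] xs_def[symmetric]
      lpf_eq_vec_of_list lp_norm_vec_of_list m by simp
qed

lemma kap_adjoint_mult:
  assumes "A \<in> carrier_mat n n" "i < n"
  shows "kap n (ent (mat_adjoint A * A)) x i = kap n (\<lambda>i j. cnj (A $$ (j, i))) (kap n (ent A) x) i"
proof -
  have "(mat_adjoint A * A) $$ (i, j) = (\<Sum>l<n. cnj (A $$ (l, i)) * A $$ (l, j))" if "j < n" for j
    using assms that
    by (simp add: mat_adjoint_def mat_of_rows_def scalar_prod_def lessThan_atLeast0)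
  then have "kap n (ent (mat_adjoint A * A)) x i = (\<Sum>j<n. \<Sum>l<n. cnj (A $$ (l, i)) * A $$ (l, j) * x j)"
    by (simp add: kap_def sum_distrib_right)
  also have "\<dots> = kap n (\<lambda>i j. cnj (A $$ (j, i))) (kap n (ent A) x) i"
    by (subst sum.swap) (simp add: kap_def sum_distrib_left mult_ac)
  finally show ?thesis .
qed

text \<open>Left vectors that belong to a vanishing singular number are zero instead of being
  completed to a basis; Bessel's inequality survives this. The last clause fixes one list
  \<open>s\<close> for the norms of all exponents, so that they can be compared.\<close>

definition svd :: "nat \<Rightarrow> complex Matrix.mat \<Rightarrow> (nat \<Rightarrow> real) \<Rightarrow> (nat \<Rightarrow> nat \<Rightarrow> complex) \<Rightarrow> (nat \<Rightarrow> nat \<Rightarrow> complex) \<Rightarrow> bool" where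
  "svd n A s q p \<longleftrightarrow> ons n n q \<and> (\<forall>k<n. 0 \<le> s k)
    \<and> (\<forall>k<n. \<forall>l<n. cip n (p k) (p l) = (if k = l \<and> s k \<noteq> 0 then 1 else 0))
    \<and> (\<forall>k<n. \<forall>i<n. kap n (ent A) (q k) i = complex_of_real (s k) * p k i)
    \<and> (\<forall>t. schatten_norm t A = lpf n t s)"

lemma svd_exists:
  assumes A: "A \<in> carrier_mat n n"
  obtains s q p where "svd n A s q p"
proof -
  define B where "B = mat_adjoint A * A"
  have cipB: "cip n (kap n (ent B) x) y = cip n (kap n (ent A) x) (kap n (ent A) y)" for x y
  proof -
    have "cip n (kap n (ent B) x) y = cip n (kap n (\<lambda>i j. cnj (A $$ (j, i))) (kap n (ent A) x)) y"
      unfolding B_def by (intro cip_cong refl kap_adjoint_mult A)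
    also have "\<dots> = cip n (kap n (ent A) x) (kap n (ent A) y)"
      by (subst cip_kap_adjoint) simp
    finally show ?thesis .
  qed
  have "herm n (ent B)"
    unfolding herm_def
  proof (intro allI impI)
    fix i j assume "i < n" "j < n"
    then show "ent B i j = cnj (ent B j i)"
      using A by (simp add: B_def mat_adjoint_def mat_of_rows_def scalar_prod_def mult.commute)
  qed
  then obtain q \<mu> where q: "ons n n q"
    and ev: "\<And>k i. k < n \<Longrightarrow> i < n \<Longrightarrow> kap n (ent B) (q k) i = complex_of_real (\<mu> k) * q k i"
    using spectral_theorem by blast
  have AA: "cip n (kap n (ent A) (q k)) (kap n (ent A) (q l)) = (if k = l then complex_of_real (\<mu> k) else 0)"
    if "k < n" "l < n" for k l
  proof -
    have "cip n (kap n (ent B) (q k)) (q l) = cip n (\<lambda>i. complex_of_real (\<mu> k) * q k i) (q l)"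
      by (intro cip_cong ev that refl)
    then show ?thesis using q that by (auto simp: cipB cip_scale_left ons_def)
  qed
  have mu: "nsq n (kap n (ent A) (q k)) = \<mu> k" if "k < n" for k
    using AA[OF that that] by (simp add: cip_self)
  then have mu0: "\<mu> k \<ge> 0" if "k < n" for k using that nsq_nonneg by metis
  define s where "s k = sqrt (\<mu> k)" for k
  \<comment> \<open>If \<open>s k = 0\<close>, division by zero makes \<open>p k\<close> the zero
    vector, as \<open>svd\<close> requires.\<close>
  define p where "p k i = complex_of_real (1 / s k) * kap n (ent A) (q k) i" for k i
  have "svd n A s q p"
    unfolding svd_def
  proof (intro conjI allI impI q)
    show "0 \<le> s k" if "k < n" for k using mu0[OF that] by (simp add: s_def)
    show "cip n (p k) (p l) = (if k = l \<and> s k \<noteq> 0 then 1 else 0)" if "k < n" "l < n" for k l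
      unfolding p_def cip_scale_left cip_scale_right AA[OF that]
      using mu0[OF that(1)] by (auto simp: s_def simp flip: of_real_mult)
    show "kap n (ent A) (q k) i = complex_of_real (s k) * p k i" if "k < n" "i < n" for k i
    proof (cases "s k = 0")
      case True
      then have "nsq n (kap n (ent A) (q k)) = 0" using mu[OF that(1)] by (simp add: s_def)
      then show ?thesis using that True by (simp add: nsq_eq_0_iff)
    qed (simp add: p_def)
    show "schatten_norm t A = lpf n t s" for t
      unfolding s_def by (rule singular_numbers_norm[OF A q ev[unfolded B_def]])
  qed
  then show ?thesis by (rule that)
qed

text \<open>Here \<open>mat_adjoint A * A\<close> is the square of \<open>A\<close> and has the same
  eigenbasis, with squared eigenvalues.\<close>

lemma svd_herm:
  assumes A: "A \<in> carrier_mat n n" and q: "ons n n e" and H: "herm n (ent A)"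
    and ev: "\<And>k i. k < n \<Longrightarrow> i < n \<Longrightarrow> kap n (ent A) (e k) i = complex_of_real (lam k) * e k i"
  shows "schatten_norm t A = lpf n t (\<lambda>k. \<bar>lam k\<bar>)"
proof -
  have "kap n (ent (mat_adjoint A * A)) (e k) i = complex_of_real ((lam k)\<^sup>2) * e k i"
    if "k < n" "i < n" for k i
  proof -
    have "kap n (ent (mat_adjoint A * A)) (e k) i = kap n (\<lambda>i j. cnj (A $$ (j, i))) (kap n (ent A) (e k)) i"
      by (rule kap_adjoint_mult[OF A that(2)])
    also have "\<dots> = kap n (ent A) (kap n (ent A) (e k)) i"
      using H that(2) by (simp add: kap_herm_adjoint)
    also have "\<dots> = kap n (ent A) (\<lambda>i. complex_of_real (lam k) * e k i) i"
      by (intro kap_cong ev that)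
    also have "\<dots> = complex_of_real ((lam k)\<^sup>2) * e k i"
      unfolding kap_scale ev[OF that] by (simp add: power2_eq_square)
    finally show ?thesis .
  qed
  from singular_numbers_norm[OF A q this] show ?thesis by simp
qed

lemma svd_bilinear:
  assumes "svd n A s q p"
  shows "cip n (kap n (ent A) x) y = (\<Sum>k<n. complex_of_real (s k) * cip n x (q k) * cip n (p k) y)"
proof -
  have q: "ons n n q" and Aq: "\<And>k i. k < n \<Longrightarrow> i < n \<Longrightarrow> kap n (ent A) (q k) i = complex_of_real (s k) * p k i"
    using assms by (auto simp: svd_def)
  have "kap n (ent A) x i = (\<Sum>k<n. cip n x (q k) * (complex_of_real (s k) * p k i))" if "i < n" for i
  proof -
    have "kap n (ent A) x i = kap n (ent A) (\<lambda>i. \<Sum>k<n. cip n x (q k) * q k i) i"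
      by (intro kap_cong ons_expand[OF q])
    also have "\<dots> = (\<Sum>k<n. cip n x (q k) * kap n (ent A) (q k) i)"
      unfolding kap_sum kap_scale ..
    finally show ?thesis using that by (simp add: Aq)
  qed
  then have "cip n (kap n (ent A) x) y = cip n (\<lambda>i. \<Sum>k<n. cip n x (q k) * (complex_of_real (s k) * p k i)) y"
    by (intro cip_cong) auto
  then show ?thesis unfolding cip_sum_left cip_scale_left by (simp add: mult_ac)
qed

lemma svd_bessel:
  assumes "svd n A s q p"
  shows "(\<Sum>k<n. (cmod (cip n x (p k)))\<^sup>2) \<le> nsq n x"
  using assms by (intro bessel[where Z = "\<lambda>k. s k \<noteq> 0"]) (auto simp: svd_def)

text \<open>Both sides are the sum of the squared lengths of the vectors \<open>A q k\<close>; their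
  i-th coordinates are the coefficients of the i-th row of \<open>A\<close> in the conjugated basis,
  to which Parseval applies.\<close>

lemma frobenius:
  assumes A: "A \<in> carrier_mat n n" and "svd n A s q p"
  shows "(\<Sum>k<n. (s k)\<^sup>2) = (\<Sum>i<n. \<Sum>j<n. (cmod (A $$ (i, j)))\<^sup>2)"
proof -
  have q: "ons n n q" and Aq: "\<And>k i. k < n \<Longrightarrow> i < n \<Longrightarrow> kap n (ent A) (q k) i = complex_of_real (s k) * p k i"
    and pp: "\<And>k. k < n \<Longrightarrow> cip n (p k) (p k) = (if s k \<noteq> 0 then 1 else 0)"
    using assms(2) by (auto simp: svd_def)
  have "ons n n (\<lambda>k j. cnj (q k j))"
    unfolding ons_def
  proof (intro allI impI)
    fix k l assume "k < n" "l < n"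
    moreover have "cip n (\<lambda>j. cnj (q k j)) (\<lambda>j. cnj (q l j)) = cip n (q l) (q k)"
      by (simp add: cip_def mult.commute)
    ultimately show "cip n (\<lambda>j. cnj (q k j)) (\<lambda>j. cnj (q l j)) = (if k = l then 1 else 0)"
      using q by (auto simp: ons_def)
  qed
  note row = parseval_nsq[OF this]
  have "(s k)\<^sup>2 = nsq n (kap n (ent A) (q k))" if "k < n" for k
  proof -
    have "nsq n (kap n (ent A) (q k)) = nsq n (\<lambda>i. complex_of_real (s k) * p k i)"
      by (intro nsq_cong Aq that)
    also have "\<dots> = (s k)\<^sup>2 * nsq n (p k)" by (simp add: nsq_scale)
    also have "\<dots> = (s k)\<^sup>2" using pp[OF that] by (simp add: cip_self split: if_splits)
    finally show ?thesis ..
  qed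
  then have "(\<Sum>k<n. (s k)\<^sup>2) = (\<Sum>k<n. \<Sum>i<n. (cmod (cip n (ent A i) (\<lambda>j. cnj (q k j))))\<^sup>2)"
    by (simp add: nsq_def kap_def cip_def)
  also have "\<dots> = (\<Sum>i<n. nsq n (ent A i))"
    by (subst sum.swap) (simp add: row)
  finally show ?thesis by (simp add: nsq_def)
qed

section \<open>Comparison of the norms\<close>

text \<open>This includes the exponent \<top>: \<open>enn2real \<top>\<close> is 0, and so is the
  quotient by it.\<close>

lemma recip_eq: "1 \<le> p \<Longrightarrow> recip p = 1 / enn2real p"
  by (cases p) (auto simp: recip_def divide_ennreal ennreal_1[symmetric] simp del: ennreal_1)

lemma recip_top_eq: "recip \<top> = 0"
  by (simp add: recip_def)

lemma recip_nonneg [simp]: "0 \<le> recip p"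
  by (simp add: recip_def)

lemma recip_le_1: "1 \<le> p \<Longrightarrow> recip p \<le> 1"
  by (cases p) (auto simp: recip_eq)

lemma enn2real_ge_1: "1 \<le> p \<Longrightarrow> p \<noteq> \<top> \<Longrightarrow> 1 \<le> enn2real p"
  by (cases p) auto

lemma lpf_top: "lpf n \<top> f = Max (insert 0 ((\<lambda>i. norm (f i)) ` {..<n}))"
proof -
  have "(\<lambda>i. norm (Matrix.vec n f $ i)) ` {..<n} = (\<lambda>i. norm (f i)) ` {..<n}"
    by (intro image_cong) auto
  then show ?thesis by (simp add: lp_norm_def)
qed

lemma lpf_fin: "p \<noteq> \<top> \<Longrightarrow> lpf n p f = (\<Sum>i<n. norm (f i) powr enn2real p) powr (1 / enn2real p)"
  by (simp add: lp_norm_def)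

lemma lpf_nonneg [simp]: "0 \<le> lpf n p f"
  by (cases "p = \<top>") (auto simp: lpf_top lpf_fin intro!: Max_ge)

lemma lpf_powr:
  assumes "1 \<le> p" "p \<noteq> \<top>"
  shows "lpf n p f powr enn2real p = (\<Sum>i<n. norm (f i) powr enn2real p)"
  using enn2real_ge_1[OF assms] by (simp add: lpf_fin assms powr_powr sum_nonneg)

lemma lpf_ge: 
  assumes "1 \<le> p" "i < n"
  shows "norm (f i) \<le> lpf n p f"
proof (cases "p = \<top>")
  case True
  then show ?thesis using assms by (auto simp: lpf_top intro!: Max_ge)
next
  case False
  define a where "a = enn2real p"
  have a: "1 \<le> a" using enn2real_ge_1[OF assms(1) False] by (simp add: a_def)
  have "norm (f i) powr a \<le> (\<Sum>i<n. norm (f i) powr a)"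
    using assms(2) by (intro member_le_sum) auto
  then have "(norm (f i) powr a) powr (1 / a) \<le> (\<Sum>i<n. norm (f i) powr a) powr (1 / a)"
    using a by (intro powr_mono2) auto
  then show ?thesis using a by (simp add: powr_powr lpf_fin False a_def)
qed

lemma lpf_top_le: "(\<And>i. i < n \<Longrightarrow> norm (f i) \<le> c) \<Longrightarrow> 0 \<le> c \<Longrightarrow> lpf n \<top> f \<le> c"
  by (simp add: lpf_top)

lemma lpf_fin_le:
  assumes "1 \<le> p" "p \<noteq> \<top>" "(\<Sum>i<n. norm (f i) powr enn2real p) \<le> c powr enn2real p" "0 \<le> c"
  shows "lpf n p f \<le> c"
proof -
  have "(\<Sum>i<n. norm (f i) powr enn2real p) powr (1 / enn2real p) \<le> (c powr enn2real p) powr (1 / enn2real p)"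
    using assms(3) by (intro powr_mono2) (auto intro: sum_nonneg)
  then show ?thesis using enn2real_ge_1[OF assms(1,2)] assms(4) by (simp add: lpf_fin assms(2) powr_powr)
qed

lemma lpf_mono:
  assumes "1 \<le> p" "\<And>i. i < n \<Longrightarrow> norm (f i) \<le> norm (g i)"
  shows "lpf n p f \<le> lpf n p g"
proof (cases "p = \<top>")
  case True
  have "norm (f i) \<le> lpf n \<top> g" if "i < n" for i
    using assms(2)[OF that] lpf_ge[of \<top> i n g] that by simp
  then show ?thesis unfolding True by (intro lpf_top_le) auto
next
  case False
  then show ?thesis using assms(2) enn2real_ge_1[OF assms(1) False]
    by (intro lpf_fin_le assms(1)) (auto simp: lpf_powr assms(1) intro!: sum_mono powr_mono2)
qed

lemma lpf_2: "(lpf n 2 f)\<^sup>2 = (\<Sum>i<n. (norm (f i))\<^sup>2)"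
  using lpf_powr[of 2 n f] by (simp add: powr_numeral)

lemma lpf_1: "lpf n 1 f = (\<Sum>i<n. norm (f i))"
  by (simp add: lpf_fin sum_nonneg)

text \<open>The power of \<open>n\<close> is the norm of the identity between the two sequence
  spaces. For the larger exponent the surplus power of each entry is bounded by the norm; for the
  smaller one Hoelder's inequality against the constant sequence gives the factor.\<close>

lemma lpf_compare:
  assumes p: "1 \<le> p" and q: "1 \<le> q" and n: "1 \<le> n"
  shows "lpf n q f \<le> real n powr max 0 (recip q - recip p) * lpf n p f"
proof -
  define N where "N = lpf n p f"
  have N0: "0 \<le> N" by (simp add: N_def)
  have fN: "norm (f i) \<le> N" if "i < n" for i using lpf_ge[OF p that, of f] by (simp add: N_def)
  show ?thesis
  proof (cases "recip q \<le> recip p")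
    case True
    have "lpf n q f \<le> N"
    proof (cases "q = \<top>")
      case True
      then show ?thesis using fN N0 by (simp add: lpf_top)
    next
      case qf: False
      have qp: "enn2real q \<ge> 1" by (rule enn2real_ge_1[OF q qf])
      have pf: "p \<noteq> \<top>" using True qp by (auto simp: recip_eq p q)
      have pp: "enn2real p \<ge> 1" by (rule enn2real_ge_1[OF p pf])
      have pq: "enn2real p \<le> enn2real q" using True pp qp by (simp add: recip_eq p q field_simps)
      have "(\<Sum>i<n. norm (f i) powr enn2real q) \<le> (\<Sum>i<n. N powr (enn2real q - enn2real p) * norm (f i) powr enn2real p)"
      proof (rule sum_mono)
        fix i assume "i \<in> {..<n}"
        have "norm (f i) powr enn2real q = norm (f i) powr (enn2real q - enn2real p) * norm (f i) powr enn2real p"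
          by (simp flip: powr_add)
        also have "\<dots> \<le> N powr (enn2real q - enn2real p) * norm (f i) powr enn2real p"
          using fN \<open>i \<in> {..<n}\<close> pq by (intro mult_right_mono powr_mono2) auto
        finally show "norm (f i) powr enn2real q \<le> N powr (enn2real q - enn2real p) * norm (f i) powr enn2real p" .
      qed
      also have "\<dots> = N powr (enn2real q - enn2real p) * N powr enn2real p"
        unfolding N_def lpf_powr[OF p pf] sum_distrib_left ..
      also have "\<dots> = N powr enn2real q" by (simp flip: powr_add)
      finally show ?thesis by (intro lpf_fin_le q qf N0)
    qed
    then show ?thesis using True n by (simp add: N_def max_def)
  next
    case less: False
    have qf: "q \<noteq> \<top>" using less recip_nonneg[of p] by (auto simp: recip_top_eq)
    define b where "b = enn2real q"
    have b: "1 \<le> b" unfolding b_def by (rule enn2real_ge_1[OF q qf])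
    have "(\<Sum>i<n. norm (f i) powr b) \<le> real n powr (1 - b * recip p) * N powr b"
    proof (cases "p = \<top>")
      case True
      have "(\<Sum>i<n. norm (f i) powr b) \<le> (\<Sum>i<n. N powr b)"
        using fN b by (intro sum_mono powr_mono2) auto
      then show ?thesis using True n by (simp add: recip_top_eq)
    next
      case pf: False
      define a where "a = enn2real p"
      have a: "1 \<le> a" unfolding a_def by (rule enn2real_ge_1[OF p pf])
      have rp: "recip p = 1 / a" and rq: "recip q = 1 / b" by (simp_all add: recip_eq p q a_def b_def)
      have ba: "b < a" using less a b by (simp add: rp rq field_simps)
      show ?thesis
      proof (cases "N = 0")
        case True
        then have "norm (f i) powr b = 0" if "i < n" for i using fN[OF that] by simp
        then show ?thesis by simp
      next
        case False
        then have Np: "N > 0" using N0 by simp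
        \<comment> \<open>Young's inequality termwise for \<open>n |f i|^a / N^a\<close> and 1 with
          weights \<open>b / a\<close> and \<open>1 - b / a\<close>. Both means over
          \<open>i\<close> are then 1, so that the right side adds up to \<open>n\<close>.\<close>
        have "(\<Sum>i<n. (real n powr (b / a) / N powr b) * norm (f i) powr b)
          \<le> (\<Sum>i<n. (b / a) * (real n * norm (f i) powr a / N powr a) + (1 - b / a))"
        proof (rule sum_mono)
          fix i
          show "(real n powr (b / a) / N powr b) * norm (f i) powr b
            \<le> (b / a) * (real n * norm (f i) powr a / N powr a) + (1 - b / a)"
          proof (cases "norm (f i) = 0")
            case True
            then show ?thesis using ba b by simp
          next
            case False
            then have "(real n * norm (f i) powr a / N powr a) powr (b / a) * 1 powr (1 - b / a)
              \<le> (b / a) * (real n * norm (f i) powr a / N powr a) + (1 - b / a) * 1"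
              using a b ba Np n by (intro Youngs_inequality_0) auto
            moreover have "(real n * norm (f i) powr a / N powr a) powr (b / a)
              = real n powr (b / a) * norm (f i) powr b / N powr b"
              using a Np by (simp add: powr_mult powr_divide powr_powr)
            ultimately show ?thesis by simp
          qed
        qed
        also have "\<dots> = (b / a) * real n / N powr a * (\<Sum>i<n. norm (f i) powr a) + real n * (1 - b / a)"
          by (simp add: sum.distrib sum_distrib_left sum_divide_distrib mult_ac)
        also have "(\<Sum>i<n. norm (f i) powr a) = N powr a"
          unfolding N_def a_def lpf_powr[OF p pf] ..
        also have "(b / a) * real n / N powr a * N powr a + real n * (1 - b / a) = real n"
          using Np by (simp add: algebra_simps)
        finally have *: "(real n powr (b / a) / N powr b) * (\<Sum>i<n. norm (f i) powr b) \<le> real n"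
          by (simp add: sum_distrib_left)
        have "real n = real n powr (b / a) * real n powr (1 - b / a)"
          using n by (simp flip: powr_add)
        with * have "real n powr (b / a) * (\<Sum>i<n. norm (f i) powr b) \<le> real n powr (b / a) * (real n powr (1 - b / a) * N powr b)"
          using Np by (simp add: field_simps)
        then show ?thesis using n by (simp add: rp)
      qed
    qed
    also have "\<dots> = (real n powr (recip q - recip p) * N) powr b"
    proof -
      have "(recip q - recip p) * b = 1 - b * recip p"
        using b by (simp add: recip_eq[OF q] b_def[symmetric] algebra_simps)
      then show ?thesis by (simp add: powr_mult powr_powr)
    qed
    finally have "lpf n q f \<le> real n powr (recip q - recip p) * N"
      using N0 by (intro lpf_fin_le q qf) (auto simp: b_def)
    then show ?thesis using less by (simp add: N_def)
  qed
qed

lemma lpf_le_lpf: "1 \<le> p \<Longrightarrow> p \<le> q \<Longrightarrow> lpf n q f \<le> lpf n p f"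
proof (cases "n = 0")
  case True
  then show ?thesis by (cases "q = \<top>") (auto simp: lpf_top lpf_fin)
next
  case False
  assume p: "1 \<le> p" and pq: "p \<le> q"
  then have "recip q \<le> recip p"
    by (cases p; cases q) (auto simp: recip_eq recip_top_eq top_unique intro!: divide_left_mono order_trans[OF p])
  then show ?thesis using lpf_compare[OF p order_trans[OF p pq], of n f] False by simp
qed

text \<open>After normalising by \<open>S\<close> and \<open>D\<close>, Young's inequality splits
  each product; the row sums absorb one of the weights, the column sums the other. With
  \<open>M\<close> made from two pairs of bases this does the work of von Neumann's trace
  inequality.\<close>

lemma substochastic_holder:
  fixes M :: "nat \<Rightarrow> nat \<Rightarrow> real"
  assumes M0: "\<And>j k. j < n \<Longrightarrow> k < n \<Longrightarrow> 0 \<le> M j k"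
    and row: "\<And>j. j < n \<Longrightarrow> (\<Sum>k<n. M j k) \<le> 1"
    and col: "\<And>k. k < n \<Longrightarrow> (\<Sum>j<n. M j k) \<le> 1"
    and s: "\<And>j. j < n \<Longrightarrow> 0 \<le> s j" and d: "\<And>k. k < n \<Longrightarrow> 0 \<le> d k"
    and ab: "1 < a" "1 < b" "1 / a + 1 / b = 1"
  shows "(\<Sum>k<n. \<Sum>j<n. d k * s j * M j k) \<le> (\<Sum>j<n. s j powr a) powr (1 / a) * (\<Sum>k<n. d k powr b) powr (1 / b)"
proof -
  define S where "S = (\<Sum>j<n. s j powr a) powr (1 / a)"
  define D where "D = (\<Sum>k<n. d k powr b) powr (1 / b)"
  have Sa: "S powr a = (\<Sum>j<n. s j powr a)" and Db: "D powr b = (\<Sum>k<n. d k powr b)"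
    using ab by (simp_all add: S_def D_def powr_powr sum_nonneg)
  show ?thesis
  proof (cases "S = 0 \<or> D = 0")
    case True
    then show ?thesis
    proof
      assume "S = 0"
      then have "(\<Sum>j<n. s j powr a) = 0" using Sa ab by simp
      then have "s j = 0" if "j < n" for j
        using that by (subst (asm) sum_nonneg_eq_0_iff) auto
      then show ?thesis by simp
    next
      assume "D = 0"
      then have "(\<Sum>k<n. d k powr b) = 0" using Db ab by simp
      then have "d k = 0" if "k < n" for k
        using that by (subst (asm) sum_nonneg_eq_0_iff) auto
      then show ?thesis by simp
    qed
  next
    case False
    then have SD: "S > 0" "D > 0" by (auto simp: S_def D_def)
    have "(\<Sum>k<n. \<Sum>j<n. d k * s j * M j k) \<le> (\<Sum>k<n. \<Sum>j<n. S * D * ((s j / S) powr a / a + (d k / D) powr b / b) * M j k)"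
    proof (intro sum_mono mult_right_mono)
      fix k j assume kj: "k \<in> {..<n}" "j \<in> {..<n}"
      show "0 \<le> M j k" using M0 kj by auto
      have "(s j / S) * (d k / D) \<le> (s j / S) powr a / a + (d k / D) powr b / b"
        using s d kj SD by (intro Youngs_inequality ab) auto
      then have "S * D * ((s j / S) * (d k / D)) \<le> S * D * ((s j / S) powr a / a + (d k / D) powr b / b)"
        using SD by (intro mult_left_mono) auto
      then show "d k * s j \<le> S * D * ((s j / S) powr a / a + (d k / D) powr b / b)"
        using SD by (simp add: mult_ac)
    qed
    also have "\<dots> = S * D * ((\<Sum>k<n. \<Sum>j<n. (s j / S) powr a / a * M j k) + (\<Sum>k<n. \<Sum>j<n. (d k / D) powr b / b * M j k))"
      by (simp add: sum_distrib_left sum.distrib algebra_simps)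
    also have "(\<Sum>k<n. \<Sum>j<n. (s j / S) powr a / a * M j k) = (\<Sum>j<n. (s j / S) powr a / a * (\<Sum>k<n. M j k))"
      by (subst sum.swap) (simp add: sum_distrib_left)
    also have "\<dots> \<le> (\<Sum>j<n. (s j / S) powr a / a * 1)"
      using ab row by (intro sum_mono mult_left_mono) auto
    also have "\<dots> = 1 / a"
    proof -
      have "(\<Sum>j<n. (s j / S) powr a / a * 1) = (\<Sum>j<n. s j powr a) / S powr a / a"
        by (simp add: powr_divide sum_divide_distrib)
      then show ?thesis using SD by (simp flip: Sa)
    qed
    also have "(\<Sum>k<n. \<Sum>j<n. (d k / D) powr b / b * M j k) = (\<Sum>k<n. (d k / D) powr b / b * (\<Sum>j<n. M j k))"
      by (simp add: sum_distrib_left)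
    also have "\<dots> \<le> (\<Sum>k<n. (d k / D) powr b / b * 1)"
      using ab col by (intro sum_mono mult_left_mono) auto
    also have "\<dots> = 1 / b"
    proof -
      have "(\<Sum>j<n. (d j / D) powr b / b * 1) = (\<Sum>j<n. d j powr b) / D powr b / b"
        by (simp add: powr_divide sum_divide_distrib)
      then show ?thesis using SD by (simp flip: Db)
    qed
    finally show ?thesis using ab SD by (simp add: S_def D_def mult.commute)
  qed
qed

section \<open>Weakly square-summable families\<close>

definition weak :: "'a cnormed \<Rightarrow> nat \<Rightarrow> (nat \<Rightarrow> 'a) \<Rightarrow> real" where
  "weak E m x = (SUP \<phi>\<in>dual_ball E. sqrt (\<Sum>i<m. (cmod (\<phi> (x i)))\<^sup>2))"

definition lin_form :: "'a cnormed \<Rightarrow> ('a \<Rightarrow> complex) \<Rightarrow> bool" where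
  "lin_form E \<phi> \<longleftrightarrow> (\<forall>x\<in>carrier E. \<forall>y\<in>carrier E. \<phi> (x \<oplus>\<^bsub>E\<^esub> y) = \<phi> x + \<phi> y)
     \<and> (\<forall>a. \<forall>x\<in>carrier E. \<phi> (a \<odot>\<^bsub>E\<^esub> x) = a * \<phi> x)"

lemma dual_ball_eq: "dual_ball E = {\<phi>. lin_form E \<phi> \<and> (\<forall>x\<in>carrier E. cmod (\<phi> x) \<le> nrm E x)}"
  by (auto simp: dual_ball_def lin_form_def)

lemma zero_in_dual_ball: "(\<And>x. x \<in> carrier E \<Longrightarrow> 0 \<le> nrm E x) \<Longrightarrow> (\<lambda>_. 0) \<in> dual_ball E"
  by (auto simp: dual_ball_def)

lemma weak_ge:
  assumes "\<And>i. i < m \<Longrightarrow> x i \<in> carrier E" "\<phi> \<in> dual_ball E"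
  shows "sqrt (\<Sum>i<m. (cmod (\<phi> (x i)))\<^sup>2) \<le> weak E m x"
  unfolding weak_def
proof (rule cSUP_upper[OF assms(2)])
  show "bdd_above ((\<lambda>\<phi>. sqrt (\<Sum>i<m. (cmod (\<phi> (x i)))\<^sup>2)) ` dual_ball E)"
  proof (rule bdd_aboveI2)
    fix \<psi> assume "\<psi> \<in> dual_ball E"
    then show "sqrt (\<Sum>i<m. (cmod (\<psi> (x i)))\<^sup>2) \<le> sqrt (\<Sum>i<m. (nrm E (x i))\<^sup>2)"
      using assms(1) by (intro real_sqrt_le_mono sum_mono power_mono) (auto simp: dual_ball_def)
  qed
qed

lemma weak_nonneg:
  assumes "\<And>i. i < m \<Longrightarrow> x i \<in> carrier E" "\<And>x. x \<in> carrier E \<Longrightarrow> 0 \<le> nrm E x"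
  shows "0 \<le> weak E m x"
proof -
  have "sqrt (\<Sum>i<m. (cmod (0::complex))\<^sup>2) \<le> weak E m x"
    by (rule weak_ge[OF assms(1) zero_in_dual_ball[OF assms(2)]])
  then show ?thesis by simp
qed

lemma weak_le:
  assumes "\<And>x. x \<in> carrier E \<Longrightarrow> 0 \<le> nrm E x"
    and "\<And>\<phi>. \<phi> \<in> dual_ball E \<Longrightarrow> (\<Sum>i<m. (cmod (\<phi> (x i)))\<^sup>2) \<le> c\<^sup>2" "0 \<le> c"
  shows "weak E m x \<le> c"
  unfolding weak_def
proof (rule cSUP_least)
  show "dual_ball E \<noteq> {}" using zero_in_dual_ball[OF assms(1)] by auto
  fix \<phi> assume "\<phi> \<in> dual_ball E"
  from real_sqrt_le_mono[OF assms(2)[OF this]]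
  show "sqrt (\<Sum>i<m. (cmod (\<phi> (x i)))\<^sup>2) \<le> c" using assms(3) by simp
qed

text \<open>Dividing the form by \<open>c\<close> puts it into the dual ball. All information on a
  weakly square-summable family enters through this inequality, applied to suitably chosen
  forms.\<close>

lemma weak_lin_form:
  assumes x: "\<And>i. i < m \<Longrightarrow> x i \<in> carrier E" and lin: "lin_form E \<phi>"
    and bd: "\<And>y. y \<in> carrier E \<Longrightarrow> cmod (\<phi> y) \<le> c * nrm E y"
    and c: "0 \<le> c"
  shows "(\<Sum>i<m. (cmod (\<phi> (x i)))\<^sup>2) \<le> (c * weak E m x)\<^sup>2"
proof (cases "c = 0")
  case True
  then have "\<phi> (x i) = 0" if "i < m" for i using bd[OF x[OF that]] by simp
  then show ?thesis by simp
next
  case False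
  then have c: "c > 0" using c by simp
  have "(\<lambda>y. of_real (1 / c) * \<phi> y) \<in> dual_ball E"
    using lin bd c by (auto simp: dual_ball_eq lin_form_def norm_mult norm_divide algebra_simps divide_simps)
  from weak_ge[OF x this] have "sqrt (\<Sum>i<m. (cmod (of_real (1 / c) * \<phi> (x i)))\<^sup>2) \<le> weak E m x" by simp
  also have "(\<Sum>i<m. (cmod (of_real (1 / c) * \<phi> (x i)))\<^sup>2) = (1 / c)\<^sup>2 * (\<Sum>i<m. (cmod (\<phi> (x i)))\<^sup>2)"
    using c by (simp add: norm_mult norm_divide power_divide sum_distrib_left sum_divide_distrib)
  finally have "sqrt (\<Sum>i<m. (cmod (\<phi> (x i)))\<^sup>2) \<le> c * weak E m x"
    using c by (simp add: real_sqrt_mult real_sqrt_divide field_simps)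
  then have "(sqrt (\<Sum>i<m. (cmod (\<phi> (x i)))\<^sup>2))\<^sup>2 \<le> (c * weak E m x)\<^sup>2"
    by (intro power_mono) (auto intro: sum_nonneg)
  then show ?thesis by (simp add: sum_nonneg)
qed

text \<open>Averaging over all signs would make the cross terms cancel. A greedy choice does it
  deterministically: each new sign makes its cross term with the preceding partial sums
  nonnegative.\<close>

lemma exists_signs:
  fixes c :: "nat \<Rightarrow> nat \<Rightarrow> complex"
  shows "\<exists>\<epsilon>::nat \<Rightarrow> real. (\<forall>k. \<bar>\<epsilon> k\<bar> = 1) \<and>
    (\<Sum>i<m. \<Sum>k<n. (cmod (c i k))\<^sup>2) \<le> (\<Sum>i<m. (cmod (\<Sum>k<n. of_real (\<epsilon> k) * c i k))\<^sup>2)"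
proof (induction n)
  case 0
  show ?case by (intro exI[of _ "\<lambda>_. 1"]) auto
next
  case (Suc n)
  then obtain \<epsilon> where eps: "\<And>k. \<bar>\<epsilon> k\<bar> = 1"
    "(\<Sum>i<m. \<Sum>k<n. (cmod (c i k))\<^sup>2) \<le> (\<Sum>i<m. (cmod (\<Sum>k<n. of_real (\<epsilon> k) * c i k))\<^sup>2)" by auto
  define S where "S i = (\<Sum>k<n. of_real (\<epsilon> k) * c i k)" for i
  define r where "r i = Re (cnj (S i) * c i n)" for i
  define R where "R = (\<Sum>i<m. r i)"
  define \<sigma> :: real where "\<sigma> = (if R \<ge> 0 then 1 else -1)"
  have sq': "(cmod (a + of_real \<sigma> * b))\<^sup>2 = (cmod a)\<^sup>2 + (cmod b)\<^sup>2 + 2 * \<sigma> * Re (cnj a * b)" for a b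
    unfolding cmod_power2 by (simp add: \<sigma>_def power2_eq_square algebra_simps)
  have sq: "(cmod (S i + of_real \<sigma> * c i n))\<^sup>2 = (cmod (S i))\<^sup>2 + (cmod (c i n))\<^sup>2 + 2 * \<sigma> * r i" for i
    unfolding sq' r_def ..
  show ?case
  proof (intro exI[of _ "\<epsilon>(n := \<sigma>)"] conjI allI)
    show "\<bar>(\<epsilon>(n := \<sigma>)) k\<bar> = 1" for k using eps by (simp add: \<sigma>_def)
    have "(\<Sum>k<Suc n. of_real ((\<epsilon>(n := \<sigma>)) k) * c i k) = S i + of_real \<sigma> * c i n" for i
      by (simp add: S_def)
    then have "(\<Sum>i<m. (cmod (\<Sum>k<Suc n. of_real ((\<epsilon>(n := \<sigma>)) k) * c i k))\<^sup>2)
      = (\<Sum>i<m. (cmod (S i))\<^sup>2) + (\<Sum>i<m. (cmod (c i n))\<^sup>2) + 2 * (\<sigma> * R)"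
      by (simp add: sq sum.distrib R_def sum_distrib_left mult_ac)
    moreover have "\<sigma> * R \<ge> 0" by (simp add: \<sigma>_def)
    ultimately show "(\<Sum>i<m. \<Sum>k<Suc n. (cmod (c i k))\<^sup>2)
      \<le> (\<Sum>i<m. (cmod (\<Sum>k<Suc n. of_real ((\<epsilon>(n := \<sigma>)) k) * c i k))\<^sup>2)"
      using eps(2) by (simp add: sum.distrib S_def)
  qed
qed

section \<open>Trace pairings and Hoelder's inequality in the Schatten classes\<close>

lemma schatten_norm_nonneg: "A \<in> carrier_mat n n \<Longrightarrow> 0 \<le> schatten_norm t A"
  by (rule svd_exists[of A n]) (auto simp: svd_def)

lemma ent_apply_add:
  assumes "A \<in> carrier_mat n n" "B \<in> carrier_mat n n" "i < n"
  shows "kap n (ent (A + B)) x i = kap n (ent A) x i + kap n (ent B) x i"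
  using assms by (simp add: kap_def sum.distrib algebra_simps)

lemma ent_apply_smult:
  assumes "A \<in> carrier_mat n n" "i < n"
  shows "kap n (ent (a \<cdot>\<^sub>m A)) x i = a * kap n (ent A) x i"
  using assms by (simp add: kap_def sum_distrib_left algebra_simps)

text \<open>These are trace pairings with an operator that is given by coefficients \<open>d\<close>
  and two systems of vectors. They supply the test functionals on matrices.\<close>

lemma lin_form_matrix:
  "lin_form (schatten_space u n) (\<lambda>A. \<Sum>k<m. d k * cip n (kap n (ent A) (e k)) (f k))"
  unfolding lin_form_def schatten_space_simps
proof (intro conjI ballI allI)
  fix A B :: "complex Matrix.mat" assume AB: "A \<in> carrier_mat n n" "B \<in> carrier_mat n n"
  have "cip n (kap n (ent (A + B)) x) y = cip n (kap n (ent A) x) y + cip n (kap n (ent B) x) y" for x y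
    unfolding cip_add_left[symmetric] by (intro cip_cong ent_apply_add AB refl)
  then show "(\<Sum>k<m. d k * cip n (kap n (ent (A + B)) (e k)) (f k)) =
      (\<Sum>k<m. d k * cip n (kap n (ent A) (e k)) (f k)) + (\<Sum>k<m. d k * cip n (kap n (ent B) (e k)) (f k))"
    by (simp add: sum.distrib algebra_simps)
next
  fix a and A :: "complex Matrix.mat" assume A: "A \<in> carrier_mat n n"
  have "cip n (kap n (ent (a \<cdot>\<^sub>m A)) x) y = a * cip n (kap n (ent A) x) y" for x y
    unfolding cip_scale_left[symmetric] by (intro cip_cong ent_apply_smult A refl)
  then show "(\<Sum>k<m. d k * cip n (kap n (ent (a \<cdot>\<^sub>m A)) (e k)) (f k)) = a * (\<Sum>k<m. d k * cip n (kap n (ent A) (e k)) (f k))"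
    by (simp add: sum_distrib_left mult_ac)
qed

lemma cmod_cip_commute: "cmod (cip n x y) = cmod (cip n y x)"
  by (metis cip_cnj complex_mod_cnj)

text \<open>Each singular number is at most the norm, for every exponent; the remaining sum of
  products is bounded by 1 through \<open>2 a b \<le> a^2 + b^2\<close>, Parseval on the right and
  Bessel on the left.\<close>

lemma bilinear_le_schatten:
  assumes A: "A \<in> carrier_mat n n" and u: "1 \<le> u" and xy: "nsq n x \<le> 1" "nsq n y \<le> 1"
  shows "cmod (cip n (kap n (ent A) x) y) \<le> schatten_norm u A"
proof -
  obtain s q p where sv: "svd n A s q p" using svd_exists[OF A] .
  have q: "ons n n q" and s0: "\<And>k. k < n \<Longrightarrow> 0 \<le> s k" and sn: "schatten_norm u A = lpf n u s"
    using sv by (auto simp: svd_def)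
  have "cmod (cip n (kap n (ent A) x) y) \<le> (\<Sum>k<n. s k * (cmod (cip n x (q k)) * cmod (cip n (p k) y)))"
    unfolding svd_bilinear[OF sv]
    by (rule order_trans[OF norm_sum]) (auto simp: norm_mult s0 intro!: sum_mono)
  also have "\<dots> \<le> (\<Sum>k<n. lpf n u s * (((cmod (cip n x (q k)))\<^sup>2 + (cmod (cip n (p k) y))\<^sup>2) / 2))"
  proof (intro sum_mono mult_mono)
    fix k assume "k \<in> {..<n}"
    then show "s k \<le> lpf n u s" using lpf_ge[OF u, of k n s] s0 by simp
    show "cmod (cip n x (q k)) * cmod (cip n (p k) y) \<le> ((cmod (cip n x (q k)))\<^sup>2 + (cmod (cip n (p k) y))\<^sup>2) / 2"
      using sum_squares_bound[of "cmod (cip n x (q k))" "cmod (cip n (p k) y)"] by simp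
  qed auto
  also have "\<dots> = lpf n u s * ((\<Sum>k<n. (cmod (cip n x (q k)))\<^sup>2) + (\<Sum>k<n. (cmod (cip n (p k) y))\<^sup>2)) / 2"
    by (simp add: sum_distrib_left sum.distrib sum_divide_distrib distrib_left add_divide_distrib)
  also have "\<dots> \<le> lpf n u s * 2 / 2"
  proof -
    have "(\<Sum>k<n. (cmod (cip n x (q k)))\<^sup>2) \<le> 1" using parseval_nsq[OF q, of x] xy by simp
    moreover have "(\<Sum>k<n. (cmod (cip n (p k) y))\<^sup>2) \<le> 1"
      using svd_bessel[OF sv, of y] xy by (simp add: cmod_cip_commute[of n _ y])
    ultimately show ?thesis by (intro divide_right_mono mult_left_mono) auto
  qed
  finally show ?thesis by (simp add: sn)
qed

lemma schatten_holder_aux: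
  assumes sv: "svd n A s q p" and e: "ons n n e"
    and f: "\<And>v. (\<Sum>k<n. (cmod (cip n v (f k)))\<^sup>2) \<le> nsq n v"
    and M_def: "M = (\<lambda>j k. cmod (cip n (e k) (q j)) * cmod (cip n (p j) (f k)))"
  shows "cmod (\<Sum>k<n. d k * cip n (kap n (ent A) (e k)) (f k)) \<le> (\<Sum>k<n. \<Sum>j<n. cmod (d k) * s j * M j k)"
    and "j < n \<Longrightarrow> (\<Sum>k<n. M j k) \<le> 1" and "k < n \<Longrightarrow> (\<Sum>j<n. M j k) \<le> 1"
proof -
  have q: "ons n n q" and s0: "\<And>k. k < n \<Longrightarrow> 0 \<le> s k"
    and pp: "\<And>k. k < n \<Longrightarrow> cip n (p k) (p k) = (if s k \<noteq> 0 then 1 else 0)"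
    using sv by (auto simp: svd_def)
  have "cmod (\<Sum>k<n. d k * cip n (kap n (ent A) (e k)) (f k)) \<le> (\<Sum>k<n. cmod (d k) * cmod (cip n (kap n (ent A) (e k)) (f k)))"
    by (rule order_trans[OF norm_sum]) (simp add: norm_mult)
  also have "\<dots> \<le> (\<Sum>k<n. cmod (d k) * (\<Sum>j<n. s j * M j k))"
  proof (intro sum_mono mult_left_mono)
    show "cmod (cip n (kap n (ent A) (e k)) (f k)) \<le> (\<Sum>j<n. s j * M j k)" for k
      unfolding svd_bilinear[OF sv] M_def
      by (rule order_trans[OF norm_sum]) (auto simp: norm_mult s0 intro!: sum_mono)
  qed auto
  finally show "cmod (\<Sum>k<n. d k * cip n (kap n (ent A) (e k)) (f k)) \<le> (\<Sum>k<n. \<Sum>j<n. cmod (d k) * s j * M j k)"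
    by (simp add: sum_distrib_left mult_ac)
  have M_le: "M j k \<le> (cmod (cip n (e k) (q j)))\<^sup>2 / 2 + (cmod (cip n (p j) (f k)))\<^sup>2 / 2" for j k
    using sum_squares_bound[of "cmod (cip n (e k) (q j))" "cmod (cip n (p j) (f k))"] by (simp add: M_def)
  have one: "nsq n (g k) = 1" if "ons n n g" "k < n" for g k
    using that unfolding ons_def by (metis cip_self of_real_eq_1_iff)
  {
    assume j: "j < n"
    have "(\<Sum>k<n. M j k) \<le> (\<Sum>k<n. (cmod (cip n (e k) (q j)))\<^sup>2 / 2 + (cmod (cip n (p j) (f k)))\<^sup>2 / 2)"
      by (intro sum_mono M_le)
    also have "\<dots> = (\<Sum>k<n. (cmod (cip n (q j) (e k)))\<^sup>2) / 2 + (\<Sum>k<n. (cmod (cip n (p j) (f k)))\<^sup>2) / 2"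
      by (simp add: sum.distrib sum_divide_distrib cmod_cip_commute[of n _ "q j"])
    also have "\<dots> \<le> nsq n (q j) / 2 + nsq n (p j) / 2"
      using f[of "p j"] by (simp add: parseval_nsq[OF e, of "q j"])
    also have "\<dots> \<le> 1" using one[OF q j] pp[OF j] by (simp add: cip_self split: if_splits)
    finally show "(\<Sum>k<n. M j k) \<le> 1" .
  next
    assume k: "k < n"
    have "(\<Sum>j<n. M j k) \<le> (\<Sum>j<n. (cmod (cip n (e k) (q j)))\<^sup>2 / 2 + (cmod (cip n (p j) (f k)))\<^sup>2 / 2)"
      by (intro sum_mono M_le)
    also have "\<dots> = (\<Sum>j<n. (cmod (cip n (e k) (q j)))\<^sup>2) / 2 + (\<Sum>j<n. (cmod (cip n (f k) (p j)))\<^sup>2) / 2"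
      by (simp add: sum.distrib sum_divide_distrib cmod_cip_commute[of n _ "f k"])
    also have "\<dots> \<le> nsq n (e k) / 2 + nsq n (f k) / 2"
      using svd_bessel[OF sv, of "f k"] by (simp add: parseval_nsq[OF q])
    also have "\<dots> \<le> 1"
    proof -
      \<comment> \<open>Bessel's inequality applied to \<open>f k\<close> itself bounds its length
        by 1.\<close>
      have "(cmod (cip n (f k) (f k)))\<^sup>2 \<le> (\<Sum>l<n. (cmod (cip n (f k) (f l)))\<^sup>2)"
        using k by (intro member_le_sum) auto
      also have "\<dots> \<le> nsq n (f k)" by (rule f)
      finally have "nsq n (f k) * nsq n (f k) \<le> 1 * nsq n (f k)" by (simp add: cip_self power2_eq_square)
      then have "nsq n (f k) \<le> 1" by (metis mult_right_le_imp_le nsq_nonneg order.order_iff_strict zero_le_one)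
      then show ?thesis using one[OF e k] by simp
    qed
    finally show "(\<Sum>j<n. M j k) \<le> 1" .
  }
qed

text \<open>The endpoint whose dual exponent is infinite; row sums of \<open>M\<close> alone
  suffice.\<close>

lemma schatten_holder_1:
  assumes A: "A \<in> carrier_mat n n" and e: "ons n n e"
    and f: "\<And>v. (\<Sum>k<n. (cmod (cip n v (f k)))\<^sup>2) \<le> nsq n v"
    and d: "\<And>k. k < n \<Longrightarrow> cmod (d k) \<le> c"
  shows "cmod (\<Sum>k<n. d k * cip n (kap n (ent A) (e k)) (f k)) \<le> c * schatten_norm 1 A"
proof -
  obtain s q p where sv: "svd n A s q p" using svd_exists[OF A] .
  then have s0: "\<And>k. k < n \<Longrightarrow> 0 \<le> s k" and sn: "schatten_norm 1 A = lpf n 1 s"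
    by (auto simp: svd_def)
  define M where "M = (\<lambda>j k. cmod (cip n (e k) (q j)) * cmod (cip n (p j) (f k)))"
  note aux = schatten_holder_aux[OF sv e f M_def]
  have "cmod (\<Sum>k<n. d k * cip n (kap n (ent A) (e k)) (f k)) \<le> (\<Sum>k<n. \<Sum>j<n. cmod (d k) * s j * M j k)"
    by (rule aux(1))
  also have "\<dots> \<le> (\<Sum>k<n. \<Sum>j<n. c * s j * M j k)"
    using d s0 by (intro sum_mono mult_right_mono) (auto simp: M_def)
  also have "\<dots> = (\<Sum>j<n. c * s j * (\<Sum>k<n. M j k))"
    by (subst sum.swap) (simp add: sum_distrib_left)
  also have "\<dots> \<le> (\<Sum>j<n. c * s j * 1)"
  proof (intro sum_mono mult_left_mono)
    fix j assume j: "j \<in> {..<n}"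
    then show "(\<Sum>k<n. M j k) \<le> 1" using aux(2) by simp
    have "0 \<le> c" using d[of j] j norm_ge_zero[of "d j"] by (meson lessThan_iff order_trans)
    then show "0 \<le> c * s j" using s0 j by simp
  qed
  also have "\<dots> = c * schatten_norm 1 A"
    using s0 by (simp add: sn lpf_1 sum_distrib_left)
  finally show ?thesis .
qed

lemma schatten_holder:
  assumes A: "A \<in> carrier_mat n n" and e: "ons n n e"
    and f: "\<And>v. (\<Sum>k<n. (cmod (cip n v (f k)))\<^sup>2) \<le> nsq n v"
    and u: "1 < enn2real u" "u \<noteq> \<top>" and b: "1 < b" "1 / enn2real u + 1 / b = 1"
  shows "cmod (\<Sum>k<n. d k * cip n (kap n (ent A) (e k)) (f k)) \<le> (\<Sum>k<n. cmod (d k) powr b) powr (1 / b) * schatten_norm u A"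
proof -
  obtain s q p where sv: "svd n A s q p" using svd_exists[OF A] .
  then have s0: "\<And>k. k < n \<Longrightarrow> 0 \<le> s k" and sn: "schatten_norm u A = lpf n u s"
    by (auto simp: svd_def)
  define M where "M = (\<lambda>j k. cmod (cip n (e k) (q j)) * cmod (cip n (p j) (f k)))"
  note aux = schatten_holder_aux[OF sv e f M_def]
  have "cmod (\<Sum>k<n. d k * cip n (kap n (ent A) (e k)) (f k)) \<le> (\<Sum>k<n. \<Sum>j<n. cmod (d k) * s j * M j k)"
    by (rule aux(1))
  also have "\<dots> \<le> (\<Sum>j<n. s j powr enn2real u) powr (1 / enn2real u) * (\<Sum>k<n. cmod (d k) powr b) powr (1 / b)"
    by (intro substochastic_holder aux u b s0) (auto simp: M_def)
  also have "(\<Sum>j<n. s j powr enn2real u) powr (1 / enn2real u) = schatten_norm u A"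
    using s0 by (simp add: sn lpf_fin u)
  finally show ?thesis by (simp add: mult.commute)
qed

text \<open>Choosing signs along the cyclic diagonals makes all the entries of \<open>X\<close> with respect to
  the basis \<open>e\<close> visible to \<open>n\<close> linear forms.\<close>

lemma diagonal_shifts:
  fixes X :: "nat \<Rightarrow> complex Matrix.mat" and d :: "nat \<Rightarrow> real"
  assumes e: "ons n n e"
    and bd: "\<And>\<epsilon> f. ons n n f \<Longrightarrow> (\<And>k. \<bar>\<epsilon> k\<bar> = 1) \<Longrightarrow>
      (\<Sum>i<m. (cmod (\<Sum>k<n. complex_of_real (\<epsilon> k * d k) * cip n (kap n (ent (X i)) (e k)) (f k)))\<^sup>2) \<le> B"
  shows "(\<Sum>i<m. \<Sum>k<n. (d k)\<^sup>2 * nsq n (kap n (ent (X i)) (e k))) \<le> real n * B"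
proof -
  have "(\<Sum>i<m. \<Sum>k<n. (d k)\<^sup>2 * nsq n (kap n (ent (X i)) (e k)))
    = (\<Sum>i<m. \<Sum>k<n. \<Sum>l<n. (d k)\<^sup>2 * (cmod (cip n (kap n (ent (X i)) (e k)) (e ((k + l) mod n))))\<^sup>2)"
  proof (intro sum.cong refl)
    fix i k assume k: "k \<in> {..<n}"
    then have n: "n > 0" by auto
    \<comment> \<open>Parseval for the image of \<open>e k\<close>, with the basis numbered from
      \<open>k\<close> on. For a fixed \<open>l\<close>, the pairs of \<open>k\<close> and
      \<open>(k + l) mod n\<close> then form one cyclic diagonal.\<close>
    have "bij_betw (\<lambda>l. (k + l) mod n) {..<n} {..<n}"
    proof (rule bij_betw_byWitness[where f' = "\<lambda>l. (l + (n - k)) mod n"])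
      show "\<forall>a\<in>{..<n}. ((k + a) mod n + (n - k)) mod n = a"
      proof
        fix a assume "a \<in> {..<n}"
        moreover have "((k + a) mod n + (n - k)) mod n = (k + a + (n - k)) mod n" by (rule mod_add_left_eq)
        moreover have "k + a + (n - k) = a + n" using k by simp
        ultimately show "((k + a) mod n + (n - k)) mod n = a" by simp
      qed
      show "\<forall>a\<in>{..<n}. (k + (a + (n - k)) mod n) mod n = a"
      proof
        fix a assume "a \<in> {..<n}"
        moreover have "(k + (a + (n - k)) mod n) mod n = (k + (a + (n - k))) mod n" by (rule mod_add_right_eq)
        moreover have "k + (a + (n - k)) = a + n" using k by simp
        ultimately show "(k + (a + (n - k)) mod n) mod n = a" by simp
      qed
    qed (use n in auto)
    from sum.reindex_bij_betw[OF this, of "\<lambda>j. (cmod (cip n (kap n (ent (X i)) (e k)) (e j)))\<^sup>2"]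
    show "(d k)\<^sup>2 * nsq n (kap n (ent (X i)) (e k)) =
      (\<Sum>l<n. (d k)\<^sup>2 * (cmod (cip n (kap n (ent (X i)) (e k)) (e ((k + l) mod n))))\<^sup>2)"
      unfolding parseval_nsq[OF e] sum_distrib_left[symmetric] by simp
  qed
  also have "\<dots> = (\<Sum>l<n. \<Sum>i<m. \<Sum>k<n. (d k)\<^sup>2 * (cmod (cip n (kap n (ent (X i)) (e k)) (e ((k + l) mod n))))\<^sup>2)"
    by (rule trans[OF sum.cong[OF refl sum.swap] sum.swap])
  also have "\<dots> \<le> (\<Sum>l<n. B)"
  proof (rule sum_mono)
    fix l assume "l \<in> {..<n}"
    \<comment> \<open>The basis shifted by \<open>l\<close> is again orthonormal, so the diagonal is
      one test functional up to the signs.\<close>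
    define f where "f k = e ((k + l) mod n)" for k
    have f: "ons n n f"
      unfolding ons_def
    proof (intro allI impI)
      fix a b assume ab: "a < n" "b < n"
      have "(a + l) mod n = (b + l) mod n \<longleftrightarrow> a = b"
      proof
        assume eq: "(a + l) mod n = (b + l) mod n"
        have "x = y" if "(x + l) mod n = (y + l) mod n" "x \<le> y" "y < n" for x y
        proof -
          have "n dvd (y + l) - (x + l)" using that by (subst mod_eq_dvd_iff_nat[symmetric]) auto
          then have "n dvd y - x" by simp
          moreover have "y - x < n" using that by simp
          ultimately have "y - x = 0" by (metis dvd_imp_le leD neq0_conv)
          then show ?thesis using that by simp
        qed
        from this[of a b] this[of b a] eq ab show "a = b" by (cases "a \<le> b") auto
      qed simp
      then show "cip n (f a) (f b) = (if a = b then 1 else 0)"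
        using e ab unfolding ons_def f_def by simp
    qed
    define c where "c i k = complex_of_real (d k) * cip n (kap n (ent (X i)) (e k)) (f k)" for i k
    obtain \<epsilon> where eps: "\<And>k. \<bar>\<epsilon> k\<bar> = (1::real)"
      "(\<Sum>i<m. \<Sum>k<n. (cmod (c i k))\<^sup>2) \<le> (\<Sum>i<m. (cmod (\<Sum>k<n. of_real (\<epsilon> k) * c i k))\<^sup>2)"
      using exists_signs[where c = c and m = m and n = n] by blast
    have "(\<Sum>i<m. \<Sum>k<n. (d k)\<^sup>2 * (cmod (cip n (kap n (ent (X i)) (e k)) (f k)))\<^sup>2) = (\<Sum>i<m. \<Sum>k<n. (cmod (c i k))\<^sup>2)"
      by (simp add: c_def norm_mult power_mult_distrib)
    also note eps(2)
    also have "(\<Sum>i<m. (cmod (\<Sum>k<n. of_real (\<epsilon> k) * c i k))\<^sup>2) \<le> B"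
      using bd[where \<epsilon> = \<epsilon> and f = f, OF f eps(1)] by (simp add: c_def mult_ac)
    finally show "(\<Sum>i<m. \<Sum>k<n. (d k)\<^sup>2 * (cmod (cip n (kap n (ent (X i)) (e k)) (e ((k + l) mod n))))\<^sup>2) \<le> B"
      by (simp add: f_def)
  qed
  finally show ?thesis by simp
qed

section \<open>Gaussian combinations\<close>

definition stdn :: "real measure" where
  "stdn = density lborel (\<lambda>x. ennreal (std_normal_density x))"

definition gfam :: "'w measure \<Rightarrow> (nat \<Rightarrow> 'w \<Rightarrow> real) \<Rightarrow> nat \<Rightarrow> bool" where
  "gfam M b m \<longleftrightarrow> prob_space M \<and> prob_space.indep_vars M (\<lambda>_. borel) b {..<m}
     \<and> (\<forall>i<m. distributed M lborel (b i) std_normal_density)"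

lemma prob_space_stdn: "prob_space stdn"
  unfolding stdn_def by (rule prob_space_normal_density) simp

lemma sets_stdn [simp, measurable_cong]: "sets stdn = sets borel"
  by (simp add: stdn_def)

lemma space_stdn [simp]: "space stdn = UNIV"
  by (simp add: stdn_def)

text \<open>In the definition of a Gaussian-summing operator the \<open>b i\<close> may enumerate
  members of the sequence in any order.\<close>

lemma (in prob_space) indep_vars_reindex_inj:
  assumes X: "indep_vars M' X I" and f: "inj_on f J" "f ` J \<subseteq> I"
  shows "indep_vars (\<lambda>j. M' (f j)) (\<lambda>j. X (f j)) J"
  unfolding indep_vars_def indep_sets_def
proof (intro conjI ballI allI impI)
  fix j assume j: "j \<in> J"
  then show "random_variable (M' (f j)) (X (f j))" using X f by (auto simp: indep_vars_def)
  show "sigma_sets (space M) {X (f j) -` A \<inter> space M |A. A \<in> sets (M' (f j))} \<subseteq> events"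
    using X f j by (auto simp: indep_vars_def indep_sets_def)
next
  fix K A assume K: "K \<subseteq> J" "K \<noteq> {}" "finite K"
    and A: "A \<in> (\<Pi> j\<in>K. sigma_sets (space M) {X (f j) -` A \<inter> space M |A. A \<in> sets (M' (f j))})"
  have inj: "inj_on f K" using f(1) K(1) by (rule inj_on_subset)
  define B where "B i = A (inv_into K f i)" for i
  have B: "B (f j) = A j" if "j \<in> K" for j using that inj by (simp add: B_def)
  have "prob (\<Inter>i\<in>f ` K. B i) = (\<Prod>i\<in>f ` K. prob (B i))"
  proof (rule indep_setsD)
    show "indep_sets (\<lambda>i. sigma_sets (space M) {X i -` A \<inter> space M |A. A \<in> sets (M' i)}) I"
      using X by (auto simp: indep_vars_def)
    show "\<forall>j\<in>f ` K. B j \<in> sigma_sets (space M) {X j -` A \<inter> space M |A. A \<in> sets (M' j)}"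
      using A B by auto
  qed (use K f in auto)
  then show "prob (\<Inter> (A ` K)) = (\<Prod>j\<in>K. prob (A j))"
    by (simp add: prod.reindex[OF inj] B)
qed

lemma gfam_of_seq:
  assumes "std_gaussian_seq M g" "inj_on b {..<m}" "b ` {..<m} \<subseteq> range g"
  shows "gfam M b m"
proof -
  interpret prob_space M using assms(1) by (simp add: std_gaussian_seq_def)
  define \<sigma> where "\<sigma> i = (SOME j. g j = b i)" for i
  have sg: "g (\<sigma> i) = b i" if "i < m" for i
    unfolding \<sigma>_def by (rule someI_ex) (use assms(3) that in force)
  have inj: "inj_on \<sigma> {..<m}"
  proof (rule inj_onI)
    fix i j assume "i \<in> {..<m}" "j \<in> {..<m}" "\<sigma> i = \<sigma> j"
    then show "i = j" using sg assms(2) by (metis inj_onD lessThan_iff)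
  qed
  have "indep_vars (\<lambda>_. borel) (\<lambda>i. g (\<sigma> i)) {..<m}"
    using assms(1) by (intro indep_vars_reindex_inj[where I = UNIV and M' = "\<lambda>_. borel", OF _ inj]) (auto simp: std_gaussian_seq_def)
  then have "indep_vars (\<lambda>_. borel) b {..<m}"
    by (subst (asm) indep_vars_cong[OF refl _ refl]) (auto simp: sg)
  moreover have "distributed M lborel (b i) std_normal_density" if "i < m" for i
    using assms(1) sg[OF that] unfolding std_gaussian_seq_def by metis
  ultimately show ?thesis using prob_space_axioms by (simp add: gfam_def)
qed

lemma gfam_measurable: "gfam M b m \<Longrightarrow> i < m \<Longrightarrow> b i \<in> borel_measurable M"
  unfolding gfam_def using distributed_measurable measurable_lborel1 by blast

section \<open>Moments and maxima of Gaussian combinations\<close>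

lemma nn_integral_stdn: "F \<in> borel_measurable borel \<Longrightarrow> (\<integral>\<^sup>+x. F x \<partial>stdn) = (\<integral>\<^sup>+x. ennreal (std_normal_density x) * F x \<partial>lborel)"
  unfolding stdn_def by (subst nn_integral_density) auto

text \<open>The combination is centred normal with variance the sum of the squared coefficients.
  Zero coefficients are discarded beforehand, because each summand must have a positive standard
  deviation; if nothing remains, both sides are \<open>F 0\<close>.\<close>

lemma gaussian_comb_nn_integral:
  assumes G: "gfam M b m" and F: "F \<in> borel_measurable borel"
  shows "(\<integral>\<^sup>+\<omega>. F (\<Sum>i<m. r i * b i \<omega>) \<partial>M) = (\<integral>\<^sup>+x. F (sqrt (\<Sum>i<m. (r i)\<^sup>2) * x) \<partial>stdn)"
proof -
  interpret prob_space M using G by (simp add: gfam_def)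
  interpret N: prob_space stdn by (rule prob_space_stdn)
  define I where "I = {i\<in>{..<m}. r i \<noteq> 0}"
  have sumI: "(\<Sum>i<m. r i * b i \<omega>) = (\<Sum>i\<in>I. r i * b i \<omega>)" for \<omega>
    unfolding I_def by (rule sum.mono_neutral_right) auto
  have sqI: "(\<Sum>i<m. (r i)\<^sup>2) = (\<Sum>i\<in>I. \<bar>r i\<bar>\<^sup>2)"
    unfolding I_def by (subst sum.mono_neutral_right[of "{..<m}" "{i\<in>{..<m}. r i \<noteq> 0}"]) auto
  show ?thesis
  proof (cases "I = {}")
    case True
    then have "r i = 0" if "i < m" for i using that by (auto simp: I_def)
    then show ?thesis by (simp add: emeasure_space_1 N.emeasure_space_1[simplified])
  next
    case False
    have "distributed M lborel (\<lambda>\<omega>. \<Sum>i\<in>I. r i * b i \<omega>) (normal_density (\<Sum>i\<in>I. 0) (sqrt (\<Sum>i\<in>I. \<bar>r i\<bar>\<^sup>2)))"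
    proof (rule sum_indep_normal)
      have "indep_vars (\<lambda>_. borel) b {..<m}" using G by (simp add: gfam_def)
      then have "indep_vars (\<lambda>_. borel) b I" by (rule indep_vars_subset) (auto simp: I_def)
      then show "indep_vars (\<lambda>_. borel) (\<lambda>i \<omega>. r i * b i \<omega>) I"
        by (rule indep_vars_compose2) auto
      fix i assume i: "i \<in> I"
      then show "0 < \<bar>r i\<bar>" by (simp add: I_def)
      have "distributed M lborel (\<lambda>x. 0 + r i * b i x) (normal_density (0 + r i * 0) (\<bar>r i\<bar> * 1))"
        by (rule normal_density_affine) (use G i in \<open>auto simp: gfam_def I_def\<close>)
      then show "distributed M lborel (\<lambda>\<omega>. r i * b i \<omega>) (normal_density 0 \<bar>r i\<bar>)" by simp
    qed (use False in \<open>auto simp: I_def\<close>)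
    then have d: "distributed M lborel (\<lambda>\<omega>. \<Sum>i\<in>I. r i * b i \<omega>) (normal_density 0 (sqrt (\<Sum>i\<in>I. \<bar>r i\<bar>\<^sup>2)))"
      by simp
    define \<sigma> where "\<sigma> = sqrt (\<Sum>i\<in>I. \<bar>r i\<bar>\<^sup>2)"
    have pos: "\<sigma> > 0" unfolding \<sigma>_def using False
      by (intro real_sqrt_gt_zero sum_pos) (auto simp: I_def)
    have "distributed M lborel (\<lambda>\<omega>. ((\<Sum>i\<in>I. r i * b i \<omega>) - 0) / \<sigma>) std_normal_density"
      using d normal_standard_normal_convert[OF pos, of "\<lambda>\<omega>. \<Sum>i\<in>I. r i * b i \<omega>" 0] by (simp add: \<sigma>_def)
    from distributed_nn_integral[OF this, of "\<lambda>x. F (\<sigma> * x)"] F pos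
    show ?thesis unfolding sumI sqI \<sigma>_def[symmetric] by (simp add: nn_integral_stdn)
  qed
qed

lemma stdn_square: "(\<integral>\<^sup>+x. ennreal ((\<sigma> * x)\<^sup>2) \<partial>stdn) = ennreal (\<sigma>\<^sup>2)"
proof -
  have "has_bochner_integral lborel (\<lambda>x. std_normal_density x * x ^ (2 * 1)) (fact (2 * 1) / (2 ^ 1 * fact 1))"
    by (rule std_normal_moment_even)
  then have h: "has_bochner_integral lborel (\<lambda>x. \<sigma>\<^sup>2 * (std_normal_density x * x\<^sup>2)) (\<sigma>\<^sup>2 * 1)"
    by (intro has_bochner_integral_mult_right) (simp add: numeral_2_eq_2)
  have "(\<integral>\<^sup>+x. ennreal ((\<sigma> * x)\<^sup>2) \<partial>stdn) = (\<integral>\<^sup>+x. ennreal (\<sigma>\<^sup>2 * (std_normal_density x * x\<^sup>2)) \<partial>lborel)"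
    by (subst nn_integral_stdn) (auto simp: power_mult_distrib mult_ac normal_density_nonneg simp flip: ennreal_mult intro!: nn_integral_cong)
  also have "\<dots> = ennreal (\<sigma>\<^sup>2)"
    using h by (subst nn_integral_eq_integral) (auto simp: has_bochner_integral_iff normal_density_nonneg)
  finally show ?thesis .
qed

lemma gaussian_comb_square:
  assumes "gfam M b m"
  shows "(\<integral>\<^sup>+\<omega>. ennreal ((\<Sum>i<m. r i * b i \<omega>)\<^sup>2) \<partial>M) = ennreal (\<Sum>i<m. (r i)\<^sup>2)"
  by (subst gaussian_comb_nn_integral[OF assms]) (auto simp: stdn_square sum_nonneg)

lemma gaussian_ccomb_square:
  fixes c :: "nat \<Rightarrow> complex"
  assumes G: "gfam M b m"
  shows "(\<integral>\<^sup>+\<omega>. ennreal ((cmod (\<Sum>i<m. complex_of_real (b i \<omega>) * c i))\<^sup>2) \<partial>M) = ennreal (\<Sum>i<m. (cmod (c i))\<^sup>2)"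
proof -
  note [measurable] = gfam_measurable[OF G]
  have "(cmod (\<Sum>i<m. complex_of_real (b i \<omega>) * c i))\<^sup>2 =
    (\<Sum>i<m. Re (c i) * b i \<omega>)\<^sup>2 + (\<Sum>i<m. Im (c i) * b i \<omega>)\<^sup>2" for \<omega>
    by (simp add: cmod_power2 mult.commute)
  then have "(\<integral>\<^sup>+\<omega>. ennreal ((cmod (\<Sum>i<m. complex_of_real (b i \<omega>) * c i))\<^sup>2) \<partial>M)
    = (\<integral>\<^sup>+\<omega>. ennreal ((\<Sum>i<m. Re (c i) * b i \<omega>)\<^sup>2) + ennreal ((\<Sum>i<m. Im (c i) * b i \<omega>)\<^sup>2) \<partial>M)"
    by (simp add: ennreal_plus)
  also have "\<dots> = ennreal (\<Sum>i<m. (Re (c i))\<^sup>2) + ennreal (\<Sum>i<m. (Im (c i))\<^sup>2)"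
    by (subst nn_integral_add) (auto simp: gaussian_comb_square[OF G])
  finally show ?thesis by (simp add: cmod_power2 sum.distrib sum_nonneg flip: ennreal_plus)
qed

text \<open>The rate 1/4 lies below the critical 1/2: the integrand is \<open>sqrt 2\<close> times
  the normal density of variance 2.\<close>

lemma stdn_exp_square: "(\<integral>\<^sup>+x. ennreal (exp (x\<^sup>2 / 4)) \<partial>stdn) \<le> 2"
proof -
  have eq: "std_normal_density x * exp (x\<^sup>2 / 4) = sqrt 2 * normal_density 0 (sqrt 2) x" for x
    by (simp add: normal_density_def real_sqrt_mult field_simps flip: exp_add)
  have "(\<integral>\<^sup>+x. ennreal (exp (x\<^sup>2 / 4)) \<partial>stdn) = (\<integral>\<^sup>+x. ennreal (sqrt 2) * ennreal (normal_density 0 (sqrt 2) x) \<partial>lborel)"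
    by (subst nn_integral_stdn) (auto simp: eq normal_density_nonneg simp flip: ennreal_mult intro!: nn_integral_cong)
  also have "\<dots> = ennreal (sqrt 2) * (\<integral>\<^sup>+x. ennreal (normal_density 0 (sqrt 2) x) \<partial>lborel)"
    by (rule nn_integral_cmult) auto
  also have "(\<integral>\<^sup>+x. ennreal (normal_density 0 (sqrt 2) x) \<partial>lborel) = ennreal 1"
    by (subst nn_integral_eq_integral) (auto simp: normal_density_nonneg integral_normal_density)
  also have "ennreal (sqrt 2) * ennreal 1 \<le> 2"
    using real_sqrt_le_mono[of 2 4] by (simp add: ennreal_le_iff2 flip: ennreal_numeral)
  finally show ?thesis .
qed

text \<open>The real and imaginary parts need not be independent, so the product of their
  exponentials is split by \<open>2 x y \<le> x^2 + y^2\<close>. This halves the rate from 1/4 to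
  1/8.\<close>

lemma gaussian_ccomb_exp:
  fixes c :: "nat \<Rightarrow> complex"
  assumes G: "gfam M b m" and c: "(\<Sum>i<m. (cmod (c i))\<^sup>2) \<le> 1"
  shows "(\<integral>\<^sup>+\<omega>. ennreal (exp ((cmod (\<Sum>i<m. complex_of_real (b i \<omega>) * c i))\<^sup>2 / 8)) \<partial>M) \<le> 2"
proof -
  note [measurable] = gfam_measurable[OF G]
  have bound: "(\<integral>\<^sup>+\<omega>. ennreal (exp ((\<Sum>i<m. r i * b i \<omega>)\<^sup>2 / 4)) \<partial>M) \<le> 2" if "(\<Sum>i<m. (r i)\<^sup>2) \<le> 1" for r
  proof -
    have "(\<integral>\<^sup>+\<omega>. ennreal (exp ((\<Sum>i<m. r i * b i \<omega>)\<^sup>2 / 4)) \<partial>M) =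
      (\<integral>\<^sup>+x. ennreal (exp ((sqrt (\<Sum>i<m. (r i)\<^sup>2) * x)\<^sup>2 / 4)) \<partial>stdn)"
      by (rule gaussian_comb_nn_integral[OF G]) auto
    also have "\<dots> \<le> (\<integral>\<^sup>+x. ennreal (exp (x\<^sup>2 / 4)) \<partial>stdn)"
      using that by (intro nn_integral_mono ennreal_leI) (auto simp: power_mult_distrib sum_nonneg intro!: mult_left_le_one_le)
    also note stdn_exp_square
    finally show ?thesis .
  qed
  have half: "ennreal (1/2) * (ennreal (exp p) + ennreal (exp q)) = ennreal ((exp p + exp q) / 2)" for p q
    by (subst ennreal_plus[symmetric], simp, simp, subst ennreal_mult[symmetric]) auto
  have part: "(\<Sum>i<m. (Re (c i))\<^sup>2) \<le> 1" "(\<Sum>i<m. (Im (c i))\<^sup>2) \<le> 1"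
    by (rule order_trans[OF sum_mono c], simp add: cmod_power2)+
  have "exp ((cmod (\<Sum>i<m. complex_of_real (b i \<omega>) * c i))\<^sup>2 / 8) \<le>
    (exp ((\<Sum>i<m. Re (c i) * b i \<omega>)\<^sup>2 / 4) + exp ((\<Sum>i<m. Im (c i) * b i \<omega>)\<^sup>2 / 4)) / 2" for \<omega>
  proof -
    define p q where "p = (\<Sum>i<m. Re (c i) * b i \<omega>)\<^sup>2 / 8" and "q = (\<Sum>i<m. Im (c i) * b i \<omega>)\<^sup>2 / 8"
    have "(cmod (\<Sum>i<m. complex_of_real (b i \<omega>) * c i))\<^sup>2 / 8 = p + q"
      by (simp add: cmod_power2 mult.commute p_def q_def add_divide_distrib)
    then have "exp ((cmod (\<Sum>i<m. complex_of_real (b i \<omega>) * c i))\<^sup>2 / 8) = exp p * exp q"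
      by (simp only: exp_add)
    moreover have "2 * exp p * exp q \<le> (exp p)\<^sup>2 + (exp q)\<^sup>2" by (rule sum_squares_bound)
    moreover have "(exp p)\<^sup>2 = exp ((\<Sum>i<m. Re (c i) * b i \<omega>)\<^sup>2 / 4)" "(exp q)\<^sup>2 = exp ((\<Sum>i<m. Im (c i) * b i \<omega>)\<^sup>2 / 4)"
      by (simp_all add: p_def q_def flip: exp_double)
    ultimately show ?thesis by simp
  qed
  then have "(\<integral>\<^sup>+\<omega>. ennreal (exp ((cmod (\<Sum>i<m. complex_of_real (b i \<omega>) * c i))\<^sup>2 / 8)) \<partial>M) \<le>
    (\<integral>\<^sup>+\<omega>. ennreal (1/2) * (ennreal (exp ((\<Sum>i<m. Re (c i) * b i \<omega>)\<^sup>2 / 4)) + ennreal (exp ((\<Sum>i<m. Im (c i) * b i \<omega>)\<^sup>2 / 4))) \<partial>M)"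
    by (intro nn_integral_mono) (simp only: half ennreal_leI)
  also have "\<dots> \<le> ennreal (1/2) * (2 + 2)"
  proof (subst nn_integral_cmult)
    have "(\<integral>\<^sup>+\<omega>. ennreal (exp ((\<Sum>i<m. Re (c i) * b i \<omega>)\<^sup>2 / 4)) + ennreal (exp ((\<Sum>i<m. Im (c i) * b i \<omega>)\<^sup>2 / 4)) \<partial>M)
      = (\<integral>\<^sup>+\<omega>. ennreal (exp ((\<Sum>i<m. Re (c i) * b i \<omega>)\<^sup>2 / 4)) \<partial>M) + (\<integral>\<^sup>+\<omega>. ennreal (exp ((\<Sum>i<m. Im (c i) * b i \<omega>)\<^sup>2 / 4)) \<partial>M)"
      by (rule nn_integral_add) auto
    also have "\<dots> \<le> 2 + 2" by (intro add_mono bound part)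
    finally show "ennreal (1/2) * (\<integral>\<^sup>+\<omega>. ennreal (exp ((\<Sum>i<m. Re (c i) * b i \<omega>)\<^sup>2 / 4)) + ennreal (exp ((\<Sum>i<m. Im (c i) * b i \<omega>)\<^sup>2 / 4)) \<partial>M)
      \<le> ennreal (1/2) * (2 + 2)" by (rule mult_left_mono) simp
  qed auto
  also have "\<dots> = ennreal ((1/2) * 4)"
    by (subst ennreal_mult) auto
  finally show ?thesis by simp
qed

text \<open>From \<open>s \<le> exp s\<close> with \<open>s = (Z - 8 ln N) / 8\<close> comes
  \<open>Z \<le> 8 ln N + (8 / N) exp (Z / 8)\<close>. Summing the last term over all
  \<open>N\<close> indices bounds the maximum, and each exponential has mean at most 2, whence 16.
  The combinations may depend on each other.\<close>

lemma gaussian_ccomb_max: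
  fixes c :: "'j \<Rightarrow> nat \<Rightarrow> complex"
  assumes G: "gfam M b m" and J: "finite J" "J \<noteq> {}" and w: "0 \<le> w"
    and c: "\<And>j. j \<in> J \<Longrightarrow> (\<Sum>i<m. (cmod (c j i))\<^sup>2) \<le> w\<^sup>2"
  shows "(\<integral>\<^sup>+\<omega>. ennreal (Max ((\<lambda>j. (cmod (\<Sum>i<m. complex_of_real (b i \<omega>) * c j i))\<^sup>2) ` J)) \<partial>M)
    \<le> ennreal (w\<^sup>2 * (8 * ln (card J) + 16))"
proof (cases "w = 0")
  case True
  have "c j i = 0" if "j \<in> J" "i < m" for i j
  proof -
    have "(\<Sum>i<m. (cmod (c j i))\<^sup>2) = 0" using c[OF that(1)] True by (simp add: sum_nonneg order_antisym)
    then show ?thesis using that(2) by (simp add: sum_nonneg_eq_0_iff)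
  qed
  then have "(\<lambda>j. (cmod (\<Sum>i<m. complex_of_real (b i \<omega>) * c j i))\<^sup>2) ` J = {0}" for \<omega>
    using J(2) by auto
  then show ?thesis by simp
next
  case False
  then have w: "w > 0" using w by simp
  note [measurable] = gfam_measurable[OF G]
  interpret prob_space M using G by (simp add: gfam_def)
  define N where "N = real (card J)"
  have N: "N \<ge> 1" using J by (simp add: N_def Suc_le_eq card_gt_0_iff)
  define Z where "Z j \<omega> = (cmod (\<Sum>i<m. complex_of_real (b i \<omega>) * (c j i / of_real w)))\<^sup>2" for j \<omega>
  have ZM: "Z j \<in> borel_measurable M" for j unfolding Z_def by measurable
  have Zw: "(cmod (\<Sum>i<m. complex_of_real (b i \<omega>) * c j i))\<^sup>2 = w\<^sup>2 * Z j \<omega>" for j \<omega>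
    using w by (simp add: Z_def norm_divide power_divide flip: sum_divide_distrib)
  have Zexp: "(\<integral>\<^sup>+\<omega>. ennreal (exp (Z j \<omega> / 8)) \<partial>M) \<le> 2" if "j \<in> J" for j
    unfolding Z_def
  proof (rule gaussian_ccomb_exp[OF G])
    have "(\<Sum>i<m. (cmod (c j i / complex_of_real w))\<^sup>2) = (\<Sum>i<m. (cmod (c j i))\<^sup>2) / w\<^sup>2"
      using w by (simp add: norm_divide power_divide sum_divide_distrib)
    then show "(\<Sum>i<m. (cmod (c j i / complex_of_real w))\<^sup>2) \<le> 1"
      using c[OF that] w by simp
  qed
  have pt: "Max ((\<lambda>j. (cmod (\<Sum>i<m. complex_of_real (b i \<omega>) * c j i))\<^sup>2) ` J)
      \<le> w\<^sup>2 * (8 * ln N + (\<Sum>j\<in>J. 8 / N * exp (Z j \<omega> / 8)))" for \<omega>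
  proof (rule Max.boundedI)
    fix a assume "a \<in> (\<lambda>j. (cmod (\<Sum>i<m. complex_of_real (b i \<omega>) * c j i))\<^sup>2) ` J"
    then obtain j where j: "j \<in> J" "a = w\<^sup>2 * Z j \<omega>" by (auto simp: Zw)
    have "(Z j \<omega> - 8 * ln N) / 8 \<le> exp ((Z j \<omega> - 8 * ln N) / 8)"
      by (rule order_trans[OF _ exp_ge_add_one_self]) simp
    also have "\<dots> = exp (Z j \<omega> / 8) / N"
      using N by (simp add: diff_divide_distrib exp_diff)
    finally have "(Z j \<omega> - 8 * ln N) / 8 \<le> exp (Z j \<omega> / 8) / N" .
    then have "8 * ((Z j \<omega> - 8 * ln N) / 8) \<le> 8 * (exp (Z j \<omega> / 8) / N)" by (rule mult_left_mono) simp
    then have "Z j \<omega> - 8 * ln N \<le> 8 * (exp (Z j \<omega> / 8) / N)" by (simp only: times_divide_eq_right nonzero_mult_div_cancel_left zero_neq_numeral not_False_eq_True)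
    moreover have "8 * (exp (Z j \<omega> / 8) / N) = 8 / N * exp (Z j \<omega> / 8)" by simp
    ultimately have "Z j \<omega> \<le> 8 * ln N + 8 / N * exp (Z j \<omega> / 8)" by linarith
    also have "8 / N * exp (Z j \<omega> / 8) \<le> (\<Sum>j\<in>J. 8 / N * exp (Z j \<omega> / 8))"
      using J j N by (intro member_le_sum) auto
    finally show "a \<le> w\<^sup>2 * (8 * ln N + (\<Sum>j\<in>J. 8 / N * exp (Z j \<omega> / 8)))"
      unfolding j by (intro mult_left_mono) auto
  qed (use J in auto)
  have scale: "ennreal (w\<^sup>2) * (ennreal (8 * ln N) + ennreal S) = ennreal (w\<^sup>2 * (8 * ln N + S))" if "0 \<le> S" for S
    using N that by (subst ennreal_plus[symmetric], simp, simp, subst ennreal_mult[symmetric]) auto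
  have ZE: "(\<lambda>\<omega>. ennreal (exp (Z j \<omega> / 8))) \<in> borel_measurable M" for j using ZM by measurable
  have "(\<integral>\<^sup>+\<omega>. ennreal (Max ((\<lambda>j. (cmod (\<Sum>i<m. complex_of_real (b i \<omega>) * c j i))\<^sup>2) ` J)) \<partial>M)
    \<le> (\<integral>\<^sup>+\<omega>. ennreal (w\<^sup>2) * (ennreal (8 * ln N) + (\<Sum>j\<in>J. ennreal (8 / N) * ennreal (exp (Z j \<omega> / 8)))) \<partial>M)"
  proof (rule nn_integral_mono)
    fix \<omega>
    have "(\<Sum>j\<in>J. ennreal (8 / N) * ennreal (exp (Z j \<omega> / 8))) = ennreal (\<Sum>j\<in>J. 8 / N * exp (Z j \<omega> / 8))"
    proof -
      have "(\<Sum>j\<in>J. ennreal (8 / N) * ennreal (exp (Z j \<omega> / 8))) = (\<Sum>j\<in>J. ennreal (8 / N * exp (Z j \<omega> / 8)))"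
        using N by (intro sum.cong refl ennreal_mult[symmetric]) auto
      then show ?thesis using N by (simp only: sum_ennreal mult_nonneg_nonneg divide_nonneg_pos exp_ge_zero)
    qed
    moreover have "0 \<le> (\<Sum>j\<in>J. 8 / N * exp (Z j \<omega> / 8))" using N by (intro sum_nonneg) auto
    ultimately have "ennreal (w\<^sup>2) * (ennreal (8 * ln N) + (\<Sum>j\<in>J. ennreal (8 / N) * ennreal (exp (Z j \<omega> / 8))))
      = ennreal (w\<^sup>2 * (8 * ln N + (\<Sum>j\<in>J. 8 / N * exp (Z j \<omega> / 8))))"
      using N by (simp only: scale ln_ge_zero_iff)
    then show "ennreal (Max ((\<lambda>j. (cmod (\<Sum>i<m. complex_of_real (b i \<omega>) * c j i))\<^sup>2) ` J))
      \<le> ennreal (w\<^sup>2) * (ennreal (8 * ln N) + (\<Sum>j\<in>J. ennreal (8 / N) * ennreal (exp (Z j \<omega> / 8))))"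
      using pt[of \<omega>] by (simp only: ennreal_leI)
  qed
  also have "\<dots> = ennreal (w\<^sup>2) * (ennreal (8 * ln N) + (\<Sum>j\<in>J. ennreal (8 / N) * (\<integral>\<^sup>+\<omega>. ennreal (exp (Z j \<omega> / 8)) \<partial>M)))"
  proof (subst nn_integral_cmult)
    show "(\<lambda>\<omega>. ennreal (8 * ln N) + (\<Sum>j\<in>J. ennreal (8 / N) * ennreal (exp (Z j \<omega> / 8)))) \<in> borel_measurable M"
      using ZE by (intro borel_measurable_add borel_measurable_sum borel_measurable_times) auto
    have "(\<integral>\<^sup>+\<omega>. ennreal (8 * ln N) + (\<Sum>j\<in>J. ennreal (8 / N) * ennreal (exp (Z j \<omega> / 8))) \<partial>M)
      = (\<integral>\<^sup>+\<omega>. ennreal (8 * ln N) \<partial>M) + (\<integral>\<^sup>+\<omega>. (\<Sum>j\<in>J. ennreal (8 / N) * ennreal (exp (Z j \<omega> / 8))) \<partial>M)"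
      using ZE by (intro nn_integral_add borel_measurable_sum borel_measurable_times) auto
    also have "(\<integral>\<^sup>+\<omega>. ennreal (8 * ln N) \<partial>M) = ennreal (8 * ln N)"
      by (simp add: emeasure_space_1)
    also have "(\<integral>\<^sup>+\<omega>. (\<Sum>j\<in>J. ennreal (8 / N) * ennreal (exp (Z j \<omega> / 8))) \<partial>M)
      = (\<Sum>j\<in>J. \<integral>\<^sup>+\<omega>. ennreal (8 / N) * ennreal (exp (Z j \<omega> / 8)) \<partial>M)"
      using ZE by (intro nn_integral_sum borel_measurable_times) auto
    also have "\<dots> = (\<Sum>j\<in>J. ennreal (8 / N) * (\<integral>\<^sup>+\<omega>. ennreal (exp (Z j \<omega> / 8)) \<partial>M))"
      by (intro sum.cong refl nn_integral_cmult ZE)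
    finally show "ennreal (w\<^sup>2) * (\<integral>\<^sup>+\<omega>. ennreal (8 * ln N) + (\<Sum>j\<in>J. ennreal (8 / N) * ennreal (exp (Z j \<omega> / 8))) \<partial>M)
      = ennreal (w\<^sup>2) * (ennreal (8 * ln N) + (\<Sum>j\<in>J. ennreal (8 / N) * (\<integral>\<^sup>+\<omega>. ennreal (exp (Z j \<omega> / 8)) \<partial>M)))"
      by simp
  qed
  also have "\<dots> \<le> ennreal (w\<^sup>2) * (ennreal (8 * ln N) + (\<Sum>j\<in>J. ennreal (8 / N) * 2))"
    by (intro mult_left_mono add_left_mono sum_mono Zexp) auto
  also have "(\<Sum>j\<in>J. ennreal (8 / N) * 2) = ennreal 16"
  proof -
    have "(\<Sum>j\<in>J. ennreal (8 / N) * 2) = (\<Sum>j\<in>J. ennreal (16 / N))"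
    proof (intro sum.cong refl)
      have "ennreal (8 / N) * ennreal 2 = ennreal (8 / N * 2)" using N by (intro ennreal_mult[symmetric]) auto
      then show "ennreal (8 / N) * 2 = ennreal (16 / N)" by simp
    qed
    also have "\<dots> = ennreal (\<Sum>j\<in>J. 16 / N)" using N by (intro sum_ennreal) auto
    also have "(\<Sum>j\<in>J. 16 / N) = 16" using N by (simp add: N_def)
    finally show ?thesis .
  qed
  also have "ennreal (w\<^sup>2) * (ennreal (8 * ln N) + ennreal 16) = ennreal (w\<^sup>2 * (8 * ln N + 16))"
    by (rule scale) simp
  finally show ?thesis by (simp add: N_def)
qed

text \<open>On the product space a single coordinate can be integrated while the others are kept
  fixed.\<close>

lemma gfam_distr_PiM:
  assumes G: "gfam M b m" and F: "F \<in> borel_measurable (PiM {..<m} (\<lambda>_. stdn))" and m: "m > 0"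
  shows "(\<integral>\<^sup>+\<omega>. F (\<lambda>i\<in>{..<m}. b i \<omega>) \<partial>M) = (\<integral>\<^sup>+x. F x \<partial>PiM {..<m} (\<lambda>_. stdn))"
proof -
  interpret prob_space M using G by (simp add: gfam_def)
  note [measurable] = gfam_measurable[OF G]
  have d: "distr M borel (b i) = stdn" if "i < m" for i
  proof -
    have "distr M lborel (b i) = stdn"
      using G that unfolding gfam_def stdn_def by (auto intro: distributed_distr_eq_density)
    then show ?thesis by (metis distr_cong sets_lborel)
  qed
  have "distr M (PiM {..<m} (\<lambda>_. borel)) (\<lambda>\<omega>. \<lambda>i\<in>{..<m}. b i \<omega>) = PiM {..<m} (\<lambda>i. distr M borel (b i))"
    using G m by (subst indep_vars_iff_distr_eq_PiM'[symmetric]) (auto simp: gfam_def)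
  also have "\<dots> = PiM {..<m} (\<lambda>_. stdn)" by (intro PiM_cong refl) (simp add: d)
  finally have eq: "distr M (PiM {..<m} (\<lambda>_. borel)) (\<lambda>\<omega>. \<lambda>i\<in>{..<m}. b i \<omega>) = PiM {..<m} (\<lambda>_. stdn)" .
  have F': "F \<in> borel_measurable (PiM {..<m} (\<lambda>_. borel))"
    using F by (subst measurable_cong_sets[OF sets_PiM_cong[OF refl] refl, of _ _ "\<lambda>_. stdn"]) auto
  show ?thesis unfolding eq[symmetric] by (subst nn_integral_distr) (auto intro!: F' measurable_restrict)
qed

section \<open>The operator norm of a Gaussian matrix\<close>

definition matcomb :: "nat \<Rightarrow> nat \<Rightarrow> (nat \<Rightarrow> complex Matrix.mat) \<Rightarrow> (nat \<Rightarrow> real) \<Rightarrow> complex Matrix.mat" where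
  "matcomb n m X t = Matrix.mat n n (\<lambda>(i, j). \<Sum>l<m. complex_of_real (t l) * X l $$ (i, j))"

lemma matcomb_carrier [simp]: "matcomb n m X t \<in> carrier_mat n n"
  by (simp add: matcomb_def)

lemma kap_matcomb:
  "i < n \<Longrightarrow> kap n (ent (matcomb n m X t)) x i = (\<Sum>l<m. complex_of_real (t l) * kap n (ent (X l)) x i)"
  unfolding kap_def matcomb_def
  by (simp add: sum_distrib_left sum_distrib_right mult_ac) (rule sum.swap)

lemma cip_matcomb:
  "cip n (kap n (ent (matcomb n m X t)) x) y = (\<Sum>l<m. complex_of_real (t l) * cip n (kap n (ent (X l)) x) y)"
proof -
  have "cip n (kap n (ent (matcomb n m X t)) x) y = cip n (\<lambda>i. \<Sum>l<m. complex_of_real (t l) * kap n (ent (X l)) x i) y"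
    by (intro cip_cong refl kap_matcomb)
  then show ?thesis unfolding cip_sum_left cip_scale_left .
qed

text \<open>The points \<open>grid_vec n z\<close> form a net of the unit ball of the complex \<open>n\<close>-space; the factor \<open>64 n\<close>
  is the squared norm bound after scaling by \<open>8 \<surd>n\<close>, which leaves only \<open>exp (O(n))\<close> points.\<close>

definition grid :: "nat \<Rightarrow> (nat \<Rightarrow> int) set" where
  "grid n = {z \<in> {..<2 * n} \<rightarrow>\<^sub>E {- int (64 * n)..int (64 * n)}. (\<Sum>j<2 * n. (z j)\<^sup>2) \<le> int (64 * n)}"

definition grid_vec :: "nat \<Rightarrow> (nat \<Rightarrow> int) \<Rightarrow> nat \<Rightarrow> complex" where
  "grid_vec n z i = Complex (z i) (z (n + i)) / (8 * sqrt n)"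

lemma finite_grid: "finite (grid n)"
  unfolding grid_def by (rule finite_subset[of _ "{..<2 * n} \<rightarrow>\<^sub>E {- int (64 * n)..int (64 * n)}"]) (auto intro!: finite_PiE)

lemma grid_nonempty: "grid n \<noteq> {}"
proof -
  have "(\<lambda>j\<in>{..<2 * n}. 0) \<in> grid n" by (auto simp: grid_def)
  then show ?thesis by auto
qed

lemma sum_half_powers: "(\<Sum>a\<in>{- int L..int L}. (1 / 2 :: real) ^ nat \<bar>a\<bar>) = 3 - 2 * (1 / 2) ^ L"
proof (induction L)
  case (Suc L)
  have "{- int (Suc L)..int (Suc L)} = insert (- int (Suc L)) (insert (int (Suc L)) {- int L..int L})" by auto
  then show ?case using Suc by (simp add: nat_add_distrib)
qed simp

lemma abs_le_square_int: "\<bar>a\<bar> \<le> a\<^sup>2" for a :: int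
proof (cases "a = 0")
  case False
  then have "\<bar>a\<bar> * 1 \<le> \<bar>a\<bar> * \<bar>a\<bar>" by (intro mult_left_mono) auto
  then show ?thesis by (simp only: power2_eq_square mult_1_right abs_mult_self_eq)
qed simp

lemma card_grid: "real (card (grid n)) \<le> 2 ^ (64 * n) * 9 ^ n"
proof -
  let ?P = "{..<2 * n} \<rightarrow>\<^sub>E {- int (64 * n)..int (64 * n)}"
  have fin: "finite ?P" by (auto intro!: finite_PiE)
  have "real (card (grid n)) = (\<Sum>z\<in>grid n. 1)" by simp
  \<comment> \<open>Every grid point receives weight at least 1: for integers |a| is at most a^2, so
    the exponents of 1/2 add up to at most \<open>64 * n\<close>. The total weight of the
    surrounding box factorises into one-dimensional geometric sums.\<close>
  also have "\<dots> \<le> (\<Sum>z\<in>grid n. 2 ^ (64 * n) * (\<Prod>j<2 * n. (1 / 2) ^ nat \<bar>z j\<bar>))"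
  proof (rule sum_mono)
    fix z assume z: "z \<in> grid n"
    have "(\<Sum>j<2 * n. \<bar>z j\<bar>) \<le> (\<Sum>j<2 * n. (z j)\<^sup>2)"
      by (intro sum_mono abs_le_square_int)
    also have "\<dots> \<le> int (64 * n)" using z by (simp add: grid_def)
    finally have "int (\<Sum>j<2 * n. nat \<bar>z j\<bar>) \<le> int (64 * n)" by simp
    then have le: "(\<Sum>j<2 * n. nat \<bar>z j\<bar>) \<le> 64 * n" by (simp only: of_nat_le_iff)
    have "(1::real) = 2 ^ (64 * n) * (1 / 2) ^ (64 * n)" by (simp add: power_one_over)
    also have "\<dots> \<le> 2 ^ (64 * n) * (1 / 2) ^ (\<Sum>j<2 * n. nat \<bar>z j\<bar>)"
      using le by (intro mult_left_mono power_decreasing) auto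
    also have "(1 / 2 :: real) ^ (\<Sum>j<2 * n. nat \<bar>z j\<bar>) = (\<Prod>j<2 * n. (1 / 2) ^ nat \<bar>z j\<bar>)"
      by (rule power_sum)
    finally show "(1::real) \<le> 2 ^ (64 * n) * (\<Prod>j<2 * n. (1 / 2) ^ nat \<bar>z j\<bar>)" .
  qed
  also have "\<dots> \<le> (\<Sum>z\<in>?P. 2 ^ (64 * n) * (\<Prod>j<2 * n. (1 / 2) ^ nat \<bar>z j\<bar>))"
  proof (rule sum_mono2[OF fin])
    show "grid n \<subseteq> ?P" unfolding grid_def by (rule Collect_restrict)
  qed (simp add: prod_nonneg)
  also have "\<dots> = 2 ^ (64 * n) * (\<Prod>j<2 * n. \<Sum>a\<in>{- int (64 * n)..int (64 * n)}. (1 / 2) ^ nat \<bar>a\<bar>)"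
    unfolding sum_distrib_left[symmetric] by (subst prod_sum_PiE) (simp_all only: finite_lessThan finite_atLeastAtMost_int)
  also have "\<dots> \<le> 2 ^ (64 * n) * (\<Prod>j<2 * n. 3)"
  proof (intro mult_left_mono prod_mono conjI)
    show "(\<Sum>a\<in>{- int (64 * n)..int (64 * n)}. (1 / 2 :: real) ^ nat \<bar>a\<bar>) \<le> 3"
      unfolding sum_half_powers by simp
  qed (auto intro!: sum_nonneg)
  also have "\<dots> = 2 ^ (64 * n) * 9 ^ n" by (simp add: power_mult)
  finally show ?thesis .
qed

lemma ln_card_grid: "ln (real (card (grid n))) \<le> 72 * real n"
proof -
  have "0 < card (grid n)" using finite_grid grid_nonempty by (simp add: card_gt_0_iff)
  then have "ln (real (card (grid n))) \<le> ln (2 ^ (64 * n) * 9 ^ n)"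
    using card_grid by (subst ln_le_cancel_iff) auto
  also have "\<dots> = 64 * real n * ln 2 + real n * ln 9"
    by (simp add: ln_mult ln_realpow)
  \<comment> \<open>The crude \<open>ln x \<le> x - 1\<close> gives 1 for \<open>ln 2\<close> and 8
    for \<open>ln 9\<close>; hence 72.\<close>
  also have "\<dots> \<le> 64 * real n * 1 + real n * 8"
    using ln_le_minus_one[of "2::real"] ln_le_minus_one[of "9::real"] by (intro add_mono mult_left_mono) auto
  finally show ?thesis by simp
qed

section \<open>Approximation of unit vectors by the net\<close>

text \<open>Rounding towards zero increases no coordinate in absolute value, so a rounded vector of
  the ball remains in \<open>grid\<close>; rounding to the nearest integer could leave it.\<close>

definition round_zero :: "real \<Rightarrow> int" where
  "round_zero t = (if 0 \<le> t then \<lfloor>t\<rfloor> else \<lceil>t\<rceil>)"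

lemma round_zero_abs_le: "\<bar>real_of_int (round_zero t)\<bar> \<le> \<bar>t\<bar>"
  by (cases "0 \<le> t"; simp add: round_zero_def; linarith)

lemma round_zero_error: "\<bar>t - real_of_int (round_zero t)\<bar> \<le> 1"
  by (cases "0 \<le> t"; simp add: round_zero_def; linarith)

lemma sum_lessThan_double: "(\<Sum>j<2 * n. f j) = (\<Sum>i<n. f i) + (\<Sum>i<n. f (n + i))"
  for f :: "nat \<Rightarrow> 'a::comm_monoid_add"
proof -
  have "(\<Sum>j<n + n. f j) = (\<Sum>j<n. f j) + (\<Sum>j\<in>{n..<n + n}. f j)"
    by (simp add: lessThan_atLeast0 sum.atLeastLessThan_concat)
  also have "(\<Sum>j\<in>{n..<n + n}. f j) = (\<Sum>i<n. f (n + i))"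
    using sum.shift_bounds_nat_ivl[of f 0 n n] by (simp add: lessThan_atLeast0 add.commute)
  finally show ?thesis by (simp add: mult_2)
qed

lemma nsq_grid_vec:
  assumes "z \<in> grid n" "1 \<le> n"
  shows "nsq n (grid_vec n z) \<le> 1"
proof -
  have "nsq n (grid_vec n z) = (\<Sum>i<n. ((real_of_int (z i))\<^sup>2 + (real_of_int (z (n + i)))\<^sup>2) / (64 * n))"
    unfolding nsq_def
  proof (intro sum.cong refl)
    fix i
    have "cmod (complex_of_real (8 * sqrt n)) = 8 * sqrt n" by (simp add: norm_mult)
    then show "(cmod (grid_vec n z i))\<^sup>2 = ((real_of_int (z i))\<^sup>2 + (real_of_int (z (n + i)))\<^sup>2) / (64 * n)"
      using assms(2) by (simp add: grid_vec_def norm_divide power_divide cmod_power2 power_mult_distrib)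
  qed
  also have "\<dots> = real_of_int (\<Sum>j<2 * n. (z j)\<^sup>2) / (64 * n)"
    by (simp add: sum_lessThan_double sum.distrib flip: sum_divide_distrib)
  also have "\<dots> \<le> 1"
  proof -
    have "real_of_int (\<Sum>j<2 * n. (z j)\<^sup>2) \<le> real_of_int (int (64 * n))"
      using assms(1) by (subst of_int_le_iff) (simp add: grid_def)
    then show ?thesis using assms(2) by simp
  qed
  finally show ?thesis .
qed

text \<open>The mesh is 1 / (8 sqrt n) and there are \<open>2 n\<close> real coordinates, so the
  squared error is at most 2n / (64 n), below 1/16.\<close>

lemma grid_approx:
  assumes n: "1 \<le> n" and q: "nsq n q \<le> 1"
  shows "\<exists>z\<in>grid n. nsq n (\<lambda>i. q i - grid_vec n z i) \<le> 1 / 16"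
proof -
  define c where "c = 8 * sqrt n"
  have c: "c > 0" "c\<^sup>2 = 64 * n" using n by (auto simp: c_def power_mult_distrib)
  define t where "t j = (if j < n then c * Re (q j) else c * Im (q (j - n)))" for j
  define z where "z = (\<lambda>j\<in>{..<2 * n}. round_zero (t j))"
  have sumt: "(\<Sum>j<2 * n. (t j)\<^sup>2) = c\<^sup>2 * nsq n q"
    unfolding sum_lessThan_double by (simp add: t_def nsq_def cmod_power2 power_mult_distrib sum.distrib sum_distrib_left distrib_left)
  have le: "real_of_int (\<Sum>j<2 * n. (z j)\<^sup>2) \<le> 64 * n"
  proof -
    have "real_of_int (\<Sum>j<2 * n. (z j)\<^sup>2) = (\<Sum>j<2 * n. \<bar>real_of_int (round_zero (t j))\<bar>\<^sup>2)"
      by (simp add: z_def)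
    also have "\<dots> \<le> (\<Sum>j<2 * n. \<bar>t j\<bar>\<^sup>2)"
      by (intro sum_mono power_mono round_zero_abs_le) auto
    also have "\<dots> \<le> c\<^sup>2 * 1" unfolding power2_abs sumt using q by (intro mult_left_mono) auto
    finally show ?thesis using c by simp
  qed
  then have le': "(\<Sum>j<2 * n. (z j)\<^sup>2) \<le> int (64 * n)"
    by (metis of_int_le_iff of_int_of_nat_eq of_nat_mult of_nat_numeral)
  have "z \<in> grid n"
    unfolding grid_def
  proof (intro CollectI conjI le' PiE_I)
    fix j assume j: "j \<in> {..<2 * n}"
    have "(z j)\<^sup>2 \<le> (\<Sum>j<2 * n. (z j)\<^sup>2)" using j by (intro member_le_sum) auto
    then have "(z j)\<^sup>2 \<le> int (64 * n)" using le' by linarith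
    then have "\<bar>z j\<bar> \<le> int (64 * n)" using abs_le_square_int[of "z j"] by linarith
    then show "z j \<in> {- int (64 * n)..int (64 * n)}" by auto
  qed (auto simp: z_def)
  moreover have "nsq n (\<lambda>i. q i - grid_vec n z i) \<le> 1 / 16"
  proof -
    have "nsq n (\<lambda>i. q i - grid_vec n z i) \<le> (\<Sum>i<n. 2 / c\<^sup>2)"
      unfolding nsq_def
    proof (rule sum_mono)
      fix i assume i: "i \<in> {..<n}"
      have "Re (q i - grid_vec n z i) = (t i - round_zero (t i)) / c" "Im (q i - grid_vec n z i) = (t (n + i) - round_zero (t (n + i))) / c"
        using i c(1) by (simp_all add: grid_vec_def c_def[symmetric] Re_divide_of_real Im_divide_of_real z_def t_def diff_divide_distrib flip: of_real_mult)
      then have "(cmod (q i - grid_vec n z i))\<^sup>2 = (\<bar>t i - round_zero (t i)\<bar>\<^sup>2 + \<bar>t (n + i) - round_zero (t (n + i))\<bar>\<^sup>2) / c\<^sup>2"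
        unfolding cmod_power2 by (simp add: power_divide add_divide_distrib)
      also have "\<dots> \<le> (1\<^sup>2 + 1\<^sup>2) / c\<^sup>2"
        by (intro divide_right_mono add_mono power_mono round_zero_error) auto
      finally show "(cmod (q i - grid_vec n z i))\<^sup>2 \<le> 2 / c\<^sup>2" by simp
    qed
    also have "\<dots> \<le> 1 / 16" using n by (simp add: c(2))
    finally show ?thesis .
  qed
  ultimately show ?thesis by blast
qed

text \<open>The standard net argument: for a pair of singular vectors at distance at most 1/4 from
  net points, each replacement costs \<sigma>/4. Hence \<sigma> is at most
  \<open>sqrt B + \<sigma> / 2\<close>, and the last term is absorbed.\<close>

lemma schatten_top_le_grid:
  assumes A: "A \<in> carrier_mat n n" and n: "1 \<le> n" and B: "0 \<le> B"
    and net: "\<And>z w. z \<in> grid n \<Longrightarrow> w \<in> grid n \<Longrightarrow> (cmod (cip n (kap n (ent A) (grid_vec n z)) (grid_vec n w)))\<^sup>2 \<le> B"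
  shows "(schatten_norm \<top> A)\<^sup>2 \<le> 4 * B"
proof -
  obtain s q p where sv: "svd n A s q p" using svd_exists[OF A] .
  define \<sigma> where "\<sigma> = schatten_norm \<top> A"
  have q: "\<And>k. k < n \<Longrightarrow> nsq n (q k) = 1" and s0: "\<And>k. k < n \<Longrightarrow> 0 \<le> s k" and sn: "\<sigma> = lpf n \<top> s"
    and pp: "\<And>k. k < n \<Longrightarrow> cip n (p k) (p k) = (if s k \<noteq> 0 then 1 else 0)"
    and Aq: "\<And>k i. k < n \<Longrightarrow> i < n \<Longrightarrow> kap n (ent A) (q k) i = complex_of_real (s k) * p k i"
  proof -
    show "nsq n (q k) = 1" if "k < n" for k
    proof -
      have "cip n (q k) (q k) = 1" using sv that by (simp add: svd_def ons_def)
      then show ?thesis by (simp add: cip_self)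
    qed
  qed (use sv in \<open>auto simp: svd_def \<sigma>_def\<close>)
  have \<sigma>0: "\<sigma> \<ge> 0" by (simp add: sn)
  have sk: "s k \<le> sqrt B + \<sigma> / 2" if k: "k < n" for k
  proof (cases "s k = 0")
    case True
    then show ?thesis using B \<sigma>0 by simp
  next
    case False
    then have p1: "nsq n (p k) = 1" using pp[OF k] by (simp add: cip_self)
    obtain z where z: "z \<in> grid n" "nsq n (\<lambda>i. q k i - grid_vec n z i) \<le> 1 / 16"
      using grid_approx[OF n, of "q k"] q[OF k] by auto
    obtain w where w: "w \<in> grid n" "nsq n (\<lambda>i. p k i - grid_vec n w i) \<le> 1 / 16"
      using grid_approx[OF n, of "p k"] p1 by auto
    \<comment> \<open>Distance 1/4 to the net makes the fourfold error vector a vector of the unit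
      ball.\<close>
    define x where "x i = 4 * (q k i - grid_vec n z i)" for i
    define y where "y i = 4 * (p k i - grid_vec n w i)" for i
    have nx: "nsq n x \<le> 1" and ny: "nsq n y \<le> 1"
      using z(2) w(2) unfolding x_def y_def nsq_scale by auto
    have b1: "cmod (cip n (kap n (ent A) x) (grid_vec n w)) \<le> \<sigma>"
      unfolding \<sigma>_def by (rule bilinear_le_schatten[OF A _ nx nsq_grid_vec[OF w(1) n]]) simp
    have b2: "cmod (cip n (kap n (ent A) (q k)) y) \<le> \<sigma>"
      unfolding \<sigma>_def by (rule bilinear_le_schatten[OF A _ _ ny]) (auto simp: q[OF k])
    have "cip n (kap n (ent A) (q k)) (p k) = cip n (\<lambda>i. complex_of_real (s k) * p k i) (p k)"
      by (intro cip_cong Aq k refl)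
    also have "\<dots> = complex_of_real (s k)" using pp[OF k] False by (simp add: cip_scale_left)
    finally have "complex_of_real (s k) = cip n (kap n (ent A) (q k)) (p k)" ..
    also have "\<dots> = cip n (kap n (ent A) (grid_vec n z)) (grid_vec n w)
        + cip n (kap n (ent A) x) (grid_vec n w) / 4 + cip n (kap n (ent A) (q k)) y / 4"
    proof -
      have "cip n (kap n (ent A) x) v = 4 * (cip n (kap n (ent A) (q k)) v - cip n (kap n (ent A) (grid_vec n z)) v)" for v
      proof -
        have "kap n (ent A) x i = 4 * (kap n (ent A) (q k) i - kap n (ent A) (grid_vec n z) i)" for i
          by (simp add: x_def kap_def sum_subtractf sum_distrib_left algebra_simps)
        then have "cip n (kap n (ent A) x) v = cip n (\<lambda>i. 4 * (kap n (ent A) (q k) i - kap n (ent A) (grid_vec n z) i)) v"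
          by (intro cip_cong) auto
        then show ?thesis unfolding cip_scale_left cip_diff_left .
      qed
      moreover have "cip n v y = 4 * (cip n v (p k) - cip n v (grid_vec n w))" for v
        by (simp add: y_def cip_def sum_subtractf sum_distrib_left algebra_simps)
      ultimately show ?thesis by (simp add: diff_divide_distrib)
    qed
    finally have "s k = cmod (cip n (kap n (ent A) (grid_vec n z)) (grid_vec n w)
        + cip n (kap n (ent A) x) (grid_vec n w) / 4 + cip n (kap n (ent A) (q k)) y / 4)"
      using s0[OF k] by (metis abs_of_nonneg norm_of_real)
    also have "\<dots> \<le> cmod (cip n (kap n (ent A) (grid_vec n z)) (grid_vec n w))
      + cmod (cip n (kap n (ent A) x) (grid_vec n w)) / 4 + cmod (cip n (kap n (ent A) (q k)) y) / 4"
      by (rule order_trans[OF norm_triangle_ineq] order_trans[OF add_right_mono[OF norm_triangle_ineq]])+ (simp add: norm_divide)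
    also have "\<dots> \<le> sqrt B + \<sigma> / 4 + \<sigma> / 4"
      using net[OF z(1) w(1)] b1 b2 by (intro add_mono real_le_rsqrt) auto
    finally show ?thesis by simp
  qed
  have "\<sigma> \<le> sqrt B + \<sigma> / 2"
    unfolding sn by (intro lpf_top_le) (use sk s0 B \<sigma>0 in \<open>auto simp: sn\<close>)
  then have "\<sigma> \<le> 2 * sqrt B" by simp
  then have "\<sigma>\<^sup>2 \<le> (2 * sqrt B)\<^sup>2" using \<sigma>0 by (intro power_mono) auto
  then show ?thesis using B by (simp add: \<sigma>_def power_mult_distrib)
qed

text \<open>Pairs of net points have logarithmic cardinality at most 2 * 72 n, so their maximum
  costs (8 * 144 + 16) n = 1168 n; the passage from the net to the norm multiplies this by 4, which
  gives 4672.\<close>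

lemma gaussian_matrix_top:
  assumes G: "gfam M b m" and n: "1 \<le> n" and w: "0 \<le> w"
    and weak: "\<And>x y. nsq n x \<le> 1 \<Longrightarrow> nsq n y \<le> 1 \<Longrightarrow> (\<Sum>i<m. (cmod (cip n (kap n (ent (X i)) x) y))\<^sup>2) \<le> w\<^sup>2"
  shows "\<exists>h. h \<in> borel_measurable M \<and> (\<forall>\<omega>. (schatten_norm \<top> (matcomb n m X (\<lambda>i. b i \<omega>)))\<^sup>2 \<le> h \<omega>)
     \<and> (\<integral>\<^sup>+\<omega>. ennreal (h \<omega>) \<partial>M) \<le> ennreal (4672 * real n * w\<^sup>2)"
proof -
  define c where "c = (\<lambda>(z, v) i. cip n (kap n (ent (X i)) (grid_vec n z)) (grid_vec n v))"
  define J where "J = grid n \<times> grid n"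
  have J: "finite J" "J \<noteq> {}" by (auto simp: J_def finite_grid grid_nonempty)
  define h where "h \<omega> = Max ((\<lambda>j. (cmod (\<Sum>i<m. complex_of_real (b i \<omega>) * c j i))\<^sup>2) ` J)" for \<omega>
  note [measurable] = gfam_measurable[OF G]
  have hM: "h \<in> borel_measurable M"
    unfolding h_def[abs_def] using J(1) by (intro borel_measurable_Max) auto
  have cw: "(\<Sum>i<m. (cmod (c j i))\<^sup>2) \<le> w\<^sup>2" if "j \<in> J" for j
    using that by (auto simp: J_def c_def intro!: weak nsq_grid_vec n)
  have h0: "0 \<le> h \<omega>" for \<omega>
  proof -
    obtain j where "j \<in> J" using J by auto
    then have "(cmod (\<Sum>i<m. complex_of_real (b i \<omega>) * c j i))\<^sup>2 \<le> h \<omega>"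
      unfolding h_def using J by (intro Max_ge) auto
    then show ?thesis by (rule order_trans[rotated]) simp
  qed
  have "(schatten_norm \<top> (matcomb n m X (\<lambda>i. b i \<omega>)))\<^sup>2 \<le> 4 * h \<omega>" for \<omega>
  proof (rule schatten_top_le_grid[OF matcomb_carrier n h0])
    fix z v assume "z \<in> grid n" "v \<in> grid n"
    then have "(z, v) \<in> J" by (simp add: J_def)
    then have "(cmod (\<Sum>i<m. complex_of_real (b i \<omega>) * c (z, v) i))\<^sup>2 \<le> h \<omega>"
      unfolding h_def using J by (intro Max_ge) auto
    then show "(cmod (cip n (kap n (ent (matcomb n m X (\<lambda>i. b i \<omega>))) (grid_vec n z)) (grid_vec n v)))\<^sup>2 \<le> h \<omega>"
      by (simp add: cip_matcomb c_def)
  qed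
  moreover have "(\<integral>\<^sup>+\<omega>. ennreal (4 * h \<omega>) \<partial>M) \<le> ennreal (4672 * real n * w\<^sup>2)"
  proof -
    have "(\<integral>\<^sup>+\<omega>. ennreal (4 * h \<omega>) \<partial>M) = ennreal 4 * (\<integral>\<^sup>+\<omega>. ennreal (h \<omega>) \<partial>M)"
      using hM h0 by (simp add: ennreal_mult nn_integral_cmult)
    also have "\<dots> \<le> ennreal 4 * ennreal (w\<^sup>2 * (8 * ln (card J) + 16))"
      unfolding h_def by (intro mult_left_mono gaussian_ccomb_max[OF G J w cw]) auto
    also have "\<dots> = ennreal (4 * (w\<^sup>2 * (8 * ln (card J) + 16)))"
      by (rule ennreal_mult'[symmetric]) simp
    also have "\<dots> \<le> ennreal (4672 * real n * w\<^sup>2)"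
    proof (rule ennreal_leI)
      have pos: "0 < card (grid n)" using finite_grid grid_nonempty by (simp add: card_gt_0_iff)
      have "ln (real (card J)) = 2 * ln (real (card (grid n)))"
        using pos by (simp add: J_def card_cartesian_product ln_mult)
      then have "ln (real (card J)) \<le> 144 * real n" using ln_card_grid[of n] by simp
      then have "w\<^sup>2 * (8 * ln (card J) + 16) \<le> w\<^sup>2 * (1168 * real n)"
        using n by (intro mult_left_mono) auto
      then have "4 * (w\<^sup>2 * (8 * ln (card J) + 16)) \<le> 4 * (w\<^sup>2 * (1168 * real n))"
        by (rule mult_left_mono) simp
      also have "\<dots> = 4672 * real n * w\<^sup>2" by simp
      finally show "4 * (w\<^sup>2 * (8 * ln (card J) + 16)) \<le> 4672 * real n * w\<^sup>2" .
    qed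
    finally show ?thesis .
  qed
  ultimately show ?thesis using hM by (intro exI[of _ "\<lambda>\<omega>. 4 * h \<omega>"]) auto
qed

section \<open>Schatten norms of a Gaussian matrix\<close>

lemma std_normal_exp_shift: "std_normal_density x * exp (a * x) = exp (a\<^sup>2 / 2) * normal_density a 1 x"
  by (simp add: normal_density_def power2_eq_square field_simps flip: exp_add)

lemma integrable_std_normal_exp_abs: "integrable lborel (\<lambda>x. std_normal_density x * exp (a * \<bar>x\<bar>))"
proof (rule Bochner_Integration.integrable_bound)
  show "integrable lborel (\<lambda>x. exp (a\<^sup>2 / 2) * normal_density a 1 x + exp (a\<^sup>2 / 2) * normal_density (- a) 1 x)"
    by (intro Bochner_Integration.integrable_add integrable_mult_right integrable_normal_density) auto
  show "AE x in lborel. norm (std_normal_density x * exp (a * \<bar>x\<bar>))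
      \<le> norm (exp (a\<^sup>2 / 2) * normal_density a 1 x + exp (a\<^sup>2 / 2) * normal_density (- a) 1 x)"
  proof (intro AE_I2)
    fix x :: real
    have "std_normal_density x * exp (a * \<bar>x\<bar>) \<le> std_normal_density x * exp (a * x) + std_normal_density x * exp (- a * x)"
      by (cases "0 \<le> x") (auto simp: normal_density_nonneg)
    also have "\<dots> = exp (a\<^sup>2 / 2) * normal_density a 1 x + exp (a\<^sup>2 / 2) * normal_density (- a) 1 x"
      using std_normal_exp_shift[of x a] std_normal_exp_shift[of x "- a"] by simp
    finally show "norm (std_normal_density x * exp (a * \<bar>x\<bar>))
      \<le> norm (exp (a\<^sup>2 / 2) * normal_density a 1 x + exp (a\<^sup>2 / 2) * normal_density (- a) 1 x)"
      by (simp add: normal_density_nonneg)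
  qed
qed auto

lemma std_normal_shift: "std_normal_density (x + h) = std_normal_density x * exp (- (x * h) - h\<^sup>2 / 2)"
  by (simp add: normal_density_def power2_eq_square field_simps flip: exp_add)

lemma std_normal_shift_le:
  assumes "0 \<le> h" "h \<le> 1"
  shows "std_normal_density (x + h) \<le> std_normal_density x * exp \<bar>x\<bar>"
proof -
  have "- x * h \<le> \<bar>x\<bar> * h" using assms by (intro mult_right_mono) auto
  then have "- (x * h) \<le> \<bar>x\<bar> * h" by simp
  also have "\<dots> \<le> \<bar>x\<bar> * 1" using assms by (intro mult_left_mono) auto
  finally have "- (x * h) \<le> \<bar>x\<bar>" by simp
  moreover have "0 \<le> h\<^sup>2 / 2" by simp
  ultimately have "- (x * h) - h\<^sup>2 / 2 \<le> \<bar>x\<bar>" by linarith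
  then show ?thesis
    unfolding std_normal_shift by (intro mult_left_mono) (auto simp: normal_density_nonneg)
qed

text \<open>A dominating function for the difference quotients, uniform in \<open>h\<close>. The
  ratio of the two densities is \<open>exp y\<close> with |y| at most \<open>h (|x| + 1)\<close>,
  and |1 - exp y| is at most \<open>|y| exp |y|\<close>, so the factor \<open>h\<close>
  cancels.\<close>

lemma std_normal_difference_le:
  assumes "0 < h" "h \<le> 1"
  shows "\<bar>(std_normal_density x - std_normal_density (x + h)) / h\<bar> \<le> std_normal_density x * exp (2 * \<bar>x\<bar> + 1)"
proof -
  define y where "y = - (x * h) - h\<^sup>2 / 2"
  have "\<bar>y\<bar> \<le> \<bar>x * h\<bar> + \<bar>h\<^sup>2 / 2\<bar>" unfolding y_def by linarith
  also have "\<dots> = h * (\<bar>x\<bar> + h / 2)" using assms by (simp add: abs_mult power2_eq_square algebra_simps)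
  also have "\<dots> \<le> h * (\<bar>x\<bar> + 1)" using assms by (intro mult_left_mono) auto
  finally have y1: "\<bar>y\<bar> \<le> h * (\<bar>x\<bar> + 1)" .
  also have "\<dots> \<le> 1 * (\<bar>x\<bar> + 1)" using assms by (intro mult_right_mono) auto
  finally have y2: "\<bar>y\<bar> \<le> \<bar>x\<bar> + 1" by simp
  have "\<bar>1 - exp y\<bar> \<le> \<bar>y\<bar> * exp \<bar>y\<bar>"
  proof (cases "0 \<le> y")
    case True
    have "1 - y \<le> exp (- y)" using exp_ge_add_one_self[of "- y"] by simp
    then have "(1 - y) * exp y \<le> exp (- y) * exp y" by (intro mult_right_mono) auto
    then show ?thesis using True by (simp add: algebra_simps flip: exp_add)
  next
    case False
    have "1 - exp y \<le> - y * 1" using exp_ge_add_one_self[of y] by linarith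
    also have "\<dots> \<le> - y * exp (- y)" using False by (intro mult_left_mono) auto
    finally show ?thesis using False by simp
  qed
  also have "\<dots> \<le> (h * (\<bar>x\<bar> + 1)) * exp (\<bar>x\<bar> + 1)"
    using y1 y2 assms by (intro mult_mono) auto
  also have "\<dots> \<le> (h * exp \<bar>x\<bar>) * exp (\<bar>x\<bar> + 1)"
  proof (intro mult_right_mono mult_left_mono)
    show "\<bar>x\<bar> + 1 \<le> exp \<bar>x\<bar>" using exp_ge_add_one_self[of "\<bar>x\<bar>"] by linarith
  qed (use assms in auto)
  also have "\<dots> = h * exp (2 * \<bar>x\<bar> + 1)" by (simp flip: exp_add)
  finally have "\<bar>1 - exp y\<bar> / h \<le> exp (2 * \<bar>x\<bar> + 1)" using assms by (simp add: field_simps)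
  then have "std_normal_density x * (\<bar>1 - exp y\<bar> / h) \<le> std_normal_density x * exp (2 * \<bar>x\<bar> + 1)"
    by (intro mult_left_mono normal_density_nonneg)
  moreover have "\<bar>(std_normal_density x - std_normal_density (x + h)) / h\<bar> = std_normal_density x * (\<bar>1 - exp y\<bar> / h)"
  proof -
    have "std_normal_density x - std_normal_density (x + h) = std_normal_density x * (1 - exp y)"
      unfolding std_normal_shift y_def by (simp add: algebra_simps)
    then show ?thesis using assms by (simp add: abs_mult normal_density_nonneg)
  qed
  ultimately show ?thesis by simp
qed

lemma inverse_Suc_tendsto: "(\<lambda>N. 1 / real (Suc N)) \<longlonglongrightarrow> 0"
  using LIMSEQ_inverse_real_of_nat by (simp only: inverse_eq_divide)

lemma std_normal_difference_quotient:
  "(\<lambda>N. (std_normal_density x - std_normal_density (x + 1 / real (Suc N))) / (1 / real (Suc N))) \<longlonglongrightarrow> x * std_normal_density x"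
proof -
  have "((\<lambda>y. std_normal_density y) has_real_derivative - x * std_normal_density x) (at x)"
    unfolding normal_density_def by (auto intro!: derivative_eq_intros simp: power2_eq_square field_simps)
  then have "((\<lambda>h. (std_normal_density (x + h) - std_normal_density x) / h) \<longlongrightarrow> - x * std_normal_density x) (at 0)"
    by (simp add: DERIV_def)
  moreover have "filterlim (\<lambda>N. 1 / real (Suc N)) (at 0) sequentially"
    unfolding filterlim_at using inverse_Suc_tendsto by auto
  ultimately have "(\<lambda>N. (std_normal_density (x + 1 / real (Suc N)) - std_normal_density x) / (1 / real (Suc N))) \<longlonglongrightarrow> - x * std_normal_density x"
    by (rule filterlim_compose)
  from tendsto_minus[OF this] show ?thesis
    by (simp only: minus_divide_left minus_diff_eq minus_mult_left minus_minus)
qed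

text \<open>Gaussian integration by parts, with the derivative of \<open>\<phi>\<close> replaced by a one-sided bound
  on its increments; it is obtained by differentiating translates of the density.\<close>

lemma gaussian_ibp_le:
  fixes \<phi> \<psi> :: "real \<Rightarrow> real"
  assumes [measurable]: "\<phi> \<in> borel_measurable borel" "\<psi> \<in> borel_measurable borel"
    and \<phi>: "\<And>x. \<bar>\<phi> x\<bar> \<le> K * exp \<bar>x\<bar>" and \<psi>: "\<And>x. \<bar>\<psi> x\<bar> \<le> K * exp \<bar>x\<bar>"
    and inc: "\<And>x t. 0 < t \<Longrightarrow> \<phi> (x + t) - \<phi> x \<le> C * t * (\<psi> (x + t) + \<psi> x)"
  shows "(\<integral>x. x * \<phi> x \<partial>stdn) \<le> 2 * C * (\<integral>x. \<psi> x \<partial>stdn)"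
proof -
  define p where "p = std_normal_density"
  have p0: "0 \<le> p x" for x by (simp add: p_def normal_density_nonneg)
  have [measurable]: "p \<in> borel_measurable borel" by (simp add: p_def)
  define h where "h N = 1 / real (Suc N)" for N
  have h: "0 < h N" "h N \<le> 1" for N by (simp_all add: h_def)
  have K: "0 \<le> K" using \<phi>[of 0] by simp
  \<comment> \<open>One dominating function serves all limits: \<phi> and \<psi> grow with rate 1,
    and the difference quotient of the density contributes rate 2 and the factor
    \<open>exp 1\<close>.\<close>
  have dom: "integrable lborel (\<lambda>x. K * exp 1 * (p x * exp (3 * \<bar>x\<bar>)))"
    unfolding p_def by (intro integrable_mult_right integrable_std_normal_exp_abs)
  have ps: "p (x + h N) \<le> p x * exp \<bar>x\<bar>" for x N unfolding p_def using h[of N] by (intro std_normal_shift_le) auto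
  have small: "f x * p (x + h N) \<in> {- (K * exp 1 * (p x * exp (3 * \<bar>x\<bar>)))..K * exp 1 * (p x * exp (3 * \<bar>x\<bar>))}"
    if f: "\<And>x. \<bar>f x\<bar> \<le> K * exp \<bar>x\<bar>" for f x N
  proof -
    have "\<bar>f x * p (x + h N)\<bar> \<le> (K * exp \<bar>x\<bar>) * (p x * exp \<bar>x\<bar>)"
      unfolding abs_mult using f ps p0 K by (intro mult_mono) (auto simp: abs_of_nonneg p0)
    also have "\<dots> = K * exp 0 * (p x * exp (2 * \<bar>x\<bar>))" by (simp add: mult_exp_exp flip: exp_add)
    also have "\<dots> \<le> K * exp 1 * (p x * exp (3 * \<bar>x\<bar>))"
      using K p0 by (intro mult_mono mult_left_mono mult_nonneg_nonneg) auto
    finally show ?thesis by (auto simp: abs_le_iff)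
  qed
  have small0: "\<bar>f x * p x\<bar> \<le> K * exp 1 * (p x * exp (3 * \<bar>x\<bar>))"
    if f: "\<And>x. \<bar>f x\<bar> \<le> K * exp \<bar>x\<bar>" for f x
  proof -
    have "\<bar>f x * p x\<bar> \<le> (K * exp \<bar>x\<bar>) * p x"
      unfolding abs_mult using f p0 K by (intro mult_mono) auto
    also have "\<dots> = K * exp 0 * (p x * exp \<bar>x\<bar>)" by simp
    also have "\<dots> \<le> K * exp 1 * (p x * exp (3 * \<bar>x\<bar>))"
      using K p0 by (intro mult_mono mult_left_mono mult_nonneg_nonneg) auto
    finally show ?thesis .
  qed
  have int_shift: "integrable lborel (\<lambda>x. f x * p (x + h N))"
    if [measurable]: "f \<in> borel_measurable borel" and f: "\<And>x. \<bar>f x\<bar> \<le> K * exp \<bar>x\<bar>" for f N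
    by (rule Bochner_Integration.integrable_bound[OF dom])
       (use small[of f, OF f] in \<open>auto intro!: AE_I2 simp: abs_le_iff order_trans[OF _ abs_ge_self] minus_le_iff\<close>)
  have int0: "integrable lborel (\<lambda>x. f x * p x)"
    if [measurable]: "f \<in> borel_measurable borel" and f: "\<And>x. \<bar>f x\<bar> \<le> K * exp \<bar>x\<bar>" for f
    by (rule Bochner_Integration.integrable_bound[OF dom])
       (use small0[of f, OF f] in \<open>auto intro!: AE_I2 simp: order_trans[OF _ abs_ge_self]\<close>)
  have translate: "(\<integral>x. f (x - h N) * p x \<partial>lborel) = (\<integral>x. f x * p (x + h N) \<partial>lborel)" for f N
    using lborel_integral_real_affine[of 1 "\<lambda>x. f (x - h N) * p x" "h N"] by (simp add: add.commute)
  have translate_int: "integrable lborel (\<lambda>x. f (x - h N) * p x)"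
    if [measurable]: "f \<in> borel_measurable borel" and f: "\<And>x. \<bar>f x\<bar> \<le> K * exp \<bar>x\<bar>" for f N
    using lborel_integrable_real_affine_iff[of 1 "\<lambda>x. f (x - h N) * p x" "h N"] int_shift[of f N, OF that]
    by (simp add: add.commute)
  \<comment> \<open>Translation invariance of Lebesgue measure moves the difference from the density
    to \<phi>, where the hypothesis on increments applies.\<close>
  have step: "(\<integral>x. \<phi> x * ((p x - p (x + h N)) / h N) \<partial>lborel) \<le> C * (\<integral>x. \<psi> x * p x \<partial>lborel) + C * (\<integral>x. \<psi> x * p (x + h N) \<partial>lborel)" for N
  proof -
    have "(\<integral>x. \<phi> x * ((p x - p (x + h N)) / h N) \<partial>lborel)
      = ((\<integral>x. \<phi> x * p x \<partial>lborel) - (\<integral>x. \<phi> x * p (x + h N) \<partial>lborel)) / h N"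
      using int0[of \<phi>] int_shift[of \<phi> N] \<phi> by (simp add: right_diff_distrib flip: Bochner_Integration.integral_diff)
    also have "\<dots> = (\<integral>x. \<phi> x * p x - \<phi> (x - h N) * p x \<partial>lborel) / h N"
      unfolding translate[of \<phi>, symmetric]
      using int0[of \<phi>] translate_int[of \<phi> N] \<phi> by (subst Bochner_Integration.integral_diff) auto
    also have "\<dots> = (\<integral>x. (\<phi> x - \<phi> (x - h N)) / h N * p x \<partial>lborel)"
      by (subst integral_divide_zero[symmetric]) (simp add: left_diff_distrib)
    also have "\<dots> \<le> (\<integral>x. C * (\<psi> x * p x) + C * (\<psi> (x - h N) * p x) \<partial>lborel)"
    proof (rule integral_mono)
      show "integrable lborel (\<lambda>x. (\<phi> x - \<phi> (x - h N)) / h N * p x)"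
        using int0[of \<phi>] translate_int[of \<phi> N] \<phi> by (simp add: left_diff_distrib diff_divide_distrib)
      show "integrable lborel (\<lambda>x. C * (\<psi> x * p x) + C * (\<psi> (x - h N) * p x))"
        using int0[of \<psi>] translate_int[of \<psi> N] \<psi> by (intro Bochner_Integration.integrable_add integrable_mult_right) auto
      fix x
      have "\<phi> x - \<phi> (x - h N) \<le> C * h N * (\<psi> x + \<psi> (x - h N))"
        using inc[OF h(1), of "x - h N" N] by simp
      then have "(\<phi> x - \<phi> (x - h N)) / h N \<le> C * (\<psi> x + \<psi> (x - h N))"
        using h(1)[of N] by (simp add: field_simps)
      then have "(\<phi> x - \<phi> (x - h N)) / h N * p x \<le> C * (\<psi> x + \<psi> (x - h N)) * p x"
        by (rule mult_right_mono[OF _ p0])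
      then show "(\<phi> x - \<phi> (x - h N)) / h N * p x \<le> C * (\<psi> x * p x) + C * (\<psi> (x - h N) * p x)"
        by (simp add: algebra_simps)
    qed
    also have "\<dots> = C * (\<integral>x. \<psi> x * p x \<partial>lborel) + C * (\<integral>x. \<psi> (x - h N) * p x \<partial>lborel)"
      using int0[of \<psi>] translate_int[of \<psi> N] \<psi> by simp
    finally show ?thesis unfolding translate .
  qed
  have lim1: "(\<lambda>N. \<integral>x. \<phi> x * ((p x - p (x + h N)) / h N) \<partial>lborel) \<longlonglongrightarrow> (\<integral>x. \<phi> x * (x * p x) \<partial>lborel)"
  proof (rule integral_dominated_convergence[OF _ _ dom])
    show "AE x in lborel. (\<lambda>N. \<phi> x * ((p x - p (x + h N)) / h N)) \<longlonglongrightarrow> \<phi> x * (x * p x)"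
      unfolding p_def h_def by (intro AE_I2 tendsto_mult tendsto_const std_normal_difference_quotient)
    fix N
    show "AE x in lborel. norm (\<phi> x * ((p x - p (x + h N)) / h N)) \<le> K * exp 1 * (p x * exp (3 * \<bar>x\<bar>))"
    proof (intro AE_I2)
      fix x
      have "norm (\<phi> x * ((p x - p (x + h N)) / h N)) \<le> (K * exp \<bar>x\<bar>) * (p x * exp (2 * \<bar>x\<bar> + 1))"
        unfolding real_norm_def abs_mult[of "\<phi> x"] using \<phi> std_normal_difference_le[OF h, of x N] K
        by (intro mult_mono) (auto simp: p_def)
      also have "\<dots> = K * p x * (exp \<bar>x\<bar> * exp (2 * \<bar>x\<bar> + 1))" by simp
      also have "exp \<bar>x\<bar> * exp (2 * \<bar>x\<bar> + 1) = exp 1 * exp (3 * \<bar>x\<bar>)" by (simp flip: exp_add)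
      also have "K * p x * (exp 1 * exp (3 * \<bar>x\<bar>)) = K * exp 1 * (p x * exp (3 * \<bar>x\<bar>))" by simp
      finally show "norm (\<phi> x * ((p x - p (x + h N)) / h N)) \<le> K * exp 1 * (p x * exp (3 * \<bar>x\<bar>))" .
    qed
  qed auto
  have lim2: "(\<lambda>N. \<integral>x. \<psi> x * p (x + h N) \<partial>lborel) \<longlonglongrightarrow> (\<integral>x. \<psi> x * p x \<partial>lborel)"
  proof (rule integral_dominated_convergence[OF _ _ dom])
    have "h \<longlonglongrightarrow> 0" unfolding h_def by (rule inverse_Suc_tendsto)
    then have "(\<lambda>N. p (x + h N)) \<longlonglongrightarrow> p (x + 0)" for x
      unfolding p_def normal_density_def by (intro tendsto_intros) auto
    then show "AE x in lborel. (\<lambda>N. \<psi> x * p (x + h N)) \<longlonglongrightarrow> \<psi> x * p x"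
      by (intro AE_I2 tendsto_mult tendsto_const) simp
    fix N
    show "AE x in lborel. norm (\<psi> x * p (x + h N)) \<le> K * exp 1 * (p x * exp (3 * \<bar>x\<bar>))"
      using small[of \<psi>, OF \<psi>] by (intro AE_I2) (auto simp: abs_le_iff minus_le_iff)
  qed auto
  \<comment> \<open>The limit \<open>h N\<close> to 0. The two translates of \<psi> have the same
    limit, whence the factor 2 in the conclusion.\<close>
  have "(\<integral>x. \<phi> x * (x * p x) \<partial>lborel) \<le> C * (\<integral>x. \<psi> x * p x \<partial>lborel) + C * (\<integral>x. \<psi> x * p x \<partial>lborel)"
    by (rule LIMSEQ_le[OF lim1 tendsto_add[OF tendsto_const tendsto_mult[OF tendsto_const lim2]]]) (use step in blast)
  moreover have "(\<integral>x. x * \<phi> x \<partial>stdn) = (\<integral>x. \<phi> x * (x * p x) \<partial>lborel)"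
    unfolding stdn_def p_def by (subst integral_density) (auto simp: normal_density_nonneg mult_ac)
  moreover have "(\<integral>x. \<psi> x \<partial>stdn) = (\<integral>x. \<psi> x * p x \<partial>lborel)"
    unfolding stdn_def p_def by (subst integral_density) (auto simp: normal_density_nonneg mult_ac)
  ultimately show ?thesis by simp
qed

lemma integrable_stdn_exp: "integrable stdn (\<lambda>x. exp (a * \<bar>x\<bar>))"
  unfolding stdn_def by (subst integrable_density) (auto simp: normal_density_nonneg integrable_std_normal_exp_abs)

section \<open>Integration by parts in several Gaussian variables\<close>

definition gaussm :: "nat set \<Rightarrow> (nat \<Rightarrow> real) measure" where
  "gaussm I = PiM I (\<lambda>_. stdn)"

text \<open>Fubini's theorem with the i-th coordinate integrated first. For fixed other coordinates
  the one-dimensional inequality applies, with \<open>K\<close> enlarged by the exponential of their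
  absolute sum.\<close>

lemma gaussm_ibp_le:
  fixes \<phi> \<psi> :: "(nat \<Rightarrow> real) \<Rightarrow> real"
  assumes m[measurable]: "\<phi> \<in> borel_measurable (gaussm {..<m})" "\<psi> \<in> borel_measurable (gaussm {..<m})"
    and \<phi>: "\<And>x. \<bar>\<phi> x\<bar> \<le> K * exp (\<Sum>j<m. \<bar>x j\<bar>)" and \<psi>: "\<And>x. \<bar>\<psi> x\<bar> \<le> K * exp (\<Sum>j<m. \<bar>x j\<bar>)"
    and i: "i < m"
    and inc: "\<And>x y t. 0 < t \<Longrightarrow> \<phi> (x(i := y + t)) - \<phi> (x(i := y)) \<le> C * t * (\<psi> (x(i := y + t)) + \<psi> (x(i := y)))"
  shows "integrable (gaussm {..<m}) (\<lambda>x. x i * \<phi> x)" "integrable (gaussm {..<m}) \<psi>"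
    "(\<integral>x. x i * \<phi> x \<partial>gaussm {..<m}) \<le> 2 * C * (\<integral>x. \<psi> x \<partial>gaussm {..<m})"
proof -
  interpret prob_space stdn by (rule prob_space_stdn)
  interpret product_sigma_finite "\<lambda>_::nat. stdn" by standard
  define I where "I = {..<m} - {i}"
  have I: "finite I" "i \<notin> I" "insert i I = {..<m}" using i by (auto simp: I_def)
  interpret PI: finite_product_sigma_finite "\<lambda>_::nat. stdn" I by standard (rule I)
  have K: "0 \<le> K" using \<phi>[of "\<lambda>_. 0"] by simp
  have intE: "integrable (PiM J (\<lambda>_. stdn)) (\<lambda>x. exp (a * (\<Sum>j\<in>J. \<bar>x j\<bar>)))" if "finite J" for J :: "nat set" and a
    using product_integrable_prod[OF that, of "\<lambda>_ x. exp (a * \<bar>x\<bar>)"] that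
    by (simp add: integrable_stdn_exp exp_sum sum_distrib_left)
  have [measurable]: "(\<lambda>x. x i) \<in> borel_measurable (gaussm {..<m})"
    unfolding gaussm_def using i by (intro measurable_compose[OF measurable_component_singleton]) auto
  have xi: "\<bar>x i * \<phi> x\<bar> \<le> K * exp (2 * (\<Sum>j<m. \<bar>x j\<bar>))" for x
  proof -
    have "\<bar>x i\<bar> \<le> (\<Sum>j<m. \<bar>x j\<bar>)" using i by (intro member_le_sum) auto
    also have "\<dots> \<le> exp (\<Sum>j<m. \<bar>x j\<bar>)" using exp_ge_add_one_self[of "\<Sum>j<m. \<bar>x j\<bar>"] by linarith
    finally have "\<bar>x i * \<phi> x\<bar> \<le> exp (\<Sum>j<m. \<bar>x j\<bar>) * (K * exp (\<Sum>j<m. \<bar>x j\<bar>))"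
      unfolding abs_mult using \<phi> by (intro mult_mono) auto
    also have "\<dots> = K * exp (2 * (\<Sum>j<m. \<bar>x j\<bar>))" by (simp add: exp_double power2_eq_square)
    finally show ?thesis .
  qed
  have dom: "integrable (gaussm {..<m}) (\<lambda>x. K * exp (a * (\<Sum>j<m. \<bar>x j\<bar>)))" for a
    unfolding gaussm_def by (intro integrable_mult_right intE) simp
  show int1: "integrable (gaussm {..<m}) (\<lambda>x. x i * \<phi> x)"
    by (rule Bochner_Integration.integrable_bound[OF dom[of 2]]) (use xi K in auto)
  show int2: "integrable (gaussm {..<m}) \<psi>"
    by (rule Bochner_Integration.integrable_bound[OF dom[of 1]]) (use \<psi> K in auto)
  have upd: "(\<lambda>y. x(i := y)) \<in> stdn \<rightarrow>\<^sub>M gaussm {..<m}" if "x \<in> space (PiM I (\<lambda>_. stdn))" for x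
    unfolding gaussm_def I(3)[symmetric] using that I(2) by (rule measurable_component_update)
  define E where "E x = (\<Sum>j\<in>I. \<bar>x j\<bar>)" for x :: "nat \<Rightarrow> real"
  have sumE: "(\<Sum>j<m. \<bar>(x(i := y)) j\<bar>) = \<bar>y\<bar> + E x" for x y
    unfolding I(3)[symmetric] E_def using I(1,2) by (simp add: sum.insert) (intro sum.cong, auto)
  have upd2: "(\<lambda>(x, y). x(i := y)) \<in> PiM I (\<lambda>_. stdn) \<Otimes>\<^sub>M stdn \<rightarrow>\<^sub>M gaussm {..<m}"
    unfolding gaussm_def I(3)[symmetric] by (rule measurable_add_dim)
  \<comment> \<open>The rate is 2 because the factor \<open>x i\<close> is itself bounded by an
    exponential of rate 1.\<close>
  have inner_int: "integrable (PiM I (\<lambda>_. stdn)) (\<lambda>x. \<integral>y. f (x(i := y)) \<partial>stdn)"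
    if f: "f \<in> borel_measurable (gaussm {..<m})" and bd: "\<And>x. \<bar>f x\<bar> \<le> K * exp (2 * (\<Sum>j<m. \<bar>x j\<bar>))" for f
  proof (rule Bochner_Integration.integrable_bound)
    show "integrable (PiM I (\<lambda>_. stdn)) (\<lambda>x. (\<integral>y. exp (2 * \<bar>y\<bar>) \<partial>stdn) * (K * exp (2 * E x)))"
      unfolding E_def by (intro integrable_mult_right intE I)
    show "(\<lambda>x. \<integral>y. f (x(i := y)) \<partial>stdn) \<in> borel_measurable (PiM I (\<lambda>_. stdn))"
    proof (rule borel_measurable_lebesgue_integral)
      show "(\<lambda>(x, y). f (x(i := y))) \<in> borel_measurable (PiM I (\<lambda>_. stdn) \<Otimes>\<^sub>M stdn)"
        using measurable_compose[OF upd2 f] by (simp add: case_prod_beta')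
    qed
    show "AE x in PiM I (\<lambda>_. stdn). norm (\<integral>y. f (x(i := y)) \<partial>stdn) \<le> norm ((\<integral>y. exp (2 * \<bar>y\<bar>) \<partial>stdn) * (K * exp (2 * E x)))"
    proof (intro AE_I2)
      fix x assume x: "x \<in> space (PiM I (\<lambda>_. stdn))"
      have "norm (\<integral>y. f (x(i := y)) \<partial>stdn) \<le> (\<integral>y. exp (2 * \<bar>y\<bar>) * (K * exp (2 * E x)) \<partial>stdn)"
      proof (rule Bochner_Integration.integral_norm_bound_integral)
        have b: "norm (f (x(i := y))) \<le> exp (2 * \<bar>y\<bar>) * (K * exp (2 * E x))" for y
          using bd[of "x(i := y)"] unfolding sumE by (simp add: distrib_left exp_add mult_ac)
        then show "norm (f (x(i := y))) \<le> exp (2 * \<bar>y\<bar>) * (K * exp (2 * E x))" for y .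
        show "integrable stdn (\<lambda>y. exp (2 * \<bar>y\<bar>) * (K * exp (2 * E x)))"
          by (intro integrable_mult_left integrable_stdn_exp)
        then show "integrable stdn (\<lambda>y. f (x(i := y)))"
          by (rule Bochner_Integration.integrable_bound)
             (use measurable_compose[OF upd[OF x] f] b K in \<open>auto simp: abs_mult\<close>)
      qed
      also have "\<dots> = (\<integral>y. exp (2 * \<bar>y\<bar>) \<partial>stdn) * (K * exp (2 * E x))" by simp
      also have "\<dots> \<le> norm \<dots>" by simp
      finally show "norm (\<integral>y. f (x(i := y)) \<partial>stdn) \<le> norm ((\<integral>y. exp (2 * \<bar>y\<bar>) \<partial>stdn) * (K * exp (2 * E x)))" .
    qed
  qed
  have \<psi>2: "\<bar>\<psi> x\<bar> \<le> K * exp (2 * (\<Sum>j<m. \<bar>x j\<bar>))" for x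
  proof -
    have "0 \<le> (\<Sum>j<m. \<bar>x j\<bar>)" by (simp add: sum_nonneg)
    then have "K * exp (\<Sum>j<m. \<bar>x j\<bar>) \<le> K * exp (2 * (\<Sum>j<m. \<bar>x j\<bar>))" using K by (intro mult_left_mono) auto
    then show ?thesis using \<psi>[of x] by linarith
  qed
  have "(\<integral>x. x i * \<phi> x \<partial>gaussm {..<m}) = (\<integral>x. (\<integral>y. (x(i := y)) i * \<phi> (x(i := y)) \<partial>stdn) \<partial>PiM I (\<lambda>_. stdn))"
    using product_integral_insert[OF I(1,2), of "\<lambda>x. x i * \<phi> x"] int1 unfolding gaussm_def I(3) .
  also have "\<dots> \<le> (\<integral>x. 2 * C * (\<integral>y. \<psi> (x(i := y)) \<partial>stdn) \<partial>PiM I (\<lambda>_. stdn))"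
  proof (rule integral_mono)
    show "integrable (PiM I (\<lambda>_. stdn)) (\<lambda>x. \<integral>y. (x(i := y)) i * \<phi> (x(i := y)) \<partial>stdn)"
      by (rule inner_int[of "\<lambda>x. x i * \<phi> x"]) (use xi in auto)
    show "integrable (PiM I (\<lambda>_. stdn)) (\<lambda>x. 2 * C * (\<integral>y. \<psi> (x(i := y)) \<partial>stdn))"
      by (intro integrable_mult_right inner_int \<psi>2 m)
    fix x assume x: "x \<in> space (PiM I (\<lambda>_. stdn))"
    have mm: "(\<lambda>y. \<phi> (x(i := y))) \<in> borel_measurable stdn" "(\<lambda>y. \<psi> (x(i := y))) \<in> borel_measurable stdn"
      using measurable_compose[OF upd[OF x] m(1)] measurable_compose[OF upd[OF x] m(2)] by auto
    have "(\<integral>y. y * \<phi> (x(i := y)) \<partial>stdn) \<le> 2 * C * (\<integral>y. \<psi> (x(i := y)) \<partial>stdn)"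
    proof (rule gaussian_ibp_le)
      show "\<bar>\<phi> (x(i := y))\<bar> \<le> (K * exp (E x)) * exp \<bar>y\<bar>" "\<bar>\<psi> (x(i := y))\<bar> \<le> (K * exp (E x)) * exp \<bar>y\<bar>" for y
        using \<phi>[of "x(i := y)"] \<psi>[of "x(i := y)"] unfolding sumE by (auto simp: exp_add mult_ac)
      show "\<phi> (x(i := y + t)) - \<phi> (x(i := y)) \<le> C * t * (\<psi> (x(i := y + t)) + \<psi> (x(i := y)))" if "0 < t" for y t
        by (rule inc[OF that])
    qed (use mm in simp_all)
    then show "(\<integral>y. (x(i := y)) i * \<phi> (x(i := y)) \<partial>stdn) \<le> 2 * C * (\<integral>y. \<psi> (x(i := y)) \<partial>stdn)" by simp
  qed
  also have "\<dots> = 2 * C * (\<integral>x. \<psi> x \<partial>gaussm {..<m})"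
    using product_integral_insert[OF I(1,2), of \<psi>] int2 unfolding gaussm_def I(3) by simp
  finally show "(\<integral>x. x i * \<phi> x \<partial>gaussm {..<m}) \<le> 2 * C * (\<integral>x. \<psi> x \<partial>gaussm {..<m})" .
qed

section \<open>Increments of traces of odd powers\<close>

text \<open>The tangent of the convex function \<open>s^(q+1)\<close> at \<open>a\<close> lies below
  its value at \<open>b\<close>; in this form it is Young's inequality for
  \<open>a^q b\<close>.\<close>

lemma powr_increment_le:
  fixes a b q :: real
  assumes "0 \<le> b" "b \<le> a" "0 < q"
  shows "a * a powr q - b * b powr q \<le> (q + 1) * (a - b) * a powr q"
proof (cases "b = 0 \<or> a = 0")
  case True
  then show ?thesis using assms by (auto simp: algebra_simps)
next
  case False
  then have ab: "a > 0" "b > 0" using assms by auto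
  have "(a powr (q + 1)) powr (q / (q + 1)) * (b powr (q + 1)) powr (1 / (q + 1))
    \<le> q / (q + 1) * a powr (q + 1) + 1 / (q + 1) * b powr (q + 1)"
    using assms ab by (intro Youngs_inequality_0) (auto simp: field_simps)
  then have "a powr q * b \<le> q / (q + 1) * a powr (q + 1) + 1 / (q + 1) * b powr (q + 1)"
    using assms ab by (simp add: powr_powr)
  then have "(q + 1) * (a powr q * b) \<le> (q + 1) * (q / (q + 1) * a powr (q + 1) + 1 / (q + 1) * b powr (q + 1))"
    using assms by (intro mult_left_mono) auto
  also have "\<dots> = q * a powr (q + 1) + b powr (q + 1)" using assms by (simp add: distrib_left)
  finally show ?thesis using ab by (simp add: powr_add algebra_simps)
qed

text \<open>The odd power has derivative \<open>(q + 1) |s|^q\<close>, which on an interval without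
  sign change is largest at the endpoint of larger modulus; across zero a direct expansion works.
  Adding the values at both ends makes the bound symmetric, as an increment inequality in either
  direction needs.\<close>

lemma odd_power_increment:
  fixes a b q :: real
  assumes q: "0 < q"
  shows "(a - b) * (a * \<bar>a\<bar> powr q - b * \<bar>b\<bar> powr q) \<le> (q + 1) * ((a - b)\<^sup>2 * (\<bar>a\<bar> powr q + \<bar>b\<bar> powr q))"
proof -
  have pos: "(a - b) * (a * \<bar>a\<bar> powr q - b * \<bar>b\<bar> powr q) \<le> (q + 1) * ((a - b)\<^sup>2 * (\<bar>a\<bar> powr q + \<bar>b\<bar> powr q))"
    if ba: "0 \<le> b" "b \<le> a" for a b :: real
  proof -
    have "(a - b) * (a * a powr q - b * b powr q) \<le> (a - b) * ((q + 1) * (a - b) * a powr q)"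
      using powr_increment_le[OF ba q] ba by (intro mult_left_mono) auto
    also have "\<dots> = (q + 1) * ((a - b)\<^sup>2 * a powr q)" by (simp add: power2_eq_square)
    also have "\<dots> \<le> (q + 1) * ((a - b)\<^sup>2 * (a powr q + b powr q))"
      using q by (intro mult_left_mono) auto
    finally show ?thesis using ba by simp
  qed
  have mixed: "(a - b) * (a * \<bar>a\<bar> powr q - b * \<bar>b\<bar> powr q) \<le> (q + 1) * ((a - b)\<^sup>2 * (\<bar>a\<bar> powr q + \<bar>b\<bar> powr q))"
    if ab: "b \<le> 0" "0 \<le> a" for a b :: real
  proof -
    have "b * \<bar>a\<bar> powr q \<le> 0" "0 \<le> a * \<bar>b\<bar> powr q" using ab by (auto intro: mult_nonpos_nonneg)
    moreover have "(a - b) * (\<bar>a\<bar> powr q + \<bar>b\<bar> powr q)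
      = a * \<bar>a\<bar> powr q + a * \<bar>b\<bar> powr q - b * \<bar>a\<bar> powr q - b * \<bar>b\<bar> powr q"
      by (simp add: algebra_simps)
    ultimately have "a * \<bar>a\<bar> powr q - b * \<bar>b\<bar> powr q \<le> (a - b) * (\<bar>a\<bar> powr q + \<bar>b\<bar> powr q)"
      by linarith
    then have "(a - b) * (a * \<bar>a\<bar> powr q - b * \<bar>b\<bar> powr q) \<le> (a - b) * ((a - b) * (\<bar>a\<bar> powr q + \<bar>b\<bar> powr q))"
      using ab by (intro mult_left_mono) auto
    also have "\<dots> = 1 * ((a - b)\<^sup>2 * (\<bar>a\<bar> powr q + \<bar>b\<bar> powr q))" by (simp add: power2_eq_square)
    also have "\<dots> \<le> (q + 1) * ((a - b)\<^sup>2 * (\<bar>a\<bar> powr q + \<bar>b\<bar> powr q))"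
      using q by (intro mult_right_mono) auto
    finally show ?thesis .
  qed
  have sw: "(a - b) * (a * \<bar>a\<bar> powr q - b * \<bar>b\<bar> powr q) = (b - a) * (b * \<bar>b\<bar> powr q - a * \<bar>a\<bar> powr q)"
    "(a - b)\<^sup>2 = (b - a)\<^sup>2" by (simp_all add: algebra_simps power2_eq_square)
  consider "0 \<le> a \<and> 0 \<le> b" | "a \<le> 0 \<and> b \<le> 0" | "b \<le> 0 \<and> 0 \<le> a" | "a \<le> 0 \<and> 0 \<le> b" by linarith
  then show ?thesis
  proof cases
    case 1
    then show ?thesis using pos[of b a] pos[of a b] sw by (cases "b \<le> a") (auto simp: add.commute)
  next
    case 2
    then show ?thesis using pos[of "- b" "- a"] pos[of "- a" "- b"]
      by (cases "b \<le> a") (auto simp: algebra_simps power2_eq_square)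
  next
    case 3
    then show ?thesis using mixed by blast
  next
    case 4
    then show ?thesis using mixed[of a b] unfolding sw by (simp add: add.commute)
  qed
qed

text \<open>Expanding in the eigenbases of \<open>A\<close> and \<open>B\<close> reduces the claim to the scalar inequality.\<close>

lemma trace_increment:
  fixes lam mu :: "nat \<Rightarrow> real"
  assumes A: "herm n A" and B: "herm n B" and e: "ons n n e" and f: "ons n n f"
    and Ae: "\<And>k i. k < n \<Longrightarrow> i < n \<Longrightarrow> kap n A (e k) i = complex_of_real (lam k) * e k i"
    and Bf: "\<And>k i. k < n \<Longrightarrow> i < n \<Longrightarrow> kap n B (f k) i = complex_of_real (mu k) * f k i"
    and AB: "\<And>v i. i < n \<Longrightarrow> kap n A v i = kap n B v i + complex_of_real t * kap n T v i"
    and t: "0 < t" and q: "0 < q"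
  shows "(\<Sum>k<n. lam k * \<bar>lam k\<bar> powr q * Re (cip n (kap n T (e k)) (e k))) - (\<Sum>k<n. mu k * \<bar>mu k\<bar> powr q * Re (cip n (kap n T (f k)) (f k)))
    \<le> (q + 1) * t * ((\<Sum>k<n. \<bar>lam k\<bar> powr q * nsq n (kap n T (e k))) + (\<Sum>k<n. \<bar>mu k\<bar> powr q * nsq n (kap n T (f k))))"
proof -
  \<comment> \<open>Squared transition coefficients between the two eigenbases; all traces below
    become double sums with these weights.\<close>
  define c where "c k l = (cmod (cip n (e k) (f l)))\<^sup>2" for k l
  have split: "complex_of_real t * cip n (kap n T v) y = cip n (kap n A v) y - cip n (kap n B v) y" for v y
  proof -
    have "cip n (kap n A v) y = cip n (\<lambda>i. kap n B v i + complex_of_real t * kap n T v i) y"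
      by (intro cip_cong AB refl)
    then show ?thesis by (simp add: cip_add_left cip_scale_left)
  qed
  have Ael: "cip n (kap n A (e k)) y = complex_of_real (lam k) * cip n (e k) y" if "k < n" for k y
    unfolding cip_scale_left[symmetric] by (intro cip_cong Ae that refl)
  have Bfl: "cip n (kap n B (f k)) y = complex_of_real (mu k) * cip n (f k) y" if "k < n" for k y
    unfolding cip_scale_left[symmetric] by (intro cip_cong Bf that refl)
  have Aer: "cip n (kap n A x) (e k) = complex_of_real (lam k) * cip n x (e k)" if "k < n" for k x
  proof -
    have "cip n (kap n A x) (e k) = cip n x (\<lambda>i. complex_of_real (lam k) * e k i)"
      unfolding cip_kap_herm[OF A] by (intro cip_cong Ae that refl)
    then show ?thesis by (simp add: cip_scale_right)
  qed
  have Bfr: "cip n (kap n B x) (f k) = complex_of_real (mu k) * cip n x (f k)" if "k < n" for k x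
  proof -
    have "cip n (kap n B x) (f k) = cip n x (\<lambda>i. complex_of_real (mu k) * f k i)"
      unfolding cip_kap_herm[OF B] by (intro cip_cong Bf that refl)
    then show ?thesis by (simp add: cip_scale_right)
  qed
  \<comment> \<open>The decisive identity: between eigenvectors of \<open>A\<close> and of
    \<open>B\<close>, the difference \<open>A - B = t T\<close> acts as multiplication by the
    difference of the eigenvalues.\<close>
  have Te: "complex_of_real t * cip n (kap n T (e k)) (f l) = complex_of_real (lam k - mu l) * cip n (e k) (f l)"
    if "k < n" "l < n" for k l
    using split[of "e k" "f l"] that by (simp add: Ael Bfr algebra_simps)
  have Tf: "complex_of_real t * cip n (kap n T (f l)) (e k) = complex_of_real (lam k - mu l) * cip n (f l) (e k)"
    if "k < n" "l < n" for k l
    using split[of "f l" "e k"] that by (simp add: Aer Bfl algebra_simps)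
  have d1: "t * Re (cip n (kap n T (e k)) (e k)) = (\<Sum>l<n. (lam k - mu l) * c k l)" if k: "k < n" for k
  proof -
    have "complex_of_real t * cip n (kap n T (e k)) (e k) = (\<Sum>l<n. (complex_of_real t * cip n (kap n T (e k)) (f l)) * cip n (f l) (e k))"
      by (subst parseval[OF f]) (simp add: sum_distrib_left mult_ac)
    also have "\<dots> = (\<Sum>l<n. complex_of_real ((lam k - mu l) * c k l))"
    proof (intro sum.cong refl)
      fix l assume "l \<in> {..<n}"
      then have "complex_of_real t * cip n (kap n T (e k)) (f l) * cip n (f l) (e k)
        = complex_of_real (lam k - mu l) * (cip n (e k) (f l) * cip n (f l) (e k))"
        using Te[OF k] by simp
      then show "complex_of_real t * cip n (kap n T (e k)) (f l) * cip n (f l) (e k) = complex_of_real ((lam k - mu l) * c k l)"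
        unfolding cip_mult_cnj c_def by simp
    qed
    finally have "complex_of_real t * cip n (kap n T (e k)) (e k) = complex_of_real (\<Sum>l<n. (lam k - mu l) * c k l)" by simp
    then have "Re (complex_of_real t * cip n (kap n T (e k)) (e k)) = (\<Sum>l<n. (lam k - mu l) * c k l)"
      by (metis Re_complex_of_real)
    then show ?thesis by simp
  qed
  have d2: "t * Re (cip n (kap n T (f l)) (f l)) = (\<Sum>k<n. (lam k - mu l) * c k l)" if l: "l < n" for l
  proof -
    have "complex_of_real t * cip n (kap n T (f l)) (f l) = (\<Sum>k<n. (complex_of_real t * cip n (kap n T (f l)) (e k)) * cip n (e k) (f l))"
      by (subst parseval[OF e]) (simp add: sum_distrib_left mult_ac)
    also have "\<dots> = (\<Sum>k<n. complex_of_real ((lam k - mu l) * c k l))"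
    proof (intro sum.cong refl)
      fix k assume "k \<in> {..<n}"
      then have "complex_of_real t * cip n (kap n T (f l)) (e k) * cip n (e k) (f l)
        = complex_of_real (lam k - mu l) * (cip n (e k) (f l) * cip n (f l) (e k))"
        using Tf[OF _ l] by simp
      then show "complex_of_real t * cip n (kap n T (f l)) (e k) * cip n (e k) (f l) = complex_of_real ((lam k - mu l) * c k l)"
        unfolding cip_mult_cnj c_def by simp
    qed
    finally have "complex_of_real t * cip n (kap n T (f l)) (f l) = complex_of_real (\<Sum>k<n. (lam k - mu l) * c k l)" by simp
    then have "Re (complex_of_real t * cip n (kap n T (f l)) (f l)) = (\<Sum>k<n. (lam k - mu l) * c k l)"
      by (metis Re_complex_of_real)
    then show ?thesis by simp
  qed
  have sq: "t\<^sup>2 * (cmod z)\<^sup>2 = s\<^sup>2 * (cmod v)\<^sup>2" if "complex_of_real t * z = complex_of_real s * v" for z v s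
  proof -
    have "(cmod (complex_of_real t * z))\<^sup>2 = (cmod (complex_of_real s * v))\<^sup>2" by (simp only: that)
    then show ?thesis by (simp add: norm_mult power_mult_distrib)
  qed
  have n1: "t\<^sup>2 * nsq n (kap n T (e k)) = (\<Sum>l<n. (lam k - mu l)\<^sup>2 * c k l)" if k: "k < n" for k
    unfolding parseval_nsq[OF f] sum_distrib_left c_def by (intro sum.cong refl sq Te k) simp
  have n2: "t\<^sup>2 * nsq n (kap n T (f l)) = (\<Sum>k<n. (lam k - mu l)\<^sup>2 * c k l)" if l: "l < n" for l
    unfolding parseval_nsq[OF e] sum_distrib_left c_def
  proof (intro sum.cong refl)
    fix k assume "k \<in> {..<n}"
    then show "t\<^sup>2 * (cmod (cip n (kap n T (f l)) (e k)))\<^sup>2 = (lam k - mu l)\<^sup>2 * (cmod (cip n (e k) (f l)))\<^sup>2"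
      using sq[OF Tf[OF _ l]] by (simp add: cmod_cip_commute[of n "e k"])
  qed
  let ?h = "\<lambda>s. s * \<bar>s\<bar> powr q"
  have "t * ((\<Sum>k<n. ?h (lam k) * Re (cip n (kap n T (e k)) (e k))) - (\<Sum>l<n. ?h (mu l) * Re (cip n (kap n T (f l)) (f l))))
    = (\<Sum>k<n. ?h (lam k) * (t * Re (cip n (kap n T (e k)) (e k)))) - (\<Sum>l<n. ?h (mu l) * (t * Re (cip n (kap n T (f l)) (f l))))"
    by (simp add: right_diff_distrib sum_distrib_left mult_ac)
  also have "\<dots> = (\<Sum>k<n. \<Sum>l<n. ?h (lam k) * ((lam k - mu l) * c k l)) - (\<Sum>l<n. \<Sum>k<n. ?h (mu l) * ((lam k - mu l) * c k l))"
    by (simp add: d1 d2 sum_distrib_left)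
  also have "(\<Sum>l<n. \<Sum>k<n. ?h (mu l) * ((lam k - mu l) * c k l)) = (\<Sum>k<n. \<Sum>l<n. ?h (mu l) * ((lam k - mu l) * c k l))"
    by (rule sum.swap)
  also have "(\<Sum>k<n. \<Sum>l<n. ?h (lam k) * ((lam k - mu l) * c k l)) - (\<Sum>k<n. \<Sum>l<n. ?h (mu l) * ((lam k - mu l) * c k l))
    = (\<Sum>k<n. \<Sum>l<n. ((lam k - mu l) * (?h (lam k) - ?h (mu l))) * c k l)"
    by (simp add: algebra_simps flip: sum_subtractf)
  also have "\<dots> \<le> (\<Sum>k<n. \<Sum>l<n. ((q + 1) * ((lam k - mu l)\<^sup>2 * (\<bar>lam k\<bar> powr q + \<bar>mu l\<bar> powr q))) * c k l)"
    by (intro sum_mono mult_right_mono odd_power_increment q) (simp add: c_def)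
  also have "\<dots> = (q + 1) * ((\<Sum>k<n. \<Sum>l<n. \<bar>lam k\<bar> powr q * ((lam k - mu l)\<^sup>2 * c k l)) + (\<Sum>k<n. \<Sum>l<n. \<bar>mu l\<bar> powr q * ((lam k - mu l)\<^sup>2 * c k l)))"
    unfolding sum.distrib[symmetric] sum_distrib_left by (intro sum.cong refl) (simp add: algebra_simps)
  also have "(\<Sum>k<n. \<Sum>l<n. \<bar>mu l\<bar> powr q * ((lam k - mu l)\<^sup>2 * c k l)) = (\<Sum>l<n. \<Sum>k<n. \<bar>mu l\<bar> powr q * ((lam k - mu l)\<^sup>2 * c k l))"
    by (rule sum.swap)
  also have "(q + 1) * ((\<Sum>k<n. \<Sum>l<n. \<bar>lam k\<bar> powr q * ((lam k - mu l)\<^sup>2 * c k l)) + (\<Sum>l<n. \<Sum>k<n. \<bar>mu l\<bar> powr q * ((lam k - mu l)\<^sup>2 * c k l)))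
    = (q + 1) * ((\<Sum>k<n. \<bar>lam k\<bar> powr q * (t\<^sup>2 * nsq n (kap n T (e k)))) + (\<Sum>l<n. \<bar>mu l\<bar> powr q * (t\<^sup>2 * nsq n (kap n T (f l)))))"
    by (simp add: n1 n2 sum_distrib_left)
  also have "\<dots> = t * ((q + 1) * t * ((\<Sum>k<n. \<bar>lam k\<bar> powr q * nsq n (kap n T (e k))) + (\<Sum>l<n. \<bar>mu l\<bar> powr q * nsq n (kap n T (f l)))))"
  proof -
    have pull: "(\<Sum>k<n. a k * (t\<^sup>2 * b k)) = t * t * (\<Sum>k<n. a k * b k)" for a b :: "nat \<Rightarrow> real"
      by (simp add: sum_distrib_left power2_eq_square mult_ac)
    show ?thesis unfolding pull by (simp add: algebra_simps)
  qed
  finally show ?thesis using t by simp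
qed

section \<open>Measurability of spectral sums\<close>

primrec kpow :: "nat \<Rightarrow> (nat \<Rightarrow> nat \<Rightarrow> complex) \<Rightarrow> nat \<Rightarrow> nat \<Rightarrow> nat \<Rightarrow> complex" where
  "kpow n K 0 = (\<lambda>i j. if i = j then 1 else 0)"
| "kpow n K (Suc d) = (\<lambda>i j. \<Sum>a<n. K i a * kpow n K d a j)"

lemma kap_mult: "kap n (\<lambda>i j. \<Sum>a<n. K i a * L a j) x i = kap n K (kap n L x) i"
proof -
  have "kap n (\<lambda>i j. \<Sum>a<n. K i a * L a j) x i = (\<Sum>j<n. \<Sum>a<n. K i a * L a j * x j)"
    by (simp add: kap_def sum_distrib_right)
  also have "\<dots> = kap n K (kap n L x) i"
    by (subst sum.swap) (simp add: kap_def sum_distrib_left mult_ac)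
  finally show ?thesis .
qed

lemma kap_kpow_eigen:
  assumes "\<And>i. i < n \<Longrightarrow> kap n K x i = a * x i" "i < n"
  shows "kap n (kpow n K d) x i = a ^ d * x i"
  using assms(2)
proof (induction d arbitrary: i)
  case 0
  have "kap n (kpow n K 0) x i = (\<Sum>j<n. if i = j then x j else 0)"
    unfolding kap_def by (intro sum.cong) auto
  then show ?case using 0 by simp
next
  case (Suc d)
  have "kap n (kpow n K (Suc d)) x i = kap n K (kap n (kpow n K d) x) i"
    by (simp add: kap_mult)
  also have "\<dots> = kap n K (\<lambda>j. a ^ d * x j) i"
    by (intro kap_cong Suc)
  finally show ?case using assms(1) Suc.prems by (simp add: kap_scale)
qed

lemma trace_ons:
  assumes "ons n n e"
  shows "(\<Sum>k<n. cip n (kap n K (e k)) (e k)) = (\<Sum>i<n. K i i)"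
proof -
  have "(\<Sum>k<n. cip n (kap n K (e k)) (e k)) = (\<Sum>k<n. \<Sum>i<n. \<Sum>j<n. K i j * (e k j * cnj (e k i)))"
    unfolding cip_def kap_def sum_distrib_right by (simp add: mult_ac)
  also have "\<dots> = (\<Sum>i<n. \<Sum>j<n. \<Sum>k<n. K i j * (e k j * cnj (e k i)))"
    by (rule trans[OF sum.swap sum.cong[OF refl sum.swap]])
  also have "\<dots> = (\<Sum>i<n. \<Sum>j<n. K i j * (if j = i then 1 else 0))"
    unfolding sum_distrib_left[symmetric] using ons_complete[OF assms] by (intro sum.cong refl) simp
  also have "\<dots> = (\<Sum>i<n. K i i)" by (simp add: if_distrib cong: if_cong)
  finally show ?thesis .
qed

text \<open>The eigenvectors need not depend measurably on \<open>x\<close>; for a polynomial \<open>f\<close> the sum below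
  is the trace of \<open>Z f(K x)\<close>, and a continuous \<open>f\<close> is a limit of polynomials.\<close>

lemma spectral_sum_measurable:
  fixes K :: "'a \<Rightarrow> nat \<Rightarrow> nat \<Rightarrow> complex" and lam :: "'a \<Rightarrow> nat \<Rightarrow> real"
  assumes Km: "\<And>i j. i < n \<Longrightarrow> j < n \<Longrightarrow> (\<lambda>x. K x i j) \<in> borel_measurable Q"
    and e: "\<And>x. ons n n (e x)"
    and ev: "\<And>x k i. k < n \<Longrightarrow> i < n \<Longrightarrow> kap n (K x) (e x k) i = complex_of_real (lam x k) * e x k i"
    and f: "continuous_on UNIV f"
  shows "(\<lambda>x. \<Sum>k<n. f (lam x k) * Re (cip n (kap n Z (e x k)) (e x k))) \<in> borel_measurable Q"
proof -
  have powm: "(\<lambda>x. kpow n (K x) d i j) \<in> borel_measurable Q" if "i < n" "j < n" for d i j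
    using that by (induction d arbitrary: i) (auto intro!: borel_measurable_sum borel_measurable_times Km)
  have mono: "(\<lambda>x. \<Sum>k<n. lam x k ^ d * Re (cip n (kap n Z (e x k)) (e x k))) \<in> borel_measurable Q" for d
  proof -
    have "(\<Sum>k<n. lam x k ^ d * Re (cip n (kap n Z (e x k)) (e x k))) = Re (\<Sum>i<n. \<Sum>a<n. Z i a * kpow n (K x) d a i)" for x
    proof -
      have "(\<Sum>i<n. \<Sum>a<n. Z i a * kpow n (K x) d a i) = (\<Sum>k<n. cip n (kap n (\<lambda>i j. \<Sum>a<n. Z i a * kpow n (K x) d a j) (e x k)) (e x k))"
        by (rule trace_ons[OF e, symmetric])
      also have "\<dots> = (\<Sum>k<n. complex_of_real (lam x k ^ d) * cip n (kap n Z (e x k)) (e x k))"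
      proof (intro sum.cong refl)
        fix k assume k: "k \<in> {..<n}"
        have "kap n (\<lambda>i j. \<Sum>a<n. Z i a * kpow n (K x) d a j) (e x k) i = complex_of_real (lam x k ^ d) * kap n Z (e x k) i" for i
        proof -
          have "kap n (\<lambda>i j. \<Sum>a<n. Z i a * kpow n (K x) d a j) (e x k) i = kap n Z (kap n (kpow n (K x) d) (e x k)) i"
            by (rule kap_mult)
          also have "\<dots> = kap n Z (\<lambda>i. complex_of_real (lam x k) ^ d * e x k i) i"
            using k by (intro kap_cong kap_kpow_eigen ev) auto
          finally show ?thesis by (simp add: kap_scale)
        qed
        then have "cip n (kap n (\<lambda>i j. \<Sum>a<n. Z i a * kpow n (K x) d a j) (e x k)) (e x k)
          = cip n (\<lambda>i. complex_of_real (lam x k ^ d) * kap n Z (e x k) i) (e x k)"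
          by (intro cip_cong) auto
        then show "cip n (kap n (\<lambda>i j. \<Sum>a<n. Z i a * kpow n (K x) d a j) (e x k)) (e x k)
          = complex_of_real (lam x k ^ d) * cip n (kap n Z (e x k)) (e x k)"
          unfolding cip_scale_left .
      qed
      finally show ?thesis by simp
    qed
    moreover define F where "F x = (\<Sum>i<n. \<Sum>a<n. Z i a * kpow n (K x) d a i)" for x
    moreover have [measurable]: "F \<in> borel_measurable Q"
      unfolding F_def[abs_def] by (intro borel_measurable_sum borel_measurable_times borel_measurable_const powm) auto
    moreover have "(\<lambda>x. Re (F x)) \<in> borel_measurable Q" by measurable
    ultimately show ?thesis by simp
  qed
  have poly: "(\<lambda>x. \<Sum>k<n. g (lam x k) * Re (cip n (kap n Z (e x k)) (e x k))) \<in> borel_measurable Q"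
    if g: "real_polynomial_function g" for g
  proof -
    obtain a d where gd: "g = (\<lambda>x. \<Sum>i\<le>d. a i * x ^ i)" using g by (auto simp: real_polynomial_function_iff_sum)
    have "(\<Sum>k<n. g (lam x k) * Re (cip n (kap n Z (e x k)) (e x k)))
      = (\<Sum>i\<le>d. a i * (\<Sum>k<n. lam x k ^ i * Re (cip n (kap n Z (e x k)) (e x k))))" for x
      unfolding gd sum_distrib_right sum_distrib_left by (subst sum.swap) (simp add: mult_ac)
    then show ?thesis by (simp only:) (intro borel_measurable_sum borel_measurable_times mono borel_measurable_const)
  qed
  \<comment> \<open>The intervals grow with \<open>N\<close>, so the polynomials converge to
    \<open>f\<close> pointwise on the whole line.\<close>
  have "\<exists>g. real_polynomial_function g \<and> (\<forall>t\<in>{- real N..real N}. \<bar>f t - g t\<bar> < 1 / real (Suc N))" for N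
    by (rule Stone_Weierstrass_real_polynomial_function[of "{- real N..real N}" f "1 / real (Suc N)"])
       (use continuous_on_subset[OF f] in auto)
  then obtain g where g: "\<And>N. real_polynomial_function (g N)"
    "\<And>N t. t \<in> {- real N..real N} \<Longrightarrow> \<bar>f t - g N t\<bar> < 1 / real (Suc N)" by metis
  have lim: "(\<lambda>N. g N t) \<longlonglongrightarrow> f t" for t
  proof (rule LIM_zero_cancel, rule Lim_null_comparison)
    obtain N0 where "\<bar>t\<bar> \<le> real N0" using real_arch_simple by blast
    then show "\<forall>\<^sub>F N in sequentially. norm (g N t - f t) \<le> 1 / real (Suc N)"
      unfolding eventually_sequentially
    proof (intro exI[of _ N0] allI impI)
      fix N assume "\<bar>t\<bar> \<le> real N0" "N0 \<le> N"
      then have "\<bar>t\<bar> \<le> real N" by linarith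
      then have "t \<in> {- real N..real N}" by (simp add: abs_le_iff minus_le_iff)
      from g(2)[OF this] show "norm (g N t - f t) \<le> 1 / real (Suc N)" by (simp add: abs_minus_commute)
    qed
  qed (rule inverse_Suc_tendsto)
  show ?thesis
    by (rule borel_measurable_LIMSEQ_real[where u = "\<lambda>N x. \<Sum>k<n. g N (lam x k) * Re (cip n (kap n Z (e x k)) (e x k))"])
       (intro tendsto_sum tendsto_mult lim tendsto_const, intro poly g)
qed

lemma powr_le_exp:
  assumes "0 \<le> q"
  obtains K where "0 \<le> K" "\<And>s. 0 \<le> s \<Longrightarrow> s powr q \<le> K * exp (s::real)"
proof -
  define N where "N = nat \<lceil>q\<rceil> + 1"
  have N: "q \<le> real N" "0 < N" unfolding N_def by linarith+
  have "s powr q \<le> (1 + real N ^ N) * exp s" if s: "0 \<le> s" for s :: real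
  proof (cases "s \<le> 1")
    case True
    have "s powr q \<le> 1" using s True assms by (intro powr_le1) auto
    moreover have "1 * 1 \<le> (1 + real N ^ N) * exp s" using s by (intro mult_mono) auto
    ultimately show ?thesis by linarith
  next
    case False
    have "s powr q \<le> s powr real N" using False N by (intro powr_mono) auto
    also have "\<dots> = s ^ N" using False by (simp add: powr_realpow)
    also have "\<dots> = real N ^ N * (s / real N) ^ N" using N by (simp add: power_divide)
    also have "\<dots> \<le> real N ^ N * (1 + s / real N) ^ N"
      using s by (intro mult_left_mono power_mono) auto
    also have "\<dots> \<le> real N ^ N * exp s"
      using s N by (intro mult_left_mono exp_ge_one_plus_x_over_n_power_n) auto
    also have "\<dots> \<le> (1 + real N ^ N) * exp s" by simp
    finally show ?thesis .
  qed
  then show ?thesis by (intro that[of "1 + real N ^ N"]) auto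
qed

lemma herm_matcomb:
  assumes "\<And>i. i < m \<Longrightarrow> herm n (ent (X i))"
  shows "herm n (ent (matcomb n m X x))"
  unfolding herm_def
proof (intro allI impI)
  fix i j assume ij: "i < n" "j < n"
  have "X l $$ (i, j) = cnj (X l $$ (j, i))" if "l < m" for l
    using assms[OF that] ij unfolding herm_def by blast
  then have "(\<Sum>l<m. complex_of_real (x l) * X l $$ (i, j)) = (\<Sum>l<m. complex_of_real (x l) * cnj (X l $$ (j, i)))"
    by (intro sum.cong) auto
  then show "matcomb n m X x $$ (i, j) = cnj (matcomb n m X x $$ (j, i))"
    using ij by (simp add: matcomb_def)
qed

lemma kap_matcomb_upd:
  assumes "i < m" "j < n"
  shows "kap n (ent (matcomb n m X (x(i := y + t)))) v j
    = kap n (ent (matcomb n m X (x(i := y)))) v j + complex_of_real t * kap n (ent (X i)) v j"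
proof -
  have "complex_of_real ((x(i := y + t)) l) * kap n (ent (X l)) v j
    = complex_of_real ((x(i := y)) l) * kap n (ent (X l)) v j + (if l = i then complex_of_real t * kap n (ent (X i)) v j else 0)" for l
    by (simp add: algebra_simps)
  then show ?thesis
    unfolding kap_matcomb[OF assms(2)] using assms(1) by (simp only: sum.distrib) simp
qed

text \<open>A noncommutative Khintchine inequality: the Gaussian integration by parts formula bounds
  the expectation of \<open>W = tr |Y|^r\<close> by that of \<open>n w\<^sup>2 W^(1 - 2/r)\<close>.\<close>

lemma gaussian_matrix_hermitian:
  assumes G: "gfam M b m" and m: "0 < m" and r: "2 < r" and w: "0 < w" and n: "1 \<le> n"
    and X: "\<And>i. i < m \<Longrightarrow> X i \<in> carrier_mat n n" and H: "\<And>i. i < m \<Longrightarrow> herm n (ent (X i))"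
    and weak: "\<And>d e f. ons n n e \<Longrightarrow> ons n n f \<Longrightarrow>
      (\<Sum>i<m. (cmod (\<Sum>k<n. complex_of_real (d k) * cip n (kap n (ent (X i)) (e k)) (f k)))\<^sup>2)
        \<le> w\<^sup>2 * (\<Sum>k<n. \<bar>d k\<bar> powr (2 * r / (r - 2))) powr ((r - 2) / r)"
  shows "\<exists>h. h \<in> borel_measurable M \<and> (\<forall>\<omega>. 0 \<le> h \<omega> \<and> (schatten_norm (ennreal r) (matcomb n m X (\<lambda>i. b i \<omega>)))\<^sup>2 \<le> h \<omega>)
     \<and> (\<integral>\<^sup>+\<omega>. ennreal (h \<omega>) \<partial>M) \<le> ennreal (2 * (r - 1) * real n * w\<^sup>2)"
proof -
  define Y where "Y x = matcomb n m X x" for x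
  have YH: "herm n (ent (Y x))" for x unfolding Y_def by (rule herm_matcomb[OF H])
  have "\<exists>el. ons n n (fst el) \<and> (\<forall>k<n. \<forall>i<n. kap n (ent (Y x)) (fst el k) i = complex_of_real (snd el k) * fst el k i)" for x
  proof -
    obtain e lam where "ons n n e" "\<And>k i. k < n \<Longrightarrow> i < n \<Longrightarrow> kap n (ent (Y x)) (e k) i = complex_of_real (lam k) * e k i"
      using spectral_theorem[OF YH] by blast
    then show ?thesis by (intro exI[of _ "(e, lam)"]) auto
  qed
  then obtain el where el: "\<And>x. ons n n (fst (el x))"
    "\<And>x k i. k < n \<Longrightarrow> i < n \<Longrightarrow> kap n (ent (Y x)) (fst (el x) k) i = complex_of_real (snd (el x) k) * fst (el x) k i"
    by metis
  define e where "e x = fst (el x)" for x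
  define lam where "lam x = snd (el x)" for x
  have e: "ons n n (e x)" and ev: "k < n \<Longrightarrow> i < n \<Longrightarrow> kap n (ent (Y x)) (e x k) i = complex_of_real (lam x k) * e x k i" for x k i
    using el by (simp_all add: e_def lam_def)
  have e1: "nsq n (e x k) = 1" if "k < n" for x k
  proof -
    have "cip n (e x k) (e x k) = 1" using e[of x] that by (simp add: ons_def)
    then show ?thesis by (simp add: cip_self)
  qed
  define q where "q = r - 2"
  have q: "0 < q" using r by (simp add: q_def)
  define W where "W x = (\<Sum>k<n. \<bar>lam x k\<bar> powr r)" for x
  define \<phi> where "\<phi> i x = (\<Sum>k<n. (lam x k * \<bar>lam x k\<bar> powr q) * Re (cip n (kap n (ent (X i)) (e x k)) (e x k)))" for i x
  define \<psi> where "\<psi> i x = (\<Sum>k<n. \<bar>lam x k\<bar> powr q * nsq n (kap n (ent (X i)) (e x k)))" for i x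
  let ?P = "gaussm {..<m}"
  have hr: "s * (s * \<bar>s\<bar> powr q) = \<bar>s\<bar> powr r" for s :: real
  proof -
    have "\<bar>s\<bar> powr r = \<bar>s\<bar> powr 2 * \<bar>s\<bar> powr q" using powr_add[of "\<bar>s\<bar>" 2 q] by (simp only: q_def) simp
    moreover have "\<bar>s\<bar> powr 2 = s * s" by (cases "s = 0") (simp_all add: powr_numeral power2_eq_square)
    ultimately show ?thesis by simp
  qed
  have lam_eq: "complex_of_real (lam x k) = cip n (kap n (ent (Y x)) (e x k)) (e x k)" if "k < n" for x k
  proof -
    have "cip n (kap n (ent (Y x)) (e x k)) (e x k) = cip n (\<lambda>i. complex_of_real (lam x k) * e x k i) (e x k)"
      by (intro cip_cong ev that refl)
    then show ?thesis using e1[OF that] by (simp add: cip_scale_left cip_self)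
  qed
  have lam_sum: "lam x k = (\<Sum>i<m. x i * Re (cip n (kap n (ent (X i)) (e x k)) (e x k)))" if "k < n" for x k
  proof -
    have "lam x k = Re (cip n (kap n (ent (Y x)) (e x k)) (e x k))" by (metis lam_eq[OF that] Re_complex_of_real)
    then show ?thesis by (simp add: Y_def cip_matcomb)
  qed
  \<comment> \<open>The trace of |Y|^r is written as the trace of Y times Y |Y|^q, and only the
    first factor is expanded in the coordinates of \<open>x\<close>. This is the form that
    integration by parts accepts.\<close>
  have W_sum: "W x = (\<Sum>i<m. x i * \<phi> i x)" for x
  proof -
    have "W x = (\<Sum>k<n. lam x k * (lam x k * \<bar>lam x k\<bar> powr q))" by (simp add: W_def hr)
    also have "\<dots> = (\<Sum>k<n. (\<Sum>i<m. x i * Re (cip n (kap n (ent (X i)) (e x k)) (e x k))) * (lam x k * \<bar>lam x k\<bar> powr q))"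
      by (intro sum.cong refl arg_cong2[where f = "(*)"]) (simp add: lam_sum[symmetric])
    also have "\<dots> = (\<Sum>i<m. x i * \<phi> i x)"
      unfolding \<phi>_def sum_distrib_left sum_distrib_right by (subst sum.swap) (simp add: mult_ac)
    finally show ?thesis .
  qed
  \<comment> \<open>The bounds through \<open>D\<close>, \<open>S\<close> and \<open>growth\<close>
    are crude; they secure the exponential growth conditions and leave no trace in the final
    constant.\<close>
  define D where "D = (\<Sum>i<m. schatten_norm \<top> (X i))"
  have D0: "0 \<le> D" unfolding D_def using X by (intro sum_nonneg schatten_norm_nonneg) auto
  have XD: "cmod (cip n (kap n (ent (X i)) x) y) \<le> D" if "i < m" "nsq n x \<le> 1" "nsq n y \<le> 1" for i x y
  proof -
    have "cmod (cip n (kap n (ent (X i)) x) y) \<le> schatten_norm \<top> (X i)"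
      by (rule bilinear_le_schatten[OF X[OF that(1)] _ that(2,3)]) simp
    also have "\<dots> \<le> D" unfolding D_def using that(1) X by (intro member_le_sum schatten_norm_nonneg) auto
    finally show ?thesis .
  qed
  define S where "S x = (\<Sum>j<m. \<bar>x j\<bar>)" for x :: "nat \<Rightarrow> real"
  have S0: "0 \<le> S x" for x by (simp add: S_def sum_nonneg)
  have lamD: "\<bar>lam x k\<bar> \<le> D * S x" if "k < n" for x k
  proof -
    have "\<bar>lam x k\<bar> \<le> (\<Sum>i<m. \<bar>x i\<bar> * \<bar>Re (cip n (kap n (ent (X i)) (e x k)) (e x k))\<bar>)"
      unfolding lam_sum[OF that] by (rule order_trans[OF sum_abs]) (simp add: abs_mult)
    also have "\<dots> \<le> (\<Sum>i<m. \<bar>x i\<bar> * D)"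
      using XD e1[OF that] by (intro sum_mono mult_left_mono order_trans[OF abs_Re_le_cmod]) auto
    finally show ?thesis by (simp add: S_def sum_distrib_left mult.commute)
  qed
  have growth: "\<exists>K\<ge>0. \<forall>x z. (\<forall>k<n. \<bar>z k\<bar> \<le> Z) \<longrightarrow> (\<Sum>k<n. \<bar>lam x k\<bar> powr a * \<bar>z k\<bar>) \<le> K * exp (S x)"
    if a: "0 \<le> a" and Z: "0 \<le> Z" for a Z
  proof -
    obtain K where K: "0 \<le> K" "\<And>s. 0 \<le> s \<Longrightarrow> s powr a \<le> K * exp s" using powr_le_exp[OF a] by blast
    show ?thesis
    proof (intro exI[of _ "real n * (D powr a * K * Z)"] conjI allI impI)
      show "0 \<le> real n * (D powr a * K * Z)" using K Z by simp
      fix x z assume z: "\<forall>k<n. \<bar>z k\<bar> \<le> Z"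
      have "(\<Sum>k<n. \<bar>lam x k\<bar> powr a * \<bar>z k\<bar>) \<le> (\<Sum>k<n. (D * S x) powr a * Z)"
        using z lamD a by (intro sum_mono mult_mono powr_mono2) auto
      also have "\<dots> = real n * (D powr a * Z * S x powr a)"
        by (simp add: powr_mult)
      also have "\<dots> \<le> real n * (D powr a * Z * (K * exp (S x)))"
        using K(2)[OF S0] Z by (intro mult_left_mono) auto
      finally show "(\<Sum>k<n. \<bar>lam x k\<bar> powr a * \<bar>z k\<bar>) \<le> real n * (D powr a * K * Z) * exp (S x)"
        by (simp add: mult_ac)
    qed
  qed
  obtain K1 where K1: "0 \<le> K1" "\<And>x z. (\<forall>k<n. \<bar>z k\<bar> \<le> D) \<Longrightarrow> (\<Sum>k<n. \<bar>lam x k\<bar> powr (q + 1) * \<bar>z k\<bar>) \<le> K1 * exp (S x)"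
    using growth[of "q + 1" D] q D0 by auto
  obtain K2 where K2: "0 \<le> K2" "\<And>x z. (\<forall>k<n. \<bar>z k\<bar> \<le> real n * D\<^sup>2) \<Longrightarrow> (\<Sum>k<n. \<bar>lam x k\<bar> powr q * \<bar>z k\<bar>) \<le> K2 * exp (S x)"
    using growth[of q "real n * D\<^sup>2"] q D0 by auto
  have \<phi>K: "\<bar>\<phi> i x\<bar> \<le> (K1 + K2) * exp (\<Sum>j<m. \<bar>x j\<bar>)" if i: "i < m" for i x
  proof -
    have "\<bar>\<phi> i x\<bar> \<le> (\<Sum>k<n. \<bar>lam x k\<bar> powr (q + 1) * \<bar>Re (cip n (kap n (ent (X i)) (e x k)) (e x k))\<bar>)"
      unfolding \<phi>_def by (rule order_trans[OF sum_abs]) (simp add: abs_mult powr_mult_base add.commute)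
    also have "\<dots> \<le> K1 * exp (S x)"
      using XD[OF i] e1 by (intro K1) (auto intro!: order_trans[OF abs_Re_le_cmod])
    also have "\<dots> \<le> (K1 + K2) * exp (S x)" using K2(1) by simp
    finally show ?thesis by (simp add: S_def)
  qed
  have \<psi>0: "0 \<le> \<psi> i x" for i x by (simp add: \<psi>_def sum_nonneg)
  have \<psi>K: "\<bar>\<psi> i x\<bar> \<le> (K1 + K2) * exp (\<Sum>j<m. \<bar>x j\<bar>)" if i: "i < m" for i x
  proof -
    have "nsq n (kap n (ent (X i)) (e x k)) \<le> real n * D\<^sup>2" if k: "k < n" for k
    proof -
      have "nsq n (kap n (ent (X i)) (e x k)) \<le> (\<Sum>l<n. D\<^sup>2)"
        unfolding parseval_nsq[OF e[of x]] using XD[OF i] e1 k by (intro sum_mono power_mono) auto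
      then show ?thesis by simp
    qed
    then have "(\<Sum>k<n. \<bar>lam x k\<bar> powr q * \<bar>nsq n (kap n (ent (X i)) (e x k))\<bar>) \<le> K2 * exp (S x)"
      by (intro K2) auto
    also have "\<dots> \<le> (K1 + K2) * exp (S x)" using K1(1) by simp
    finally show ?thesis using \<psi>0[of i x] by (simp add: S_def \<psi>_def)
  qed
  have Ym: "(\<lambda>x. ent (Y x) i j) \<in> borel_measurable ?P" if "i < n" "j < n" for i j
  proof -
    have "(\<lambda>x. x l) \<in> borel_measurable ?P" if "l < m" for l
      unfolding gaussm_def using that by (intro measurable_compose[OF measurable_component_singleton]) auto
    then have "(\<lambda>x. \<Sum>l<m. complex_of_real (x l) * X l $$ (i, j)) \<in> borel_measurable ?P"
      by (intro borel_measurable_sum borel_measurable_times borel_measurable_const borel_measurable_of_real) auto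
    then show ?thesis using that by (simp add: Y_def matcomb_def)
  qed
  note meas = spectral_sum_measurable[OF Ym e ev]
  have pc: "continuous_on UNIV (\<lambda>s::real. \<bar>s\<bar> powr a)" if "0 < a" for a
    by (rule continuous_on_powr') (use that in \<open>auto intro!: continuous_intros\<close>)
  have \<phi>M: "\<phi> i \<in> borel_measurable ?P" for i
    unfolding \<phi>_def[abs_def] by (rule meas) (auto intro!: continuous_intros pc q)
  have \<psi>M: "\<psi> i \<in> borel_measurable ?P" if i: "i < m" for i
  proof -
    \<comment> \<open>For Hermitian \<open>X i\<close> this is the quadratic form of its square,
      which puts \<psi> among the spectral sums.\<close>
    have "nsq n (kap n (ent (X i)) v) = Re (cip n (kap n (\<lambda>a c. \<Sum>l<n. ent (X i) a l * ent (X i) l c) v) v)" for v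
    proof -
      have "cip n (kap n (\<lambda>a c. \<Sum>l<n. ent (X i) a l * ent (X i) l c) v) v = cip n (kap n (ent (X i)) (kap n (ent (X i)) v)) v"
        by (intro cip_cong kap_mult refl)
      also have "\<dots> = cip n (kap n (ent (X i)) v) (kap n (ent (X i)) v)"
        by (rule cip_kap_herm[OF H[OF i]])
      finally show ?thesis by (simp add: cip_self)
    qed
    then show ?thesis unfolding \<psi>_def[abs_def] by (simp only:) (rule meas, auto intro!: pc q)
  qed
  have WM: "W \<in> borel_measurable ?P"
  proof -
    \<comment> \<open>The zeroth matrix power is the identity and contributes the factor 1.\<close>
    have "W x = (\<Sum>k<n. \<bar>lam x k\<bar> powr r * Re (cip n (kap n (kpow n (\<lambda>_ _. 0) 0) (e x k)) (e x k)))" for x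
      unfolding W_def
    proof (intro sum.cong refl)
      fix k assume k: "k \<in> {..<n}"
      have "cip n (kap n (kpow n (\<lambda>_ _. 0) 0) (e x k)) (e x k) = cip n (e x k) (e x k)"
        using kap_kpow_eigen[of n "\<lambda>_ _. 0" "e x k" 0 _ 0] by (intro cip_cong) (auto simp: kap_def)
      then show "\<bar>lam x k\<bar> powr r = \<bar>lam x k\<bar> powr r * Re (cip n (kap n (kpow n (\<lambda>_ _. 0) 0) (e x k)) (e x k))"
        using e1[of k x] k by (simp add: cip_self del: kpow.simps)
    qed
    then have "W = (\<lambda>x. \<Sum>k<n. \<bar>lam x k\<bar> powr r * Re (cip n (kap n (kpow n (\<lambda>_ _. 0) 0) (e x k)) (e x k)))" by blast
    then show ?thesis by (simp only:) (rule meas, use r in \<open>auto intro!: pc\<close>)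
  qed
  have inc: "\<phi> i (x(i := y + t)) - \<phi> i (x(i := y)) \<le> (r - 1) * t * (\<psi> i (x(i := y + t)) + \<psi> i (x(i := y)))"
    if "0 < t" "i < m" for i x y t
  proof -
    have qr: "r - 1 = q + 1" by (simp add: q_def)
    show ?thesis
      unfolding \<phi>_def \<psi>_def qr
    proof (rule trace_increment[OF YH YH e e ev ev _ that(1) q])
      show "kap n (ent (Y (x(i := y + t)))) v j = kap n (ent (Y (x(i := y)))) v j + complex_of_real t * kap n (ent (X i)) v j"
        if "j < n" for v j
        unfolding Y_def by (rule kap_matcomb_upd[OF \<open>i < m\<close> that])
    qed
  qed
  note ibp = gaussm_ibp_le[OF \<phi>M \<psi>M \<phi>K \<psi>K _ inc]
  have Wint: "integrable ?P W"
    unfolding W_sum[abs_def] using ibp(1) by (intro Bochner_Integration.integrable_sum) auto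
  have W0: "0 \<le> W x" for x by (simp add: W_def sum_nonneg)
  define A where "A = 2 * (r - 1) * real n * w\<^sup>2"
  have A: "0 < A" using r n w by (simp add: A_def)
  \<comment> \<open>The value at which the estimate closes: the mean of \<open>W\<close> is at most
    \<open>(1 - 2/r)\<close> times itself plus \<open>(2/r) Q\<close>, hence at most
    \<open>Q\<close>. Then \<open>Q^(2/r) = A\<close> is the bound sought for the squared
    norm.\<close>
  define Q where "Q = A powr (r / 2)"
  have Q: "0 < Q" using A by (simp add: Q_def)
  have QA: "Q powr (2 / r) = A" using A r by (simp add: Q_def powr_powr)
  \<comment> \<open>The test coefficients are |lam|^(q/2) with signs: their squares reproduce the
    weights in \<psi>, and raised to the dual exponent 2r/(r-2) they give |lam|^r, that is,
    \<open>W\<close> again. Young's inequality then makes the power of \<open>W\<close>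
    linear.\<close>
  have key: "2 * (r - 1) * (\<Sum>i<m. \<psi> i x) \<le> (1 - 2 / r) * W x + 2 / r * Q" for x
  proof -
    have "(\<Sum>i<m. \<Sum>k<n. (\<bar>lam x k\<bar> powr (q / 2))\<^sup>2 * nsq n (kap n (ent (X i)) (e x k))) \<le> real n * (w\<^sup>2 * W x powr ((r - 2) / r))"
    proof (rule diagonal_shifts[OF e])
      fix \<epsilon> f assume f: "ons n n f" and eps: "\<And>k::nat. \<bar>\<epsilon> k\<bar> = (1::real)"
      have "\<bar>\<epsilon> k * \<bar>lam x k\<bar> powr (q / 2)\<bar> powr (2 * r / (r - 2)) = \<bar>lam x k\<bar> powr r" for k
        using eps[of k] r by (simp add: abs_mult powr_powr q_def)
      then show "(\<Sum>i<m. (cmod (\<Sum>k<n. complex_of_real (\<epsilon> k * \<bar>lam x k\<bar> powr (q / 2)) * cip n (kap n (ent (X i)) (e x k)) (f k)))\<^sup>2)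
        \<le> w\<^sup>2 * W x powr ((r - 2) / r)"
        using weak[where d = "\<lambda>k. \<epsilon> k * \<bar>lam x k\<bar> powr (q / 2)" and e = "e x", OF e f] by (simp add: W_def)
    qed
    moreover have "(\<bar>lam x k\<bar> powr (q / 2))\<^sup>2 = \<bar>lam x k\<bar> powr q" for k
      by (simp add: power2_eq_square flip: powr_add)
    ultimately have "(\<Sum>i<m. \<psi> i x) \<le> real n * (w\<^sup>2 * W x powr ((r - 2) / r))" by (simp add: \<psi>_def)
    then have "2 * (r - 1) * (\<Sum>i<m. \<psi> i x) \<le> 2 * (r - 1) * (real n * (w\<^sup>2 * W x powr ((r - 2) / r)))"
      using r by (intro mult_left_mono) auto
    also have "\<dots> = W x powr (1 - 2 / r) * Q powr (2 / r)"
      using r by (simp add: QA A_def diff_divide_distrib)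
    also have "\<dots> \<le> (1 - 2 / r) * W x + 2 / r * Q"
    proof (cases "W x = 0")
      case True
      then show ?thesis using r Q by simp
    next
      case False
      then show ?thesis using W0[of x] Q r by (intro Youngs_inequality_0) auto
    qed
    finally show ?thesis .
  qed
  interpret P: prob_space ?P
    unfolding gaussm_def by (intro prob_space_PiM prob_space_stdn)
  have "(\<integral>x. W x \<partial>?P) = (\<Sum>i<m. \<integral>x. x i * \<phi> i x \<partial>?P)"
    unfolding W_sum using ibp(1) by (intro Bochner_Integration.integral_sum) auto
  also have "\<dots> \<le> (\<Sum>i<m. 2 * (r - 1) * (\<integral>x. \<psi> i x \<partial>?P))"
    using ibp(3) by (intro sum_mono) auto
  also have "\<dots> = (\<integral>x. 2 * (r - 1) * (\<Sum>i<m. \<psi> i x) \<partial>?P)"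
    using ibp(2) by (simp add: sum_distrib_left)
  also have "\<dots> \<le> (\<integral>x. (1 - 2 / r) * W x + 2 / r * Q \<partial>?P)"
    using ibp(2) Wint by (intro integral_mono key integrable_mult_right Bochner_Integration.integrable_sum Bochner_Integration.integrable_add) auto
  also have "\<dots> = (1 - 2 / r) * (\<integral>x. W x \<partial>?P) + 2 / r * Q"
    using Wint by (simp add: P.prob_space)
  finally have "2 / r * (\<integral>x. W x \<partial>?P) \<le> 2 / r * Q" by (simp add: algebra_simps)
  then have EW: "(\<integral>x. W x \<partial>?P) \<le> Q"
    by (rule mult_left_le_imp_le) (use r in simp)
  \<comment> \<open>The tangent at \<open>Q\<close> of the concave function \<open>W^(2/r)\<close>:
    a measurable majorant whose integral needs only the mean of \<open>W\<close>.\<close>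
  define h where "h x = A * (2 / r * (W x / Q) + (1 - 2 / r))" for x
  have h0: "0 \<le> h x" for x unfolding h_def using A W0[of x] Q r by (intro mult_nonneg_nonneg add_nonneg_nonneg) auto
  have hM: "h \<in> borel_measurable ?P" unfolding h_def[abs_def] using WM by measurable
  have hint: "integrable ?P h" unfolding h_def[abs_def] using Wint by simp
  have hbound: "(schatten_norm (ennreal r) (Y x))\<^sup>2 \<le> h x" for x
  proof -
    have "schatten_norm (ennreal r) (Y x) = lpf n (ennreal r) (\<lambda>k. \<bar>lam x k\<bar>)"
      by (rule svd_herm[OF _ e YH ev]) (auto simp: Y_def)
    also have "\<dots> = W x powr (1 / r)" using r by (simp add: lpf_fin W_def)
    finally have "(schatten_norm (ennreal r) (Y x))\<^sup>2 = W x powr (2 / r)"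
      by (simp add: power2_eq_square flip: powr_add)
    also have "\<dots> \<le> h x"
    proof (cases "W x = 0")
      case True
      then show ?thesis using h0[of x] by simp
    next
      case False
      then have "(W x / Q) powr (2 / r) * 1 powr (1 - 2 / r) \<le> 2 / r * (W x / Q) + (1 - 2 / r) * 1"
        using W0[of x] Q r by (intro Youngs_inequality_0) auto
      then have "A * (W x / Q) powr (2 / r) \<le> h x" unfolding h_def using A by (intro mult_left_mono) auto
      moreover have "A * (W x / Q) powr (2 / r) = W x powr (2 / r)" using A by (simp add: powr_divide QA)
      ultimately show ?thesis by simp
    qed
    finally show ?thesis .
  qed
  have Eh: "(\<integral>\<^sup>+x. ennreal (h x) \<partial>?P) \<le> ennreal A"
  proof -
    have "(\<integral>\<^sup>+x. ennreal (h x) \<partial>?P) = ennreal (\<integral>x. h x \<partial>?P)"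
      using hint h0 by (intro nn_integral_eq_integral) auto
    also have "(\<integral>x. h x \<partial>?P) = A * (2 / r * ((\<integral>x. W x \<partial>?P) / Q) + (1 - 2 / r))"
      unfolding h_def using Wint by (simp add: P.prob_space)
    also have "\<dots> \<le> A * (2 / r * 1 + (1 - 2 / r))"
      using EW Q A r by (intro mult_left_mono add_right_mono) auto
    finally show ?thesis by (simp add: ennreal_leI)
  qed
  have restr: "(\<lambda>\<omega>. \<lambda>i\<in>{..<m}. b i \<omega>) \<in> M \<rightarrow>\<^sub>M ?P"
    unfolding gaussm_def using gfam_measurable[OF G] by (intro measurable_restrict) auto
  have same: "matcomb n m X (\<lambda>i. b i \<omega>) = Y (\<lambda>i\<in>{..<m}. b i \<omega>)" for \<omega>
    unfolding Y_def matcomb_def by (intro cong_mat refl) (auto intro!: sum.cong)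
  show ?thesis
  proof (intro exI[of _ "\<lambda>\<omega>. h (\<lambda>i\<in>{..<m}. b i \<omega>)"] conjI allI)
    show "(\<lambda>\<omega>. h (\<lambda>i\<in>{..<m}. b i \<omega>)) \<in> borel_measurable M"
      by (rule measurable_compose[OF restr hM])
    show "0 \<le> h (\<lambda>i\<in>{..<m}. b i \<omega>)" for \<omega> by (rule h0)
    show "(schatten_norm (ennreal r) (matcomb n m X (\<lambda>i. b i \<omega>)))\<^sup>2 \<le> h (\<lambda>i\<in>{..<m}. b i \<omega>)" for \<omega>
      unfolding same by (rule hbound)
    have "(\<integral>\<^sup>+\<omega>. ennreal (h (\<lambda>i\<in>{..<m}. b i \<omega>)) \<partial>M) = (\<integral>\<^sup>+x. ennreal (h x) \<partial>?P)"
      unfolding gaussm_def using hM by (intro gfam_distr_PiM[OF G _ m]) (simp add: gaussm_def)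
    also note Eh
    finally show "(\<integral>\<^sup>+\<omega>. ennreal (h (\<lambda>i\<in>{..<m}. b i \<omega>)) \<partial>M) \<le> ennreal (2 * (r - 1) * real n * w\<^sup>2)"
      by (simp add: A_def)
  qed
qed

section \<open>The triangle inequality and weak norms in the Schatten classes\<close>

lemma ons_bessel: "ons n n f \<Longrightarrow> (\<Sum>k<n. (cmod (cip n v (f k)))\<^sup>2) \<le> nsq n v"
  by (simp add: parseval_nsq)

text \<open>Duality: \<open>C\<close> is paired with the functional built from its own singular
  vectors and the coefficients \<open>s^(r-1)\<close>, which attains \<open>W\<close>; Hoelder's
  inequality bounds the same pairing with \<open>A\<close> and with \<open>B\<close>. The factor
  \<i> fits the splitting of a matrix into two Hermitian ones.\<close>

lemma schatten_triangle:
  assumes A: "A \<in> carrier_mat n n" and B: "B \<in> carrier_mat n n" and C: "C \<in> carrier_mat n n"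
    and ABC: "\<And>x y. cip n (kap n (ent C) x) y = cip n (kap n (ent A) x) y + \<i> * cip n (kap n (ent B) x) y"
    and r: "1 < r"
  shows "schatten_norm (ennreal r) C \<le> schatten_norm (ennreal r) A + schatten_norm (ennreal r) B"
proof -
  obtain s q p where sv: "svd n C s q p" using svd_exists[OF C] .
  then have q: "ons n n q" and s0: "\<And>k. k < n \<Longrightarrow> 0 \<le> s k" and sn: "schatten_norm (ennreal r) C = lpf n (ennreal r) s"
    and pp: "\<And>k. k < n \<Longrightarrow> cip n (p k) (p k) = (if s k \<noteq> 0 then 1 else 0)"
    and Cq: "\<And>k i. k < n \<Longrightarrow> i < n \<Longrightarrow> kap n (ent C) (q k) i = complex_of_real (s k) * p k i"
    by (auto simp: svd_def)
  define W where "W = (\<Sum>k<n. s k powr r)"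
  have W0: "0 \<le> W" by (simp add: W_def sum_nonneg)
  have N: "schatten_norm (ennreal r) C = W powr (1 / r)"
    using r s0 by (simp add: sn lpf_fin W_def)
  let ?NA = "schatten_norm (ennreal r) A" and ?NB = "schatten_norm (ennreal r) B"
  have nn: "0 \<le> ?NA" "0 \<le> ?NB" using A B by (auto intro: schatten_norm_nonneg)
  define d where "d k = s k powr (r - 1)" for k
  define b where "b = r / (r - 1)"
  have b: "1 < b" "1 / r + 1 / b = 1" using r by (auto simp: b_def field_simps)
  have db: "(\<Sum>k<n. cmod (complex_of_real (d k)) powr b) = W"
    using r by (simp add: W_def d_def b_def powr_powr)
  have hold: "cmod (\<Sum>k<n. complex_of_real (d k) * cip n (kap n (ent Z) (q k)) (p k)) \<le> W powr (1 / b) * schatten_norm (ennreal r) Z"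
    if "Z \<in> carrier_mat n n" for Z
    using schatten_holder[OF that q svd_bessel[OF sv], of "ennreal r" b "\<lambda>k. complex_of_real (d k)"] r b db by simp
  have "complex_of_real W = (\<Sum>k<n. complex_of_real (d k) * cip n (kap n (ent C) (q k)) (p k))"
    unfolding W_def of_real_sum
  proof (intro sum.cong refl)
    fix k assume "k \<in> {..<n}"
    then have k: "k < n" by simp
    have "cip n (kap n (ent C) (q k)) (p k) = cip n (\<lambda>i. complex_of_real (s k) * p k i) (p k)"
      by (intro cip_cong Cq k refl)
    also have "\<dots> = complex_of_real (s k)" using pp[OF k] by (auto simp: cip_scale_left)
    finally have "complex_of_real (d k) * cip n (kap n (ent C) (q k)) (p k) = complex_of_real (s k * s k powr (r - 1))"
      by (simp add: d_def)
    also have "s k * s k powr (r - 1) = s k powr r" using s0[OF k] by (simp add: powr_mult_base)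
    finally show "complex_of_real (s k powr r) = complex_of_real (d k) * cip n (kap n (ent C) (q k)) (p k)" ..
  qed
  also have "\<dots> = (\<Sum>k<n. complex_of_real (d k) * cip n (kap n (ent A) (q k)) (p k))
      + \<i> * (\<Sum>k<n. complex_of_real (d k) * cip n (kap n (ent B) (q k)) (p k))"
    by (simp add: ABC sum.distrib sum_distrib_left algebra_simps)
  finally have "W = cmod ((\<Sum>k<n. complex_of_real (d k) * cip n (kap n (ent A) (q k)) (p k))
      + \<i> * (\<Sum>k<n. complex_of_real (d k) * cip n (kap n (ent B) (q k)) (p k)))"
    using W0 by (metis abs_of_nonneg norm_of_real)
  also have "\<dots> \<le> W powr (1 / b) * ?NA + W powr (1 / b) * ?NB"
    by (rule order_trans[OF norm_triangle_ineq]) (use hold[OF A] hold[OF B] in \<open>simp add: norm_mult\<close>)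
  finally have le: "W \<le> W powr (1 / b) * (?NA + ?NB)" by (simp add: distrib_left)
  show ?thesis
  proof (cases "W = 0")
    case True
    then show ?thesis using nn by (simp add: N)
  next
    case False
    have "W = W powr (1 / b) * W powr (1 / r)" using False W0 b by (simp add: add.commute flip: powr_add)
    then have "W powr (1 / b) * W powr (1 / r) \<le> W powr (1 / b) * (?NA + ?NB)" using le by simp
    then show ?thesis using False by (simp add: N)
  qed
qed

lemma weak_schatten_lin:
  assumes X: "\<And>i. i < m \<Longrightarrow> X i \<in> carrier_mat n n" and c: "0 \<le> c"
    and bd: "\<And>A. A \<in> carrier_mat n n \<Longrightarrow> cmod (\<Sum>k<l. d k * cip n (kap n (ent A) (e k)) (f k)) \<le> c * schatten_norm u A"
  shows "(\<Sum>i<m. (cmod (\<Sum>k<l. d k * cip n (kap n (ent (X i)) (e k)) (f k)))\<^sup>2) \<le> (c * weak (schatten_space u n) m X)\<^sup>2"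
  by (rule weak_lin_form[OF _ lin_form_matrix _ c])
     (use X bd in \<open>auto simp: schatten_space_simps\<close>)

lemma weak_schatten_bilinear:
  assumes X: "\<And>i. i < m \<Longrightarrow> X i \<in> carrier_mat n n" and u: "1 \<le> u"
    and xy: "nsq n x \<le> 1" "nsq n y \<le> 1"
  shows "(\<Sum>i<m. (cmod (cip n (kap n (ent (X i)) x) y))\<^sup>2) \<le> (weak (schatten_space u n) m X)\<^sup>2"
proof -
  have "(\<Sum>i<m. (cmod (\<Sum>k<Suc 0. 1 * cip n (kap n (ent (X i)) x) y))\<^sup>2) \<le> (1 * weak (schatten_space u n) m X)\<^sup>2"
  proof (rule weak_schatten_lin[where X = X, OF X])
    show "cmod (\<Sum>k<Suc 0. 1 * cip n (kap n (ent A) x) y) \<le> 1 * schatten_norm u A" if "A \<in> carrier_mat n n" for A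
      using bilinear_le_schatten[OF that u xy] by simp
  qed auto
  then show ?thesis by simp
qed

lemma weak_schatten_nonneg:
  "(\<And>i. i < m \<Longrightarrow> X i \<in> carrier_mat n n) \<Longrightarrow> 0 \<le> weak (schatten_space u n) m X"
  by (intro weak_nonneg) (auto simp: schatten_space_simps schatten_norm_nonneg)

definition std_basis :: "nat \<Rightarrow> nat \<Rightarrow> complex" where
  "std_basis k i = (if i = k then 1 else 0)"

lemma cip_std_basis: "a < n \<Longrightarrow> cip n x (std_basis a) = x a"
proof -
  assume "a < n"
  then have "cip n x (std_basis a) = (\<Sum>i<n. if i = a then x i else 0)"
    unfolding cip_def std_basis_def by (intro sum.cong) auto
  then show ?thesis using \<open>a < n\<close> by simp
qed

lemma ons_std_basis: "ons n n std_basis"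
  by (auto simp: ons_def cip_std_basis) (auto simp: std_basis_def)

lemma kap_std_basis: "k < n \<Longrightarrow> kap n K (std_basis k) i = K i k"
proof -
  assume "k < n"
  then have "kap n K (std_basis k) i = (\<Sum>j<n. if j = k then K i j else 0)"
    unfolding kap_def std_basis_def by (intro sum.cong) auto
  then show ?thesis using \<open>k < n\<close> by simp
qed

lemma nsq_std_basis: "k < n \<Longrightarrow> nsq n (std_basis k) = 1"
  using cip_self[of n "std_basis k"] by (simp add: cip_std_basis) (simp add: std_basis_def)

text \<open>Used for \<open>1/t = max 0 (1/u - 1/2)\<close> only; comparing norms gives all other pairs.\<close>

definition gauss_bound :: "'w itself \<Rightarrow> ennreal \<Rightarrow> ennreal \<Rightarrow> real \<Rightarrow> bool" where
  "gauss_bound TYPE('w) u t C \<longleftrightarrow>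
    (\<forall>(M::'w measure) b m n X. 1 \<le> n \<longrightarrow> gfam M b m \<longrightarrow> (\<forall>i<m. X i \<in> carrier_mat n n) \<longrightarrow>
      (\<exists>h. h \<in> borel_measurable M \<and> (\<forall>\<omega>. 0 \<le> h \<omega> \<and> (schatten_norm t (matcomb n m X (\<lambda>i. b i \<omega>)))\<^sup>2 \<le> h \<omega>)
        \<and> (\<integral>\<^sup>+\<omega>. ennreal (h \<omega>) \<partial>M) \<le> ennreal (C * real n * (weak (schatten_space u n) m X)\<^sup>2)))"

lemma gauss_bound_top:
  assumes u: "1 \<le> u"
  shows "gauss_bound TYPE('w) u \<top> 4672"
  unfolding gauss_bound_def
proof (intro allI impI)
  fix M :: "'w measure" and b m n and X :: "nat \<Rightarrow> complex Matrix.mat"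
  assume n: "1 \<le> n" and G: "gfam M b m" and "\<forall>i<m. X i \<in> carrier_mat n n"
  then have X: "\<And>i. i < m \<Longrightarrow> X i \<in> carrier_mat n n" by simp
  obtain h where h: "h \<in> borel_measurable M" "\<And>\<omega>. (schatten_norm \<top> (matcomb n m X (\<lambda>i. b i \<omega>)))\<^sup>2 \<le> h \<omega>"
     "(\<integral>\<^sup>+\<omega>. ennreal (h \<omega>) \<partial>M) \<le> ennreal (4672 * real n * (weak (schatten_space u n) m X)\<^sup>2)"
    using gaussian_matrix_top[where X = X, OF G n weak_schatten_nonneg[where X = X, OF X] weak_schatten_bilinear[where X = X, OF X u]] by blast
  moreover have "0 \<le> h \<omega>" for \<omega> using h(2)[of \<omega>] by (meson order_trans zero_le_power2)
  ultimately show "\<exists>h. h \<in> borel_measurable M \<and> (\<forall>\<omega>. 0 \<le> h \<omega> \<and> (schatten_norm \<top> (matcomb n m X (\<lambda>i. b i \<omega>)))\<^sup>2 \<le> h \<omega>)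
        \<and> (\<integral>\<^sup>+\<omega>. ennreal (h \<omega>) \<partial>M) \<le> ennreal (4672 * real n * (weak (schatten_space u n) m X)\<^sup>2)"
    by blast
qed

lemma schatten_2:
  assumes "A \<in> carrier_mat n n"
  shows "(schatten_norm 2 A)\<^sup>2 = (\<Sum>i<n. \<Sum>j<n. (cmod (A $$ (i, j)))\<^sup>2)"
proof -
  obtain s q p where sv: "svd n A s q p" using svd_exists[OF assms] .
  then have "schatten_norm 2 A = lpf n 2 s" by (simp add: svd_def)
  then show ?thesis using frobenius[OF assms sv] by (simp add: lpf_2)
qed

text \<open>The second moment of the Hilbert-Schmidt norm is exactly the sum of all squared entries
  of the \<open>X i\<close>. Diagonal shifts with unit coefficients bound it by \<open>n\<close>
  times the squared weak norm, since unimodular coefficients have norm 1 as functionals on the trace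
  class.\<close>

lemma gauss_bound_1: "gauss_bound TYPE('w) 1 2 1"
  unfolding gauss_bound_def
proof (intro allI impI)
  fix M :: "'w measure" and b m n and X :: "nat \<Rightarrow> complex Matrix.mat"
  assume n: "1 \<le> n" and G: "gfam M b m" and "\<forall>i<m. X i \<in> carrier_mat n n"
  then have X: "\<And>i. i < m \<Longrightarrow> X i \<in> carrier_mat n n" by simp
  note [measurable] = gfam_measurable[OF G]
  define w where "w = weak (schatten_space 1 n) m X"
  define h where "h \<omega> = (\<Sum>a<n. \<Sum>c<n. (cmod (\<Sum>i<m. complex_of_real (b i \<omega>) * X i $$ (a, c)))\<^sup>2)" for \<omega>
  have hM: "h \<in> borel_measurable M" unfolding h_def by measurable
  have h: "(schatten_norm 2 (matcomb n m X (\<lambda>i. b i \<omega>)))\<^sup>2 = h \<omega>" for \<omega>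
    unfolding schatten_2[OF matcomb_carrier] by (simp add: h_def matcomb_def)
  have "(\<Sum>i<m. \<Sum>k<n. 1\<^sup>2 * nsq n (kap n (ent (X i)) (std_basis k))) \<le> real n * (1 * w)\<^sup>2"
  proof (rule diagonal_shifts[OF ons_std_basis])
    fix \<epsilon> :: "nat \<Rightarrow> real" and f assume f: "ons n n f" and eps: "\<And>k. \<bar>\<epsilon> k\<bar> = 1"
    show "(\<Sum>i<m. (cmod (\<Sum>k<n. complex_of_real (\<epsilon> k * 1) * cip n (kap n (ent (X i)) (std_basis k)) (f k)))\<^sup>2) \<le> (1 * w)\<^sup>2"
      unfolding w_def
      by (rule weak_schatten_lin[OF X], assumption, simp, rule schatten_holder_1[OF _ ons_std_basis ons_bessel[OF f]])
         (auto simp: eps)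
  qed
  then have le: "(\<Sum>a<n. \<Sum>c<n. \<Sum>i<m. (cmod (X i $$ (a, c)))\<^sup>2) \<le> real n * w\<^sup>2"
  proof -
    have "(\<Sum>a<n. \<Sum>c<n. \<Sum>i<m. (cmod (X i $$ (a, c)))\<^sup>2) = (\<Sum>i<m. \<Sum>k<n. \<Sum>a<n. (cmod (X i $$ (a, k)))\<^sup>2)"
      by (subst (2) sum.swap, subst sum.swap) (intro sum.cong refl sum.swap)
    also have "\<dots> = (\<Sum>i<m. \<Sum>k<n. 1\<^sup>2 * nsq n (kap n (ent (X i)) (std_basis k)))"
      by (intro sum.cong refl) (simp add: nsq_def kap_std_basis)
    also have "\<dots> \<le> real n * (1 * w)\<^sup>2" by fact
    finally show ?thesis by simp
  qed
  have "(\<integral>\<^sup>+\<omega>. ennreal (h \<omega>) \<partial>M) = (\<integral>\<^sup>+\<omega>. (\<Sum>a<n. \<Sum>c<n. ennreal ((cmod (\<Sum>i<m. complex_of_real (b i \<omega>) * X i $$ (a, c)))\<^sup>2)) \<partial>M)"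
    unfolding h_def by (intro nn_integral_cong) (simp add: sum_nonneg flip: sum_ennreal)
  also have "\<dots> = (\<Sum>a<n. \<integral>\<^sup>+\<omega>. (\<Sum>c<n. ennreal ((cmod (\<Sum>i<m. complex_of_real (b i \<omega>) * X i $$ (a, c)))\<^sup>2)) \<partial>M)"
    by (rule nn_integral_sum) measurable
  also have "\<dots> = (\<Sum>a<n. \<Sum>c<n. \<integral>\<^sup>+\<omega>. ennreal ((cmod (\<Sum>i<m. complex_of_real (b i \<omega>) * X i $$ (a, c)))\<^sup>2) \<partial>M)"
    by (intro sum.cong refl nn_integral_sum) measurable
  also have "\<dots> = (\<Sum>a<n. \<Sum>c<n. ennreal (\<Sum>i<m. (cmod (X i $$ (a, c)))\<^sup>2))"
    unfolding gaussian_ccomb_square[OF G] ..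
  also have "\<dots> = ennreal (\<Sum>a<n. \<Sum>c<n. \<Sum>i<m. (cmod (X i $$ (a, c)))\<^sup>2)"
    by (simp add: sum_nonneg)
  also have "\<dots> \<le> ennreal (1 * real n * w\<^sup>2)" using le by (simp add: ennreal_leI)
  finally have "(\<integral>\<^sup>+\<omega>. ennreal (h \<omega>) \<partial>M) \<le> ennreal (1 * real n * w\<^sup>2)" .
  moreover have "0 \<le> h \<omega>" for \<omega> by (simp add: h_def sum_nonneg)
  ultimately show "\<exists>h. h \<in> borel_measurable M \<and> (\<forall>\<omega>. 0 \<le> h \<omega> \<and> (schatten_norm 2 (matcomb n m X (\<lambda>i. b i \<omega>)))\<^sup>2 \<le> h \<omega>)
        \<and> (\<integral>\<^sup>+\<omega>. ennreal (h \<omega>) \<partial>M) \<le> ennreal (1 * real n * (weak (schatten_space 1 n) m X)\<^sup>2)"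
    using hM h unfolding w_def by (intro exI[of _ h]) auto
qed

lemma schatten_compare:
  assumes "A \<in> carrier_mat n n" "1 \<le> p" "1 \<le> q" "1 \<le> n"
  shows "schatten_norm q A \<le> real n powr max 0 (recip q - recip p) * schatten_norm p A"
proof -
  obtain s q' p' where "svd n A s q' p'" using svd_exists[OF assms(1)] .
  then have "\<And>t. schatten_norm t A = lpf n t s" by (simp add: svd_def)
  then show ?thesis using lpf_compare[OF assms(2,3,4)] by simp
qed

text \<open>The Hermitian estimate is applied to the two parts of \<open>X = Xp + \<i> Xm\<close>.
  Their weak bounds are no worse than that of \<open>X\<close>, and squaring the triangle inequality
  costs a factor 2 for each of the two terms: 4 * 2 (r - 1) = 8 (r - 1).\<close>

lemma gauss_bound_between:
  assumes a: "1 < a" "a < 2" and r: "1 / r = 1 / a - 1 / 2"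
  shows "gauss_bound TYPE('w) (ennreal a) (ennreal r) (8 * (r - 1))"
  unfolding gauss_bound_def
proof (intro allI impI)
  fix M :: "'w measure" and b m n and X :: "nat \<Rightarrow> complex Matrix.mat"
  assume n: "1 \<le> n" and G: "gfam M b m" and "\<forall>i<m. X i \<in> carrier_mat n n"
  then have X: "\<And>i. i < m \<Longrightarrow> X i \<in> carrier_mat n n" by simp
  have "0 < 1 / r" unfolding r using a by (simp add: field_simps)
  then have r0: "0 < r" by simp
  have r2: "2 < r"
  proof -
    have "1 / r < 1 / 2" unfolding r using a by (simp add: field_simps)
    then show ?thesis using r0 by (simp add: field_simps)
  qed
  define w where "w = weak (schatten_space (ennreal a) n) m X"
  have w0: "0 \<le> w" unfolding w_def by (rule weak_schatten_nonneg[OF X])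
  let ?goal = "\<exists>h. h \<in> borel_measurable M \<and> (\<forall>\<omega>. 0 \<le> h \<omega> \<and> (schatten_norm (ennreal r) (matcomb n m X (\<lambda>i. b i \<omega>)))\<^sup>2 \<le> h \<omega>)
        \<and> (\<integral>\<^sup>+\<omega>. ennreal (h \<omega>) \<partial>M) \<le> ennreal (8 * (r - 1) * real n * w\<^sup>2)"
  have ?goal
  proof (cases "w = 0")
    case True
    \<comment> \<open>The Hermitian estimate needs a positive weak norm. For \<open>w = 0\<close>
      the bound on the operator norm has integral 0, and equivalence of norms with the constant
      \<open>c\<close> keeps it 0.\<close>
    obtain h where h: "h \<in> borel_measurable M" "\<And>\<omega>. 0 \<le> h \<omega>"
      "\<And>\<omega>. (schatten_norm \<top> (matcomb n m X (\<lambda>i. b i \<omega>)))\<^sup>2 \<le> h \<omega>"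
      "(\<integral>\<^sup>+\<omega>. ennreal (h \<omega>) \<partial>M) \<le> ennreal (4672 * real n * w\<^sup>2)"
      using gauss_bound_top[of "ennreal a", where 'w = 'w, unfolded gauss_bound_def, rule_format, where X = X, OF _ n G X] a
      unfolding w_def by auto
    define c where "c = real n powr max 0 (recip (ennreal r) - recip \<top>)"
    have c: "0 \<le> c" by (simp add: c_def)
    have "(schatten_norm (ennreal r) (matcomb n m X (\<lambda>i. b i \<omega>)))\<^sup>2 \<le> c\<^sup>2 * h \<omega>" for \<omega>
    proof -
      have "schatten_norm (ennreal r) (matcomb n m X (\<lambda>i. b i \<omega>)) \<le> c * schatten_norm \<top> (matcomb n m X (\<lambda>i. b i \<omega>))"
        unfolding c_def using r2 by (intro schatten_compare[OF matcomb_carrier _ _ n]) auto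
      then have "(schatten_norm (ennreal r) (matcomb n m X (\<lambda>i. b i \<omega>)))\<^sup>2 \<le> (c * schatten_norm \<top> (matcomb n m X (\<lambda>i. b i \<omega>)))\<^sup>2"
        by (intro power_mono schatten_norm_nonneg[OF matcomb_carrier])
      also have "\<dots> \<le> c\<^sup>2 * h \<omega>" unfolding power_mult_distrib by (intro mult_left_mono h) auto
      finally show ?thesis .
    qed
    moreover have "(\<integral>\<^sup>+\<omega>. ennreal (c\<^sup>2 * h \<omega>) \<partial>M) \<le> ennreal (8 * (r - 1) * real n * w\<^sup>2)"
      using h True by (simp add: ennreal_mult nn_integral_cmult)
    ultimately show ?thesis using h(1,2) by (intro exI[of _ "\<lambda>\<omega>. c\<^sup>2 * h \<omega>"]) auto
  next
    case False
    then have w: "0 < w" using w0 by simp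
    have m: "0 < m"
    proof (rule ccontr)
      assume "\<not> 0 < m"
      then have "w \<le> 0" unfolding w_def
        by (intro weak_le) (auto simp: schatten_space_simps schatten_norm_nonneg)
      then show False using w by simp
    qed
    define Xp where "Xp i = Matrix.mat n n (\<lambda>(j, k). (X i $$ (j, k) + cnj (X i $$ (k, j))) / 2)" for i
    define Xm where "Xm i = Matrix.mat n n (\<lambda>(j, k). (X i $$ (j, k) - cnj (X i $$ (k, j))) / (2 * \<i>))" for i
    have cXp: "Xp i \<in> carrier_mat n n" and cXm: "Xm i \<in> carrier_mat n n" for i by (simp_all add: Xp_def Xm_def)
    have Hp: "herm n (ent (Xp i))" for i
      by (auto simp: herm_def Xp_def add.commute)
    have Hm: "herm n (ent (Xm i))" for i
      by (auto simp: herm_def Xm_def field_simps)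
    have adj: "cip n (kap n (\<lambda>j k. cnj (X i $$ (k, j))) x) y = cnj (cip n (kap n (ent (X i)) y) x)" for i x y
      using cip_kap_adjoint[of n "\<lambda>j k. cnj (X i $$ (k, j))" x y] by (simp add: cip_cnj)
    have cp: "cip n (kap n (ent (Xp i)) x) y = (cip n (kap n (ent (X i)) x) y + cnj (cip n (kap n (ent (X i)) y) x)) / 2" for i x y
    proof -
      have "cip n (kap n (ent (Xp i)) x) y = cip n (\<lambda>j. 1 / 2 * (kap n (ent (X i)) x j + kap n (\<lambda>j k. cnj (X i $$ (k, j))) x j)) y"
        by (intro cip_cong) (auto simp: kap_def Xp_def sum.distrib sum_divide_distrib add_divide_distrib algebra_simps)
      then show ?thesis by (simp only: cip_scale_left cip_add_left adj) simp
    qed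
    have cm: "cip n (kap n (ent (Xm i)) x) y = (cip n (kap n (ent (X i)) x) y - cnj (cip n (kap n (ent (X i)) y) x)) / (2 * \<i>)" for i x y
    proof -
      have "cip n (kap n (ent (Xm i)) x) y = cip n (\<lambda>j. 1 / (2 * \<i>) * (kap n (ent (X i)) x j - kap n (\<lambda>j k. cnj (X i $$ (k, j))) x j)) y"
        by (intro cip_cong) (auto simp: kap_def Xm_def sum_subtractf sum_divide_distrib diff_divide_distrib algebra_simps)
      then show ?thesis by (simp only: cip_scale_left cip_diff_left adj) simp
    qed
    \<comment> \<open>The dual exponent of \<open>a\<close>; it coincides with 2r/(r-2) precisely
      because 1/r = 1/a - 1/2.\<close>
    define \<beta> where "\<beta> = a / (a - 1)"
    have \<beta>: "1 < \<beta>" "1 / a + 1 / \<beta> = 1" using a by (auto simp: \<beta>_def field_simps)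
    have rr: "(r - 2) / r = 2 / \<beta>"
    proof -
      have "(r - 2) / r = 1 - 2 * (1 / r)" using r0 by (simp add: field_simps)
      also have "\<dots> = 2 / \<beta>" unfolding r using a by (simp add: \<beta>_def field_simps)
      finally show ?thesis .
    qed
    have rr': "2 * r / (r - 2) = \<beta>"
    proof -
      have "2 * r / (r - 2) = 2 / ((r - 2) / r)" using r0 by simp
      then show ?thesis unfolding rr using \<beta> by simp
    qed
    have base: "(\<Sum>i<m. (cmod (\<Sum>k<n. complex_of_real (d k) * cip n (kap n (ent (X i)) (e k)) (f k)))\<^sup>2)
        \<le> w\<^sup>2 * (\<Sum>k<n. \<bar>d k\<bar> powr \<beta>) powr (2 / \<beta>)" if e: "ons n n e" and f: "ons n n f" for d e f
    proof -
      have "(\<Sum>i<m. (cmod (\<Sum>k<n. complex_of_real (d k) * cip n (kap n (ent (X i)) (e k)) (f k)))\<^sup>2)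
        \<le> ((\<Sum>k<n. cmod (complex_of_real (d k)) powr \<beta>) powr (1 / \<beta>) * w)\<^sup>2"
        unfolding w_def
        by (rule weak_schatten_lin[OF X], assumption, simp, rule schatten_holder[OF _ e ons_bessel[OF f]])
           (use a \<beta> in auto)
      also have "\<dots> = w\<^sup>2 * (\<Sum>k<n. \<bar>d k\<bar> powr \<beta>) powr (2 / \<beta>)"
        by (simp add: power_mult_distrib power2_eq_square flip: powr_add)
      finally show ?thesis .
    qed
    \<comment> \<open>On the systems \<open>e\<close>, \<open>f\<close> a part of \<open>X\<close>
      is the mean, up to a phase, of \<open>X\<close> on \<open>e\<close>, \<open>f\<close> and of
      the conjugate of \<open>X\<close> on \<open>f\<close>, \<open>e\<close>. As the coefficients
      \<open>d\<close> are real, the conjugation can be pulled out of the sum.\<close>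
    have avg: "(cmod (\<Sum>k<n. complex_of_real (d k) * ((x k + \<sigma> * cnj (y k)) / \<tau>)))\<^sup>2
      \<le> ((cmod (\<Sum>k<n. complex_of_real (d k) * x k))\<^sup>2 + (cmod (\<Sum>k<n. complex_of_real (d k) * y k))\<^sup>2) / 2"
      if "cmod \<sigma> = 1" "cmod \<tau> = 2" for d :: "nat \<Rightarrow> real" and x y :: "nat \<Rightarrow> complex" and \<sigma> \<tau> :: complex
    proof -
      define p q where "p = (\<Sum>k<n. complex_of_real (d k) * x k)" and "q = (\<Sum>k<n. complex_of_real (d k) * y k)"
      have "(\<Sum>k<n. complex_of_real (d k) * ((x k + \<sigma> * cnj (y k)) / \<tau>)) = (p + \<sigma> * cnj q) / \<tau>"
        by (simp add: p_def q_def sum.distrib sum_divide_distrib sum_distrib_left algebra_simps add_divide_distrib)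
      then have "cmod (\<Sum>k<n. complex_of_real (d k) * ((x k + \<sigma> * cnj (y k)) / \<tau>)) = cmod (p + \<sigma> * cnj q) / 2"
        by (simp add: norm_divide that)
      also have "\<dots> \<le> (cmod p + cmod q) / 2"
        using norm_triangle_ineq[of p "\<sigma> * cnj q"] that by (simp add: norm_mult)
      finally have "(cmod (\<Sum>k<n. complex_of_real (d k) * ((x k + \<sigma> * cnj (y k)) / \<tau>)))\<^sup>2 \<le> ((cmod p + cmod q) / 2)\<^sup>2"
        by (intro power_mono) auto
      also have "\<dots> \<le> ((cmod p)\<^sup>2 + (cmod q)\<^sup>2) / 2"
        using sum_squares_bound[of "cmod p" "cmod q"] by (simp add: power2_eq_square field_simps)
      finally show ?thesis by (simp add: p_def q_def)
    qed
    have half: "(\<Sum>i<m. (cmod (\<Sum>k<n. complex_of_real (d k) * cip n (kap n (ent (Z i)) (e k)) (f k)))\<^sup>2)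
        \<le> w\<^sup>2 * (\<Sum>k<n. \<bar>d k\<bar> powr \<beta>) powr (2 / \<beta>)"
      if e: "ons n n e" and f: "ons n n f" and st: "cmod \<sigma> = 1" "cmod \<tau> = 2"
        and Z: "\<And>i x y. cip n (kap n (ent (Z i)) x) y = (cip n (kap n (ent (X i)) x) y + \<sigma> * cnj (cip n (kap n (ent (X i)) y) x)) / \<tau>"
      for d e f \<sigma> \<tau> Z
    proof -
      have "(\<Sum>i<m. (cmod (\<Sum>k<n. complex_of_real (d k) * cip n (kap n (ent (Z i)) (e k)) (f k)))\<^sup>2)
        \<le> (\<Sum>i<m. ((cmod (\<Sum>k<n. complex_of_real (d k) * cip n (kap n (ent (X i)) (e k)) (f k)))\<^sup>2
            + (cmod (\<Sum>k<n. complex_of_real (d k) * cip n (kap n (ent (X i)) (f k)) (e k)))\<^sup>2) / 2)"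
        unfolding Z by (intro sum_mono avg st)
      also have "\<dots> \<le> w\<^sup>2 * (\<Sum>k<n. \<bar>d k\<bar> powr \<beta>) powr (2 / \<beta>)"
        using base[OF e f, of d] base[OF f e, of d] by (simp add: sum.distrib flip: sum_divide_distrib)
      finally show ?thesis .
    qed
    obtain hp where hp: "hp \<in> borel_measurable M" "\<And>\<omega>. 0 \<le> hp \<omega>"
      "\<And>\<omega>. (schatten_norm (ennreal r) (matcomb n m Xp (\<lambda>i. b i \<omega>)))\<^sup>2 \<le> hp \<omega>"
      "(\<integral>\<^sup>+\<omega>. ennreal (hp \<omega>) \<partial>M) \<le> ennreal (2 * (r - 1) * real n * w\<^sup>2)"
    proof -
      have "\<exists>h. h \<in> borel_measurable M \<and> (\<forall>\<omega>. 0 \<le> h \<omega> \<and> (schatten_norm (ennreal r) (matcomb n m Xp (\<lambda>i. b i \<omega>)))\<^sup>2 \<le> h \<omega>)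
        \<and> (\<integral>\<^sup>+\<omega>. ennreal (h \<omega>) \<partial>M) \<le> ennreal (2 * (r - 1) * real n * w\<^sup>2)"
        by (rule gaussian_matrix_hermitian[OF G m r2 w n cXp Hp], unfold rr rr', rule half[where \<sigma> = 1 and \<tau> = 2]) (auto simp: cp)
      then show ?thesis using that by blast
    qed
    obtain hm where hm: "hm \<in> borel_measurable M" "\<And>\<omega>. 0 \<le> hm \<omega>"
      "\<And>\<omega>. (schatten_norm (ennreal r) (matcomb n m Xm (\<lambda>i. b i \<omega>)))\<^sup>2 \<le> hm \<omega>"
      "(\<integral>\<^sup>+\<omega>. ennreal (hm \<omega>) \<partial>M) \<le> ennreal (2 * (r - 1) * real n * w\<^sup>2)"
    proof -
      have "\<exists>h. h \<in> borel_measurable M \<and> (\<forall>\<omega>. 0 \<le> h \<omega> \<and> (schatten_norm (ennreal r) (matcomb n m Xm (\<lambda>i. b i \<omega>)))\<^sup>2 \<le> h \<omega>)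
        \<and> (\<integral>\<^sup>+\<omega>. ennreal (h \<omega>) \<partial>M) \<le> ennreal (2 * (r - 1) * real n * w\<^sup>2)"
        by (rule gaussian_matrix_hermitian[OF G m r2 w n cXm Hm], unfold rr rr', rule half[where \<sigma> = "-1" and \<tau> = "2 * \<i>"])
           (auto simp: cm norm_mult)
      then show ?thesis using that by blast
    qed
    have tri: "(schatten_norm (ennreal r) (matcomb n m X (\<lambda>i. b i \<omega>)))\<^sup>2 \<le> 2 * hp \<omega> + 2 * hm \<omega>" for \<omega>
    proof -
      let ?P = "schatten_norm (ennreal r) (matcomb n m Xp (\<lambda>i. b i \<omega>))" and ?Q = "schatten_norm (ennreal r) (matcomb n m Xm (\<lambda>i. b i \<omega>))"
      have "schatten_norm (ennreal r) (matcomb n m X (\<lambda>i. b i \<omega>)) \<le> ?P + ?Q"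
      proof (rule schatten_triangle[OF matcomb_carrier matcomb_carrier matcomb_carrier])
        show "cip n (kap n (ent (matcomb n m X (\<lambda>i. b i \<omega>))) x) y = cip n (kap n (ent (matcomb n m Xp (\<lambda>i. b i \<omega>))) x) y
          + \<i> * cip n (kap n (ent (matcomb n m Xm (\<lambda>i. b i \<omega>))) x) y" for x y
        proof -
          have "cip n (kap n (ent (X i)) x) y = cip n (kap n (ent (Xp i)) x) y + \<i> * cip n (kap n (ent (Xm i)) x) y" for i
            unfolding cp cm by (simp add: field_simps)
          then show ?thesis unfolding cip_matcomb by (simp add: sum.distrib sum_distrib_left algebra_simps)
        qed
      qed (use r2 in simp)
      then have "(schatten_norm (ennreal r) (matcomb n m X (\<lambda>i. b i \<omega>)))\<^sup>2 \<le> (?P + ?Q)\<^sup>2"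
        by (intro power_mono schatten_norm_nonneg[OF matcomb_carrier])
      also have "\<dots> \<le> 2 * ?P\<^sup>2 + 2 * ?Q\<^sup>2"
        using sum_squares_bound[of ?P ?Q] by (simp add: power2_sum)
      also have "\<dots> \<le> 2 * hp \<omega> + 2 * hm \<omega>" using hp(3) hm(3) by (intro add_mono mult_left_mono) auto
      finally show ?thesis .
    qed
    have "(\<integral>\<^sup>+\<omega>. ennreal (2 * hp \<omega> + 2 * hm \<omega>) \<partial>M) = (\<integral>\<^sup>+\<omega>. ennreal 2 * ennreal (hp \<omega>) + ennreal 2 * ennreal (hm \<omega>) \<partial>M)"
      using hp(2) hm(2) by (intro nn_integral_cong) (simp add: ennreal_mult' ennreal_plus)
    also have "\<dots> = ennreal 2 * (\<integral>\<^sup>+\<omega>. ennreal (hp \<omega>) \<partial>M) + ennreal 2 * (\<integral>\<^sup>+\<omega>. ennreal (hm \<omega>) \<partial>M)"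
      using hp(1) hm(1) by (simp add: nn_integral_add nn_integral_cmult)
    also have "\<dots> \<le> ennreal 2 * ennreal (2 * (r - 1) * real n * w\<^sup>2) + ennreal 2 * ennreal (2 * (r - 1) * real n * w\<^sup>2)"
      by (intro add_mono mult_left_mono hp hm) auto
    also have "\<dots> = ennreal (8 * (r - 1) * real n * w\<^sup>2)"
    proof -
      have "ennreal 2 * ennreal z + ennreal 2 * ennreal z = ennreal (4 * z)" if "0 \<le> z" for z
        using that by (subst (1 2) ennreal_mult[symmetric], simp, simp, simp, simp, subst ennreal_plus[symmetric]) auto
      moreover have "0 \<le> 2 * (r - 1) * real n * w\<^sup>2" using r2 by (intro mult_nonneg_nonneg) auto
      moreover have four: "4 * (2 * (r - 1) * real n * w\<^sup>2) = 8 * (r - 1) * real n * w\<^sup>2" by simp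
      ultimately show ?thesis unfolding four[symmetric] by blast
    qed
    finally show ?thesis
      using tri hp(1,2) hm(1,2) by (intro exI[of _ "\<lambda>\<omega>. 2 * hp \<omega> + 2 * hm \<omega>"]) auto
  qed
  then show "\<exists>h. h \<in> borel_measurable M \<and> (\<forall>\<omega>. 0 \<le> h \<omega> \<and> (schatten_norm (ennreal r) (matcomb n m X (\<lambda>i. b i \<omega>)))\<^sup>2 \<le> h \<omega>)
        \<and> (\<integral>\<^sup>+\<omega>. ennreal (h \<omega>) \<partial>M) \<le> ennreal (8 * (r - 1) * real n * (weak (schatten_space (ennreal a) n) m X)\<^sup>2)"
    unfolding w_def .
qed

lemma gauss_bound_exists:
  assumes u: "1 \<le> u"
  shows "\<exists>t C. 1 \<le> t \<and> 0 < C \<and> recip t = max 0 (recip u - 1 / 2) \<and> gauss_bound TYPE('w) u t C"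
proof (cases "2 \<le> u")
  case True
  have "recip u \<le> 1 / 2" using True by (cases u) (auto simp: recip_eq recip_top_eq u ennreal_le_iff2 field_simps simp flip: ennreal_numeral)
  then show ?thesis using gauss_bound_top[OF u] by (intro exI[of _ \<top>] exI[of _ 4672]) (auto simp: recip_top_eq)
next
  case False
  then obtain a where a: "u = ennreal a" "1 \<le> a" "a < 2"
    using u by (cases u) (auto simp: ennreal_less_iff simp flip: ennreal_numeral ennreal_1)
  have ru: "recip u = 1 / a" using a u by (simp add: recip_eq)
  show ?thesis
  proof (cases "a = 1")
    case True
    have "recip (2::ennreal) = 1 / 2" by (simp add: recip_eq)
    then show ?thesis using True a gauss_bound_1 ru by (intro exI[of _ 2] exI[of _ 1]) auto
  next
    case False
    define r where "r = 1 / (1 / a - 1 / 2)"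
    have pos: "1 / a - 1 / 2 > 0" "1 / a - 1 / 2 < 1 / 2" using a False by (auto simp: field_simps)
    then have r: "1 / r = 1 / a - 1 / 2" "2 < r" by (auto simp: r_def field_simps)
    have "recip (ennreal r) = 1 / r" using r(2) by (subst recip_eq) auto
    then show ?thesis using gauss_bound_between[OF _ a(3) r(1)] a False r pos
      by (intro exI[of _ "ennreal r"] exI[of _ "8 * (r - 1)"]) (auto simp: ru[unfolded a(1)])
  qed
qed

section \<open>Identities between Schatten classes\<close>

lemma abelian_monoid_schatten: "abelian_monoid (schatten_space u n)"
  by (rule abelian_monoidI) (auto simp: schatten_space_simps)

lemma abelian_monoid_lp: "abelian_monoid (lp_space u n)"
  by (rule abelian_monoidI) (auto simp: lp_space_simps)

lemma finsum_schatten: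
  fixes m :: nat
  assumes "\<And>i. i < m \<Longrightarrow> X i \<in> carrier_mat n n"
  shows "finsum (schatten_space u n) (\<lambda>i. c i \<odot>\<^bsub>schatten_space u n\<^esub> X i) {..<m}
    = Matrix.mat n n (\<lambda>(j, k). \<Sum>i<m. c i * X i $$ (j, k))"
  using assms
proof (induction m)
  case 0
  interpret abelian_monoid "schatten_space u n" by (rule abelian_monoid_schatten)
  show ?case by (simp add: schatten_space_simps(3)) (intro eq_matI, auto)
next
  case (Suc m)
  interpret abelian_monoid "schatten_space u n" by (rule abelian_monoid_schatten)
  have "finsum (schatten_space u n) (\<lambda>i. c i \<odot>\<^bsub>schatten_space u n\<^esub> X i) (insert m {..<m})
    = (c m \<odot>\<^bsub>schatten_space u n\<^esub> X m) \<oplus>\<^bsub>schatten_space u n\<^esub> finsum (schatten_space u n) (\<lambda>i. c i \<odot>\<^bsub>schatten_space u n\<^esub> X i) {..<m}"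
    using Suc.prems by (intro finsum_insert) (auto simp: schatten_space_simps)
  also have "\<dots> = c m \<cdot>\<^sub>m X m + Matrix.mat n n (\<lambda>(j, k). \<Sum>i<m. c i * X i $$ (j, k))"
    by (subst Suc.IH) (use Suc.prems in \<open>auto simp only: schatten_space_simps less_SucI\<close>)
  also have "\<dots> = Matrix.mat n n (\<lambda>(j, k). \<Sum>i<Suc m. c i * X i $$ (j, k))"
    using Suc.prems[of m] by (intro eq_matI) auto
  finally show ?case unfolding lessThan_Suc .
qed

lemma finsum_lp:
  fixes m :: nat
  assumes "\<And>i. i < m \<Longrightarrow> x i \<in> carrier_vec n"
  shows "finsum (lp_space u n) (\<lambda>i. c i \<odot>\<^bsub>lp_space u n\<^esub> x i) {..<m}
    = Matrix.vec n (\<lambda>j. \<Sum>i<m. c i * x i $ j)"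
  using assms
proof (induction m)
  case 0
  interpret abelian_monoid "lp_space u n" by (rule abelian_monoid_lp)
  show ?case by (simp add: lp_space_simps(3)) (intro eq_vecI, auto)
next
  case (Suc m)
  interpret abelian_monoid "lp_space u n" by (rule abelian_monoid_lp)
  have "finsum (lp_space u n) (\<lambda>i. c i \<odot>\<^bsub>lp_space u n\<^esub> x i) (insert m {..<m})
    = (c m \<odot>\<^bsub>lp_space u n\<^esub> x m) \<oplus>\<^bsub>lp_space u n\<^esub> finsum (lp_space u n) (\<lambda>i. c i \<odot>\<^bsub>lp_space u n\<^esub> x i) {..<m}"
    using Suc.prems by (intro finsum_insert) (auto simp: lp_space_simps)
  also have "\<dots> = c m \<cdot>\<^sub>v x m + Matrix.vec n (\<lambda>j. \<Sum>i<m. c i * x i $ j)"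
    by (subst Suc.IH) (use Suc.prems in \<open>auto simp only: lp_space_simps less_SucI\<close>)
  also have "\<dots> = Matrix.vec n (\<lambda>j. \<Sum>i<Suc m. c i * x i $ j)"
    using Suc.prems[of m] by (intro eq_vecI) auto
  finally show ?case unfolding lessThan_Suc .
qed

lemma dual_ball_finsum:
  fixes m :: nat
  assumes E: "abelian_monoid E" and sm: "\<And>a x. x \<in> carrier E \<Longrightarrow> a \<odot>\<^bsub>E\<^esub> x \<in> carrier E"
    and x: "\<And>i. i < m \<Longrightarrow> x i \<in> carrier E" and \<phi>: "\<phi> \<in> dual_ball E"
  shows "\<phi> (finsum E (\<lambda>i. a i \<odot>\<^bsub>E\<^esub> x i) {..<m}) = (\<Sum>i<m. a i * \<phi> (x i))"
proof -
  interpret abelian_monoid E by (rule E)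
  have add: "\<phi> (y \<oplus>\<^bsub>E\<^esub> z) = \<phi> y + \<phi> z" if "y \<in> carrier E" "z \<in> carrier E" for y z
    using \<phi> that by (auto simp: dual_ball_def)
  have mul: "\<phi> (c \<odot>\<^bsub>E\<^esub> y) = c * \<phi> y" if "y \<in> carrier E" for c y
    using \<phi> that by (auto simp: dual_ball_def)
  show ?thesis
    using x
  proof (induction m)
    case 0
    have "\<phi> \<zero>\<^bsub>E\<^esub> + \<phi> \<zero>\<^bsub>E\<^esub> = \<phi> \<zero>\<^bsub>E\<^esub>" using add[of "\<zero>\<^bsub>E\<^esub>" "\<zero>\<^bsub>E\<^esub>"] by simp
    then show ?case by simp
  next
    case (Suc m)
    have "finsum E (\<lambda>i. a i \<odot>\<^bsub>E\<^esub> x i) (insert m {..<m}) = (a m \<odot>\<^bsub>E\<^esub> x m) \<oplus>\<^bsub>E\<^esub> finsum E (\<lambda>i. a i \<odot>\<^bsub>E\<^esub> x i) {..<m}"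
      using Suc.prems sm by (intro finsum_insert) auto
    moreover have "finsum E (\<lambda>i. a i \<odot>\<^bsub>E\<^esub> x i) {..<m} \<in> carrier E"
      using Suc.prems sm by (intro finsum_closed) auto
    ultimately show ?case
      using Suc add mul sm by (simp add: lessThan_Suc)
  qed
qed

text \<open>Dual form of the weak norm: test \<open>\<phi>\<close> on the combination with coefficients \<open>cnj (\<phi> (x i))\<close>.\<close>

lemma weak_le_of_combinations:
  assumes E: "abelian_monoid E" and sm: "\<And>a x. x \<in> carrier E \<Longrightarrow> a \<odot>\<^bsub>E\<^esub> x \<in> carrier E"
    and nn: "\<And>x. x \<in> carrier E \<Longrightarrow> 0 \<le> nrm E x"
    and x: "\<And>i. i < m \<Longrightarrow> x i \<in> carrier E" and w: "0 \<le> w"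
    and bd: "\<And>a. nrm E (finsum E (\<lambda>i. a i \<odot>\<^bsub>E\<^esub> x i) {..<m}) \<le> w * sqrt (\<Sum>i<m. (cmod (a i))\<^sup>2)"
  shows "weak E m x \<le> w"
proof (rule weak_le[OF nn _ w])
  fix \<phi> assume \<phi>: "\<phi> \<in> dual_ball E"
  interpret abelian_monoid E by (rule E)
  define S where "S = (\<Sum>i<m. (cmod (\<phi> (x i)))\<^sup>2)"
  have S0: "0 \<le> S" by (simp add: S_def sum_nonneg)
  let ?y = "finsum E (\<lambda>i. cnj (\<phi> (x i)) \<odot>\<^bsub>E\<^esub> x i) {..<m}"
  have yc: "?y \<in> carrier E" using x sm by (intro finsum_closed) auto
  have "\<phi> ?y = complex_of_real S"
    unfolding S_def
    by (subst dual_ball_finsum[where x = x and m = m, OF E sm x \<phi>]) (simp_all add: complex_norm_square mult.commute del: of_real_power)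
  then have "S = cmod (\<phi> ?y)" using S0 by simp
  also have "\<dots> \<le> nrm E ?y" using \<phi> yc by (auto simp: dual_ball_def)
  also have "\<dots> \<le> w * sqrt (\<Sum>i<m. (cmod (cnj (\<phi> (x i))))\<^sup>2)" by (rule bd)
  also have "\<dots> = w * sqrt S" by (simp add: S_def)
  finally have le: "S \<le> w * sqrt S" .
  have "sqrt S \<le> w"
  proof (cases "S = 0")
    case False
    then have "sqrt S * sqrt S \<le> w * sqrt S" using le S0 by simp
    then show ?thesis by (rule mult_right_le_imp_le) (use False S0 in simp)
  qed (use w in simp)
  then have "(sqrt S)\<^sup>2 \<le> w\<^sup>2" using S0 by (intro power_mono) auto
  then show "(\<Sum>i<m. (cmod (\<phi> (x i)))\<^sup>2) \<le> w\<^sup>2" using S0 by (simp add: S_def)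
qed auto

section \<open>Testing the Gaussian-summing constant\<close>

text \<open>If two members coincided, their difference would vanish, but by independence its second
  moment is 2. Hence initial segments of the sequence are admissible choices of distinct Gaussian
  variables.\<close>

lemma gaussian_seq_inj:
  assumes "std_gaussian_seq M g"
  shows "inj g"
proof (rule injI, rule ccontr)
  fix i j assume eq: "g i = g j" and ij: "i \<noteq> j"
  define b where "b = (\<lambda>k::nat. g (if k = 0 then i else j))"
  interpret prob_space M using assms by (simp add: std_gaussian_seq_def)
  have "inj_on (\<lambda>k::nat. if k = 0 then i else j) {..<2}" using ij by (auto simp: inj_on_def)
  then have "indep_vars (\<lambda>_. borel) b {..<2}"
    unfolding b_def using indep_vars_reindex_inj[where I = UNIV and M' = "\<lambda>_. borel" and X = g] assms
    by (simp add: std_gaussian_seq_def)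
  moreover have "distributed M lborel (b k) std_normal_density" for k
    using assms by (auto simp: b_def std_gaussian_seq_def)
  ultimately have G: "gfam M b 2" using prob_space_axioms by (simp add: gfam_def)
  have "(\<Sum>k<2::nat. (if k = 0 then 1 else -1) * b k \<omega>) = 0" for \<omega>
    by (simp add: b_def eq numeral_2_eq_2)
  then have "(0::ennreal) = (\<integral>\<^sup>+\<omega>. ennreal ((\<Sum>k<2::nat. (if k = 0 then 1 else -1) * b k \<omega>)\<^sup>2) \<partial>M)" by simp
  also have "\<dots> = ennreal (\<Sum>k<2::nat. (if k = 0 then 1 else -1)\<^sup>2)"
    by (rule gaussian_comb_square[OF G])
  also have "\<dots> = 2" by (simp add: numeral_2_eq_2 flip: ennreal_numeral)
  finally show False by simp
qed

text \<open>One family, combined with the first \<open>m\<close> members of the sequence, bounds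
  every admissible constant from below.\<close>

lemma pi_gamma_lower:
  assumes g: "std_gaussian_seq M g" and x: "\<And>i. i < m \<Longrightarrow> x i \<in> carrier E"
    and nn: "\<And>x. x \<in> carrier E \<Longrightarrow> 0 \<le> nrm E x"
    and w: "weak E m x \<le> w" "0 < w" and B: "0 \<le> B"
    and low: "ennreal (B\<^sup>2) \<le> (\<integral>\<^sup>+\<omega>. ennreal ((nrm F (finsum F (\<lambda>i. complex_of_real (g i \<omega>) \<odot>\<^bsub>F\<^esub> x i) {..<m}))\<^sup>2) \<partial>M)"
  shows "ennreal (B / w) \<le> pi_gamma M g E F (\<lambda>x. x)"
  unfolding pi_gamma_def
proof (rule Inf_greatest)
  fix z assume "z \<in> {ennreal c |c. bounded_clinear_on E F (\<lambda>x. x) \<and> gaussian_summing_const M g E F (\<lambda>x. x) c}"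
  then obtain c where c: "z = ennreal c" "c > 0" and gc: "gaussian_summing_const M g E F (\<lambda>x. x) c"
    by (auto simp: gaussian_summing_const_def)
  have "inj_on g {..<m}" using gaussian_seq_inj[OF g] by (rule inj_on_subset) simp
  then have "(\<integral>\<^sup>+\<omega>. ennreal ((nrm F (finsum F (\<lambda>i. complex_of_real (g i \<omega>) \<odot>\<^bsub>F\<^esub> x i) {..<m}))\<^sup>2) \<partial>M)
    \<le> ennreal ((c * weak E m x)\<^sup>2)"
    using gc x unfolding gaussian_summing_const_def weak_def by (auto simp: image_subset_iff)
  with low have "ennreal (B\<^sup>2) \<le> ennreal ((c * weak E m x)\<^sup>2)" by (rule order_trans)
  then have "B\<^sup>2 \<le> (c * weak E m x)\<^sup>2" by (simp add: ennreal_le_iff)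
  then have "B \<le> c * weak E m x"
    using c weak_nonneg[where x = x and E = E and m = m, OF x nn] by (intro power2_le_imp_le[of B]) auto
  also have "\<dots> \<le> c * w" using w c by (intro mult_left_mono) auto
  finally show "ennreal (B / w) \<le> z" using w c by (simp add: field_simps ennreal_leI)
qed

lemma pi_gamma_upper:
  assumes c: "0 < c" and bdd: "bounded_clinear_on E F (\<lambda>x. x)"
    and up: "\<And>m b x. inj_on b {..<m} \<Longrightarrow> b ` {..<m} \<subseteq> range g \<Longrightarrow> (\<And>i. i < m \<Longrightarrow> x i \<in> carrier E) \<Longrightarrow>
      (\<integral>\<^sup>+\<omega>. ennreal ((nrm F (finsum F (\<lambda>i. complex_of_real (b i \<omega>) \<odot>\<^bsub>F\<^esub> x i) {..<m}))\<^sup>2) \<partial>M)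
        \<le> ennreal ((c * weak E m x)\<^sup>2)"
  shows "pi_gamma M g E F (\<lambda>x. x) \<le> ennreal c"
  unfolding pi_gamma_def
proof (rule Inf_lower)
  have "gaussian_summing_const M g E F (\<lambda>x. x) c"
    using c up unfolding gaussian_summing_const_def weak_def by (auto simp: image_subset_iff)
  then show "ennreal c \<in> {ennreal c |c. bounded_clinear_on E F (\<lambda>x. x) \<and> gaussian_summing_const M g E F (\<lambda>x. x) c}"
    using bdd by auto
qed

text \<open>The inner maximum merges the two ranges of \<open>u\<close>: it is 0 for
  \<open>u \<ge> 2\<close> and \<open>recip u - 1/2\<close> otherwise. It is the
  \<open>recip t\<close> for which \<open>gauss_bound\<close> is proved.\<close>

definition crit :: "ennreal \<Rightarrow> ennreal \<Rightarrow> real" where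
  "crit u v = max 0 (recip v - max 0 (recip u - 1 / 2))"

lemma schatten_upper:
  assumes g: "std_gaussian_seq (M::'w measure) g" and u: "1 \<le> u" and v: "1 \<le> v"
  shows "\<exists>C>0. \<forall>n\<ge>1. pi_gamma M g (schatten_space u n) (schatten_space v n) (\<lambda>x. x) \<le> ennreal (C * real n powr (1 / 2 + crit u v))"
proof -
  obtain t C where t: "1 \<le> t" and C: "0 < C" and rt: "recip t = max 0 (recip u - 1 / 2)" and gb: "gauss_bound TYPE('w) u t C"
    using gauss_bound_exists[OF u] by blast
  show ?thesis
  proof (intro exI[of _ "sqrt C"] conjI allI impI)
    show "0 < sqrt C" using C by simp
    fix n :: nat assume n: "1 \<le> n"
    define K where "K = real n powr crit u v"
    have K: "0 < K" using n by (simp add: K_def)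
    \<comment> \<open>The choice of \<open>t\<close> makes the norm of the identity from exponent
      \<open>t\<close> to \<open>v\<close> equal to \<open>n^crit\<close>.\<close>
    have cmp: "schatten_norm v A \<le> K * schatten_norm t A" if "A \<in> carrier_mat n n" for A
      using schatten_compare[OF that t v n] by (simp add: K_def crit_def rt)
    show "pi_gamma M g (schatten_space u n) (schatten_space v n) (\<lambda>x. x) \<le> ennreal (sqrt C * real n powr (1 / 2 + crit u v))"
    proof (rule pi_gamma_upper)
      show "0 < sqrt C * real n powr (1 / 2 + crit u v)" using C n by simp
      show "bounded_clinear_on (schatten_space u n) (schatten_space v n) (\<lambda>x. x)"
        unfolding bounded_clinear_on_def clinear_on_def schatten_space_simps
        using schatten_compare[OF _ u v n] by auto
      fix m and b :: "nat \<Rightarrow> 'w \<Rightarrow> real" and X :: "nat \<Rightarrow> complex Matrix.mat"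
      assume b: "inj_on b {..<m}" "b ` {..<m} \<subseteq> range g" and "\<And>i. i < m \<Longrightarrow> X i \<in> carrier (schatten_space u n)"
      then have X: "\<And>i. i < m \<Longrightarrow> X i \<in> carrier_mat n n" by (simp add: schatten_space_simps)
      have G: "gfam M b m" by (rule gfam_of_seq[OF g b])
      obtain h where h: "h \<in> borel_measurable M" "\<And>\<omega>. 0 \<le> h \<omega>"
        "\<And>\<omega>. (schatten_norm t (matcomb n m X (\<lambda>i. b i \<omega>)))\<^sup>2 \<le> h \<omega>"
        "(\<integral>\<^sup>+\<omega>. ennreal (h \<omega>) \<partial>M) \<le> ennreal (C * real n * (weak (schatten_space u n) m X)\<^sup>2)"
        using gb n G X unfolding gauss_bound_def by blast
      have "(\<integral>\<^sup>+\<omega>. ennreal ((nrm (schatten_space v n) (finsum (schatten_space v n) (\<lambda>i. complex_of_real (b i \<omega>) \<odot>\<^bsub>schatten_space v n\<^esub> X i) {..<m}))\<^sup>2) \<partial>M)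
        \<le> (\<integral>\<^sup>+\<omega>. ennreal (K\<^sup>2) * ennreal (h \<omega>) \<partial>M)"
      proof (rule nn_integral_mono)
        fix \<omega>
        have fs: "finsum (schatten_space v n) (\<lambda>i. complex_of_real (b i \<omega>) \<odot>\<^bsub>schatten_space v n\<^esub> X i) {..<m} = matcomb n m X (\<lambda>i. b i \<omega>)"
          unfolding matcomb_def by (rule finsum_schatten) (rule X)
        have "(schatten_norm v (matcomb n m X (\<lambda>i. b i \<omega>)))\<^sup>2 \<le> (K * schatten_norm t (matcomb n m X (\<lambda>i. b i \<omega>)))\<^sup>2"
          by (intro power_mono cmp schatten_norm_nonneg[OF matcomb_carrier] matcomb_carrier)
        also have "\<dots> \<le> K\<^sup>2 * h \<omega>" unfolding power_mult_distrib by (intro mult_left_mono h) auto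
        finally show "ennreal ((nrm (schatten_space v n) (finsum (schatten_space v n) (\<lambda>i. complex_of_real (b i \<omega>) \<odot>\<^bsub>schatten_space v n\<^esub> X i) {..<m}))\<^sup>2)
          \<le> ennreal (K\<^sup>2) * ennreal (h \<omega>)"
          unfolding schatten_space_simps(5) fs using h(2) by (subst ennreal_mult[symmetric]) (auto intro: ennreal_leI)
      qed
      also have "\<dots> = ennreal (K\<^sup>2) * (\<integral>\<^sup>+\<omega>. ennreal (h \<omega>) \<partial>M)"
        using h(1) by (intro nn_integral_cmult) auto
      also have "\<dots> \<le> ennreal (K\<^sup>2) * ennreal (C * real n * (weak (schatten_space u n) m X)\<^sup>2)"
        by (intro mult_left_mono h) auto
      also have "\<dots> = ennreal (K\<^sup>2 * (C * real n * (weak (schatten_space u n) m X)\<^sup>2))"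
        using C by (intro ennreal_mult[symmetric]) auto
      also have "K\<^sup>2 * (C * real n * (weak (schatten_space u n) m X)\<^sup>2) = (sqrt C * real n powr (1 / 2 + crit u v) * weak (schatten_space u n) m X)\<^sup>2"
      proof -
        have "(real n powr (1 / 2 + crit u v))\<^sup>2 = real n * K\<^sup>2"
          using n by (simp add: powr_add K_def power_mult_distrib powr_half_sqrt)
        then show ?thesis using C by (simp add: power_mult_distrib)
      qed
      finally show "(\<integral>\<^sup>+\<omega>. ennreal ((nrm (schatten_space v n) (finsum (schatten_space v n) (\<lambda>i. complex_of_real (b i \<omega>) \<odot>\<^bsub>schatten_space v n\<^esub> X i) {..<m}))\<^sup>2) \<partial>M)
        \<le> ennreal ((sqrt C * real n powr (1 / 2 + crit u v) * weak (schatten_space u n) m X)\<^sup>2)" .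
    qed
  qed
qed

section \<open>Lower estimates from matrix units\<close>

lemma gfam_seq: "std_gaussian_seq M g \<Longrightarrow> gfam M g m"
  by (rule gfam_of_seq) (auto intro: inj_on_subset[OF gaussian_seq_inj])

lemma weak_schatten_le:
  assumes "\<And>i. i < m \<Longrightarrow> X i \<in> carrier_mat n n" "0 \<le> w"
    and "\<And>a. schatten_norm u (Matrix.mat n n (\<lambda>(j, k). \<Sum>i<m. a i * X i $$ (j, k))) \<le> w * sqrt (\<Sum>i<m. (cmod (a i))\<^sup>2)"
  shows "weak (schatten_space u n) m X \<le> w"
proof (rule weak_le_of_combinations)
  show "abelian_monoid (schatten_space u n)" by (rule abelian_monoid_schatten)
  show "nrm (schatten_space u n) (finsum (schatten_space u n) (\<lambda>i. a i \<odot>\<^bsub>schatten_space u n\<^esub> X i) {..<m})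
    \<le> w * sqrt (\<Sum>i<m. (cmod (a i))\<^sup>2)" for a
    by (subst finsum_schatten) (use assms(1,3) in \<open>auto simp: schatten_space_simps(5)\<close>)
qed (use assms(1,2) in \<open>auto simp: schatten_space_simps schatten_norm_nonneg\<close>)

lemma schatten_lower:
  assumes g: "std_gaussian_seq M g" and X: "\<And>i. i < m \<Longrightarrow> X i \<in> carrier_mat n n"
    and w: "0 < w" and B: "0 \<le> B"
    and bd: "\<And>a. schatten_norm u (Matrix.mat n n (\<lambda>(j, k). \<Sum>i<m. a i * X i $$ (j, k))) \<le> w * sqrt (\<Sum>i<m. (cmod (a i))\<^sup>2)"
    and low: "ennreal (B\<^sup>2) \<le> (\<integral>\<^sup>+\<omega>. ennreal ((schatten_norm v (matcomb n m X (\<lambda>i. g i \<omega>)))\<^sup>2) \<partial>M)"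
  shows "ennreal (B / w) \<le> pi_gamma M g (schatten_space u n) (schatten_space v n) (\<lambda>x. x)"
proof (rule pi_gamma_lower[OF g])
  show "weak (schatten_space u n) m X \<le> w" using w by (intro weak_schatten_le X bd) auto
  have "finsum (schatten_space v n) (\<lambda>i. complex_of_real (g i \<omega>) \<odot>\<^bsub>schatten_space v n\<^esub> X i) {..<m} = matcomb n m X (\<lambda>i. g i \<omega>)" for \<omega>
    unfolding matcomb_def by (rule finsum_schatten) (rule X)
  then show "ennreal (B\<^sup>2) \<le> (\<integral>\<^sup>+\<omega>. ennreal ((nrm (schatten_space v n) (finsum (schatten_space v n) (\<lambda>i. complex_of_real (g i \<omega>) \<odot>\<^bsub>schatten_space v n\<^esub> X i) {..<m}))\<^sup>2) \<partial>M)"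
    using low by (simp only: schatten_space_simps(5))
qed (use X w B in \<open>auto simp: schatten_space_simps schatten_norm_nonneg\<close>)

definition unit_mat :: "nat \<Rightarrow> nat \<Rightarrow> nat \<Rightarrow> complex Matrix.mat" where
  "unit_mat n a c = Matrix.mat n n (\<lambda>(j, k). if j = a \<and> k = c then 1 else 0)"

text \<open>The matrix has rank at most one, so already its trace norm is the Euclidean norm of the
  row: Cauchy-Schwarz over the singular vectors, Parseval for \<open>q\<close> and Bessel for
  \<open>p\<close>. The other exponents follow by monotonicity.\<close>

lemma schatten_row_le:
  assumes n: "1 \<le> n" and u: "1 \<le> u"
    and A: "A = Matrix.mat n n (\<lambda>(j, k). if j = 0 then z k else 0)"
  shows "schatten_norm u A \<le> sqrt (\<Sum>k<n. (cmod (z k))\<^sup>2)"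
proof -
  have c: "A \<in> carrier_mat n n" by (simp add: A)
  obtain s q p where sv: "svd n A s q p" using svd_exists[OF c] .
  then have q: "ons n n q" and s0: "\<And>k. k < n \<Longrightarrow> 0 \<le> s k" and sn: "\<And>t. schatten_norm t A = lpf n t s"
    and pp: "\<And>k. k < n \<Longrightarrow> cip n (p k) (p k) = (if s k \<noteq> 0 then 1 else 0)"
    and Aq: "\<And>k i. k < n \<Longrightarrow> i < n \<Longrightarrow> kap n (ent A) (q k) i = complex_of_real (s k) * p k i"
    by (auto simp: svd_def)
  have bil: "cip n (kap n (ent A) x) y = cip n x (\<lambda>k. cnj (z k)) * cip n (std_basis 0) y" for x y
  proof -
    have "kap n (ent A) x i = cip n x (\<lambda>k. cnj (z k)) * std_basis 0 i" if "i < n" for i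
      using that by (simp add: A kap_def cip_def std_basis_def mult.commute)
    then have "cip n (kap n (ent A) x) y = cip n (\<lambda>i. cip n x (\<lambda>k. cnj (z k)) * std_basis 0 i) y"
      by (intro cip_cong) auto
    then show ?thesis by (simp add: cip_scale_left)
  qed
  have sk: "s k = cmod (cip n (\<lambda>k. cnj (z k)) (q k)) * cmod (cip n (std_basis 0) (p k))" if k: "k < n" for k
  proof -
    have "complex_of_real (s k) = cip n (\<lambda>i. complex_of_real (s k) * p k i) (p k)"
      using pp[OF k] by (auto simp: cip_scale_left)
    also have "\<dots> = cip n (kap n (ent A) (q k)) (p k)"
      by (intro cip_cong) (auto simp: Aq k)
    also have "\<dots> = cip n (q k) (\<lambda>k. cnj (z k)) * cip n (std_basis 0) (p k)" by (rule bil)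
    finally have "cmod (complex_of_real (s k)) = cmod (cip n (q k) (\<lambda>k. cnj (z k))) * cmod (cip n (std_basis 0) (p k))"
      by (simp add: norm_mult)
    then show ?thesis using s0[OF k] by (simp add: cmod_cip_commute[of n "q k"])
  qed
  have "schatten_norm u A \<le> schatten_norm 1 A"
    unfolding sn by (rule lpf_le_lpf[OF _ u]) simp
  also have "\<dots> = (\<Sum>k<n. cmod (cip n (\<lambda>k. cnj (z k)) (q k)) * cmod (cip n (std_basis 0) (p k)))"
    using s0 by (simp add: sn lpf_1 sk[symmetric])
  also have "\<dots> \<le> sqrt (nsq n (\<lambda>k. cnj (z k)) * nsq n (std_basis 0))"
  proof (rule real_le_rsqrt)
    have "(\<Sum>k<n. cmod (cip n (\<lambda>k. cnj (z k)) (q k)) * cmod (cip n (std_basis 0) (p k)))\<^sup>2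
      \<le> (\<Sum>k<n. (cmod (cip n (\<lambda>k. cnj (z k)) (q k)))\<^sup>2) * (\<Sum>k<n. (cmod (cip n (std_basis 0) (p k)))\<^sup>2)"
      by (rule Cauchy_Schwarz_ineq_sum)
    also have "\<dots> \<le> nsq n (\<lambda>k. cnj (z k)) * nsq n (std_basis 0)"
      using svd_bessel[OF sv] by (intro mult_mono) (auto simp: parseval_nsq[OF q] sum_nonneg)
    finally show "(\<Sum>k<n. cmod (cip n (\<lambda>k. cnj (z k)) (q k)) * cmod (cip n (std_basis 0) (p k)))\<^sup>2
      \<le> nsq n (\<lambda>k. cnj (z k)) * nsq n (std_basis 0)" .
  qed
  also have "\<dots> = sqrt (\<Sum>k<n. (cmod (z k))\<^sup>2)"
    using n by (simp add: nsq_std_basis) (simp add: nsq_def)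
  finally show ?thesis .
qed

text \<open>Evaluating at the normalised conjugate of the row shows that the operator norm, hence
  every Schatten norm, is at least its Euclidean length.\<close>

lemma schatten_row_ge:
  assumes n: "1 \<le> n" and v: "1 \<le> v"
    and A: "A = Matrix.mat n n (\<lambda>(j, k). if j = 0 then z k else 0)"
  shows "(\<Sum>k<n. (cmod (z k))\<^sup>2) \<le> (schatten_norm v A)\<^sup>2"
proof -
  have c: "A \<in> carrier_mat n n" by (simp add: A)
  define Z where "Z = (\<Sum>k<n. (cmod (z k))\<^sup>2)"
  have Z0: "0 \<le> Z" by (simp add: Z_def sum_nonneg)
  show ?thesis
  proof (cases "Z = 0")
    case True
    then show ?thesis by (simp add: Z_def)
  next
    case False
    then have Z: "0 < Z" using Z0 by simp
    define x where "x k = complex_of_real (1 / sqrt Z) * cnj (z k)" for k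
    have "nsq n (\<lambda>k. cnj (z k)) = Z" by (simp add: nsq_def Z_def)
    then have nx: "nsq n x \<le> 1"
      unfolding x_def nsq_scale norm_of_real power2_abs using Z by (simp add: power_divide)
    have "cip n (kap n (ent A) x) (std_basis 0) = kap n (ent A) x 0"
      using n by (simp add: cip_std_basis)
    also have "\<dots> = (\<Sum>k<n. complex_of_real (1 / sqrt Z) * (z k * cnj (z k)))"
      using n by (simp add: kap_def A x_def mult_ac)
    also have "\<dots> = complex_of_real (1 / sqrt Z * Z)"
      unfolding sum_distrib_left[symmetric] by (simp add: Z_def complex_norm_square del: of_real_power)
    also have "1 / sqrt Z * Z = sqrt Z" using Z by (simp add: real_div_sqrt)
    finally have "cmod (cip n (kap n (ent A) x) (std_basis 0)) = sqrt Z" using Z by simp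
    moreover have "cmod (cip n (kap n (ent A) x) (std_basis 0)) \<le> schatten_norm v A"
      using n by (intro bilinear_le_schatten c v nx) (simp add: nsq_std_basis)
    ultimately have "(sqrt Z)\<^sup>2 \<le> (schatten_norm v A)\<^sup>2" using Z by (intro power_mono) auto
    then show ?thesis using Z by (simp add: Z_def)
  qed
qed

lemma schatten_lower_row:
  assumes g: "std_gaussian_seq M g" and n: "1 \<le> n" and u: "1 \<le> u" and v: "1 \<le> v"
  shows "ennreal (sqrt n) \<le> pi_gamma M g (schatten_space u n) (schatten_space v n) (\<lambda>x. x)"
proof -
  have comb: "Matrix.mat n n (\<lambda>(j, k). \<Sum>i<n. a i * unit_mat n 0 i $$ (j, k)) = Matrix.mat n n (\<lambda>(j, k). if j = 0 then a k else 0)" for a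
  proof (rule cong_mat[OF refl refl])
    fix j k assume jk: "j < n" "k < n"
    have "(\<Sum>i<n. a i * unit_mat n 0 i $$ (j, k)) = (\<Sum>i<n. if k = i then (if j = 0 then a k else 0) else 0)"
      using jk by (intro sum.cong) (auto simp: unit_mat_def)
    then show "(case (j, k) of (j, k) \<Rightarrow> \<Sum>i<n. a i * unit_mat n 0 i $$ (j, k)) = (case (j, k) of (j, k) \<Rightarrow> if j = 0 then a k else 0)"
      using jk by simp
  qed
  have G: "gfam M g n" by (rule gfam_seq[OF g])
  note [measurable] = gfam_measurable[OF G]
  have "ennreal (sqrt n / 1) \<le> pi_gamma M g (schatten_space u n) (schatten_space v n) (\<lambda>x. x)"
  proof (rule schatten_lower[OF g, where X = "unit_mat n 0" and m = n])
    show "schatten_norm u (Matrix.mat n n (\<lambda>(j, k). \<Sum>i<n. a i * unit_mat n 0 i $$ (j, k))) \<le> 1 * sqrt (\<Sum>i<n. (cmod (a i))\<^sup>2)" for a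
      using schatten_row_le[OF n u comb] by simp
    have "ennreal ((sqrt n)\<^sup>2) = (\<Sum>i<n. (1::ennreal))" by (simp add: ennreal_of_nat_eq_real_of_nat)
    also have "\<dots> = (\<Sum>i<n. \<integral>\<^sup>+\<omega>. ennreal ((g i \<omega>)\<^sup>2) \<partial>M)"
    proof (rule sum.cong[OF refl])
      fix i assume i: "i \<in> {..<n}"
      have "(\<Sum>l<n. (if l = i then 1 else 0) * g l \<omega>) = g i \<omega>" for \<omega>
        using i by (simp add: if_distrib if_distribR cong: if_cong)
      moreover have "(\<Sum>l<n. (if l = i then 1 else 0 :: real)\<^sup>2) = 1"
        using i by (simp add: if_distrib if_distribR cong: if_cong)
      ultimately show "1 = (\<integral>\<^sup>+\<omega>. ennreal ((g i \<omega>)\<^sup>2) \<partial>M)"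
        using gaussian_comb_square[OF G, of "\<lambda>l. if l = i then 1 else 0"] by simp
    qed
    also have "\<dots> = (\<integral>\<^sup>+\<omega>. (\<Sum>i<n. ennreal ((g i \<omega>)\<^sup>2)) \<partial>M)"
      by (rule nn_integral_sum[symmetric]) simp
    also have "\<dots> \<le> (\<integral>\<^sup>+\<omega>. ennreal ((schatten_norm v (matcomb n n (unit_mat n 0) (\<lambda>i. g i \<omega>)))\<^sup>2) \<partial>M)"
    proof (rule nn_integral_mono)
      fix \<omega>
      have "(\<Sum>i<n. (cmod (complex_of_real (g i \<omega>)))\<^sup>2) \<le> (schatten_norm v (matcomb n n (unit_mat n 0) (\<lambda>i. g i \<omega>)))\<^sup>2"
        unfolding matcomb_def by (rule schatten_row_ge[OF n v comb])
      then show "(\<Sum>i<n. ennreal ((g i \<omega>)\<^sup>2)) \<le> ennreal ((schatten_norm v (matcomb n n (unit_mat n 0) (\<lambda>i. g i \<omega>)))\<^sup>2)"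
        by (simp add: ennreal_leI)
    qed
    finally show "ennreal ((sqrt n)\<^sup>2) \<le> (\<integral>\<^sup>+\<omega>. ennreal ((schatten_norm v (matcomb n n (unit_mat n 0) (\<lambda>i. g i \<omega>)))\<^sup>2) \<partial>M)" .
  qed (auto simp: unit_mat_def)
  then show ?thesis by simp
qed

text \<open>The product of trace norm and operator norm is split by a weighted arithmetic-geometric
  mean inequality, so that both terms are squares whose means can be treated separately; the weight
  \<open>l\<close> is adjusted later.\<close>

lemma schatten_2_le:
  assumes A: "A \<in> carrier_mat n n" and l: "0 < l"
  shows "(schatten_norm 2 A)\<^sup>2 \<le> l / 2 * (schatten_norm 1 A)\<^sup>2 + (schatten_norm \<top> A)\<^sup>2 / (2 * l)"
proof -
  obtain s q p where "svd n A s q p" using svd_exists[OF A] .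
  then have s0: "\<And>k. k < n \<Longrightarrow> 0 \<le> s k" and sn: "\<And>t. schatten_norm t A = lpf n t s" by (auto simp: svd_def)
  have "(schatten_norm 2 A)\<^sup>2 = (\<Sum>k<n. s k * s k)" unfolding sn lpf_2 by (simp add: power2_eq_square)
  also have "\<dots> \<le> (\<Sum>k<n. s k * schatten_norm \<top> A)"
    using s0 lpf_ge[of \<top> _ n s] by (intro sum_mono mult_left_mono) (auto simp: sn)
  also have "\<dots> = schatten_norm 1 A * schatten_norm \<top> A"
    using s0 by (simp add: sn lpf_1 sum_distrib_right)
  also have "\<dots> \<le> l / 2 * (schatten_norm 1 A)\<^sup>2 + (schatten_norm \<top> A)\<^sup>2 / (2 * l)"
  proof -
    have "2 * (sqrt l * schatten_norm 1 A) * (schatten_norm \<top> A / sqrt l) \<le> (sqrt l * schatten_norm 1 A)\<^sup>2 + (schatten_norm \<top> A / sqrt l)\<^sup>2"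
      by (rule sum_squares_bound)
    then show ?thesis using l by (simp add: power_mult_distrib power_divide field_simps)
  qed
  finally show ?thesis .
qed

text \<open>A Gaussian matrix \<open>G\<close> has large trace norm since \<open>\<parallel>G\<parallel>\<^sub>2\<^sup>2 \<le> \<parallel>G\<parallel>\<^sub>1 \<parallel>G\<parallel>\<^sub>\<infinity>\<close> and
  \<open>\<parallel>G\<parallel>\<^sub>\<infinity>\<close> is of order \<open>\<surd>n\<close>.\<close>

lemma schatten_lower_full:
  assumes g: "std_gaussian_seq M g" and n: "1 \<le> n" and u: "1 \<le> u" and v: "1 \<le> v"
  shows "ennreal (1 / sqrt 4672 * real n powr (1 / 2 + recip v - max 0 (recip u - 1 / 2)))
    \<le> pi_gamma M g (schatten_space u n) (schatten_space v n) (\<lambda>x. x)"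
proof -
  \<comment> \<open>The number \<open>i\<close> encodes the row \<open>i div n\<close> and the
    column \<open>i mod n\<close>.\<close>
  define m where "m = n * n"
  define X where "X i = unit_mat n (i div n) (i mod n)" for i
  have X: "X i \<in> carrier_mat n n" for i by (simp add: X_def unit_mat_def)
  have comb: "(\<Sum>i<m. a i * X i $$ (j, k)) = a (j * n + k)" if jk: "j < n" "k < n" for a :: "nat \<Rightarrow> complex" and j k
  proof -
    have lt: "j * n + k < m"
    proof -
      have "j * n + k < Suc j * n" using jk by simp
      also have "\<dots> \<le> n * n" using jk by (intro mult_right_mono) auto
      finally show ?thesis by (simp add: m_def)
    qed
    have "(\<Sum>i<m. a i * X i $$ (j, k)) = (\<Sum>i<m. if i = j * n + k then a i else 0)"
    proof (rule sum.cong[OF refl])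
      fix i
      have "j = i div n \<and> k = i mod n \<longleftrightarrow> i = j * n + k"
        using jk div_mult_mod_eq[of i n] by auto
      then show "a i * X i $$ (j, k) = (if i = j * n + k then a i else 0)"
        using jk by (auto simp: X_def unit_mat_def)
    qed
    then show ?thesis using lt by simp
  qed
  have frob: "(schatten_norm 2 (Matrix.mat n n (\<lambda>(j, k). \<Sum>i<m. a i * X i $$ (j, k))))\<^sup>2 = (\<Sum>i<m. (cmod (a i))\<^sup>2)" for a
  proof -
    have "(schatten_norm 2 (Matrix.mat n n (\<lambda>(j, k). \<Sum>i<m. a i * X i $$ (j, k))))\<^sup>2 = (\<Sum>j<n. \<Sum>k<n. (cmod (a (j * n + k)))\<^sup>2)"
      by (subst schatten_2) (auto simp: comb intro!: sum.cong)
    also have "\<dots> = (\<Sum>j<n. \<Sum>i\<in>{j * n..<j * n + n}. (cmod (a i))\<^sup>2)"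
    proof (rule sum.cong[OF refl])
      fix j
      show "(\<Sum>k<n. (cmod (a (j * n + k)))\<^sup>2) = (\<Sum>i\<in>{j * n..<j * n + n}. (cmod (a i))\<^sup>2)"
        using sum.shift_bounds_nat_ivl[of "\<lambda>i. (cmod (a i))\<^sup>2" 0 "j * n" n] by (simp add: lessThan_atLeast0 add.commute)
    qed
    also have "\<dots> = (\<Sum>i<m. (cmod (a i))\<^sup>2)" unfolding m_def by (rule sum.nat_group)
    finally show ?thesis .
  qed
  have G: "gfam M g m" by (rule gfam_seq[OF g])
  note [measurable] = gfam_measurable[OF G]
  interpret prob_space M using G by (simp add: gfam_def)
  define \<tau> where "\<tau> = max 0 (recip u - 1 / 2)"
  have r2: "recip (2::ennreal) = 1 / 2" by (simp add: recip_eq)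
  have weakop: "(\<Sum>i<m. (cmod (cip n (kap n (ent (X i)) x) y))\<^sup>2) \<le> 1\<^sup>2" if "nsq n x \<le> 1" "nsq n y \<le> 1" for x y
  proof -
    have "cip n (kap n (ent (X i)) x) y = x (i mod n) * cnj (y (i div n))" if i: "i < m" for i
    proof -
      have lt: "i mod n < n" "i div n < n" using i n by (auto simp: m_def less_mult_imp_div_less)
      have "kap n (ent (X i)) x j = x (i mod n) * std_basis (i div n) j" if "j < n" for j
      proof -
        have "kap n (ent (X i)) x j = (\<Sum>k<n. if k = i mod n then (if j = i div n then x k else 0) else 0)"
          unfolding kap_def using that by (intro sum.cong) (auto simp: X_def unit_mat_def)
        then show ?thesis using lt by (simp add: std_basis_def)
      qed
      then have "cip n (kap n (ent (X i)) x) y = cip n (\<lambda>j. x (i mod n) * std_basis (i div n) j) y"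
        by (intro cip_cong) auto
      also have "\<dots> = x (i mod n) * cnj (cip n y (std_basis (i div n)))" by (simp add: cip_scale_left cip_cnj)
      finally show ?thesis using lt by (simp add: cip_std_basis)
    qed
    then have "(\<Sum>i<m. (cmod (cip n (kap n (ent (X i)) x) y))\<^sup>2) = (\<Sum>i<m. (cmod (x (i mod n)))\<^sup>2 * (cmod (y (i div n)))\<^sup>2)"
      by (intro sum.cong refl) (simp add: norm_mult power_mult_distrib)
    also have "\<dots> = (\<Sum>j<n. \<Sum>i\<in>{j * n..<j * n + n}. (cmod (x (i mod n)))\<^sup>2 * (cmod (y (i div n)))\<^sup>2)"
      unfolding m_def by (rule sum.nat_group[symmetric])
    also have "\<dots> = (\<Sum>j<n. \<Sum>k<n. (cmod (x k))\<^sup>2 * (cmod (y j))\<^sup>2)"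
    proof (rule sum.cong[OF refl])
      fix j
      have "(\<Sum>i\<in>{j * n..<j * n + n}. (cmod (x (i mod n)))\<^sup>2 * (cmod (y (i div n)))\<^sup>2)
        = (\<Sum>k<n. (cmod (x ((j * n + k) mod n)))\<^sup>2 * (cmod (y ((j * n + k) div n)))\<^sup>2)"
        using sum.shift_bounds_nat_ivl[of "\<lambda>i. (cmod (x (i mod n)))\<^sup>2 * (cmod (y (i div n)))\<^sup>2" 0 "j * n" n]
        by (simp add: lessThan_atLeast0 add.commute)
      also have "\<dots> = (\<Sum>k<n. (cmod (x k))\<^sup>2 * (cmod (y j))\<^sup>2)"
        by (intro sum.cong) auto
      finally show "(\<Sum>i\<in>{j * n..<j * n + n}. (cmod (x (i mod n)))\<^sup>2 * (cmod (y (i div n)))\<^sup>2) = (\<Sum>k<n. (cmod (x k))\<^sup>2 * (cmod (y j))\<^sup>2)" .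
    qed
    also have "\<dots> = nsq n y * nsq n x"
      unfolding nsq_def sum_product by (intro sum.cong refl mult.commute)
    also have "\<dots> \<le> 1 * 1" using that by (intro mult_mono) auto
    finally show ?thesis by simp
  qed
  obtain h where h: "h \<in> borel_measurable M" "\<And>\<omega>. (schatten_norm \<top> (matcomb n m X (\<lambda>i. g i \<omega>)))\<^sup>2 \<le> h \<omega>"
    "(\<integral>\<^sup>+\<omega>. ennreal (h \<omega>) \<partial>M) \<le> ennreal (4672 * real n * 1\<^sup>2)"
    using gaussian_matrix_top[where X = X, OF G n zero_le_one weakop] by blast
  note [measurable] = h(1)
  have h0: "0 \<le> h \<omega>" for \<omega> using h(2)[of \<omega>] by (meson order_trans zero_le_power2)
  \<comment> \<open>Chosen so that the operator norm part \<open>h / (2 l)\<close> has mean at most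
    n^2 / 2, half of the mean n^2 of the squared Hilbert-Schmidt norm \<open>F\<close>.\<close>
  define l where "l = 4672 / real n"
  have l: "0 < l" using n by (simp add: l_def)
  define F where "F \<omega> = (\<Sum>i<m. (g i \<omega>)\<^sup>2)" for \<omega>
  have [measurable]: "F \<in> borel_measurable M" unfolding F_def[abs_def] by measurable
  have intF: "(\<integral>\<^sup>+\<omega>. ennreal (F \<omega>) \<partial>M) = ennreal (real n * real n)"
  proof -
    have "(\<integral>\<^sup>+\<omega>. ennreal (F \<omega>) \<partial>M) = (\<Sum>i<m. \<integral>\<^sup>+\<omega>. ennreal ((g i \<omega>)\<^sup>2) \<partial>M)"
      unfolding F_def by (subst nn_integral_sum[symmetric]) (auto intro!: nn_integral_cong)
    also have "\<dots> = (\<Sum>i<m. 1)"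
    proof (rule sum.cong[OF refl])
      fix i assume i: "i \<in> {..<m}"
      have "(\<Sum>l<m. (if l = i then 1 else 0) * g l \<omega>) = g i \<omega>" for \<omega>
        using i by (simp add: if_distrib if_distribR cong: if_cong)
      moreover have "(\<Sum>l<m. (if l = i then 1 else 0 :: real)\<^sup>2) = 1"
        using i by (simp add: if_distrib if_distribR cong: if_cong)
      ultimately show "(\<integral>\<^sup>+\<omega>. ennreal ((g i \<omega>)\<^sup>2) \<partial>M) = 1"
        using gaussian_comb_square[OF G, of "\<lambda>l. if l = i then 1 else 0"] by simp
    qed
    also have "\<dots> = ennreal (real n * real n)" by (simp add: m_def ennreal_of_nat_eq_real_of_nat)
    finally show ?thesis .
  qed
  \<comment> \<open>The norm of the identity from exponent \<open>v\<close> to exponent 1.\<close>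
  define K where "K = real n powr (1 - recip v)"
  have K: "0 < K" using n by (simp add: K_def)
  \<comment> \<open>A measurable minorant of the squared norm. Where it is negative,
    \<open>ennreal\<close> truncates it to 0, which can only increase its integral.\<close>
  have pt: "2 / (l * K\<^sup>2) * (F \<omega> - h \<omega> / (2 * l)) \<le> (schatten_norm v (matcomb n m X (\<lambda>i. g i \<omega>)))\<^sup>2" for \<omega>
  proof -
    let ?A = "matcomb n m X (\<lambda>i. g i \<omega>)"
    have "F \<omega> = (schatten_norm 2 ?A)\<^sup>2" unfolding matcomb_def frob by (simp add: F_def)
    also have "\<dots> \<le> l / 2 * (schatten_norm 1 ?A)\<^sup>2 + (schatten_norm \<top> ?A)\<^sup>2 / (2 * l)"
      by (rule schatten_2_le[OF matcomb_carrier l])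
    also have "\<dots> \<le> l / 2 * (K * schatten_norm v ?A)\<^sup>2 + h \<omega> / (2 * l)"
    proof (intro add_mono mult_left_mono power_mono divide_right_mono h schatten_norm_nonneg[OF matcomb_carrier])
      have "max 0 (recip 1 - recip v) = 1 - recip v" using recip_le_1[OF v] by (simp add: recip_eq)
      then show "schatten_norm 1 ?A \<le> K * schatten_norm v ?A"
        using schatten_compare[OF matcomb_carrier v _ n, of 1 m X "\<lambda>i. g i \<omega>"] by (simp add: K_def)
    qed (use l in auto)
    finally have "F \<omega> - h \<omega> / (2 * l) \<le> l * K\<^sup>2 / 2 * (schatten_norm v ?A)\<^sup>2" by (simp add: power_mult_distrib)
    then have "2 / (l * K\<^sup>2) * (F \<omega> - h \<omega> / (2 * l)) \<le> 2 / (l * K\<^sup>2) * (l * K\<^sup>2 / 2 * (schatten_norm v ?A)\<^sup>2)"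
      using l K by (intro mult_left_mono) auto
    then show ?thesis using l K by simp
  qed
  have half: "ennreal (real n * real n / 2) \<le> (\<integral>\<^sup>+\<omega>. ennreal (F \<omega> - h \<omega> / (2 * l)) \<partial>M)"
  proof -
    define I where "I = (\<integral>\<^sup>+\<omega>. ennreal (F \<omega> - h \<omega> / (2 * l)) \<partial>M)"
    have "ennreal (real n * real n) \<le> (\<integral>\<^sup>+\<omega>. ennreal (F \<omega> - h \<omega> / (2 * l)) + ennreal (1 / (2 * l)) * ennreal (h \<omega>) \<partial>M)"
      unfolding intF[symmetric]
    proof (rule nn_integral_mono)
      fix \<omega>
      have "ennreal (F \<omega>) \<le> ennreal ((F \<omega> - h \<omega> / (2 * l)) + h \<omega> / (2 * l))" by simp
      also have "\<dots> \<le> ennreal (F \<omega> - h \<omega> / (2 * l)) + ennreal (h \<omega> / (2 * l))"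
        using l h0[of \<omega>] by (auto simp: ennreal_plus_if intro!: ennreal_leI)
      also have "ennreal (h \<omega> / (2 * l)) = ennreal (1 / (2 * l)) * ennreal (h \<omega>)"
        using l h0 by (subst ennreal_mult[symmetric]) auto
      finally show "ennreal (F \<omega>) \<le> ennreal (F \<omega> - h \<omega> / (2 * l)) + ennreal (1 / (2 * l)) * ennreal (h \<omega>)" .
    qed
    also have "\<dots> = I + ennreal (1 / (2 * l)) * (\<integral>\<^sup>+\<omega>. ennreal (h \<omega>) \<partial>M)"
      unfolding I_def by (subst nn_integral_add) (auto simp: nn_integral_cmult)
    also have "\<dots> \<le> I + ennreal (1 / (2 * l)) * ennreal (4672 * real n * 1\<^sup>2)"
      by (intro add_left_mono mult_left_mono h) auto
    also have "ennreal (1 / (2 * l)) * ennreal (4672 * real n * 1\<^sup>2) = ennreal (real n * real n / 2)"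
      using l n by (subst ennreal_mult[symmetric]) (auto simp: l_def)
    finally have "ennreal (real n * real n) \<le> I + ennreal (real n * real n / 2)" .
    then have "ennreal (real n * real n) - ennreal (real n * real n / 2) \<le> I"
      by (simp add: ennreal_minus_le_iff add.commute)
    moreover have "ennreal (real n * real n) - ennreal (real n * real n / 2) = ennreal (real n * real n / 2)"
      by (subst ennreal_minus) auto
    ultimately show ?thesis by (simp add: I_def)
  qed
  define B where "B = 1 / sqrt 4672 * real n powr (1 / 2 + recip v)"
  have B2: "B\<^sup>2 = 2 / (l * K\<^sup>2) * (real n * real n / 2)"
  proof -
    have "(real n powr (1 / 2 + recip v))\<^sup>2 * K\<^sup>2 = (real n powr (1 / 2 + recip v) * K)\<^sup>2" by (simp add: power_mult_distrib)
    also have "real n powr (1 / 2 + recip v) * K = real n powr (3 / 2)" by (simp add: K_def flip: powr_add)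
    also have "\<dots>\<^sup>2 = real n powr 3" by (simp add: power2_eq_square flip: powr_add)
    also have "\<dots> = real n ^ 3" using n by (simp add: powr_numeral)
    finally have "(real n powr (1 / 2 + recip v))\<^sup>2 = real n ^ 3 / K\<^sup>2" using K by (simp add: field_simps)
    then show ?thesis using n by (simp add: B_def power_mult_distrib power_divide l_def power3_eq_cube)
  qed
  have "ennreal (B / real n powr \<tau>) \<le> pi_gamma M g (schatten_space u n) (schatten_space v n) (\<lambda>x. x)"
  proof (rule schatten_lower[OF g, where X = X and m = m])
    show "schatten_norm u (Matrix.mat n n (\<lambda>(j, k). \<Sum>i<m. a i * X i $$ (j, k))) \<le> real n powr \<tau> * sqrt (\<Sum>i<m. (cmod (a i))\<^sup>2)" for a
    proof -
      let ?A = "Matrix.mat n n (\<lambda>(j, k). \<Sum>i<m. a i * X i $$ (j, k))"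
      have "schatten_norm 2 ?A = sqrt (\<Sum>i<m. (cmod (a i))\<^sup>2)"
        unfolding frob[symmetric] using schatten_norm_nonneg[of ?A n 2] by simp
      then show ?thesis using schatten_compare[of ?A n 2 u] u n by (simp add: \<tau>_def r2)
    qed
    have "ennreal (B\<^sup>2) = ennreal (2 / (l * K\<^sup>2)) * ennreal (real n * real n / 2)"
      unfolding B2 using l K by (intro ennreal_mult) auto
    also have "\<dots> \<le> ennreal (2 / (l * K\<^sup>2)) * (\<integral>\<^sup>+\<omega>. ennreal (F \<omega> - h \<omega> / (2 * l)) \<partial>M)"
      by (intro mult_left_mono half) auto
    also have "\<dots> = (\<integral>\<^sup>+\<omega>. ennreal (2 / (l * K\<^sup>2)) * ennreal (F \<omega> - h \<omega> / (2 * l)) \<partial>M)"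
      by (rule nn_integral_cmult[symmetric]) measurable
    also have "\<dots> \<le> (\<integral>\<^sup>+\<omega>. ennreal ((schatten_norm v (matcomb n m X (\<lambda>i. g i \<omega>)))\<^sup>2) \<partial>M)"
    proof (rule nn_integral_mono)
      fix \<omega>
      have "ennreal (2 / (l * K\<^sup>2)) * ennreal (F \<omega> - h \<omega> / (2 * l)) = ennreal (2 / (l * K\<^sup>2) * (F \<omega> - h \<omega> / (2 * l)))"
        using l K by (intro ennreal_mult'[symmetric]) auto
      then show "ennreal (2 / (l * K\<^sup>2)) * ennreal (F \<omega> - h \<omega> / (2 * l)) \<le> ennreal ((schatten_norm v (matcomb n m X (\<lambda>i. g i \<omega>)))\<^sup>2)"
        using pt[of \<omega>] by (simp only: ennreal_leI)
    qed
    finally show "ennreal (B\<^sup>2) \<le> (\<integral>\<^sup>+\<omega>. ennreal ((schatten_norm v (matcomb n m X (\<lambda>i. g i \<omega>)))\<^sup>2) \<partial>M)" .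
  qed (use n X in \<open>auto simp: B_def\<close>)
  then show ?thesis unfolding B_def \<tau>_def by (simp add: powr_diff)
qed

lemma schatten_equiv:
  assumes g: "std_gaussian_seq M g" and u: "1 \<le> u" and v: "1 \<le> v"
  shows "seq_equiv (\<lambda>n. pi_gamma M g (schatten_space u n) (schatten_space v n) (\<lambda>x. x))
    (\<lambda>n. real n powr (1 / 2 + crit u v))"
proof -
  obtain C where C: "C > 0" "\<And>n. 1 \<le> n \<Longrightarrow> pi_gamma M g (schatten_space u n) (schatten_space v n) (\<lambda>x. x) \<le> ennreal (C * real n powr (1 / 2 + crit u v))"
    using schatten_upper[OF g u v] by blast
  have "ennreal (1 / sqrt 4672 * real n powr (1 / 2 + crit u v)) \<le> pi_gamma M g (schatten_space u n) (schatten_space v n) (\<lambda>x. x)"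
    if n: "1 \<le> n" for n
  \<comment> \<open>In the first case \<open>crit\<close> is 0 and one row of matrix units suffices;
    otherwise its outer maximum is inactive and all matrix units are used.\<close>
  proof (cases "recip v \<le> max 0 (recip u - 1 / 2)")
    case True
    then have "1 / sqrt 4672 * real n powr (1 / 2 + crit u v) \<le> 1 * sqrt n"
      using n by (intro mult_mono) (auto simp: crit_def powr_half_sqrt)
    then have "ennreal (1 / sqrt 4672 * real n powr (1 / 2 + crit u v)) \<le> ennreal (sqrt n)" by (simp add: ennreal_leI)
    also note schatten_lower_row[OF g n u v]
    finally show ?thesis .
  next
    case False
    then show ?thesis using schatten_lower_full[OF g n u v] by (simp add: crit_def add_diff_eq)
  qed
  then show ?thesis unfolding seq_equiv_def using C by (intro exI[of _ "1 / sqrt 4672"] conjI exI[of _ C]) auto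
qed

section \<open>The limit order\<close>

lemma lpf_scale:
  fixes f :: "nat \<Rightarrow> real"
  assumes "1 \<le> p" "0 \<le> c"
  shows "lpf n p (\<lambda>i. c * f i) \<le> c * lpf n p f"
proof (cases "p = \<top>")
  case True
  then show ?thesis
    using assms lpf_ge[of \<top> _ n f] by (auto simp: abs_mult intro!: lpf_top_le mult_left_mono)
next
  case False
  have "(\<Sum>i<n. norm (c * f i) powr enn2real p) = c powr enn2real p * (\<Sum>i<n. norm (f i) powr enn2real p)"
    using assms by (simp add: abs_mult powr_mult sum_distrib_left)
  also have "\<dots> = (c * lpf n p f) powr enn2real p"
    by (simp add: powr_mult lpf_powr assms False)
  finally show ?thesis using assms by (intro lpf_fin_le False) auto
qed

lemma lp_norm_nonneg [simp]: "0 \<le> lp_norm p x"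
proof -
  have "lp_norm p x = lpf (dim_vec x) p (vec_index x)" by (intro arg_cong[where f = "lp_norm p"] eq_vecI) auto
  then show ?thesis by simp
qed

lemma lp_norm_eq_lpf: "x \<in> carrier_vec n \<Longrightarrow> lp_norm p x = lpf n p (vec_index x)"
  by (intro arg_cong[where f = "lp_norm p"] eq_vecI) auto

lemma lin_form_vector: "lin_form (lp_space u n) (\<lambda>x. \<Sum>j<n. d j * x $ j)"
  unfolding lin_form_def lp_space_simps
  by (auto simp: sum.distrib sum_distrib_left algebra_simps)

lemma lp_holder_finite:
  assumes x: "x \<in> carrier_vec n" and a: "1 < a" and b: "1 < b" "1 / a + 1 / b = 1"
  shows "cmod (\<Sum>j<n. d j * x $ j) \<le> (\<Sum>j<n. cmod (d j) powr b) powr (1 / b) * lp_norm (ennreal a) x"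
proof -
  have "cmod (\<Sum>j<n. d j * x $ j) \<le> (\<Sum>j<n. cmod (d j) * cmod (x $ j))"
    by (rule order_trans[OF norm_sum]) (simp add: norm_mult)
  \<comment> \<open>The ordinary Hoelder inequality is the case in which the weights form the
    identity matrix.\<close>
  also have "\<dots> = (\<Sum>k<n. \<Sum>j<n. cmod (d k) * cmod (x $ j) * (if j = k then 1 else 0))"
    by (simp add: if_distrib cong: if_cong)
  also have "\<dots> \<le> (\<Sum>j<n. cmod (x $ j) powr a) powr (1 / a) * (\<Sum>j<n. cmod (d j) powr b) powr (1 / b)"
    by (rule substochastic_holder) (use a b in auto)
  also have "(\<Sum>j<n. cmod (x $ j) powr a) powr (1 / a) = lp_norm (ennreal a) x"
    using a by (simp add: lp_norm_eq_lpf[OF x] lpf_fin)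
  finally show ?thesis by (simp add: mult.commute)
qed

lemma weak_lp_lin:
  assumes X: "\<And>i. i < m \<Longrightarrow> x i \<in> carrier_vec n" and c: "0 \<le> c"
    and bd: "\<And>y. y \<in> carrier_vec n \<Longrightarrow> cmod (\<Sum>j<n. d j * y $ j) \<le> c * lp_norm u y"
  shows "(\<Sum>i<m. (cmod (\<Sum>j<n. d j * x i $ j))\<^sup>2) \<le> (c * weak (lp_space u n) m x)\<^sup>2"
  by (rule weak_lin_form[OF _ lin_form_vector _ c])
     (use X bd in \<open>auto simp: lp_space_simps\<close>)

text \<open>Signs are chosen so that one multiplier controls the weighted sum of squares over all
  coordinates; the bound on the multiplier is uniform in the signs.\<close>

lemma weak_lp_signs:
  fixes d :: "nat \<Rightarrow> real"
  assumes X: "\<And>i. i < m \<Longrightarrow> x i \<in> carrier_vec n" and c: "0 \<le> c"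
    and bd: "\<And>\<epsilon> y. (\<And>k. \<bar>\<epsilon> k\<bar> = 1) \<Longrightarrow> y \<in> carrier_vec n \<Longrightarrow> cmod (\<Sum>j<n. complex_of_real (\<epsilon> j * d j) * y $ j) \<le> c * lp_norm u y"
  shows "(\<Sum>j<n. (d j)\<^sup>2 * (\<Sum>i<m. (cmod (x i $ j))\<^sup>2)) \<le> (c * weak (lp_space u n) m x)\<^sup>2"
proof -
  obtain \<epsilon> where eps: "\<And>k. \<bar>\<epsilon> k\<bar> = (1::real)"
    "(\<Sum>i<m. \<Sum>k<n. (cmod (complex_of_real (d k) * x i $ k))\<^sup>2) \<le> (\<Sum>i<m. (cmod (\<Sum>k<n. of_real (\<epsilon> k) * (complex_of_real (d k) * x i $ k)))\<^sup>2)"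
    using exists_signs[where m = m and n = n and c = "\<lambda>i k. complex_of_real (d k) * x i $ k"] by blast
  have "(\<Sum>j<n. (d j)\<^sup>2 * (\<Sum>i<m. (cmod (x i $ j))\<^sup>2)) = (\<Sum>i<m. \<Sum>k<n. (cmod (complex_of_real (d k) * x i $ k))\<^sup>2)"
    by (subst sum.swap) (simp add: norm_mult power_mult_distrib sum_distrib_left)
  also note eps(2)
  also have "(\<Sum>i<m. (cmod (\<Sum>k<n. of_real (\<epsilon> k) * (complex_of_real (d k) * x i $ k)))\<^sup>2)
    = (\<Sum>i<m. (cmod (\<Sum>k<n. complex_of_real (\<epsilon> k * d k) * x i $ k))\<^sup>2)"
    by (simp add: mult.assoc)
  also have "\<dots> \<le> (c * weak (lp_space u n) m x)\<^sup>2"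
    by (rule weak_lp_lin[OF X c bd]) (simp_all add: eps(1))
  finally show ?thesis .
qed

lemma weak_lp_nonneg:
  assumes "\<And>i. i < m \<Longrightarrow> x i \<in> carrier_vec n"
  shows "0 \<le> weak (lp_space u n) m x"
  by (rule weak_nonneg) (use assms in \<open>auto simp: lp_space_simps\<close>)

text \<open>The commutative counterpart of the bounds for matrices, with diagonal multipliers as
  test functionals. The Euclidean norms of the rows are the standard deviations of the Gaussian
  coordinates, up to the splitting into real and imaginary parts.\<close>

lemma row_norms_le:
  assumes u: "1 \<le> u"
  shows "\<exists>t\<ge>1. recip t = max 0 (recip u - 1 / 2) \<and>
    (\<forall>n m x. (\<forall>i<m. x i \<in> carrier_vec n) \<longrightarrow> lpf n t (\<lambda>j. sqrt (\<Sum>i<m. (cmod (x i $ j))\<^sup>2)) \<le> weak (lp_space u n) m x)"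
proof -
  consider "2 \<le> u" | "u = 1" | a where "u = ennreal a" "1 < a" "a < 2"
  proof (cases "2 \<le> u")
    case False
    then obtain a where a: "u = ennreal a" "1 \<le> a" "a < 2"
      using u by (cases u) (auto simp: ennreal_less_iff simp flip: ennreal_numeral ennreal_1)
    then show thesis using that(2) that(3)[of a] by (cases "a = 1") auto
  qed (rule that(1))
  then show ?thesis
  proof cases
    case 1
    have "recip u \<le> 1 / 2" using 1 by (cases u) (auto simp: recip_eq recip_top_eq u ennreal_le_iff2 field_simps simp flip: ennreal_numeral)
    moreover have "lpf n \<top> (\<lambda>j. sqrt (\<Sum>i<m. (cmod (x i $ j))\<^sup>2)) \<le> weak (lp_space u n) m x"
      if x: "\<And>i. i < m \<Longrightarrow> x i \<in> carrier_vec n" for n m and x :: "nat \<Rightarrow> complex Matrix.vec"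
    proof (rule lpf_top_le)
      show w0: "0 \<le> weak (lp_space u n) m x" by (rule weak_lp_nonneg[OF x])
      fix j assume j: "j < n"
      have d: "(\<Sum>k<n. (if k = j then 1 else 0) * y $ k) = y $ j" for y :: "complex Matrix.vec"
        using j by (simp add: if_distrib if_distribR cong: if_cong)
      have "(\<Sum>i<m. (cmod (\<Sum>k<n. (if k = j then 1 else 0) * x i $ k))\<^sup>2) \<le> (1 * weak (lp_space u n) m x)\<^sup>2"
      proof (rule weak_lp_lin[OF x])
        fix y :: "complex Matrix.vec" assume y: "y \<in> carrier_vec n"
        show "cmod (\<Sum>k<n. (if k = j then 1 else 0) * y $ k) \<le> 1 * lp_norm u y"
          unfolding d lp_norm_eq_lpf[OF y] using lpf_ge[OF u j, of "vec_index y"] by simp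
      qed auto
      then have "sqrt (\<Sum>i<m. (cmod (x i $ j))\<^sup>2) \<le> weak (lp_space u n) m x"
        unfolding d using w0 by (intro real_le_lsqrt) (auto simp: sum_nonneg)
      then show "norm (sqrt (\<Sum>i<m. (cmod (x i $ j))\<^sup>2)) \<le> weak (lp_space u n) m x" by (simp add: sum_nonneg)
    qed
    ultimately show ?thesis by (intro exI[of _ \<top>]) (auto simp: recip_top_eq)
  next
    case 2
    have "lpf n 2 (\<lambda>j. sqrt (\<Sum>i<m. (cmod (x i $ j))\<^sup>2)) \<le> weak (lp_space u n) m x"
      if x: "\<And>i. i < m \<Longrightarrow> x i \<in> carrier_vec n" for n m and x :: "nat \<Rightarrow> complex Matrix.vec"
    proof (rule power2_le_imp_le)
      have "(\<Sum>j<n. 1\<^sup>2 * (\<Sum>i<m. (cmod (x i $ j))\<^sup>2)) \<le> (1 * weak (lp_space u n) m x)\<^sup>2"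
      proof (rule weak_lp_signs[OF x])
        fix \<epsilon> :: "nat \<Rightarrow> real" and y :: "complex Matrix.vec" assume eps: "\<And>k. \<bar>\<epsilon> k\<bar> = 1" and y: "y \<in> carrier_vec n"
        show "cmod (\<Sum>j<n. complex_of_real (\<epsilon> j * 1) * y $ j) \<le> 1 * lp_norm u y"
          unfolding 2 lp_norm_eq_lpf[OF y] lpf_1 by (rule order_trans[OF norm_sum]) (simp add: norm_mult eps)
      qed auto
      then show "(lpf n 2 (\<lambda>j. sqrt (\<Sum>i<m. (cmod (x i $ j))\<^sup>2)))\<^sup>2 \<le> (weak (lp_space u n) m x)\<^sup>2"
        by (simp add: lpf_2 sum_nonneg)
    qed (rule weak_lp_nonneg[OF x])
    then show ?thesis using 2 by (intro exI[of _ 2]) (auto simp: recip_eq)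
  next
    case (3 a)
    define r where "r = 1 / (1 / a - 1 / 2)"
    have pos: "1 / a - 1 / 2 > 0" "1 / a - 1 / 2 < 1 / 2" using 3 by (auto simp: field_simps)
    then have r: "1 / r = 1 / a - 1 / 2" "2 < r" by (auto simp: r_def field_simps)
    have rr: "recip (ennreal r) = 1 / r" using r(2) by (subst recip_eq) auto
    have ru: "recip (ennreal a) = 1 / a" using 3 by (subst recip_eq) auto
    define \<beta> where "\<beta> = a / (a - 1)"
    have \<beta>: "1 < \<beta>" "1 / a + 1 / \<beta> = 1" using 3 by (auto simp: \<beta>_def field_simps)
    have \<beta>r: "2 / \<beta> = 1 - 2 / r"
    proof -
      have "2 / r = 2 * (1 / r)" by simp
      also have "\<dots> = 2 / a - 1" unfolding r(1) by simp
      finally show ?thesis using 3 by (simp add: \<beta>_def field_simps)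
    qed
    have row: "lpf n (ennreal r) (\<lambda>j. sqrt (\<Sum>i<m. (cmod (x i $ j))\<^sup>2)) \<le> weak (lp_space u n) m x"
      if x: "\<And>i. i < m \<Longrightarrow> x i \<in> carrier_vec n" for n m and x :: "nat \<Rightarrow> complex Matrix.vec"
    proof -
      define \<alpha> where "\<alpha> j = sqrt (\<Sum>i<m. (cmod (x i $ j))\<^sup>2)" for j
      define w where "w = weak (lp_space u n) m x"
      have w0: "0 \<le> w" unfolding w_def by (rule weak_lp_nonneg[OF x])
      have \<alpha>0: "0 \<le> \<alpha> j" for j by (simp add: \<alpha>_def sum_nonneg)
      define W where "W = (\<Sum>j<n. \<alpha> j powr r)"
      have W0: "0 \<le> W" by (simp add: W_def sum_nonneg)
      \<comment> \<open>The extremal multiplier: its \<beta>-th power and its squared product with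
        \<alpha> both equal \<alpha>^r, so that both sides become powers of
        \<open>W\<close>.\<close>
      define d where "d j = \<alpha> j powr (r / \<beta>)" for j
      have "(\<Sum>j<n. (d j)\<^sup>2 * (\<Sum>i<m. (cmod (x i $ j))\<^sup>2)) \<le> (W powr (1 / \<beta>) * w)\<^sup>2"
        unfolding w_def
      proof (rule weak_lp_signs[OF x])
        fix \<epsilon> :: "nat \<Rightarrow> real" and y :: "complex Matrix.vec" assume eps: "\<And>k. \<bar>\<epsilon> k\<bar> = 1" and y: "y \<in> carrier_vec n"
        have "(\<Sum>j<n. cmod (complex_of_real (\<epsilon> j * d j)) powr \<beta>) = W"
          unfolding W_def using \<beta> \<alpha>0 eps by (intro sum.cong refl) (simp add: norm_mult d_def powr_powr)
        then show "cmod (\<Sum>j<n. complex_of_real (\<epsilon> j * d j) * y $ j) \<le> W powr (1 / \<beta>) * lp_norm u y"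
          using lp_holder_finite[OF y 3(2) \<beta>, of "\<lambda>j. complex_of_real (\<epsilon> j * d j)"] 3(1) by simp
      qed auto
      moreover have "(\<Sum>j<n. (d j)\<^sup>2 * (\<Sum>i<m. (cmod (x i $ j))\<^sup>2)) = W"
        unfolding W_def
      proof (intro sum.cong refl)
        fix j
        have "(\<Sum>i<m. (cmod (x i $ j))\<^sup>2) = (\<alpha> j)\<^sup>2" by (simp add: \<alpha>_def sum_nonneg)
        moreover have "(d j)\<^sup>2 = \<alpha> j powr (r - 2)"
        proof -
          have "2 * (r / \<beta>) = r * (2 / \<beta>)" by simp
          also have "\<dots> = r - 2" unfolding \<beta>r using r(2) by (simp add: field_simps)
          finally have "r / \<beta> + r / \<beta> = r - 2" by simp
          then show ?thesis by (simp add: d_def power2_eq_square flip: powr_add)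
        qed
        moreover have "\<alpha> j powr (r - 2) * (\<alpha> j)\<^sup>2 = \<alpha> j powr r"
        proof (cases "\<alpha> j = 0")
          case False
          then have "\<alpha> j powr (r - 2) * \<alpha> j powr 2 = \<alpha> j powr r" by (simp flip: powr_add)
          then show ?thesis using False \<alpha>0[of j] by (simp add: powr_numeral)
        qed simp
        ultimately show "(d j)\<^sup>2 * (\<Sum>i<m. (cmod (x i $ j))\<^sup>2) = \<alpha> j powr r" by simp
      qed
      moreover have "(W powr (1 / \<beta>))\<^sup>2 = W powr (2 / \<beta>)"
        by (simp add: power2_eq_square flip: powr_add)
      ultimately have le: "W \<le> W powr (2 / \<beta>) * w\<^sup>2" by (simp add: power_mult_distrib)
      have "W powr (1 / r) \<le> w"
      proof (cases "W = 0")
        case False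
        have "W = W powr (2 / \<beta>) * W powr (2 / r)" using False W0 unfolding \<beta>r by (simp flip: powr_add)
        then have "W powr (2 / \<beta>) * W powr (2 / r) \<le> W powr (2 / \<beta>) * w\<^sup>2" using le by simp
        then have "W powr (2 / r) \<le> w\<^sup>2" using False by simp
        moreover have "(W powr (1 / r))\<^sup>2 = W powr (2 / r)" by (simp add: power2_eq_square flip: powr_add)
        ultimately have "(W powr (1 / r))\<^sup>2 \<le> w\<^sup>2" by metis
        then show ?thesis using w0 by (rule power2_le_imp_le)
      qed (use w0 in simp)
      moreover have "lpf n (ennreal r) \<alpha> = W powr (1 / r)"
        using r(2) \<alpha>0 by (simp add: lpf_fin W_def)
      ultimately show ?thesis by (simp add: w_def \<alpha>_def[abs_def])
    qed
    have "1 \<le> ennreal r" using r(2) by (simp flip: ennreal_1)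
    moreover have "recip (ennreal r) = max 0 (recip u - 1 / 2)"
      unfolding rr 3(1) ru r(1) using pos by simp
    ultimately show ?thesis by (intro exI[of _ "ennreal r"] conjI allI impI row) simp_all
  qed
qed

lemma lp_upper:
  assumes g: "std_gaussian_seq (M::'w measure) g" and u: "1 \<le> u" and v: "1 \<le> v" and n: "1 \<le> n"
  shows "pi_gamma M g (lp_space u n) (lp_space v n) (\<lambda>x. x) \<le> ennreal (sqrt (8 * ln n + 16) * real n powr crit u v)"
proof -
  obtain t where t: "1 \<le> t" "recip t = max 0 (recip u - 1 / 2)"
    and row: "\<And>n m x. (\<forall>i<m. x i \<in> carrier_vec n) \<Longrightarrow> lpf n t (\<lambda>j. sqrt (\<Sum>i<m. (cmod (x i $ j))\<^sup>2)) \<le> weak (lp_space u n) m x"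
    using row_norms_le[OF u] by blast
  define L where "L = 8 * ln (real n) + 16"
  have L: "16 \<le> L" using n by (simp add: L_def)
  show ?thesis
  proof (rule pi_gamma_upper)
    have "0 < 8 * ln (real n) + 16" using L unfolding L_def by linarith
    then show "0 < sqrt (8 * ln n + 16) * real n powr crit u v" using n by (intro mult_pos_pos) auto
    show "bounded_clinear_on (lp_space u n) (lp_space v n) (\<lambda>x. x)"
    proof -
      have "lp_norm v x \<le> real n powr max 0 (recip v - recip u) * lp_norm u x" if "x \<in> carrier_vec n" for x
        unfolding lp_norm_eq_lpf[OF that] by (rule lpf_compare[OF u v n])
      then show ?thesis unfolding bounded_clinear_on_def clinear_on_def lp_space_simps by auto
    qed
    fix m and b :: "nat \<Rightarrow> 'w \<Rightarrow> real" and x :: "nat \<Rightarrow> complex Matrix.vec"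
    assume b: "inj_on b {..<m}" "b ` {..<m} \<subseteq> range g" and "\<And>i. i < m \<Longrightarrow> x i \<in> carrier (lp_space u n)"
    then have x: "\<And>i. i < m \<Longrightarrow> x i \<in> carrier_vec n" by (simp add: lp_space_simps)
    have G: "gfam M b m" by (rule gfam_of_seq[OF g b])
    note [measurable] = gfam_measurable[OF G]
    define \<alpha> where "\<alpha> j = sqrt (\<Sum>i<m. (cmod (x i $ j))\<^sup>2)" for j
    have \<alpha>0: "0 \<le> \<alpha> j" for j by (simp add: \<alpha>_def sum_nonneg)
    have \<alpha>2: "(\<alpha> j)\<^sup>2 = (\<Sum>i<m. (cmod (x i $ j))\<^sup>2)" for j by (simp add: \<alpha>_def sum_nonneg)
    \<comment> \<open>Rows are normalised so that one maximum over \<open>n\<close> combinations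
      controls all coordinates. For a vanishing row the quotient by 0 is 0, and \<open>xc\<close>
      still holds.\<close>
    define c where "c j i = x i $ j / complex_of_real (\<alpha> j)" for j i
    have c1: "(\<Sum>i<m. (cmod (c j i))\<^sup>2) \<le> 1\<^sup>2" for j
    proof -
      have "(\<Sum>i<m. (cmod (c j i))\<^sup>2) = (\<Sum>i<m. (cmod (x i $ j))\<^sup>2) / (\<alpha> j)\<^sup>2"
        by (simp add: c_def norm_divide power_divide sum_divide_distrib)
      then show ?thesis by (simp add: \<alpha>2)
    qed
    have xc: "x i $ j = complex_of_real (\<alpha> j) * c j i" if "i < m" for i j
    proof (cases "\<alpha> j = 0")
      case True
      then have "(\<Sum>i<m. (cmod (x i $ j))\<^sup>2) = 0" using \<alpha>2[of j] by simp
      then show ?thesis using that True by (simp add: sum_nonneg_eq_0_iff)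
    qed (simp add: c_def)
    have J: "finite {..<n}" "{..<n} \<noteq> {}" using n by (auto simp: lessThan_empty_iff)
    define h where "h \<omega> = Max ((\<lambda>j. (cmod (\<Sum>i<m. complex_of_real (b i \<omega>) * c j i))\<^sup>2) ` {..<n})" for \<omega>
    have hj: "(cmod (\<Sum>i<m. complex_of_real (b i \<omega>) * c j i))\<^sup>2 \<le> h \<omega>" if "j < n" for j \<omega>
      unfolding h_def using that by (intro Max_ge) auto
    have h0: "0 \<le> h \<omega>" for \<omega> by (rule order_trans[OF zero_le_power2 hj[of 0]]) (use n in simp)
    have hM: "h \<in> borel_measurable M"
      unfolding h_def[abs_def] by (intro borel_measurable_Max) auto
    have Eh: "(\<integral>\<^sup>+\<omega>. ennreal (h \<omega>) \<partial>M) \<le> ennreal L"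
      using gaussian_ccomb_max[OF G J zero_le_one c1] unfolding h_def L_def by simp
    define w where "w = weak (lp_space u n) m x"
    define K where "K = real n powr crit u v * w"
    have \<alpha>K: "lpf n v \<alpha> \<le> K"
    proof -
      have "lpf n v \<alpha> \<le> real n powr crit u v * lpf n t \<alpha>"
        using lpf_compare[OF t(1) v n, of \<alpha>] by (simp add: crit_def t(2))
      also have "\<dots> \<le> K" unfolding K_def w_def \<alpha>_def[abs_def] using x by (intro mult_left_mono row) auto
      finally show ?thesis .
    qed
    have pt: "(lp_norm v (Matrix.vec n (\<lambda>j. \<Sum>i<m. complex_of_real (b i \<omega>) * x i $ j)))\<^sup>2 \<le> K\<^sup>2 * h \<omega>" for \<omega>
    proof -
      \<comment> \<open>The common factor \<open>sqrt (h \<omega>)\<close> is taken out of the norm;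
        what remains is the deterministic sequence \<alpha>.\<close>
      have "lpf n v (\<lambda>j. \<Sum>i<m. complex_of_real (b i \<omega>) * x i $ j) \<le> lpf n v (\<lambda>j. sqrt (h \<omega>) * \<alpha> j)"
      proof (rule lpf_mono[OF v])
        fix j assume j: "j < n"
        have "(\<Sum>i<m. complex_of_real (b i \<omega>) * x i $ j) = complex_of_real (\<alpha> j) * (\<Sum>i<m. complex_of_real (b i \<omega>) * c j i)"
          unfolding sum_distrib_left by (intro sum.cong refl) (simp add: xc)
        then have "norm (\<Sum>i<m. complex_of_real (b i \<omega>) * x i $ j) = \<alpha> j * cmod (\<Sum>i<m. complex_of_real (b i \<omega>) * c j i)"
          using \<alpha>0 by (simp add: norm_mult)
        also have "\<dots> \<le> \<alpha> j * sqrt (h \<omega>)"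
          using \<alpha>0 hj[OF j] by (intro mult_left_mono real_le_rsqrt) auto
        finally show "norm (\<Sum>i<m. complex_of_real (b i \<omega>) * x i $ j) \<le> norm (sqrt (h \<omega>) * \<alpha> j)"
          using \<alpha>0 h0 by (simp add: mult.commute)
      qed
      also have "\<dots> \<le> sqrt (h \<omega>) * lpf n v \<alpha>" using h0 by (intro lpf_scale v) simp
      also have "\<dots> \<le> sqrt (h \<omega>) * K" using \<alpha>K h0 by (intro mult_left_mono) auto
      finally have "(lpf n v (\<lambda>j. \<Sum>i<m. complex_of_real (b i \<omega>) * x i $ j))\<^sup>2 \<le> (sqrt (h \<omega>) * K)\<^sup>2"
        by (intro power_mono) auto
      then show ?thesis using h0 by (simp add: power_mult_distrib mult.commute)
    qed
    have "(\<integral>\<^sup>+\<omega>. ennreal ((nrm (lp_space v n) (finsum (lp_space v n) (\<lambda>i. complex_of_real (b i \<omega>) \<odot>\<^bsub>lp_space v n\<^esub> x i) {..<m}))\<^sup>2) \<partial>M)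
      \<le> (\<integral>\<^sup>+\<omega>. ennreal (K\<^sup>2) * ennreal (h \<omega>) \<partial>M)"
    proof (rule nn_integral_mono)
      fix \<omega>
      have fs: "finsum (lp_space v n) (\<lambda>i. complex_of_real (b i \<omega>) \<odot>\<^bsub>lp_space v n\<^esub> x i) {..<m}
        = Matrix.vec n (\<lambda>j. \<Sum>i<m. complex_of_real (b i \<omega>) * x i $ j)"
        by (rule finsum_lp) (rule x)
      show "ennreal ((nrm (lp_space v n) (finsum (lp_space v n) (\<lambda>i. complex_of_real (b i \<omega>) \<odot>\<^bsub>lp_space v n\<^esub> x i) {..<m}))\<^sup>2)
        \<le> ennreal (K\<^sup>2) * ennreal (h \<omega>)"
        unfolding lp_space_simps(5) fs using pt h0 by (subst ennreal_mult[symmetric]) (auto intro: ennreal_leI)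
    qed
    also have "\<dots> = ennreal (K\<^sup>2) * (\<integral>\<^sup>+\<omega>. ennreal (h \<omega>) \<partial>M)"
      using hM by (intro nn_integral_cmult) auto
    also have "\<dots> \<le> ennreal (K\<^sup>2) * ennreal L" by (intro mult_left_mono Eh) auto
    also have "\<dots> = ennreal (K\<^sup>2 * L)" using L by (intro ennreal_mult[symmetric]) auto
    also have "K\<^sup>2 * L = (sqrt (8 * ln n + 16) * real n powr crit u v * weak (lp_space u n) m x)\<^sup>2"
      using L by (simp add: K_def w_def L_def power_mult_distrib)
    finally show "(\<integral>\<^sup>+\<omega>. ennreal ((nrm (lp_space v n) (finsum (lp_space v n) (\<lambda>i. complex_of_real (b i \<omega>) \<odot>\<^bsub>lp_space v n\<^esub> x i) {..<m}))\<^sup>2) \<partial>M)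
      \<le> ennreal ((sqrt (8 * ln n + 16) * real n powr crit u v * weak (lp_space u n) m x)\<^sup>2)" .
  qed
qed

section \<open>The lower estimate between sequence spaces\<close>

lemma stdn_abs: "(\<integral>\<^sup>+x. ennreal \<bar>x\<bar> \<partial>stdn) = ennreal (sqrt (2 / pi))"
proof -
  have h: "has_bochner_integral lborel (\<lambda>x. std_normal_density x * \<bar>x\<bar>) (sqrt (2 / pi))"
    using std_normal_moment_abs_odd[of 0] by simp
  have "(\<integral>\<^sup>+x. ennreal \<bar>x\<bar> \<partial>stdn) = (\<integral>\<^sup>+x. ennreal (std_normal_density x * \<bar>x\<bar>) \<partial>lborel)"
    by (subst nn_integral_stdn) (auto simp: normal_density_nonneg simp flip: ennreal_mult intro!: nn_integral_cong)
  also have "\<dots> = ennreal (sqrt (2 / pi))"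
    using h by (subst nn_integral_eq_integral) (auto simp: has_bochner_integral_iff normal_density_nonneg)
  finally show ?thesis .
qed

text \<open>The unit vectors are tested. Up to the norm of the identity, the norm of the Gaussian
  vector dominates its l_1 norm, whose mean is \<open>n\<close> times the first absolute moment
  \<open>sqrt (2 / pi)\<close>.\<close>

lemma lp_lower:
  assumes g: "std_gaussian_seq M g" and u: "1 \<le> u" and v: "1 \<le> v" and n: "1 \<le> n"
  shows "ennreal (sqrt (2 / pi) * real n powr (recip v - max 0 (recip u - 1 / 2)))
    \<le> pi_gamma M g (lp_space u n) (lp_space v n) (\<lambda>x. x)"
proof -
  have G: "gfam M g n" by (rule gfam_seq[OF g])
  note [measurable] = gfam_measurable[OF G]
  interpret prob_space M using G by (simp add: gfam_def)
  define \<mu> where "\<mu> = sqrt (2 / pi)"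
  have \<mu>: "0 < \<mu>" by (simp add: \<mu>_def)
  define \<tau> where "\<tau> = max 0 (recip u - 1 / 2)"
  have r2: "recip (2::ennreal) = 1 / 2" by (simp add: recip_eq)
  have comb: "Matrix.vec n (\<lambda>j. \<Sum>i<n. a i * unit_vec n i $ j) = Matrix.vec n a" for a :: "nat \<Rightarrow> complex"
  proof (intro eq_vecI)
    fix j assume "j < dim_vec (Matrix.vec n a)"
    then have j: "j < n" by simp
    have "(\<Sum>i<n. a i * unit_vec n i $ j) = (\<Sum>i<n. if j = i then a i else 0)"
      using j by (intro sum.cong) auto
    then show "Matrix.vec n (\<lambda>j. \<Sum>i<n. a i * unit_vec n i $ j) $ j = Matrix.vec n a $ j" using j by simp
  qed simp
  define S where "S \<omega> = (\<Sum>i<n. \<bar>g i \<omega>\<bar>)" for \<omega>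
  have [measurable]: "S \<in> borel_measurable M" unfolding S_def[abs_def] by measurable
  have S0: "0 \<le> S \<omega>" for \<omega> by (simp add: S_def sum_nonneg)
  have ES: "(\<integral>\<^sup>+\<omega>. ennreal (S \<omega>) \<partial>M) = ennreal (n * \<mu>)"
  proof -
    have "(\<integral>\<^sup>+\<omega>. ennreal (S \<omega>) \<partial>M) = (\<Sum>i<n. \<integral>\<^sup>+\<omega>. ennreal \<bar>g i \<omega>\<bar> \<partial>M)"
      unfolding S_def by (subst nn_integral_sum[symmetric]) (auto intro!: nn_integral_cong)
    also have "\<dots> = (\<Sum>i<n. ennreal \<mu>)"
    proof (rule sum.cong[OF refl])
      fix i assume i: "i \<in> {..<n}"
      have "(\<Sum>l<n. (if l = i then 1 else 0) * g l \<omega>) = g i \<omega>" for \<omega>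
        using i by (simp add: if_distrib if_distribR cong: if_cong)
      moreover have "(\<Sum>l<n. (if l = i then 1 else 0 :: real)\<^sup>2) = 1"
        using i by (simp add: if_distrib if_distribR cong: if_cong)
      ultimately show "(\<integral>\<^sup>+\<omega>. ennreal \<bar>g i \<omega>\<bar> \<partial>M) = ennreal \<mu>"
        using gaussian_comb_nn_integral[OF G, of "\<lambda>x. ennreal \<bar>x\<bar>" "\<lambda>l. if l = i then 1 else 0"] by (simp add: stdn_abs \<mu>_def)
    qed
    also have "\<dots> = ennreal (n * \<mu>)" using \<mu> by (simp add: ennreal_mult ennreal_of_nat_eq_real_of_nat)
    finally show ?thesis .
  qed
  \<comment> \<open>A second moment is at least the square of the mean, here obtained by integrating
    \<open>2 a S \<le> S^2 + a^2\<close> with \<open>a\<close> the mean of \<open>S\<close>.\<close>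
  have ES2: "ennreal ((n * \<mu>)\<^sup>2) \<le> (\<integral>\<^sup>+\<omega>. ennreal ((S \<omega>)\<^sup>2) \<partial>M)"
  proof -
    define I where "I = (\<integral>\<^sup>+\<omega>. ennreal ((S \<omega>)\<^sup>2) \<partial>M)"
    have "ennreal (2 * (n * \<mu>)) * (\<integral>\<^sup>+\<omega>. ennreal (S \<omega>) \<partial>M) = (\<integral>\<^sup>+\<omega>. ennreal (2 * (n * \<mu>)) * ennreal (S \<omega>) \<partial>M)"
      by (rule nn_integral_cmult[symmetric]) measurable
    also have "\<dots> \<le> (\<integral>\<^sup>+\<omega>. ennreal ((S \<omega>)\<^sup>2) + ennreal ((n * \<mu>)\<^sup>2) \<partial>M)"
    proof (rule nn_integral_mono)
      fix \<omega>
      have "2 * (n * \<mu>) * S \<omega> \<le> (S \<omega>)\<^sup>2 + (n * \<mu>)\<^sup>2" using sum_squares_bound[of "n * \<mu>" "S \<omega>"] by simp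
      then have "ennreal (2 * (n * \<mu>) * S \<omega>) \<le> ennreal ((S \<omega>)\<^sup>2 + (n * \<mu>)\<^sup>2)" by (rule ennreal_leI)
      moreover have "ennreal (2 * (n * \<mu>)) * ennreal (S \<omega>) = ennreal (2 * (n * \<mu>) * S \<omega>)"
        by (rule ennreal_mult[symmetric]) (use \<mu> S0 in auto)
      moreover have "ennreal ((S \<omega>)\<^sup>2) + ennreal ((n * \<mu>)\<^sup>2) = ennreal ((S \<omega>)\<^sup>2 + (n * \<mu>)\<^sup>2)"
        by (rule ennreal_plus[symmetric]) auto
      ultimately show "ennreal (2 * (n * \<mu>)) * ennreal (S \<omega>) \<le> ennreal ((S \<omega>)\<^sup>2) + ennreal ((n * \<mu>)\<^sup>2)" by metis
    qed
    also have "\<dots> = I + ennreal ((n * \<mu>)\<^sup>2)"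
      unfolding I_def by (subst nn_integral_add) (auto simp: emeasure_space_1)
    finally have "ennreal (2 * (n * \<mu>)) * ennreal (n * \<mu>) \<le> I + ennreal ((n * \<mu>)\<^sup>2)" unfolding ES .
    also have "ennreal (2 * (n * \<mu>)) * ennreal (n * \<mu>) = ennreal (2 * (n * \<mu>)\<^sup>2)"
      using \<mu> by (subst ennreal_mult[symmetric]) (auto simp: power2_eq_square)
    finally have "ennreal (2 * (n * \<mu>)\<^sup>2) - ennreal ((n * \<mu>)\<^sup>2) \<le> I"
      by (simp add: ennreal_minus_le_iff add.commute)
    moreover have "ennreal (2 * (n * \<mu>)\<^sup>2) - ennreal ((n * \<mu>)\<^sup>2) = ennreal ((n * \<mu>)\<^sup>2)"
      by (subst ennreal_minus) auto
    ultimately show ?thesis by (simp add: I_def)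
  qed
  define k where "k = real n powr (recip v - 1)"
  have k: "0 < k" using n by (simp add: k_def)
  have pt: "k * S \<omega> \<le> lpf n v (\<lambda>i. complex_of_real (g i \<omega>))" for \<omega>
  proof -
    have "max 0 (recip 1 - recip v) = 1 - recip v" using recip_le_1[OF v] by (simp add: recip_eq)
    then have "S \<omega> \<le> real n powr (1 - recip v) * lpf n v (\<lambda>i. complex_of_real (g i \<omega>))"
      using lpf_compare[OF v _ n, of 1 "\<lambda>i. complex_of_real (g i \<omega>)"] by (simp add: lpf_1 S_def)
    then have "k * S \<omega> \<le> k * (real n powr (1 - recip v) * lpf n v (\<lambda>i. complex_of_real (g i \<omega>)))"
      using k by (intro mult_left_mono) auto
    also have "\<dots> = (k * real n powr (1 - recip v)) * lpf n v (\<lambda>i. complex_of_real (g i \<omega>))" by simp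
    also have "k * real n powr (1 - recip v) = 1" using n by (simp add: k_def flip: powr_add)
    finally show ?thesis by simp
  qed
  define B where "B = k * (n * \<mu>)"
  have "ennreal (B / real n powr \<tau>) \<le> pi_gamma M g (lp_space u n) (lp_space v n) (\<lambda>x. x)"
  proof (rule pi_gamma_lower[OF g, where x = "unit_vec n" and m = n])
    show "weak (lp_space u n) n (unit_vec n) \<le> real n powr \<tau>"
    proof (rule weak_le_of_combinations)
      show "abelian_monoid (lp_space u n)" by (rule abelian_monoid_lp)
      show "nrm (lp_space u n) (finsum (lp_space u n) (\<lambda>i. a i \<odot>\<^bsub>lp_space u n\<^esub> unit_vec n i) {..<n})
        \<le> real n powr \<tau> * sqrt (\<Sum>i<n. (cmod (a i))\<^sup>2)" for a
      proof -
        have "finsum (lp_space u n) (\<lambda>i. a i \<odot>\<^bsub>lp_space u n\<^esub> unit_vec n i) {..<n} = Matrix.vec n a"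
          by (subst finsum_lp) (simp_all add: comb)
        moreover have "lpf n 2 a = sqrt (\<Sum>i<n. (cmod (a i))\<^sup>2)" unfolding lpf_2[symmetric] by simp
        ultimately show ?thesis
          using lpf_compare[of 2 u n a] u n by (simp add: lp_space_simps(5) \<tau>_def r2)
      qed
    qed (auto simp: lp_space_simps)
    have "ennreal (B\<^sup>2) = ennreal (k\<^sup>2) * ennreal ((n * \<mu>)\<^sup>2)"
      unfolding B_def power_mult_distrib[of k] by (rule ennreal_mult) auto
    also have "\<dots> \<le> ennreal (k\<^sup>2) * (\<integral>\<^sup>+\<omega>. ennreal ((S \<omega>)\<^sup>2) \<partial>M)" by (intro mult_left_mono ES2) auto
    also have "\<dots> = (\<integral>\<^sup>+\<omega>. ennreal (k\<^sup>2) * ennreal ((S \<omega>)\<^sup>2) \<partial>M)"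
      by (rule nn_integral_cmult[symmetric]) measurable
    also have "\<dots> \<le> (\<integral>\<^sup>+\<omega>. ennreal ((nrm (lp_space v n) (finsum (lp_space v n) (\<lambda>i. complex_of_real (g i \<omega>) \<odot>\<^bsub>lp_space v n\<^esub> unit_vec n i) {..<n}))\<^sup>2) \<partial>M)"
    proof (rule nn_integral_mono)
      fix \<omega>
      have fs: "finsum (lp_space v n) (\<lambda>i. complex_of_real (g i \<omega>) \<odot>\<^bsub>lp_space v n\<^esub> unit_vec n i) {..<n} = Matrix.vec n (\<lambda>i. complex_of_real (g i \<omega>))"
        by (subst finsum_lp) (simp_all add: comb)
      have "ennreal (k\<^sup>2) * ennreal ((S \<omega>)\<^sup>2) = ennreal ((k * S \<omega>)\<^sup>2)"
        unfolding power_mult_distrib by (rule ennreal_mult[symmetric]) auto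
      also have "\<dots> \<le> ennreal ((lpf n v (\<lambda>i. complex_of_real (g i \<omega>)))\<^sup>2)"
        using k S0 pt by (intro ennreal_leI power_mono) auto
      finally show "ennreal (k\<^sup>2) * ennreal ((S \<omega>)\<^sup>2) \<le> ennreal ((nrm (lp_space v n) (finsum (lp_space v n) (\<lambda>i. complex_of_real (g i \<omega>) \<odot>\<^bsub>lp_space v n\<^esub> unit_vec n i) {..<n}))\<^sup>2)"
        unfolding lp_space_simps(5) fs .
    qed
    finally show "ennreal (B\<^sup>2) \<le> (\<integral>\<^sup>+\<omega>. ennreal ((nrm (lp_space v n) (finsum (lp_space v n) (\<lambda>i. complex_of_real (g i \<omega>) \<odot>\<^bsub>lp_space v n\<^esub> unit_vec n i) {..<n}))\<^sup>2) \<partial>M)" .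
  qed (use n k \<mu> in \<open>auto simp: lp_space_simps B_def\<close>)
  also have "B / real n powr \<tau> = \<mu> * real n powr (recip v - \<tau>)"
  proof -
    have "k * real n = real n powr (recip v - 1 + 1)" unfolding powr_add k_def using n by simp
    then show ?thesis by (simp add: B_def powr_diff)
  qed
  finally show ?thesis by (simp add: \<mu>_def \<tau>_def)
qed

text \<open>The upper estimate carries a logarithm and the lower one does not; any surplus in the
  exponent absorbs the logarithm, so the infimum is unaffected. It need not be attained.\<close>

lemma limit_order_eq:
  assumes g: "std_gaussian_seq M g" and u: "1 \<le> u" and v: "1 \<le> v"
  shows "limit_order_gamma M g u v = crit u v"
proof -
  define S where "S = {l. 0 < l \<and> (\<exists>r>0. \<forall>n\<ge>1. pi_gamma M g (lp_space u n) (lp_space v n) (\<lambda>x. x) \<le> ennreal (r * real n powr l))}"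
  have k0: "0 \<le> crit u v" by (simp add: crit_def)
  have up: "l \<in> S" if l: "crit u v < l" for l
  proof -
    \<comment> \<open>Twice the surplus, since the logarithm stands under a square root.\<close>
    define \<epsilon> where "\<epsilon> = 2 * (l - crit u v)"
    have e: "0 < \<epsilon>" using l by (simp add: \<epsilon>_def)
    define r where "r = sqrt (8 / \<epsilon> + 16)"
    have r: "0 < r" using e by (simp add: r_def add_pos_pos)
    have "pi_gamma M g (lp_space u n) (lp_space v n) (\<lambda>x. x) \<le> ennreal (r * real n powr l)" if n: "1 \<le> n" for n
    proof -
      have "ln (real n) * \<epsilon> = ln (real n powr \<epsilon>)" using n by (simp add: ln_powr mult.commute)
      also have "\<dots> \<le> real n powr \<epsilon>" using ln_le_minus_one[of "real n powr \<epsilon>"] n by simp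
      finally have "ln (real n) \<le> real n powr \<epsilon> / \<epsilon>" using e by (simp add: field_simps)
      moreover have "1 \<le> real n powr \<epsilon>" using n e by (simp add: ge_one_powr_ge_zero)
      ultimately have "8 * ln (real n) + 16 \<le> 8 * (real n powr \<epsilon> / \<epsilon>) + 16 * real n powr \<epsilon>" by linarith
      also have "\<dots> = (8 / \<epsilon> + 16) * real n powr \<epsilon>" by (simp add: distrib_right)
      finally have "sqrt (8 * ln (real n) + 16) \<le> sqrt ((8 / \<epsilon> + 16) * real n powr \<epsilon>)" by (rule real_sqrt_le_mono)
      also have "\<dots> = r * real n powr (l - crit u v)"
      proof -
        have "real n powr \<epsilon> = (real n powr (l - crit u v))\<^sup>2" by (simp add: power2_eq_square \<epsilon>_def flip: powr_add)
        then show ?thesis by (simp add: real_sqrt_mult r_def)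
      qed
      finally have "sqrt (8 * ln (real n) + 16) * real n powr crit u v \<le> r * real n powr (l - crit u v) * real n powr crit u v"
        by (intro mult_right_mono) auto
      also have "\<dots> = r * real n powr l" by (simp flip: powr_add)
      finally have "ennreal (sqrt (8 * ln (real n) + 16) * real n powr crit u v) \<le> ennreal (r * real n powr l)" by (rule ennreal_leI)
      with lp_upper[OF g u v n] show ?thesis by (rule order_trans)
    qed
    then show ?thesis using l k0 r by (auto simp: S_def)
  qed
  have low: "crit u v \<le> l" if l: "l \<in> S" for l
  proof (rule ccontr)
    assume "\<not> crit u v \<le> l"
    then have lt: "l < crit u v" by simp
    have l0: "0 < l" using l by (simp add: S_def)
    \<comment> \<open>Members of \<open>S\<close> are positive, so an exponent below
      \<open>crit\<close> makes \<open>crit\<close> positive and its outer maximum inactive; the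
      lower estimate therefore has the exponent \<open>crit\<close> itself.\<close>
    define \<kappa> where "\<kappa> = recip v - max 0 (recip u - 1 / 2)"
    have \<kappa>: "crit u v = \<kappa>" using lt l0 by (simp add: crit_def \<kappa>_def max_def split: if_splits)
    obtain r where r: "0 < r" "\<And>n. 1 \<le> n \<Longrightarrow> pi_gamma M g (lp_space u n) (lp_space v n) (\<lambda>x. x) \<le> ennreal (r * real n powr l)"
      using l by (auto simp: S_def)
    have bound: "real n powr (\<kappa> - l) \<le> r / sqrt (2 / pi)" if n: "1 \<le> n" for n
    proof -
      have "ennreal (sqrt (2 / pi) * real n powr \<kappa>) \<le> ennreal (r * real n powr l)"
        using order_trans[OF lp_lower[OF g u v n] r(2)[OF n]] by (simp add: \<kappa>_def)
      then have "sqrt (2 / pi) * real n powr \<kappa> \<le> r * real n powr l"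
        using r(1) by (subst (asm) ennreal_le_iff) auto
      then show ?thesis using n by (simp add: powr_diff field_simps)
    qed
    \<comment> \<open>A value above the uniform bound; a power of \<open>n\<close> with the positive
      exponent \<open>\<kappa> - l\<close> eventually reaches it.\<close>
    define b where "b = r / sqrt (2 / pi) + 1"
    have b: "0 < b" using r(1) by (simp add: b_def add_pos_pos)
    have d: "0 < \<kappa> - l" using lt \<kappa> by simp
    obtain n0 :: nat where n0: "b powr (1 / (\<kappa> - l)) \<le> real n0" using real_arch_simple by blast
    define n where "n = max n0 1"
    have "b = (b powr (1 / (\<kappa> - l))) powr (\<kappa> - l)" using b d by (simp add: powr_powr)
    also have "\<dots> \<le> real n powr (\<kappa> - l)" using n0 d by (intro powr_mono2) (auto simp: n_def)
    also have "\<dots> \<le> r / sqrt (2 / pi)" by (rule bound) (simp add: n_def)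
    finally show False by (simp add: b_def)
  qed
  have "Inf S = crit u v"
  proof (rule cInf_eq_non_empty)
    show "S \<noteq> {}" using up[of "crit u v + 1"] by auto
    show "crit u v \<le> l" if "l \<in> S" for l by (rule low[OF that])
    fix y assume y: "\<And>l. l \<in> S \<Longrightarrow> y \<le> l"
    show "y \<le> crit u v"
      by (rule field_le_epsilon) (use y up in auto)
  qed
  then show ?thesis by (simp add: limit_order_gamma_def S_def)
qed

theorem theorem2:
  fixes M :: "'w measure" and g :: "nat \<Rightarrow> 'w \<Rightarrow> real" and u v :: ennreal
  assumes "std_gaussian_seq M g"
    and "1 \<le> u" and "1 \<le> v"
  shows "(2 \<le> u \<longrightarrow>
            seq_equiv (\<lambda>n. pi_gamma M g (schatten_space u n) (schatten_space v n) (\<lambda>x. x))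
                      (\<lambda>n. real n powr (1/2 + recip v)))
       \<and> (u \<le> 2 \<longrightarrow>
            seq_equiv (\<lambda>n. pi_gamma M g (schatten_space u n) (schatten_space v n) (\<lambda>x. x))
                      (\<lambda>n. real n powr (1/2 + max 0 (1/2 + recip v - recip u))))
       \<and> seq_equiv (\<lambda>n. pi_gamma M g (schatten_space u n) (schatten_space v n) (\<lambda>x. x))
                   (\<lambda>n. real n powr (1/2 + limit_order_gamma M g u v))"
proof (intro conjI impI)
  note main = schatten_equiv[OF assms]
  show "seq_equiv (\<lambda>n. pi_gamma M g (schatten_space u n) (schatten_space v n) (\<lambda>x. x))
    (\<lambda>n. real n powr (1/2 + limit_order_gamma M g u v))"
    unfolding limit_order_eq[OF assms] by (rule main)
  {
    assume "2 \<le> u"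
    then have "recip u \<le> 1 / 2" using assms(2)
      by (cases u) (auto simp: recip_eq recip_top_eq ennreal_le_iff2 field_simps simp flip: ennreal_numeral)
    then have "crit u v = recip v" by (simp add: crit_def)
    then show "seq_equiv (\<lambda>n. pi_gamma M g (schatten_space u n) (schatten_space v n) (\<lambda>x. x))
      (\<lambda>n. real n powr (1/2 + recip v))" using main by simp
  next
    assume u: "u \<le> 2"
    then have "1 / 2 \<le> recip u" using assms(2)
      by (cases u) (auto simp: recip_eq top_unique ennreal_le_iff2 field_simps simp flip: ennreal_numeral)
    then have "crit u v = max 0 (1/2 + recip v - recip u)" by (simp add: crit_def)
    then show "seq_equiv (\<lambda>n. pi_gamma M g (schatten_space u n) (schatten_space v n) (\<lambda>x. x))
      (\<lambda>n. real n powr (1/2 + max 0 (1/2 + recip v - recip u)))" using main by simp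
  }
qed

end
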